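(* Let $Q$ be a connected Dynkin quiver, $A=kQ$ its path algebra, and $M$ a finite-dimensional $A$-module, identified with a $\mathcal{P}$-module supported on $\mathrm{proj}(A)\subset\mathcal{P}$. Then the $\mathrm{mod}(\mathcal{P})$-module $K_{LR}(M)$ is supported on $\mathcal{H}_Q$ and its restriction to $\mathcal{H}_Q$ is canonically isomorphic to $\hat M$, where \[ \hat M(P_1\to P_0)=\mathrm{im}\bigl(\mathrm{Hom}_A(P_0,M)\to\mathrm{Hom}_A(P_1,M)\bigr) \] for each object $P_1\to P_0$ of $\mathcal{H}_Q$.
   Context: Let $k$ be a field. Modules over a $k$-category $\mathcal{C}$ are $k$-linear functors $\mathcal{C}^{op}\to\mathrm{Mod}\,k$; $\mathrm{mod}(\mathcal{C})$ denotes the finitely presented ones. Let $DA=\mathrm{Hom}_k(A,k)$, $\nu(L)=L\otimes_A DA$, and let $T(A)=A\oplus DA$ be the trivial extension with multiplication $(a,f)(b,g)=(ab,ag+fb)$, graded with $A$ in degree $0$ and $DA$ in degree $1$. A $\mathbb{Z}$-graded $T(A)$-module is a sequence of $A$-modules $M^p$ with $A$-linear maps $m^p:\nu(M^p)\to M^{p+1}$ such that $m^{p+1}\circ\nu(m^p)=0$. $\mathrm{grm}(T(A))$ is the category of finite-dimensional graded $T(A)$-modules with degree $0$ morphisms and $\mathcal{P}$ its full subcategory of projectives; there is a canonical equivalence $\mathrm{grm}(T(A))\simeq\mathrm{mod}(\mathcal{P})$, $M\mapsto\mathrm{Hom}(?,M)|_{\mathcal{P}}$. Write $L\leadsto N$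 for the graded module with $L$ in degree $0$, $N$ in degree $1$, and all other components zero. $\mathcal{H}_Q$ is the full subcategory of the category of morphisms of $\mathrm{mod}(A)$ whose objects are the injective morphisms $f:P_1\to P_0$ between finitely generated projective $A$-modules which do not admit a non zero direct factor of the form $0\to P$. There are fully faithful functors $\mathrm{proj}(A)\to\mathcal{P}$, $P\mapsto(P\leadsto\nu(P))$ with structure map the identity of $\nu(P)$, and $\mathcal{H}_Q\to\mathrm{mod}(\mathcal{P})=\mathrm{grm}(T(A))$, $(f:P_1\to P_0)\mapsto(P_1\leadsto\nu(P_0))$ with structure map $\nu(f):\nu(P_1)\to\nu(P_0)$. Through these, $\mathrm{mod}(A)$ is identified with the full subcategory of $\mathrm{mod}(\mathcal{P})$ of modules supported on $\mathrm{proj}(A)$ (an $A$-module $M$ corresponds to the graded module $M\leadsto 0$), and $\mathrm{mod}(\mathcal{H}_Q)$ with the full subcategory of $\mathrm{mod}(\mathrm{mod}(\mathcal{P}))$ of modules supported on $\mathcal{H}_Q$ (i.e. vanishing at all indecomposables not in the image of $\mathcal{H}_Q$). The restriction $\mathrm{res}:\mathrm{mod}(\mathrm{mod}(\mathcal{P}))\to\mathrm{mod}(\mathcal{P})$ along the Yoneda embedding $\mathcal{P}\to\mathrm{mod}(\mathcal{P})$ has fully faithful left and right adjoints $K_L$, $K_R$; there is a canonical morphism $K_L\to K_R$ (corresponding by adjunction to the isomorphism $\mathbf{1}\to\mathrm{res}\,K_L$), and the intermediate extension $K_{LR}$ is its image. *)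

theory Defs
  imports
    "Graph_Theory.Arc_Walk"
    "HOL-Library.Function_Algebras"
    "HOL-Library.Product_Plus"
    Complex_Main
begin

text \<open>
  Vector spaces. All vector spaces over the field \<open>'k\<close> (the type of scalars) are linear
  subspaces of ambient spaces, the latter being types of class \<^class>\<open>ab_group_add\<close> with a scalar
  multiplication \<open>s\<close> (in the sense of the locale \<^locale>\<open>vector_space\<close>). Modules over algebras, and
  values of modules over categories, are subspaces of one ambient space \<open>'u\<close>. In the theorem
  \<open>'u\<close> is an arbitrary infinite-dimensional space, so that every finite-dimensional space
  has a copy in it. Spaces of morphisms live in function types with pointwise operations.

  Linear maps between subspaces are functions which vanish outside their domain, so that equality
  of linear maps is equality of functions and composition is composition of functions.
\<close>

definition fscale :: "('k \<Rightarrow> 'b \<Rightarrow> 'b) \<Rightarrow> 'k \<Rightarrow> ('a \<Rightarrow> 'b) \<Rightarrow> 'a \<Rightarrow> 'b" where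
  "fscale s c f = (\<lambda>x. s c (f x))"

definition lin :: "('k::field \<Rightarrow> 'a::ab_group_add \<Rightarrow> 'a) \<Rightarrow> 'a set \<Rightarrow>
    ('k \<Rightarrow> 'b::ab_group_add \<Rightarrow> 'b) \<Rightarrow> 'b set \<Rightarrow> ('a \<Rightarrow> 'b) set" where
  "lin s V t W = {f. (\<forall>x\<in>V. f x \<in> W) \<and> (\<forall>x\<in>V. \<forall>y\<in>V. f (x + y) = f x + f y) \<and>
     (\<forall>c. \<forall>x\<in>V. f (s c x) = t c (f x)) \<and> (\<forall>x. x \<notin> V \<longrightarrow> f x = 0)}"

definition idm :: "'a set \<Rightarrow> 'a \<Rightarrow> 'a::zero" where
  "idm V = (\<lambda>x. if x \<in> V then x else 0)"

definition fin_dim :: "('k::field \<Rightarrow> 'a::ab_group_add \<Rightarrow> 'a) \<Rightarrow> 'a set \<Rightarrow> bool" where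
  "fin_dim s V \<longleftrightarrow> (\<exists>B. finite B \<and> module.span s B = V)"

text \<open>A chosen linear embedding of a space \<open>V\<close> into the ambient space \<open>'u\<close>.\<close>

definition emb :: "('k::field \<Rightarrow> 'u::ab_group_add \<Rightarrow> 'u) \<Rightarrow> ('k \<Rightarrow> 'a::ab_group_add \<Rightarrow> 'a) \<Rightarrow>
    'a set \<Rightarrow> 'a \<Rightarrow> 'u" where
  "emb s t V = (SOME e. e \<in> lin t V s UNIV \<and> inj_on e V)"


section \<open>Linear categories\<close>

text \<open>
  A morphism need not determine its source and target, which is why the action of functors on
  morphisms (below) takes the objects as arguments. Addition of morphisms is that of the type \<open>'m\<close>.
\<close>

record ('k, 'o, 'm) kcat =
  Ob :: "'o set"
  Hom :: "'o \<Rightarrow> 'o \<Rightarrow> 'm set"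
  Cmp :: "'m \<Rightarrow> 'm \<Rightarrow> 'm"
  Ident :: "'o \<Rightarrow> 'm"
  Scl :: "'k \<Rightarrow> 'm \<Rightarrow> 'm"

definition full_sub :: "('k, 'o, 'm) kcat \<Rightarrow> ('o \<Rightarrow> bool) \<Rightarrow> ('k, 'o, 'm) kcat" where
  "full_sub C S = C\<lparr>Ob := {X \<in> Ob C. S X}\<rparr>"

definition iso_obj :: "('k, 'o, 'm) kcat \<Rightarrow> 'o \<Rightarrow> 'o \<Rightarrow> bool" where
  "iso_obj C X Y \<longleftrightarrow> (\<exists>f\<in>Hom C X Y. \<exists>g\<in>Hom C Y X. Cmp C g f = Ident C X \<and> Cmp C f g = Ident C Y)"

definition zero_obj :: "('k, 'o, 'm::zero) kcat \<Rightarrow> 'o \<Rightarrow> bool" where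
  "zero_obj C X \<longleftrightarrow> Ident C X = 0"

text \<open>\<open>X\<close> is a direct sum (biproduct) of \<open>Y\<close> and \<open>Z\<close>.\<close>

definition direct_sum :: "('k, 'o, 'm::plus) kcat \<Rightarrow> 'o \<Rightarrow> 'o \<Rightarrow> 'o \<Rightarrow> bool" where
  "direct_sum C X Y Z \<longleftrightarrow>
     (\<exists>i\<in>Hom C Y X. \<exists>p\<in>Hom C X Y. \<exists>j\<in>Hom C Z X. \<exists>q\<in>Hom C X Z.
        Cmp C p i = Ident C Y \<and> Cmp C q j = Ident C Z \<and> Cmp C i p + Cmp C j q = Ident C X)"

definition direct_factor :: "('k, 'o, 'm::plus) kcat \<Rightarrow> 'o \<Rightarrow> 'o \<Rightarrow> bool" where
  "direct_factor C Y X \<longleftrightarrow> Y \<in> Ob C \<and> (\<exists>Z\<in>Ob C. direct_sum C X Y Z)"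

definition indecomposable :: "('k, 'o, 'm::monoid_add) kcat \<Rightarrow> 'o \<Rightarrow> bool" where
  "indecomposable C X \<longleftrightarrow> X \<in> Ob C \<and> \<not> zero_obj C X \<and>
     (\<forall>Y\<in>Ob C. \<forall>Z\<in>Ob C. direct_sum C X Y Z \<longrightarrow> zero_obj C Y \<or> zero_obj C Z)"

definition epi :: "('k, 'o, 'm) kcat \<Rightarrow> 'o \<Rightarrow> 'o \<Rightarrow> 'm \<Rightarrow> bool" where
  "epi C X Y e \<longleftrightarrow> e \<in> Hom C X Y \<and>
     (\<forall>Z\<in>Ob C. \<forall>u\<in>Hom C Y Z. \<forall>v\<in>Hom C Y Z. Cmp C u e = Cmp C v e \<longrightarrow> u = v)"

definition projective :: "('k, 'o, 'm) kcat \<Rightarrow> 'o \<Rightarrow> bool" where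
  "projective C P \<longleftrightarrow> P \<in> Ob C \<and>
     (\<forall>X\<in>Ob C. \<forall>Y\<in>Ob C. \<forall>e g. epi C X Y e \<and> g \<in> Hom C P Y \<longrightarrow> (\<exists>h\<in>Hom C P X. Cmp C e h = g))"

record ('o, 'm, 'p, 'n) fctr =
  fob :: "'o \<Rightarrow> 'p"
  fmor :: "'o \<Rightarrow> 'o \<Rightarrow> 'm \<Rightarrow> 'n"

definition is_functor :: "('k, 'o, 'm::ab_group_add) kcat \<Rightarrow> ('k, 'p, 'n::ab_group_add) kcat \<Rightarrow>
    ('o, 'm, 'p, 'n) fctr \<Rightarrow> bool" where
  "is_functor C D F \<longleftrightarrow>
     (\<forall>X\<in>Ob C. fob F X \<in> Ob D \<and> fmor F X X (Ident C X) = Ident D (fob F X)) \<and>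
     (\<forall>X\<in>Ob C. \<forall>Y\<in>Ob C. \<forall>f\<in>Hom C X Y. fmor F X Y f \<in> Hom D (fob F X) (fob F Y) \<and>
        (\<forall>g\<in>Hom C X Y. fmor F X Y (f + g) = fmor F X Y f + fmor F X Y g) \<and>
        (\<forall>c. fmor F X Y (Scl C c f) = Scl D c (fmor F X Y f))) \<and>
     (\<forall>X\<in>Ob C. \<forall>Y\<in>Ob C. \<forall>Z\<in>Ob C. \<forall>f\<in>Hom C X Y. \<forall>g\<in>Hom C Y Z.
        fmor F X Z (Cmp C g f) = Cmp D (fmor F Y Z g) (fmor F X Y f))"

text \<open>
  \<open>L : C \<rightarrow> D\<close> is left adjoint to \<open>R : D \<rightarrow> C\<close> by means of the natural bijections
  \<open>\<phi> X Y : D(L X, Y) \<rightarrow> C(X, R Y)\<close>.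
\<close>

definition adjunction :: "('k, 'o, 'm::ab_group_add) kcat \<Rightarrow> ('k, 'p, 'n::ab_group_add) kcat \<Rightarrow>
    ('o, 'm, 'p, 'n) fctr \<Rightarrow> ('p, 'n, 'o, 'm) fctr \<Rightarrow> ('o \<Rightarrow> 'p \<Rightarrow> 'n \<Rightarrow> 'm) \<Rightarrow> bool" where
  "adjunction C D L R \<phi> \<longleftrightarrow> is_functor C D L \<and> is_functor D C R \<and>
     (\<forall>X\<in>Ob C. \<forall>Y\<in>Ob D. bij_betw (\<phi> X Y) (Hom D (fob L X) Y) (Hom C X (fob R Y))) \<and>
     (\<forall>X\<in>Ob C. \<forall>X'\<in>Ob C. \<forall>Y\<in>Ob D. \<forall>Y'\<in>Ob D.
        \<forall>u\<in>Hom C X' X. \<forall>v\<in>Hom D Y Y'. \<forall>h\<in>Hom D (fob L X) Y.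
          \<phi> X' Y' (Cmp D v (Cmp D h (fmor L X' X u))) = Cmp C (fmor R Y Y' v) (Cmp C (\<phi> X Y h) u))"


section \<open>Modules over linear categories\<close>

text \<open>
  A module over \<open>C\<close> is a linear functor from the opposite of \<open>C\<close> to vector spaces:
  \<open>mmap F X Y f\<close>, for \<open>f : X \<rightarrow> Y\<close>, is a linear map \<open>mval F Y \<rightarrow> mval F X\<close>.
  What such a record does outside \<open>Ob C\<close> is irrelevant; thus the restriction of a module to a full
  subcategory is given by the same record.
\<close>

record ('o, 'm, 'w) cmod =
  mval :: "'o \<Rightarrow> 'w set"
  mmap :: "'o \<Rightarrow> 'o \<Rightarrow> 'm \<Rightarrow> 'w \<Rightarrow> 'w"

definition is_cmod :: "('k::field, 'o, 'm::ab_group_add) kcat \<Rightarrow>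
    ('k \<Rightarrow> 'w::ab_group_add \<Rightarrow> 'w) \<Rightarrow> ('o, 'm, 'w) cmod \<Rightarrow> bool" where
  "is_cmod C s F \<longleftrightarrow>
     (\<forall>X\<in>Ob C. module.subspace s (mval F X) \<and> mmap F X X (Ident C X) = idm (mval F X)) \<and>
     (\<forall>X\<in>Ob C. \<forall>Y\<in>Ob C. \<forall>f\<in>Hom C X Y. mmap F X Y f \<in> lin s (mval F Y) s (mval F X) \<and>
        (\<forall>g\<in>Hom C X Y. mmap F X Y (f + g) = mmap F X Y f + mmap F X Y g) \<and>
        (\<forall>c. mmap F X Y (Scl C c f) = fscale s c (mmap F X Y f))) \<and>
     (\<forall>X\<in>Ob C. \<forall>Y\<in>Ob C. \<forall>Z\<in>Ob C. \<forall>f\<in>Hom C X Y. \<forall>g\<in>Hom C Y Z.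
        mmap F X Z (Cmp C g f) = mmap F X Y f \<circ> mmap F Y Z g)"

definition cmod_hom :: "('k::field, 'o, 'm) kcat \<Rightarrow>
    ('k \<Rightarrow> 'v::ab_group_add \<Rightarrow> 'v) \<Rightarrow> ('o, 'm, 'v) cmod \<Rightarrow>
    ('k \<Rightarrow> 'w::ab_group_add \<Rightarrow> 'w) \<Rightarrow> ('o, 'm, 'w) cmod \<Rightarrow> ('o \<Rightarrow> 'v \<Rightarrow> 'w) set" where
  "cmod_hom C s F t G = {\<tau>.
     (\<forall>X\<in>Ob C. \<tau> X \<in> lin s (mval F X) t (mval G X)) \<and> (\<forall>X. X \<notin> Ob C \<longrightarrow> \<tau> X = 0) \<and>
     (\<forall>X\<in>Ob C. \<forall>Y\<in>Ob C. \<forall>f\<in>Hom C X Y. \<tau> X \<circ> mmap F X Y f = mmap G X Y f \<circ> \<tau> Y)}"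

definition cmod_iso :: "('k::field, 'o, 'm::ab_group_add) kcat \<Rightarrow>
    ('k \<Rightarrow> 'v::ab_group_add \<Rightarrow> 'v) \<Rightarrow> ('o, 'm, 'v) cmod \<Rightarrow>
    ('k \<Rightarrow> 'w::ab_group_add \<Rightarrow> 'w) \<Rightarrow> ('o, 'm, 'w) cmod \<Rightarrow> ('o \<Rightarrow> 'v \<Rightarrow> 'w) \<Rightarrow> bool" where
  "cmod_iso C s F t G \<theta> \<longleftrightarrow> is_cmod C s F \<and> is_cmod C t G \<and> \<theta> \<in> cmod_hom C s F t G \<and>
     (\<forall>X\<in>Ob C. bij_betw (\<theta> X) (mval F X) (mval G X))"

text \<open>
  The representable module \<open>C(?, X)\<close>, with values copied into \<open>'u\<close>. The morphism
  \<open>h : Y \<rightarrow> X\<close> is represented by the element \<open>rep s C Y X h\<close> of its value at \<open>Y\<close>.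
\<close>

definition rep :: "('k::field \<Rightarrow> 'u::ab_group_add \<Rightarrow> 'u) \<Rightarrow> ('k, 'o, 'm::ab_group_add) kcat \<Rightarrow>
    'o \<Rightarrow> 'o \<Rightarrow> 'm \<Rightarrow> 'u" where
  "rep s C Y X = emb s (Scl C) (Hom C Y X)"

definition unrep :: "('k::field \<Rightarrow> 'u::ab_group_add \<Rightarrow> 'u) \<Rightarrow> ('k, 'o, 'm::ab_group_add) kcat \<Rightarrow>
    'o \<Rightarrow> 'o \<Rightarrow> 'u \<Rightarrow> 'm" where
  "unrep s C Y X = inv_into (Hom C Y X) (rep s C Y X)"

definition hom_mod :: "('k::field \<Rightarrow> 'u::ab_group_add \<Rightarrow> 'u) \<Rightarrow> ('k, 'o, 'm::ab_group_add) kcat \<Rightarrow>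
    'o \<Rightarrow> ('o, 'm, 'u) cmod" where
  "hom_mod s C X = \<lparr>
     mval = (\<lambda>Y. rep s C Y X ` Hom C Y X),
     mmap = (\<lambda>Y Z f v. if v \<in> rep s C Z X ` Hom C Z X
                        then rep s C Y X (Cmp C (unrep s C Z X v) f) else 0)\<rparr>"

text \<open>
  The restricted Yoneda functor \<open>X \<mapsto> C(?, X)|\<^sub>B\<close> from \<open>C\<close> to \<open>B\<close>-modules, for a full subcategory
  \<open>B\<close> of \<open>C\<close>; for \<open>B = C\<close> it is the Yoneda embedding.
\<close>

definition yoneda :: "('k::field \<Rightarrow> 'u::ab_group_add \<Rightarrow> 'u) \<Rightarrow> ('k, 'o, 'm::ab_group_add) kcat \<Rightarrow>
    ('k, 'o, 'm) kcat \<Rightarrow> ('o, 'm, ('o, 'm, 'u) cmod, 'o \<Rightarrow> 'u \<Rightarrow> 'u) fctr" where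
  "yoneda s C B = \<lparr>
     fob = hom_mod s C,
     fmor = (\<lambda>X X' g Y v. if Y \<in> Ob B \<and> v \<in> mval (hom_mod s C X) Y
                           then rep s C Y X' (Cmp C g (unrep s C Y X v)) else 0)\<rparr>"

text \<open>
  Finitely presented modules are cokernels of morphisms between representable modules. (The
  categories for which this is used have finite direct sums, so that finite direct sums of
  representable modules are representable.)
\<close>

definition fin_pres :: "('k::field \<Rightarrow> 'u::ab_group_add \<Rightarrow> 'u) \<Rightarrow> ('k, 'o, 'm::ab_group_add) kcat \<Rightarrow>
    ('o, 'm, 'u) cmod \<Rightarrow> bool" where
  "fin_pres s C F \<longleftrightarrow> is_cmod C s F \<and>
     (\<exists>X\<^sub>1\<in>Ob C. \<exists>X\<^sub>0\<in>Ob C. \<exists>g\<in>Hom C X\<^sub>1 X\<^sub>0. \<exists>\<pi>\<in>cmod_hom C s (hom_mod s C X\<^sub>0) s F.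
        \<forall>Y\<in>Ob C. \<pi> Y ` mval (hom_mod s C X\<^sub>0) Y = mval F Y \<and>
          {v \<in> mval (hom_mod s C X\<^sub>0) Y. \<pi> Y v = 0} =
            fmor (yoneda s C C) X\<^sub>1 X\<^sub>0 g Y ` mval (hom_mod s C X\<^sub>1) Y)"

definition mod_cat :: "('k::field \<Rightarrow> 'u::ab_group_add \<Rightarrow> 'u) \<Rightarrow> ('k, 'o, 'm::ab_group_add) kcat \<Rightarrow>
    ('k, ('o, 'm, 'u) cmod, 'o \<Rightarrow> 'u \<Rightarrow> 'u) kcat" where
  "mod_cat s C = \<lparr>
     Ob = {F. fin_pres s C F},
     Hom = (\<lambda>F G. cmod_hom C s F s G),
     Cmp = (\<lambda>\<tau> \<sigma> X. \<tau> X \<circ> \<sigma> X),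
     Ident = (\<lambda>F X. if X \<in> Ob C then idm (mval F X) else 0),
     Scl = fscale (fscale s)\<rparr>"

text \<open>Pull-back of modules along a functor \<open>J\<close> with source \<open>B\<close>, on objects and as a functor.\<close>

definition pull :: "('o, 'm, 'p, 'n) fctr \<Rightarrow> ('p, 'n, 'w) cmod \<Rightarrow> ('o, 'm, 'w) cmod" where
  "pull J F = \<lparr>
     mval = (\<lambda>X. mval F (fob J X)),
     mmap = (\<lambda>X Y f. mmap F (fob J X) (fob J Y) (fmor J X Y f))\<rparr>"

definition pull_functor :: "('k, 'o, 'm) kcat \<Rightarrow> ('o, 'm, 'p, 'n) fctr \<Rightarrow>
    (('p, 'n, 'w::zero) cmod, 'p \<Rightarrow> 'w \<Rightarrow> 'w, ('o, 'm, 'w) cmod, 'o \<Rightarrow> 'w \<Rightarrow> 'w) fctr" where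
  "pull_functor B J = \<lparr>
     fob = pull J,
     fmor = (\<lambda>F G \<tau> X. if X \<in> Ob B then \<tau> (fob J X) else (\<lambda>_. 0))\<rparr>"

definition image_mod :: "('o, 'm, 'w::zero) cmod \<Rightarrow> ('o, 'm, 'w) cmod \<Rightarrow> ('o \<Rightarrow> 'w \<Rightarrow> 'w) \<Rightarrow>
    ('o, 'm, 'w) cmod" where
  "image_mod F G \<tau> = \<lparr>
     mval = (\<lambda>X. \<tau> X ` mval F X),
     mmap = (\<lambda>X Y f v. if v \<in> \<tau> Y ` mval F Y then mmap G X Y f v else 0)\<rparr>"

definition supported_on :: "('k::field, 'o, 'm::ab_group_add) kcat \<Rightarrow>
    ('k \<Rightarrow> 'w::ab_group_add \<Rightarrow> 'w) \<Rightarrow> ('o, 'm, 'w) cmod \<Rightarrow> 'o set \<Rightarrow> bool" where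
  "supported_on C s F S \<longleftrightarrow> is_cmod C s F \<and>
     (\<forall>X. indecomposable C X \<and> \<not> (\<exists>Y\<in>S. iso_obj C X Y) \<longrightarrow> mval F X = {0})"


section \<open>Intermediate extension\<close>

definition res :: "('k::field \<Rightarrow> 'u::ab_group_add \<Rightarrow> 'u) \<Rightarrow> ('k, 'o, 'm::ab_group_add) kcat \<Rightarrow>
    ((('o, 'm, 'u) cmod, 'o \<Rightarrow> 'u \<Rightarrow> 'u, 'u) cmod, ('o, 'm, 'u) cmod \<Rightarrow> 'u \<Rightarrow> 'u,
     ('o, 'm, 'u) cmod, 'o \<Rightarrow> 'u \<Rightarrow> 'u) fctr" where
  "res s P = pull_functor P (yoneda s P P)"

text \<open>
  Let \<open>\<phi>\<close> be an adjunction between \<open>KL : C \<rightarrow> D\<close> and \<open>R : D \<rightarrow> C\<close>, and \<open>\<psi>\<close> one between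
  \<open>R\<close> and \<open>KR : C \<rightarrow> D\<close>, where the unit \<open>M \<rightarrow> R (KL M)\<close> is invertible. The morphism
  \<open>KL M \<rightarrow> KR M\<close> below corresponds under \<open>\<psi>\<close> to the inverse of that unit.
\<close>

definition unit_inv :: "('k, 'o, 'm) kcat \<Rightarrow> ('k, 'p, 'n) kcat \<Rightarrow> ('o, 'm, 'p, 'n) fctr \<Rightarrow>
    ('p, 'n, 'o, 'm) fctr \<Rightarrow> ('o \<Rightarrow> 'p \<Rightarrow> 'n \<Rightarrow> 'm) \<Rightarrow> 'o \<Rightarrow> 'm" where
  "unit_inv C D KL R \<phi> M = (let \<eta> = \<phi> M (fob KL M) (Ident D (fob KL M)) in
     THE g. g \<in> Hom C (fob R (fob KL M)) M \<and>
       Cmp C g \<eta> = Ident C M \<and> Cmp C \<eta> g = Ident C (fob R (fob KL M)))"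

definition KL_to_KR :: "('k, 'o, 'm) kcat \<Rightarrow> ('k, 'p, 'n) kcat \<Rightarrow> ('o, 'm, 'p, 'n) fctr \<Rightarrow>
    ('p, 'n, 'o, 'm) fctr \<Rightarrow> ('o \<Rightarrow> 'p \<Rightarrow> 'n \<Rightarrow> 'm) \<Rightarrow> ('p \<Rightarrow> 'o \<Rightarrow> 'm \<Rightarrow> 'n) \<Rightarrow> 'o \<Rightarrow> 'n" where
  "KL_to_KR C D KL R \<phi> \<psi> M = \<psi> (fob KL M) M (unit_inv C D KL R \<phi> M)"

definition KLR :: "('k::field \<Rightarrow> 'u::ab_group_add \<Rightarrow> 'u) \<Rightarrow> ('k, 'o, 'm::ab_group_add) kcat \<Rightarrow>
    (('o, 'm, 'u) cmod, 'o \<Rightarrow> 'u \<Rightarrow> 'u,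
     (('o, 'm, 'u) cmod, 'o \<Rightarrow> 'u \<Rightarrow> 'u, 'u) cmod, ('o, 'm, 'u) cmod \<Rightarrow> 'u \<Rightarrow> 'u) fctr \<Rightarrow>
    (('o, 'm, 'u) cmod, 'o \<Rightarrow> 'u \<Rightarrow> 'u,
     (('o, 'm, 'u) cmod, 'o \<Rightarrow> 'u \<Rightarrow> 'u, 'u) cmod, ('o, 'm, 'u) cmod \<Rightarrow> 'u \<Rightarrow> 'u) fctr \<Rightarrow>
    (('o, 'm, 'u) cmod \<Rightarrow> (('o, 'm, 'u) cmod, 'o \<Rightarrow> 'u \<Rightarrow> 'u, 'u) cmod \<Rightarrow>
     (('o, 'm, 'u) cmod \<Rightarrow> 'u \<Rightarrow> 'u) \<Rightarrow> ('o \<Rightarrow> 'u \<Rightarrow> 'u)) \<Rightarrow>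
    ((('o, 'm, 'u) cmod, 'o \<Rightarrow> 'u \<Rightarrow> 'u, 'u) cmod \<Rightarrow> ('o, 'm, 'u) cmod \<Rightarrow>
     ('o \<Rightarrow> 'u \<Rightarrow> 'u) \<Rightarrow> (('o, 'm, 'u) cmod \<Rightarrow> 'u \<Rightarrow> 'u)) \<Rightarrow>
    ('o, 'm, 'u) cmod \<Rightarrow> (('o, 'm, 'u) cmod, 'o \<Rightarrow> 'u \<Rightarrow> 'u, 'u) cmod" where
  "KLR s P KL KR \<phi> \<psi> M = image_mod (fob KL M) (fob KR M)
     (KL_to_KR (mod_cat s P) (mod_cat s (mod_cat s P)) KL (res s P) \<phi> \<psi> M)"

text \<open>
  The canonical isomorphism \<open>Hom(X, M) \<rightarrow> KR(M)(X)\<close> for \<open>P\<close>-modules \<open>X\<close> and \<open>M\<close>, composed of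
  the Yoneda isomorphism \<open>res(Hom(?, X)) \<rightarrow> X\<close>, the adjunction
  \<open>Hom(res(Hom(?, X)), M) \<rightarrow> Hom(Hom(?, X), KR M)\<close>, and evaluation at the identity of \<open>X\<close>.
\<close>

definition yoneda_ev :: "('k::field \<Rightarrow> 'u::ab_group_add \<Rightarrow> 'u) \<Rightarrow> ('k, 'o, 'm::ab_group_add) kcat \<Rightarrow>
    ('o, 'm, 'u) cmod \<Rightarrow> 'o \<Rightarrow> 'u \<Rightarrow> 'u" where
  "yoneda_ev s P X Y v =
     (if Y \<in> Ob P \<and> v \<in> mval (hom_mod s (mod_cat s P) X) (hom_mod s P Y)
      then unrep s (mod_cat s P) (hom_mod s P Y) X v Y (rep s P Y Y (Ident P Y)) else 0)"

definition hom_to_KR :: "('k::field \<Rightarrow> 'u::ab_group_add \<Rightarrow> 'u) \<Rightarrow> ('k, 'o, 'm::ab_group_add) kcat \<Rightarrow>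
    ((('o, 'm, 'u) cmod, 'o \<Rightarrow> 'u \<Rightarrow> 'u, 'u) cmod \<Rightarrow> ('o, 'm, 'u) cmod \<Rightarrow>
     ('o \<Rightarrow> 'u \<Rightarrow> 'u) \<Rightarrow> (('o, 'm, 'u) cmod \<Rightarrow> 'u \<Rightarrow> 'u)) \<Rightarrow>
    ('o, 'm, 'u) cmod \<Rightarrow> ('o, 'm, 'u) cmod \<Rightarrow> ('o \<Rightarrow> 'u \<Rightarrow> 'u) \<Rightarrow> 'u" where
  "hom_to_KR s P \<psi> X M u =
     \<psi> (hom_mod s (mod_cat s P) X) M (Cmp (mod_cat s P) u (yoneda_ev s P X)) X
       (rep s (mod_cat s P) X X (Ident (mod_cat s P) X))"


section \<open>Algebras and modules over them\<close>

record ('k, 'a) kalg =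
  acar :: "'a set"
  amul :: "'a \<Rightarrow> 'a \<Rightarrow> 'a"
  aone :: "'a"
  ascl :: "'k \<Rightarrow> 'a \<Rightarrow> 'a"

text \<open>Right modules.\<close>

record ('a, 'u) rmod =
  rsp :: "'u set"
  ract :: "'u \<Rightarrow> 'a \<Rightarrow> 'u"

definition is_rmod :: "('k::field \<Rightarrow> 'u::ab_group_add \<Rightarrow> 'u) \<Rightarrow> ('k, 'a::ab_group_add) kalg \<Rightarrow>
    ('a, 'u) rmod \<Rightarrow> bool" where
  "is_rmod s A L \<longleftrightarrow> module.subspace s (rsp L) \<and>
     (\<forall>x\<in>rsp L. \<forall>a\<in>acar A. ract L x a \<in> rsp L \<and>
        (\<forall>y\<in>rsp L. ract L (x + y) a = ract L x a + ract L y a) \<and>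
        (\<forall>b\<in>acar A. ract L x (a + b) = ract L x a + ract L x b) \<and>
        (\<forall>c. ract L (s c x) a = s c (ract L x a) \<and> ract L x (ascl A c a) = s c (ract L x a)) \<and>
        (\<forall>b\<in>acar A. ract L (ract L x a) b = ract L x (amul A a b))) \<and>
     (\<forall>x\<in>rsp L. ract L x (aone A) = x)"

definition rhom :: "('k::field \<Rightarrow> 'u::ab_group_add \<Rightarrow> 'u) \<Rightarrow> ('k, 'a) kalg \<Rightarrow>
    ('a, 'u) rmod \<Rightarrow> ('a, 'u) rmod \<Rightarrow> ('u \<Rightarrow> 'u) set" where
  "rhom s A L N = {f \<in> lin s (rsp L) s (rsp N).
     \<forall>x\<in>rsp L. \<forall>a\<in>acar A. f (ract L x a) = ract N (f x) a}"

text \<open>The category \<open>mod(A)\<close> of finite-dimensional modules over a finite-dimensional algebra.\<close>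

definition modA :: "('k::field \<Rightarrow> 'u::ab_group_add \<Rightarrow> 'u) \<Rightarrow> ('k, 'a::ab_group_add) kalg \<Rightarrow>
    ('k, ('a, 'u) rmod, 'u \<Rightarrow> 'u) kcat" where
  "modA s A = \<lparr>
     Ob = {L. is_rmod s A L \<and> fin_dim s (rsp L)},
     Hom = rhom s A,
     Cmp = (\<circ>),
     Ident = (\<lambda>L. idm (rsp L)),
     Scl = fscale s\<rparr>"

definition zero_rmod :: "('a, 'u::zero) rmod" where
  "zero_rmod = \<lparr>rsp = {0}, ract = (\<lambda>_ _. 0)\<rparr>"

text \<open>The bimodule \<open>DA = Hom(A, k)\<close>, with \<open>(a f)(x) = f(x a)\<close> and \<open>(f a)(x) = f(a x)\<close>.\<close>

definition dual :: "('k::field, 'a::ab_group_add) kalg \<Rightarrow> ('a \<Rightarrow> 'k) set" where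
  "dual A = lin (ascl A) (acar A) (*) UNIV"

definition dual_lact :: "('k::zero, 'a) kalg \<Rightarrow> 'a \<Rightarrow> ('a \<Rightarrow> 'k) \<Rightarrow> 'a \<Rightarrow> 'k" where
  "dual_lact A a f = (\<lambda>x. if x \<in> acar A then f (amul A x a) else 0)"

definition dual_ract :: "('k::zero, 'a) kalg \<Rightarrow> ('a \<Rightarrow> 'k) \<Rightarrow> 'a \<Rightarrow> 'a \<Rightarrow> 'k" where
  "dual_ract A f a = (\<lambda>x. if x \<in> acar A then f (amul A a x) else 0)"

text \<open>
  The right module \<open>\<nu>(L) = L \<otimes>\<^sub>A DA\<close>, characterized by the universal property of the tensor product:
  \<open>tens s A L x f\<close> is the element \<open>x \<otimes> f\<close>.
\<close>

definition balanced :: "('k::field \<Rightarrow> 'u::ab_group_add \<Rightarrow> 'u) \<Rightarrow> ('k, 'a::ab_group_add) kalg \<Rightarrow>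
    ('a, 'u) rmod \<Rightarrow> 'u set \<Rightarrow> ('u \<Rightarrow> ('a \<Rightarrow> 'k) \<Rightarrow> 'u) \<Rightarrow> bool" where
  "balanced s A L W \<beta> \<longleftrightarrow>
     (\<forall>x\<in>rsp L. \<forall>f\<in>dual A. \<beta> x f \<in> W \<and>
        (\<forall>y\<in>rsp L. \<beta> (x + y) f = \<beta> x f + \<beta> y f) \<and>
        (\<forall>g\<in>dual A. \<beta> x (f + g) = \<beta> x f + \<beta> x g) \<and>
        (\<forall>c. \<beta> (s c x) f = s c (\<beta> x f) \<and> \<beta> x (fscale (*) c f) = s c (\<beta> x f)) \<and>
        (\<forall>a\<in>acar A. \<beta> (ract L x a) f = \<beta> x (dual_lact A a f)))"

definition is_tensor :: "('k::field \<Rightarrow> 'u::ab_group_add \<Rightarrow> 'u) \<Rightarrow> ('k, 'a::ab_group_add) kalg \<Rightarrow>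
    ('a, 'u) rmod \<Rightarrow> ('a, 'u) rmod \<Rightarrow> ('u \<Rightarrow> ('a \<Rightarrow> 'k) \<Rightarrow> 'u) \<Rightarrow> bool" where
  "is_tensor s A L T t \<longleftrightarrow> is_rmod s A T \<and> balanced s A L (rsp T) t \<and>
     (\<forall>x\<in>rsp L. \<forall>f\<in>dual A. \<forall>a\<in>acar A. ract T (t x f) a = t x (dual_ract A f a)) \<and>
     (\<forall>W \<beta>. module.subspace s W \<and> balanced s A L W \<beta> \<longrightarrow>
        (\<exists>!h. h \<in> lin s (rsp T) s W \<and> (\<forall>x\<in>rsp L. \<forall>f\<in>dual A. h (t x f) = \<beta> x f)))"

definition nu_tens :: "('k::field \<Rightarrow> 'u::ab_group_add \<Rightarrow> 'u) \<Rightarrow> ('k, 'a::ab_group_add) kalg \<Rightarrow>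
    ('a, 'u) rmod \<Rightarrow> ('a, 'u) rmod \<times> ('u \<Rightarrow> ('a \<Rightarrow> 'k) \<Rightarrow> 'u)" where
  "nu_tens s A L = (SOME (T, t). is_tensor s A L T t)"

definition nu :: "('k::field \<Rightarrow> 'u::ab_group_add \<Rightarrow> 'u) \<Rightarrow> ('k, 'a::ab_group_add) kalg \<Rightarrow>
    ('a, 'u) rmod \<Rightarrow> ('a, 'u) rmod" where
  "nu s A L = fst (nu_tens s A L)"

definition tens :: "('k::field \<Rightarrow> 'u::ab_group_add \<Rightarrow> 'u) \<Rightarrow> ('k, 'a::ab_group_add) kalg \<Rightarrow>
    ('a, 'u) rmod \<Rightarrow> 'u \<Rightarrow> ('a \<Rightarrow> 'k) \<Rightarrow> 'u" where
  "tens s A L = snd (nu_tens s A L)"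

definition nu_map :: "('k::field \<Rightarrow> 'u::ab_group_add \<Rightarrow> 'u) \<Rightarrow> ('k, 'a::ab_group_add) kalg \<Rightarrow>
    ('a, 'u) rmod \<Rightarrow> ('a, 'u) rmod \<Rightarrow> ('u \<Rightarrow> 'u) \<Rightarrow> 'u \<Rightarrow> 'u" where
  "nu_map s A L N g = (THE h. h \<in> lin s (rsp (nu s A L)) s (rsp (nu s A N)) \<and>
     (\<forall>x\<in>rsp L. \<forall>f\<in>dual A. h (tens s A L x f) = tens s A N (g x) f))"


section \<open>Graded modules over the trivial extension\<close>

text \<open>
  A graded module over \<open>T(A) = A \<oplus> DA\<close> is a sequence of \<open>A\<close>-modules \<open>gcomp M p\<close> with \<open>A\<close>-linear
  maps \<open>gstr M p : \<nu>(gcomp M p) \<rightarrow> gcomp M (p + 1)\<close>, which describe the action of \<open>DA\<close>.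
\<close>

record ('a, 'u) gmod =
  gcomp :: "int \<Rightarrow> ('a, 'u) rmod"
  gstr :: "int \<Rightarrow> 'u \<Rightarrow> 'u"

definition is_gmod :: "('k::field \<Rightarrow> 'u::ab_group_add \<Rightarrow> 'u) \<Rightarrow> ('k, 'a::ab_group_add) kalg \<Rightarrow>
    ('a, 'u) gmod \<Rightarrow> bool" where
  "is_gmod s A M \<longleftrightarrow>
     (\<forall>p. is_rmod s A (gcomp M p) \<and> gstr M p \<in> rhom s A (nu s A (gcomp M p)) (gcomp M (p + 1)) \<and>
        gstr M (p + 1) \<circ> nu_map s A (nu s A (gcomp M p)) (gcomp M (p + 1)) (gstr M p) = (\<lambda>_. 0))"

definition grm :: "('k::field \<Rightarrow> 'u::ab_group_add \<Rightarrow> 'u) \<Rightarrow> ('k, 'a::ab_group_add) kalg \<Rightarrow>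
    ('k, ('a, 'u) gmod, int \<Rightarrow> 'u \<Rightarrow> 'u) kcat" where
  "grm s A = \<lparr>
     Ob = {M. is_gmod s A M \<and> (\<forall>p. fin_dim s (rsp (gcomp M p))) \<and>
              finite {p. rsp (gcomp M p) \<noteq> {0}}},
     Hom = (\<lambda>M N. {f. \<forall>p. f p \<in> rhom s A (gcomp M p) (gcomp N p) \<and>
              f (p + 1) \<circ> gstr M p = gstr N p \<circ> nu_map s A (gcomp M p) (gcomp N p) (f p)}),
     Cmp = (\<lambda>g f p. g p \<circ> f p),
     Ident = (\<lambda>M p. idm (rsp (gcomp M p))),
     Scl = fscale (fscale s)\<rparr>"

definition grP :: "('k::field \<Rightarrow> 'u::ab_group_add \<Rightarrow> 'u) \<Rightarrow> ('k, 'a::ab_group_add) kalg \<Rightarrow>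
    ('k, ('a, 'u) gmod, int \<Rightarrow> 'u \<Rightarrow> 'u) kcat" where
  "grP s A = full_sub (grm s A) (projective (grm s A))"

text \<open>The graded module with \<open>L\<close> in degree 0, \<open>N\<close> in degree 1, and structure map \<open>m : \<nu>(L) \<rightarrow> N\<close>.\<close>

definition leadsto :: "('a, 'u) rmod \<Rightarrow> ('a, 'u) rmod \<Rightarrow> ('u \<Rightarrow> 'u) \<Rightarrow> ('a, 'u::zero) gmod" where
  "leadsto L N m = \<lparr>
     gcomp = (\<lambda>p. if p = 0 then L else if p = 1 then N else zero_rmod),
     gstr = (\<lambda>p. if p = 0 then m else (\<lambda>_. 0))\<rparr>"

definition stalk :: "('a, 'u) rmod \<Rightarrow> ('a, 'u::zero) gmod" where
  "stalk M = leadsto M zero_rmod (\<lambda>_. 0)"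

text \<open>The restricted Yoneda functor \<open>N \<mapsto> Hom(?, N)|\<^sub>P\<close>, an equivalence \<open>grm(T(A)) \<rightarrow> mod(P)\<close>.\<close>

definition grm_to_modP :: "('k::field \<Rightarrow> 'u::ab_group_add \<Rightarrow> 'u) \<Rightarrow> ('k, 'a::ab_group_add) kalg \<Rightarrow>
    (('a, 'u) gmod, int \<Rightarrow> 'u \<Rightarrow> 'u,
     (('a, 'u) gmod, int \<Rightarrow> 'u \<Rightarrow> 'u, 'u) cmod, ('a, 'u) gmod \<Rightarrow> 'u \<Rightarrow> 'u) fctr" where
  "grm_to_modP s A = yoneda s (grm s A) (grP s A)"

definition modA_to_modP :: "('k::field \<Rightarrow> 'u::ab_group_add \<Rightarrow> 'u) \<Rightarrow> ('k, 'a::ab_group_add) kalg \<Rightarrow>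
    ('a, 'u) rmod \<Rightarrow> (('a, 'u) gmod, int \<Rightarrow> 'u \<Rightarrow> 'u, 'u) cmod" where
  "modA_to_modP s A M = fob (grm_to_modP s A) (stalk M)"


section \<open>The category of injective morphisms between projectives\<close>

text \<open>The category of morphisms of \<open>mod(A)\<close>; an object \<open>(L\<^sub>1, L\<^sub>0, f)\<close> is a morphism \<open>f : L\<^sub>1 \<rightarrow> L\<^sub>0\<close>.\<close>

definition mor_cat :: "('k::field \<Rightarrow> 'u::ab_group_add \<Rightarrow> 'u) \<Rightarrow> ('k, 'a::ab_group_add) kalg \<Rightarrow>
    ('k, ('a, 'u) rmod \<times> ('a, 'u) rmod \<times> ('u \<Rightarrow> 'u), ('u \<Rightarrow> 'u) \<times> ('u \<Rightarrow> 'u)) kcat" where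
  "mor_cat s A = \<lparr>
     Ob = {(L\<^sub>1, L\<^sub>0, f). L\<^sub>1 \<in> Ob (modA s A) \<and> L\<^sub>0 \<in> Ob (modA s A) \<and> f \<in> rhom s A L\<^sub>1 L\<^sub>0},
     Hom = (\<lambda>(L\<^sub>1, L\<^sub>0, f) (N\<^sub>1, N\<^sub>0, g).
       {(a, b). a \<in> rhom s A L\<^sub>1 N\<^sub>1 \<and> b \<in> rhom s A L\<^sub>0 N\<^sub>0 \<and> b \<circ> f = g \<circ> a}),
     Cmp = (\<lambda>(a', b') (a, b). (a' \<circ> a, b' \<circ> b)),
     Ident = (\<lambda>(L\<^sub>1, L\<^sub>0, f). (idm (rsp L\<^sub>1), idm (rsp L\<^sub>0))),
     Scl = (\<lambda>c (a, b). (fscale s c a, fscale s c b))\<rparr>"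

definition in_HQ :: "('k::field \<Rightarrow> 'u::ab_group_add \<Rightarrow> 'u) \<Rightarrow> ('k, 'a::ab_group_add) kalg \<Rightarrow>
    ('a, 'u) rmod \<times> ('a, 'u) rmod \<times> ('u \<Rightarrow> 'u) \<Rightarrow> bool" where
  "in_HQ s A = (\<lambda>(P\<^sub>1, P\<^sub>0, f).
     projective (modA s A) P\<^sub>1 \<and> projective (modA s A) P\<^sub>0 \<and> inj_on f (rsp P\<^sub>1) \<and>
     (\<forall>P. projective (modA s A) P \<and>
          direct_factor (mor_cat s A) (zero_rmod, P, \<lambda>_. 0) (P\<^sub>1, P\<^sub>0, f) \<longrightarrow> zero_obj (modA s A) P))"

definition HQ :: "('k::field \<Rightarrow> 'u::ab_group_add \<Rightarrow> 'u) \<Rightarrow> ('k, 'a::ab_group_add) kalg \<Rightarrow>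
    ('k, ('a, 'u) rmod \<times> ('a, 'u) rmod \<times> ('u \<Rightarrow> 'u), ('u \<Rightarrow> 'u) \<times> ('u \<Rightarrow> 'u)) kcat" where
  "HQ s A = full_sub (mor_cat s A) (in_HQ s A)"

definition HQ_to_grm :: "('k::field \<Rightarrow> 'u::ab_group_add \<Rightarrow> 'u) \<Rightarrow> ('k, 'a::ab_group_add) kalg \<Rightarrow>
    (('a, 'u) rmod \<times> ('a, 'u) rmod \<times> ('u \<Rightarrow> 'u), ('u \<Rightarrow> 'u) \<times> ('u \<Rightarrow> 'u),
     ('a, 'u) gmod, int \<Rightarrow> 'u \<Rightarrow> 'u) fctr" where
  "HQ_to_grm s A = \<lparr>
     fob = (\<lambda>(P\<^sub>1, P\<^sub>0, f). leadsto P\<^sub>1 (nu s A P\<^sub>0) (nu_map s A P\<^sub>1 P\<^sub>0 f)),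
     fmor = (\<lambda>(P\<^sub>1, P\<^sub>0, f) (P\<^sub>1', P\<^sub>0', f') (a, b) p.
       if p = 0 then a else if p = 1 then nu_map s A P\<^sub>0 P\<^sub>0' b else (\<lambda>_. 0))\<rparr>"

definition HQ_to_modP :: "('k::field \<Rightarrow> 'u::ab_group_add \<Rightarrow> 'u) \<Rightarrow> ('k, 'a::ab_group_add) kalg \<Rightarrow>
    (('a, 'u) rmod \<times> ('a, 'u) rmod \<times> ('u \<Rightarrow> 'u), ('u \<Rightarrow> 'u) \<times> ('u \<Rightarrow> 'u),
     (('a, 'u) gmod, int \<Rightarrow> 'u \<Rightarrow> 'u, 'u) cmod, ('a, 'u) gmod \<Rightarrow> 'u \<Rightarrow> 'u) fctr" where
  "HQ_to_modP s A = \<lparr>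
     fob = (\<lambda>x. fob (grm_to_modP s A) (fob (HQ_to_grm s A) x)),
     fmor = (\<lambda>x y u. fmor (grm_to_modP s A) (fob (HQ_to_grm s A) x) (fob (HQ_to_grm s A) y)
                       (fmor (HQ_to_grm s A) x y u))\<rparr>"

definition hatM :: "('k::field \<Rightarrow> 'u::ab_group_add \<Rightarrow> 'u) \<Rightarrow> ('k, 'a::ab_group_add) kalg \<Rightarrow>
    ('a, 'u) rmod \<Rightarrow>
    (('a, 'u) rmod \<times> ('a, 'u) rmod \<times> ('u \<Rightarrow> 'u), ('u \<Rightarrow> 'u) \<times> ('u \<Rightarrow> 'u), 'u \<Rightarrow> 'u) cmod" where
  "hatM s A M = (let V = (\<lambda>(P\<^sub>1, P\<^sub>0, f). (\<lambda>g. g \<circ> f) ` rhom s A P\<^sub>0 M) in \<lparr>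
     mval = V,
     mmap = (\<lambda>x y (a, b) h. if h \<in> V y then h \<circ> a else 0)\<rparr>)"

text \<open>
  The canonical map from \<open>hatM(f)\<close> to \<open>KR(M)(f)\<close>: an element \<open>h : P\<^sub>1 \<rightarrow> M\<close> of \<open>hatM(f)\<close>, where
  \<open>f : P\<^sub>1 \<rightarrow> P\<^sub>0\<close>, is extended by zero to a morphism of graded modules from the image of \<open>f\<close> in
  \<open>grm(T(A))\<close> to \<open>M\<close> in degree 0, and then sent to \<open>KR(M)(f)\<close> by \<^const>\<open>hom_to_KR\<close>.
\<close>

definition hatM_to_KR :: "('k::field \<Rightarrow> 'u::ab_group_add \<Rightarrow> 'u) \<Rightarrow> ('k, 'a::ab_group_add) kalg \<Rightarrow>
    (((('a, 'u) gmod, int \<Rightarrow> 'u \<Rightarrow> 'u, 'u) cmod, ('a, 'u) gmod \<Rightarrow> 'u \<Rightarrow> 'u, 'u) cmod \<Rightarrow>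
     (('a, 'u) gmod, int \<Rightarrow> 'u \<Rightarrow> 'u, 'u) cmod \<Rightarrow> (('a, 'u) gmod \<Rightarrow> 'u \<Rightarrow> 'u) \<Rightarrow>
     ((('a, 'u) gmod, int \<Rightarrow> 'u \<Rightarrow> 'u, 'u) cmod \<Rightarrow> 'u \<Rightarrow> 'u)) \<Rightarrow>
    ('a, 'u) rmod \<Rightarrow> ('a, 'u) rmod \<times> ('a, 'u) rmod \<times> ('u \<Rightarrow> 'u) \<Rightarrow> ('u \<Rightarrow> 'u) \<Rightarrow> 'u" where
  "hatM_to_KR s A \<psi> M x h =
     (if x \<in> Ob (HQ s A) \<and> h \<in> mval (hatM s A M) x
      then hom_to_KR s (grP s A) \<psi> (fob (HQ_to_modP s A) x) (modA_to_modP s A M)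
             (fmor (grm_to_modP s A) (fob (HQ_to_grm s A) x) (stalk M)
                (\<lambda>p. if p = 0 then h else (\<lambda>_. 0)))
      else 0)"


section \<open>Dynkin quivers and path algebras\<close>

text \<open>
  The Dynkin diagrams of type \<open>A\<^sub>n\<close>, \<open>D\<^sub>n\<close>, and \<open>E\<^sub>6, E\<^sub>7, E\<^sub>8\<close>, as sets of edges on \<open>{0, ..., n - 1}\<close>.
  In \<open>branched n b\<close>, the vertex \<open>n - 1\<close> is attached to the vertex \<open>b\<close> of the chain
  \<open>0 - 1 - ... - (n - 2)\<close>.
\<close>

definition chain :: "nat \<Rightarrow> nat set set" where
  "chain n = {{i, i + 1} | i. i + 1 < n}"

definition branched :: "nat \<Rightarrow> nat \<Rightarrow> nat set set" where
  "branched n b = insert {b, n - 1} (chain (n - 1))"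

definition dynkin_diagram :: "nat \<Rightarrow> nat set set \<Rightarrow> bool" where
  "dynkin_diagram n E \<longleftrightarrow> (1 \<le> n \<and> E = chain n) \<or> (4 \<le> n \<and> E = branched n (n - 3)) \<or>
     (n \<in> {6, 7, 8} \<and> E = branched n 2)"

definition connected_dynkin_quiver :: "('v, 'e) pre_digraph \<Rightarrow> bool" where
  "connected_dynkin_quiver Q \<longleftrightarrow> wf_digraph Q \<and>
     (\<exists>n E \<rho>. dynkin_diagram n E \<and> bij_betw \<rho> (verts Q) {..<n} \<and>
        bij_betw (\<lambda>e. {\<rho> (tail Q e), \<rho> (head Q e)}) (arcs Q) E)"

text \<open>
  Paths are pairs consisting of a start vertex and a list of consecutive arcs. The product
  \<open>x y\<close> of two paths is the path which first runs through \<open>y\<close> and then through \<open>x\<close>.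
\<close>

definition quiver_paths :: "('v, 'e) pre_digraph \<Rightarrow> ('v \<times> 'e list) set" where
  "quiver_paths Q = {(u, p). \<exists>v. pre_digraph.awalk Q u p v}"

definition path_algebra :: "('v, 'e) pre_digraph \<Rightarrow> ('k::field, 'v \<times> 'e list \<Rightarrow> 'k) kalg" where
  "path_algebra Q = \<lparr>
     acar = {x. finite {w. x w \<noteq> 0} \<and> {w. x w \<noteq> 0} \<subseteq> quiver_paths Q},
     amul = (\<lambda>x y (u, p). \<Sum>i\<le>length p.
               x (pre_digraph.awlast Q u (take i p), drop i p) * y (u, take i p)),
     aone = (\<lambda>(u, p). if u \<in> verts Q \<and> p = [] then 1 else 0),
     ascl = fscale (*)\<rparr>"

end

theory Submission
 imports Defs
begin

text \<open>
 The adjunctions identify KR(M)(X) with Hom(X, M), and KL M is generated by the image of a generator of M, as a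
 retract of the functor which has the same presentation as M. So KLR(M)(X) is the space of those morphisms
 X \<rightarrow> M which factor through a representable module (KLR_values). Graded modules form a category with enough projectives
 (enough_projectives_grm), so N \<mapsto> Hom(?, N) is an equivalence to the \<P>-modules, and it remains to see which morphisms of
 graded modules from N to M, placed in degree 0, factor through a projective object.

 Every morphism from a projective object to M factors through F \<leadsto> \<nu>(F) \<rightarrow> M, where F \<rightarrow> M is a free cover (stalk_cover). A morphism from P1 \<leadsto> \<nu>(P0) to
 F \<leadsto> \<nu>(F) has a component \<nu>(P0) \<rightarrow> \<nu>(F), which is \<nu>(b) for some b : P0 \<rightarrow> F (nu_full), and the component in degree 0 is
 then b f. Hence a morphism from P1 \<leadsto> \<nu>(P0) to M, that is, a homomorphism P1 \<rightarrow> M, factors through a projective object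
 if and only if it factors through f (factor_iff). These are the elements of the module in the statement.

 For the support, let N be indecomposable with a nonzero morphism to M of this kind. It gives a morphism t : N \<rightarrow> (F \<leadsto> \<nu>(F))
 with t^0 \<noteq> 0, so DA does not annihilate N^0. As A is hereditary, the image of \<nu>(N^0) \<rightarrow> N^1 is injective, hence of the form
 \<nu>(P0), and the image R of the corresponding homomorphism N^0 \<rightarrow> P0 is projective; so R \<leadsto> \<nu>(P0) is a nonzero direct factor of
 N (hqm_retract), and equal to N up to isomorphism.

 What is needed of A is thus that it is finite-dimensional and hereditary. For the path algebra of a Dynkin quiver, the former holds because
 the underlying graph is a tree with finitely many vertices (acyclic_quiver_dynkin), and the latter because the arcs of a
 representation may act by arbitrary linear maps (path_algebra_ext_lift).
\<close>

section \<open>Linear maps between subspaces\<close>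

lemma subspace_iff:
 assumes "vector_space s"
 shows "module.subspace s V \<longleftrightarrow> 0 : V & (\<forall>x\<in>V. \<forall>y\<in>V. x + y : V) & (\<forall>c. \<forall>x\<in>V. s c x : V)"
proof -
 interpret vector_space s by fact
 show ?thesis by (simp add: subspace_def)
qed

lemma subspaceD:
 assumes "vector_space s" "module.subspace s V"
 shows "0 : V" and "x : V ==> y : V ==> x + y : V" and "x : V ==> s c x : V"
  and "x : V ==> y : V ==> x - y : V" and "x : V ==> - x : V"
proof -
 interpret vector_space s by fact
 show "0 : V" and "x : V ==> y : V ==> x + y : V" and "x : V ==> s c x : V"
  and "x : V ==> y : V ==> x - y : V" and "x : V ==> - x : V"
  using assms(2) by (auto intro: subspace_0 subspace_add subspace_scale subspace_diff subspace_neg)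
qed

lemma subspaceI:
 assumes "vector_space s" "0 : V" "!!x y. x : V ==> y : V ==> x + y : V"
  "!!c x. x : V ==> s c x : V"
 shows "module.subspace s V"
 using assms by (simp add: subspace_iff)

lemma vs_scaleD:
 assumes "vector_space s"
 shows "s c (x + y) = s c x + s c y" "s (c + d) x = s c x + s d x" "s c (s d x) = s (c * d) x"
  "s 1 x = x" "s c 0 = 0" "s 0 x = 0" "s c (- x) = - s c x" "s c (x - y) = s c x - s c y"
  "s (-1) x = - x" "s c (sum f S) = (\<Sum>i\<in>S. s c (f i))"
proof -
 interpret vector_space s by fact
 show "s c (x + y) = s c x + s c y" "s (c + d) x = s c x + s d x" "s c (s d x) = s (c * d) x"
  "s 1 x = x" "s c 0 = 0" "s 0 x = 0" "s c (- x) = - s c x" "s c (x - y) = s c x - s c y"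
  "s (-1) x = - x" "s c (sum f S) = (\<Sum>i\<in>S. s c (f i))"
  by (auto simp: scale_right_distrib scale_left_distrib scale_right_diff_distrib scale_sum_right)
qed

lemma vector_space_fscale:
 assumes "vector_space s"
 shows "vector_space (fscale s)"
 by unfold_locales (auto simp: fscale_def fun_eq_iff vs_scaleD[OF assms])

lemma vector_space_mult: "vector_space ((*) :: 'k::field => 'k => 'k)"
 by unfold_locales (auto simp: algebra_simps)

lemma subspace_sum:
 assumes "vector_space s" "module.subspace s V" "!!i. i : I ==> f i : V"
 shows "sum f I : V"
proof -
 interpret vector_space s by fact
 show ?thesis using assms(2,3) by (rule subspace_sum)
qed

lemma subspace_UNIV': "vector_space s ==> module.subspace s UNIV"
 by (rule subspaceI) auto

lemma subspace_zero: "vector_space s ==> module.subspace s {0}"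
 by (rule subspaceI) (auto simp: vs_scaleD)

lemma linI:
 assumes "!!x. x : V ==> f x : W" "!!x y. x : V ==> y : V ==> f (x + y) = f x + f y"
  "!!c x. x : V ==> f (s c x) = t c (f x)" "!!x. x \<notin> V ==> f x = 0"
 shows "f : lin s V t W"
 using assms by (simp add: lin_def)

lemma linD:
 assumes "f : lin s V t W"
 shows "x : V ==> f x : W" "x : V ==> y : V ==> f (x + y) = f x + f y"
  "x : V ==> f (s c x) = t c (f x)" "x \<notin> V ==> f x = 0"
 using assms by (simp_all add: lin_def)

lemma lin_0:
 assumes "f : lin s V t W"
 shows "f 0 = 0"
proof (cases "0 : V")
 case True
 have "f (0 + 0) = f 0 + f 0" using linD(2)[OF assms True True] .
 then show ?thesis by simp
qed (use linD(4)[OF assms] in auto)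

lemma lin_range: "f : lin s V t W ==> 0 : W ==> f x : W"
 by (cases "x : V") (auto dest: linD)

lemma lin_diff:
 assumes "f : lin s V t W" "vector_space s" "module.subspace s V" "x : V" "y : V"
 shows "f (x - y) = f x - f y"
 using linD(2)[OF assms(1), of "x - y" y] subspaceD(4)[OF assms(2,3,4,5)] assms(5)
 by (simp add: algebra_simps)

lemma lin_sum:
 assumes "f : lin s V t W" "vector_space s" "module.subspace s V" "!!i. i : I ==> g i : V"
 shows "f (sum g I) = (\<Sum>i\<in>I. f (g i))"
 using assms(4)
proof (induction I rule: infinite_finite_induct)
 case (insert x F)
 then show ?case
  using subspace_sum[OF assms(2,3), of F g] linD(2)[OF assms(1), of "g x" "sum g F"] by simp
qed (auto simp: lin_0[OF assms(1)])

lemma lin_comp: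
 assumes "f : lin s V t W" "g : lin t W r U"
 shows "g o f : lin s V r U"
 using assms lin_0[OF assms(2)] by (auto simp: lin_def)

lemma lin_zero: "vector_space t ==> 0 : W ==> 0 : lin s V t W"
 by (auto simp: lin_def vs_scaleD)

lemma lin_mono: "f : lin s V t W ==> (!!x. x : V ==> f x : W') ==> f : lin s V t W'"
 by (auto simp: lin_def)

lemma subspace_lin:
 assumes "vector_space t" "module.subspace t W"
 shows "module.subspace (fscale t) (lin s V t W)"
 by (rule subspaceI[OF vector_space_fscale[OF assms(1)]])
  (auto simp: lin_def fscale_def vs_scaleD[OF assms(1)] subspaceD[OF assms] mult.commute)

lemma lin_add: "vector_space t ==> module.subspace t W ==> f : lin s V t W ==> g : lin s V t W
  ==> f + g : lin s V t W"
 and lin_scale: "vector_space t ==> module.subspace t W ==> f : lin s V t W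
  ==> fscale t c f : lin s V t W"
 and lin_minus: "vector_space t ==> module.subspace t W ==> f : lin s V t W ==> g : lin s V t W
  ==> f - g : lin s V t W"
 using subspaceD[OF vector_space_fscale subspace_lin] by metis+

lemma lin_eqI:
 assumes "f : lin s V t W" "g : lin s V t W'" "!!x. x : V ==> f x = g x"
 shows "f = g"
proof
 fix x show "f x = g x" using assms by (cases "x : V") (auto simp: linD(4))
qed

lemma idm_lin: "module.subspace s V ==> vector_space s ==> V \<subseteq> W ==> idm V : lin s V s W"
 by (auto simp: lin_def idm_def dest: subspaceD)

lemma idm_simp [simp]: "x : V ==> idm V x = x" "x \<notin> V ==> idm V x = 0"
 by (auto simp: idm_def)

lemma lin_idm: "f : lin s V t W ==> f o idm V = f"
 using lin_0[of f] by (auto simp: fun_eq_iff idm_def linD(4))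

lemma idm_lin_comp: "f : lin s V t W ==> 0 : W ==> idm W o f = f"
 by (auto simp: fun_eq_iff idm_def dest: lin_range)

lemma comp_add_lin:
 assumes "g : lin t W r U" "f : lin s V t W" "f' : lin s V t W"
 shows "g o (f + f') = (g o f) + (g o f')"
proof
 fix x show "(g o (f + f')) x = ((g o f) + (g o f')) x"
  by (cases "x : V") (auto simp: linD(2)[OF assms(1)] linD[OF assms(2)] linD[OF assms(3)] lin_0[OF assms(1)])
qed

lemma comp_fscale_lin:
 assumes "g : lin t W r U" "f : lin s V t W" "vector_space t" "vector_space r"
 shows "g o fscale t c f = fscale r c (g o f)"
proof
 fix x show "(g o fscale t c f) x = fscale r c (g o f) x"
  by (cases "x : V") (auto simp: fscale_def linD(3)[OF assms(1)] linD[OF assms(2)] lin_0[OF assms(1)] vs_scaleD assms(3,4))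
qed

lemma lin_ker:
 assumes "f : lin s V t W" "vector_space s" "vector_space t" "module.subspace s V"
 shows "module.subspace s {x : V. f x = 0}"
 by (rule subspaceI) (auto simp: subspaceD[OF assms(2,4)] linD[OF assms(1)] lin_0[OF assms(1)] vs_scaleD assms(2,3))

lemma lin_image:
 assumes "f : lin s V t W" "vector_space s" "vector_space t" "module.subspace s V"
 shows "module.subspace t (f ` V)"
proof (rule subspaceI)
 show "0 : f ` V" using lin_0[OF assms(1)] subspaceD(1)[OF assms(2,4)] by (metis imageI)
 show "x + y : f ` V" if "x : f ` V" "y : f ` V" for x y
  using that by (auto simp: linD(2)[OF assms(1), symmetric] intro!: imageI subspaceD(2)[OF assms(2,4)])
 show "t c x : f ` V" if "x : f ` V" for c x
  using that by (auto simp: linD(3)[OF assms(1), symmetric] intro!: imageI subspaceD(3)[OF assms(2,4)])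
qed fact

lemma lin_inj_iff:
 assumes "f : lin s V t W" "vector_space s" "module.subspace s V"
 shows "inj_on f V \<longleftrightarrow> (\<forall>x\<in>V. f x = 0 --> x = 0)"
proof
 assume "inj_on f V"
 then show "\<forall>x\<in>V. f x = 0 --> x = 0"
  using lin_0[OF assms(1)] subspaceD(1)[OF assms(2,3)] by (metis inj_onD)
next
 assume *: "\<forall>x\<in>V. f x = 0 --> x = 0"
 show "inj_on f V"
 proof (rule inj_onI)
  fix x y assume "x : V" "y : V" "f x = f y"
  then have "f (x - y) = 0" "x - y : V" using lin_diff[OF assms] subspaceD(4)[OF assms(2,3)] by auto
  then show "x = y" using * by auto
 qed
qed

text \<open>The inverse of a bijective linear map, again extended by zero.\<close>

definition lin_inv :: "'a set => ('a => 'b) => 'b => 'a::zero" where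
 "lin_inv V f y = (if y : f ` V then inv_into V f y else 0)"

lemma lin_inv_simp: "inj_on f V ==> x : V ==> lin_inv V f (f x) = x"
 by (simp add: lin_inv_def)

lemma lin_inv_lin:
 assumes "f : lin s V t W" "vector_space s" "module.subspace s V" "inj_on f V" "f ` V = U"
 shows "lin_inv V f : lin t U s V"
proof (rule linI)
 show "lin_inv V f x : V" if "x : U" for x
  using that assms(5) by (auto simp: lin_inv_def assms(4))
 show "lin_inv V f (x + y) = lin_inv V f x + lin_inv V f y" if xy: "x : U" "y : U" for x y
 proof -
  obtain a b where "a : V" "b : V" "x = f a" "y = f b" using xy assms(5) by blast
  then show ?thesis using linD(2)[OF assms(1), of a b] lin_inv_simp[OF assms(4)] subspaceD(2)[OF assms(2,3)] by metis
 qed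
 show "lin_inv V f (t c x) = s c (lin_inv V f x)" if x: "x : U" for c x
 proof -
  obtain a where "a : V" "x = f a" using x assms(5) by blast
  then show ?thesis using linD(3)[OF assms(1), of a c] lin_inv_simp[OF assms(4)] subspaceD(3)[OF assms(2,3)] by metis
 qed
 show "lin_inv V f x = 0" if "x \<notin> U" for x using that assms(5) by (simp add: lin_inv_def)
qed

text \<open>Linear algebra inside a subspace is reduced to that of the ambient space by a projection.\<close>

lemma ex_retraction:
 assumes "vector_space s" "module.subspace s V" "module.subspace s W" "V \<subseteq> W"
 shows "\<exists>rho\<in>lin s W s V. \<forall>v\<in>V. rho v = v"
proof -
 interpret vector_space s by fact
 interpret vector_space_pair s s by unfold_locales
 obtain g where g: "range g \<subseteq> V" "Vector_Spaces.linear s s g" "\<forall>v\<in>V. g v = v"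
  using linear_exists_left_inverse_on[of id V] assms(2) linear_id by auto
 interpret g: Vector_Spaces.linear s s g by fact
 show ?thesis
  by (rule bexI[of _ "\<lambda>x. if x : W then g x else 0"])
   (use g assms in "auto intro!: linI simp: g.add g.scale subspaceD[OF assms(1,3)]")
qed

lemma ex_section:
 assumes q: "q : lin s V t W" and "vector_space s" "vector_space t" "module.subspace s V" "q ` V = W"
 shows "\<exists>sigma\<in>lin t W s V. \<forall>w\<in>W. q (sigma w) = w"
proof -
 interpret a: vector_space s by fact
 interpret b: vector_space t by fact
 interpret vector_space_pair s t by unfold_locales
 interpret ba: vector_space_pair t s by unfold_locales
 obtain rho where r: "rho : lin s UNIV s V" "\<forall>v\<in>V. rho v = v"
  using ex_retraction[OF assms(2,4) subspace_UNIV'[OF assms(2)]] by auto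
 have lq: "Vector_Spaces.linear s t (q o rho)"
  using lin_comp[OF r(1) q] by (unfold_locales) (auto simp: lin_def)
 obtain g where g: "range g \<subseteq> V" "Vector_Spaces.linear t s g" "\<forall>v\<in>(q o rho) ` V. (q o rho) (g v) = v"
  using linear_exists_right_inverse_on[OF lq assms(4)] by auto
 interpret g: Vector_Spaces.linear t s g by fact
 have W: "module.subspace t W" using lin_image[OF q assms(2,3,4)] assms(5) by simp
 have "(q o rho) (g w) = w" if "w : W" for w using g(3) r(2) assms(5) that by force
 moreover have "rho (g w) = g w" for w using g(1) r(2) by blast
 ultimately have "q (g w) = w" if "w : W" for w using that by simp
 then show ?thesis
  by (intro bexI[of _ "\<lambda>x. if x : W then g x else 0"] linI)
   (use g(1) in "auto simp: g.add g.scale subspaceD[OF assms(3) W]")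
qed

lemma ex_quotient_projection:
 assumes "vector_space s" "module.subspace s V" "module.subspace s K" "K \<subseteq> V"
 shows "\<exists>p\<in>lin s V s V. (\<forall>x\<in>V. p x = 0 \<longleftrightarrow> x : K) & (\<forall>x\<in>V. p (p x) = p x)"
proof -
 obtain rho where r: "rho : lin s V s K" "\<forall>v\<in>K. rho v = v"
  using ex_retraction[OF assms(1,3,2,4)] by auto
 have rV: "rho : lin s V s V" by (rule lin_mono[OF r(1)]) (use linD(1)[OF r(1)] assms(4) in auto)
 have p: "idm V - rho : lin s V s V"
  by (rule lin_minus[OF assms(1,2) idm_lin rV]) (use assms in auto)
 have "x - rho x - rho (x - rho x) = x - rho x" "x - rho x : V" if "x : V" for x
  using that r(2) linD(1)[OF r(1) that] linD(1)[OF rV that] lin_diff[OF rV assms(1,2)] subspaceD(4)[OF assms(1,2)] by auto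
 moreover have "x - rho x = 0 \<longleftrightarrow> x : K" if "x : V" for x
  using r(2) linD(1)[OF r(1) that] by force
 ultimately show ?thesis
  by (intro bexI[OF _ p]) (simp add: lin_diff[OF rV assms(1,2)] linD(1)[OF rV])
qed

lemma fin_dim_subspace: "vector_space s ==> fin_dim s V ==> module.subspace s V"
proof -
 assume "vector_space s" "fin_dim s V"
 interpret vector_space s by fact
 show ?thesis using \<open>fin_dim s V\<close> by (auto simp: fin_dim_def subspace_span)
qed

lemma fin_dim_zero: "vector_space s ==> fin_dim s {0}"
proof -
 assume "vector_space s"
 interpret vector_space s by fact
 show ?thesis unfolding fin_dim_def by (rule exI[of _ "{}"]) simp
qed

lemma fin_dim_field: "fin_dim ((*) :: 'k::field => 'k => 'k) UNIV"
proof -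
 interpret vector_space "(*) :: 'k => 'k => 'k" by (rule vector_space_mult)
 have "x : span {1}" for x :: 'k
  using span_scale[OF span_base[of 1 "{1}"], of x] by simp
 then show ?thesis unfolding fin_dim_def by (intro exI[of _ "{1}"]) auto
qed

lemma fin_dim_basis:
 assumes "vector_space s" "fin_dim s V"
 obtains B where "finite B" "B \<subseteq> V" "\<not> module.dependent s B" "module.span s B = V"
proof -
 interpret vector_space s by fact
 obtain C where C: "finite C" "span C = V" using assms(2) by (auto simp: fin_dim_def)
 obtain B where B: "B \<subseteq> V" "independent B" "V \<subseteq> span B" using maximal_independent_subset by blast
 have "finite B" using independent_span_bound[OF C(1) B(2)] B(1) C(2) by auto
 moreover have "span B = V"
  using B fin_dim_subspace[OF assms] by (metis span_minimal subset_antisym)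
 ultimately show ?thesis using that B by blast
qed

lemma fin_dim_sub:
 assumes "vector_space s" "fin_dim s V" "module.subspace s W" "W \<subseteq> V"
 shows "fin_dim s W"
proof -
 interpret vector_space s by fact
 obtain C where C: "finite C" "span C = V" using assms(2) by (auto simp: fin_dim_def)
 obtain B where B: "B \<subseteq> W" "independent B" "W \<subseteq> span B" using maximal_independent_subset by blast
 have "finite B" using independent_span_bound[OF C(1) B(2)] B(1) C(2) assms(4) by auto
 moreover have "span B = W" using B assms(3) by (metis span_minimal subset_antisym)
 ultimately show ?thesis by (auto simp: fin_dim_def)
qed

lemma dual_basis:
 assumes "vector_space s" "fin_dim s V"
 obtains B c where "finite B" "B \<subseteq> V" "!!b. b : B ==> c b : lin s V (*) UNIV"
  "!!x. x : V ==> (\<Sum>b\<in>B. s (c b x) b) = x"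
proof -
 interpret vector_space s by fact
 obtain B where B: "finite B" "B \<subseteq> V" "independent B" "span B = V" using fin_dim_basis[OF assms] by blast
 let ?c = "\<lambda>b x. if x : V then representation B x b else 0"
 have "?c b : lin s V (*) UNIV" for b
  using B(3,4) subspace_add[OF fin_dim_subspace[OF assms]] subspace_scale[OF fin_dim_subspace[OF assms]]
  by (auto simp: lin_def representation_add representation_scale)
 moreover have "(\<Sum>b\<in>B. s (?c b x) b) = x" if "x : V" for x
  using sum_representation_eq[OF B(3) _ B(1) subset_refl, of x] B(4) that by simp
 ultimately show ?thesis by (rule that[OF B(1,2)])
qed

lemma fin_dim_image:
 assumes "f : lin s V t W" "vector_space s" "vector_space t" "fin_dim s V"
 shows "fin_dim t (f ` V)"
proof -
 note V = fin_dim_subspace[OF assms(2,4)]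
 obtain B c where B: "finite B" "B \<subseteq> V" "!!b. b : B ==> c b : lin s V (*) UNIV"
  "!!x. x : V ==> (\<Sum>b\<in>B. s (c b x) b) = x" using dual_basis[OF assms(2,4)] by metis
 interpret t: vector_space t by fact
 have "t.span (f ` B) = f ` V"
 proof
  show "t.span (f ` B) \<subseteq> f ` V"
   by (rule t.span_minimal) (use B(2) lin_image[OF assms(1-3) V] in auto)
  show "f ` V \<subseteq> t.span (f ` B)"
  proof
   fix y assume "y : f ` V"
   then obtain x where x: "x : V" "y = f x" by auto
   have "f x = f (\<Sum>b\<in>B. s (c b x) b)" by (rule arg_cong[OF B(4)[OF x(1), symmetric]])
   also have "... = (\<Sum>b\<in>B. f (s (c b x) b))"
    by (rule lin_sum[OF assms(1,2) V]) (use B(2) subspaceD(3)[OF assms(2) V] in auto)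
   also have "... = (\<Sum>b\<in>B. t (c b x) (f b))"
    by (rule sum.cong) (use B(2) linD(3)[OF assms(1)] in auto)
   also have "... : t.span (f ` B)" by (auto intro!: t.span_sum t.span_scale intro: t.span_base)
   finally show "y : t.span (f ` B)" using x by simp
  qed
 qed
 then show ?thesis using B(1) by (auto simp: fin_dim_def)
qed

lemma fin_dim_ker_image:
 assumes f: "f : lin s V t W" and "vector_space s" "vector_space t" "module.subspace s V"
  "fin_dim t (f ` V)" "fin_dim s {x\<in>V. f x = 0}"
 shows "fin_dim s V"
proof -
 interpret vector_space s by fact
 have fV: "f : lin s V t (f ` V)" by (rule lin_mono[OF f]) auto
 obtain sigma where sg: "sigma : lin t (f ` V) s V" "\<forall>w\<in>f ` V. f (sigma w) = w"
  using ex_section[OF fV assms(2,3,4)] by auto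
 obtain C where C: "finite C" "span C = {x\<in>V. f x = 0}" using assms(6) by (auto simp: fin_dim_def)
 obtain D where D: "finite D" "span D = sigma ` f ` V"
  using fin_dim_image[OF sg(1) assms(3,2,5)] by (auto simp: fin_dim_def)
 have "span (C \<union> D) = V"
 proof
  have "C \<subseteq> V" using C(2) span_superset[of C] by auto
  moreover have "D \<subseteq> V" using D(2) span_superset[of D] linD(1)[OF sg(1)] by auto
  ultimately show "span (C \<union> D) \<subseteq> V" by (intro span_minimal assms(4)) auto
  show "V \<subseteq> span (C \<union> D)"
  proof
   fix x assume x: "x : V"
   have s: "sigma (f x) : V" using linD(1)[OF sg(1)] x by auto
   have "f (x - sigma (f x)) = 0" using lin_diff[OF f assms(2,4) x s] sg(2) x by auto
   then have "x - sigma (f x) : span C" using C(2) subspaceD(4)[OF assms(2,4) x s] by auto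
   moreover have "sigma (f x) : span D" using D(2) x by auto
   ultimately have "(x - sigma (f x)) + sigma (f x) : span (C \<union> D)"
    using span_mono[of C "C \<union> D"] span_mono[of D "C \<union> D"] by (intro span_add) auto
   then show "x : span (C \<union> D)" by simp
  qed
 qed
 then show ?thesis using C(1) D(1) by (auto simp: fin_dim_def)
qed

lemma fin_dim_inj:
 assumes f: "f : lin s V t W" and "vector_space s" "vector_space t" "module.subspace s V"
  "fin_dim t W" "!!x. x : V ==> f x = 0 ==> x = 0"
 shows "fin_dim s V"
proof (rule fin_dim_ker_image[OF f assms(2-4)])
 show "fin_dim t (f ` V)"
  by (rule fin_dim_sub[OF assms(3,5) lin_image[OF f assms(2-4)]]) (use linD(1)[OF f] in auto)
 have "{x : V. f x = 0} = {0}" using assms(6) lin_0[OF f] subspaceD(1)[OF assms(2,4)] by auto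
 then show "fin_dim s {x : V. f x = 0}" using fin_dim_zero[OF assms(2)] by simp
qed

text \<open>A space of functions which are determined by finitely many of their values is
 finite-dimensional as soon as these values range over finite-dimensional spaces.\<close>

lemma fin_dim_eval:
 assumes "vector_space t" "module.subspace (fscale t) H" "finite J" "!!j. j : J ==> fin_dim t (W j)"
  "!!f j. f : H ==> j : J ==> f j : W j" "!!f. f : H ==> \<forall>j\<in>J. f j = 0 ==> f = 0"
 shows "fin_dim (fscale t) H"
 using assms(3,2,4-6)
proof (induction J arbitrary: H rule: finite_induct)
 case empty
 have "H = {0}" using empty(4) subspaceD(1)[OF vector_space_fscale[OF assms(1)] empty(1)] by blast
 then show ?case using fin_dim_zero[OF vector_space_fscale[OF assms(1)]] by simp
next
 case (insert j J)
 note v = vector_space_fscale[OF assms(1)]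
 let ?e = "\<lambda>f. if f : H then f j else 0"
 have e: "?e : lin (fscale t) H t (W j)"
  by (rule linI) (use insert.prems(3) subspaceD[OF v insert.prems(1)] in "auto simp: fscale_def")
 show ?case
 proof (rule fin_dim_ker_image[OF e v assms(1) insert.prems(1)])
  show "fin_dim t (?e ` H)"
   by (rule fin_dim_sub[OF assms(1) _ lin_image[OF e v assms(1) insert.prems(1)]])
    (use insert.prems(2,3) in auto)
  show "fin_dim (fscale t) {f : H. ?e f = 0}"
   by (rule insert.IH[OF lin_ker[OF e v assms(1) insert.prems(1)]])
    (use insert.prems in auto)
 qed
qed

lemma fin_dim_lin:
 assumes "vector_space s" "vector_space t" "fin_dim s V" "fin_dim t W"
 shows "fin_dim (fscale t) (lin s V t W)"
proof -
 obtain B c where B: "finite B" "B \<subseteq> V" "!!b. b : B ==> c b : lin s V (*) UNIV"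
  "!!x. x : V ==> (\<Sum>b\<in>B. s (c b x) b) = x" using dual_basis[OF assms(1,3)] by metis
 show ?thesis
 proof (rule fin_dim_eval[OF assms(2) subspace_lin B(1), of _ "\<lambda>_. W"])
  show "f = 0" if f: "f : lin s V t W" "\<forall>j\<in>B. f j = 0" for f
  proof (rule lin_eqI[OF f(1) lin_zero])
   fix x assume x: "x : V"
   have "f x = f (\<Sum>b\<in>B. s (c b x) b)" by (rule arg_cong[OF B(4)[OF x, symmetric]])
   also have "... = (\<Sum>b\<in>B. f (s (c b x) b))"
    by (rule lin_sum[OF f(1) assms(1) fin_dim_subspace])
     (use assms B(2) subspaceD(3)[OF assms(1) fin_dim_subspace[OF assms(1,3)]] in auto)
   also have "... = 0"
    by (rule sum.neutral) (use f(2) B(2) linD(3)[OF f(1)] in "auto simp: vs_scaleD assms(2)")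
   finally show "f x = 0 x" by simp
  qed (use assms subspaceD(1)[OF assms(2) fin_dim_subspace[OF assms(2,4)]] in auto)
  show "f j : W" if "f : lin s V t W" "j : B" for f j using linD(1)[OF that(1)] that(2) B(2) by auto
 qed (use assms(2,4) fin_dim_subspace[OF assms(2,4)] in auto)
qed

lemma finite_subset_infinite_dim:
 fixes s :: "'k::field => 'u::ab_group_add => 'u"
 assumes "vector_space s" "\<not> fin_dim s (UNIV :: 'u set)" "finite (B :: 'b set)"
 obtains \<beta> :: "'b => 'u" where "inj_on \<beta> B" "\<not> module.dependent s (\<beta> ` B)"
proof -
 interpret vector_space s by fact
 obtain C :: "'u set" where C: "independent C" "UNIV \<subseteq> span C" using maximal_independent_subset by blast
 have "infinite C" using assms(2) C(2) by (auto simp: fin_dim_def)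
 then obtain D where D: "D \<subseteq> C" "finite D" "card D = card B" using infinite_arbitrarily_large by metis
 then obtain \<beta> where "bij_betw \<beta> B D" using assms(3) finite_same_card_bij by metis
 then show ?thesis using that[of \<beta>] independent_mono[OF C(1) D(1)] by (auto simp: bij_betw_def)
qed

text \<open>A space of infinite dimension contains a copy of every finite-dimensional one; hence the choice in emb is possible.\<close>

lemma emb_spec:
 fixes s :: "'k::field => 'u::ab_group_add => 'u" and V :: "'b::ab_group_add set"
 assumes "vector_space s" "\<not> fin_dim s (UNIV :: 'u set)" "vector_space t" "fin_dim t V"
 shows "emb s t V : lin t V s UNIV" "inj_on (emb s t V) V"
proof -
 interpret a: vector_space s by fact
 interpret b: vector_space t by fact
 interpret vector_space_pair t s by unfold_locales
 obtain B where B: "finite B" "B \<subseteq> V" "b.independent B" "b.span B = V" using fin_dim_basis[OF assms(3,4)] by blast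
 obtain \<beta> :: "'b => 'u" where be: "inj_on \<beta> B" "a.independent (\<beta> ` B)"
  using finite_subset_infinite_dim[OF assms(1,2) B(1)] by blast
 obtain g where g: "Vector_Spaces.linear t s g" "\<forall>x\<in>B. g x = \<beta> x" using linear_independent_extend[OF B(3)] by blast
 interpret g: Vector_Spaces.linear t s g by fact
 have gb: "g ` B = \<beta> ` B" by (rule image_cong) (use g(2) in auto)
 have "inj_on g B" using inj_on_cong[of B g \<beta>] g(2) be(1) by auto
 then have "inj_on g (b.span B)"
  using linear_inj_on_span_iff_independent_image[OF g(1)] be(2) gb by metis
 then have "inj_on (\<lambda>x. if x : V then g x else 0) V" using B(4) by (auto simp: inj_on_def)
 moreover have "(\<lambda>x. if x : V then g x else 0) : lin t V s UNIV"
  by (rule linI) (auto simp: g.add g.scale subspaceD[OF assms(3) fin_dim_subspace[OF assms(3,4)]])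
 ultimately have "\<exists>e. e : lin t V s UNIV & inj_on e V" by blast
 from someI_ex[OF this] show "emb s t V : lin t V s UNIV" "inj_on (emb s t V) V"
  by (auto simp: emb_def)
qed

section \<open>Hom-finite linear categories and their modules\<close>

locale infinite_space =
 fixes s :: "'k::field => 'u::ab_group_add => 'u"
 assumes vs: "vector_space s" and inf_dim: "\<not> fin_dim s (UNIV :: 'u set)"

lemma mod_cat_simps [simp]: "Hom (mod_cat s C) F G = cmod_hom C s F s G"
 "(F : Ob (mod_cat s C)) = fin_pres s C F"
 "Cmp (mod_cat s C) tau sigma = (\<lambda>X. tau X o sigma X)"
 "Scl (mod_cat s C) = fscale (fscale s)"
 by (auto simp: mod_cat_def)

lemma mod_cat_ident: "Ident (mod_cat s C) F X = (if X : Ob C then idm (mval F X) else 0)"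
 by (simp add: mod_cat_def)

locale hf_category = infinite_space s for s :: "'k::field => 'u::ab_group_add => 'u" +
 fixes C :: "('k, 'o, 'm::ab_group_add) kcat"
 assumes vsC: "vector_space (Scl C)"
  and hom_fd: "X : Ob C ==> Y : Ob C ==> fin_dim (Scl C) (Hom C X Y)"
  and cmp_in: "X : Ob C ==> Y : Ob C ==> Z : Ob C ==> f : Hom C X Y ==> g : Hom C Y Z ==> Cmp C g f : Hom C X Z"
  and ident_in: "X : Ob C ==> Ident C X : Hom C X X"
  and ident_left: "X : Ob C ==> Y : Ob C ==> f : Hom C X Y ==> Cmp C (Ident C Y) f = f"
  and ident_right: "X : Ob C ==> Y : Ob C ==> f : Hom C X Y ==> Cmp C f (Ident C X) = f"
  and cmp_assoc: "W : Ob C ==> X : Ob C ==> Y : Ob C ==> Z : Ob C ==> f : Hom C W X ==> g : Hom C X Y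
    ==> h : Hom C Y Z ==> Cmp C h (Cmp C g f) = Cmp C (Cmp C h g) f"
  and cmp_add_left: "X : Ob C ==> Y : Ob C ==> Z : Ob C ==> f : Hom C X Y ==> g : Hom C Y Z ==> g' : Hom C Y Z
    ==> Cmp C (g + g') f = Cmp C g f + Cmp C g' f"
  and cmp_add_right: "X : Ob C ==> Y : Ob C ==> Z : Ob C ==> f : Hom C X Y ==> f' : Hom C X Y ==> g : Hom C Y Z
    ==> Cmp C g (f + f') = Cmp C g f + Cmp C g f'"
  and cmp_scl_left: "X : Ob C ==> Y : Ob C ==> Z : Ob C ==> f : Hom C X Y ==> g : Hom C Y Z
    ==> Cmp C (Scl C c g) f = Scl C c (Cmp C g f)"
  and cmp_scl_right: "X : Ob C ==> Y : Ob C ==> Z : Ob C ==> f : Hom C X Y ==> g : Hom C Y Z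
    ==> Cmp C g (Scl C c f) = Scl C c (Cmp C g f)"
begin

lemma hom_sub: "X : Ob C ==> Y : Ob C ==> module.subspace (Scl C) (Hom C X Y)"
 by (rule fin_dim_subspace[OF vsC hom_fd])

lemmas hom_closed = subspaceD[OF vsC hom_sub]

lemma rep_lin: "Y : Ob C ==> X : Ob C ==> rep s C Y X : lin (Scl C) (Hom C Y X) s UNIV"
 and rep_inj: "Y : Ob C ==> X : Ob C ==> inj_on (rep s C Y X) (Hom C Y X)"
 unfolding rep_def using emb_spec[OF vs inf_dim vsC hom_fd] by auto

lemma unrep_rep [simp]: "Y : Ob C ==> X : Ob C ==> h : Hom C Y X ==> unrep s C Y X (rep s C Y X h) = h"
 by (simp add: unrep_def rep_inj)

lemma rep_add: "Y : Ob C ==> X : Ob C ==> h : Hom C Y X ==> h' : Hom C Y X ==>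
  rep s C Y X (h + h') = rep s C Y X h + rep s C Y X h'"
 and rep_scl: "Y : Ob C ==> X : Ob C ==> h : Hom C Y X ==> rep s C Y X (Scl C c h) = s c (rep s C Y X h)"
 and rep_zero: "Y : Ob C ==> X : Ob C ==> rep s C Y X 0 = 0"
 using linD[OF rep_lin] lin_0[OF rep_lin] by auto

lemma cmp_zero: "X : Ob C ==> Y : Ob C ==> Z : Ob C ==> f : Hom C X Y ==> Cmp C (0 :: 'm) f = 0"
 "X : Ob C ==> Y : Ob C ==> Z : Ob C ==> g : Hom C Y Z ==> Cmp C g (0 :: 'm) = 0"
proof -
 show "X : Ob C ==> Y : Ob C ==> Z : Ob C ==> f : Hom C X Y ==> Cmp C (0 :: 'm) f = 0"
  using cmp_add_left[of X Y Z f 0 0] hom_closed(1)[of Y Z] by auto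
 show "X : Ob C ==> Y : Ob C ==> Z : Ob C ==> g : Hom C Y Z ==> Cmp C g (0 :: 'm) = 0"
  using cmp_add_right[of X Y Z 0 0 g] hom_closed(1)[of X Y] by auto
qed

lemma mval_hom_mod: "mval (hom_mod s C X) Y = rep s C Y X ` Hom C Y X"
 by (simp add: hom_mod_def)

lemma mmap_hom_mod: "Z : Ob C ==> X : Ob C ==> h : Hom C Z X ==>
  mmap (hom_mod s C X) Y Z f (rep s C Z X h) = rep s C Y X (Cmp C h f)"
 by (simp add: hom_mod_def)

lemma is_cmod_hom_mod:
 assumes "X : Ob C" shows "is_cmod C s (hom_mod s C X)"
proof -
 have sub: "module.subspace s (mval (hom_mod s C X) Y)" if "Y : Ob C" for Y
  unfolding mval_hom_mod by (rule lin_image[OF rep_lin vsC vs hom_sub]) (use assms that in auto)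
 have l: "mmap (hom_mod s C X) Y Z f : lin s (mval (hom_mod s C X) Z) s (mval (hom_mod s C X) Y)"
  if "Y : Ob C" "Z : Ob C" "f : Hom C Y Z" for Y Z f
 proof (rule linI)
  fix x y c assume x: "x : mval (hom_mod s C X) Z"
  then obtain h where h: "h : Hom C Z X" "x = rep s C Z X h" by (auto simp: mval_hom_mod)
  show "mmap (hom_mod s C X) Y Z f x : mval (hom_mod s C X) Y"
   using h that assms cmp_in by (auto simp: mmap_hom_mod mval_hom_mod)
  show "mmap (hom_mod s C X) Y Z f (s c x) = s c (mmap (hom_mod s C X) Y Z f x)"
   using h that assms by (simp add: rep_scl[symmetric] mmap_hom_mod hom_closed cmp_scl_left cmp_in)
  assume y: "y : mval (hom_mod s C X) Z"
  then obtain h' where h': "h' : Hom C Z X" "y = rep s C Z X h'" by (auto simp: mval_hom_mod)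
  show "mmap (hom_mod s C X) Y Z f (x + y) = mmap (hom_mod s C X) Y Z f x + mmap (hom_mod s C X) Y Z f y"
   using h h' that assms by (simp add: rep_add[symmetric] mmap_hom_mod hom_closed cmp_add_left cmp_in)
 next
  show "x \<notin> mval (hom_mod s C X) Z ==> mmap (hom_mod s C X) Y Z f x = 0" for x
   by (simp add: hom_mod_def)
 qed
 have eq: "u = v" if "u : lin s (mval (hom_mod s C X) Z) s W" "v : lin s (mval (hom_mod s C X) Z) s W'"
  "!!h. h : Hom C Z X ==> u (rep s C Z X h) = v (rep s C Z X h)" for u v Z W W'
  by (rule lin_eqI[OF that(1,2)]) (use that(3) in "auto simp: mval_hom_mod")
 have "mmap (hom_mod s C X) Y Y (Ident C Y) = idm (mval (hom_mod s C X) Y)" if "Y : Ob C" for Y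
  by (rule eq[OF l idm_lin[OF sub]]) (use that assms vs in "auto simp: ident_in mmap_hom_mod ident_right mval_hom_mod")
 moreover have "mmap (hom_mod s C X) Y Z (f + g) = mmap (hom_mod s C X) Y Z f + mmap (hom_mod s C X) Y Z g"
  if "Y : Ob C" "Z : Ob C" "f : Hom C Y Z" "g : Hom C Y Z" for Y Z f g
  by (rule eq[OF l lin_add[OF vs sub l l]])
   (use that assms in "auto simp: hom_closed mmap_hom_mod cmp_add_right rep_add cmp_in")
 moreover have "mmap (hom_mod s C X) Y Z (Scl C c f) = fscale s c (mmap (hom_mod s C X) Y Z f)"
  if "Y : Ob C" "Z : Ob C" "f : Hom C Y Z" for Y Z f c
  by (rule eq[OF l lin_scale[OF vs sub l]])
   (use that assms in "auto simp: fscale_def hom_closed mmap_hom_mod cmp_scl_right rep_scl cmp_in")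
 moreover have "mmap (hom_mod s C X) Y W (Cmp C g f) = mmap (hom_mod s C X) Y Z f o mmap (hom_mod s C X) Z W g"
  if "Y : Ob C" "Z : Ob C" "W : Ob C" "f : Hom C Y Z" "g : Hom C Z W" for Y Z W f g
  by (rule eq[OF l lin_comp[OF l l]])
   (use that assms in "auto simp: mmap_hom_mod cmp_in cmp_assoc")
 ultimately show ?thesis
  unfolding is_cmod_def using sub l by blast
qed

end

lemma is_cmodD:
 assumes "is_cmod C s F"
 shows "X : Ob C ==> module.subspace s (mval F X)"
  "X : Ob C ==> mmap F X X (Ident C X) = idm (mval F X)"
  "X : Ob C ==> Y : Ob C ==> f : Hom C X Y ==> mmap F X Y f : lin s (mval F Y) s (mval F X)"
  "X : Ob C ==> Y : Ob C ==> f : Hom C X Y ==> g : Hom C X Y ==> mmap F X Y (f + g) = mmap F X Y f + mmap F X Y g"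
  "X : Ob C ==> Y : Ob C ==> f : Hom C X Y ==> mmap F X Y (Scl C c f) = fscale s c (mmap F X Y f)"
  "X : Ob C ==> Y : Ob C ==> Z : Ob C ==> f : Hom C X Y ==> g : Hom C Y Z ==> mmap F X Z (Cmp C g f) = mmap F X Y f o mmap F Y Z g"
 using assms by (auto simp: is_cmod_def)

lemma cmod_homD:
 assumes "tau : cmod_hom C s F t G"
 shows "X : Ob C ==> tau X : lin s (mval F X) t (mval G X)" "X \<notin> Ob C ==> tau X = 0"
  "X : Ob C ==> Y : Ob C ==> f : Hom C X Y ==> tau X (mmap F X Y f x) = mmap G X Y f (tau Y x)"
 using assms by (auto simp: cmod_hom_def fun_eq_iff)

lemma cmod_homD_val: "tau : cmod_hom C s F t G ==> X : Ob C ==> x : mval F X ==> tau X x : mval G X"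
 by (rule linD(1)[OF cmod_homD(1)])

lemma mmap_val: "is_cmod C s F ==> X : Ob C ==> Y : Ob C ==> f : Hom C X Y ==> y : mval F Y ==> mmap F X Y f y : mval F X"
 by (rule linD(1)[OF is_cmodD(3)])

text \<open>Naturality need only be checked on the elements of the values.\<close>

lemma cmod_homI:
 assumes F: "is_cmod C s F" and G: "is_cmod C t G"
  and l: "!!X. X : Ob C ==> tau X : lin s (mval F X) t (mval G X)" and "!!X. X \<notin> Ob C ==> tau X = 0"
  and n: "!!X Y f y. X : Ob C ==> Y : Ob C ==> f : Hom C X Y ==> y : mval F Y ==>
   tau X (mmap F X Y f y) = mmap G X Y f (tau Y y)"
 shows "tau : cmod_hom C s F t G"
proof -
 have "tau X o mmap F X Y f = mmap G X Y f o tau Y" if "X : Ob C" "Y : Ob C" "f : Hom C X Y" for X Y f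
  by (rule lin_eqI[OF lin_comp[OF is_cmodD(3)[OF F] l] lin_comp[OF l is_cmodD(3)[OF G]]])
   (use that n in auto)
 then show ?thesis using assms(3,4) by (auto simp: cmod_hom_def)
qed

lemma cmod_hom_eqI:
 assumes "tau : cmod_hom C s F t G" "sigma : cmod_hom C s F t H" "!!X x. X : Ob C ==> x : mval F X ==> tau X x = sigma X x"
 shows "tau = sigma"
proof
 fix X show "tau X = sigma X"
 proof (cases "X : Ob C")
  case True
  show ?thesis by (rule lin_eqI[OF cmod_homD(1)[OF assms(1) True] cmod_homD(1)[OF assms(2) True]]) (use assms(3) True in auto)
 qed (simp add: cmod_homD(2)[OF assms(1)] cmod_homD(2)[OF assms(2)])
qed

lemma cmod_hom_comp:
 assumes "sigma : cmod_hom C s F t G" "tau : cmod_hom C t G r H"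
 shows "(\<lambda>X. tau X o sigma X) : cmod_hom C s F r H"
proof -
 have "tau X o sigma X : lin s (mval F X) r (mval H X)" if "X : Ob C" for X
  using cmod_homD(1)[OF assms(1) that] cmod_homD(1)[OF assms(2) that] by (rule lin_comp)
 moreover have "tau X o sigma X = 0" if "X \<notin> Ob C" for X
  using cmod_homD(2)[OF assms(2) that] by (auto simp: fun_eq_iff)
 ultimately show ?thesis
  using cmod_homD(3)[OF assms(1)] cmod_homD(3)[OF assms(2)] by (auto simp: cmod_hom_def fun_eq_iff)
qed

lemma subspace_cmod_hom:
 assumes "is_cmod C s F" "is_cmod C t G" "vector_space t"
 shows "module.subspace (fscale (fscale t)) (cmod_hom C s F t G)"
proof (rule subspaceI[OF vector_space_fscale[OF vector_space_fscale[OF assms(3)]]])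
 note l = lin_add[OF assms(3) is_cmodD(1)[OF assms(2)]] lin_scale[OF assms(3) is_cmodD(1)[OF assms(2)]]
  lin_zero[OF assms(3) subspaceD(1)[OF assms(3) is_cmodD(1)[OF assms(2)]]]
 note m = is_cmodD(3)[OF assms(2)]
 show "0 : cmod_hom C s F t G"
  by (rule cmod_homI[OF assms(1,2)]) (auto simp: l lin_0[OF m])
 show "tau + sigma : cmod_hom C s F t G" if "tau : cmod_hom C s F t G" "sigma : cmod_hom C s F t G" for tau sigma
  by (rule cmod_homI[OF assms(1,2)])
   (use that in "auto simp: l cmod_homD[OF that(1)] cmod_homD[OF that(2)] cmod_homD_val linD(2)[OF m]")
 show "fscale (fscale t) c tau : cmod_hom C s F t G" if "tau : cmod_hom C s F t G" for c tau
  by (rule cmod_homI[OF assms(1,2)])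
   (use that in \<open>auto simp: l fscale_def[of "fscale t"] cmod_homD[OF that] cmod_homD_val\<close>,
    auto simp: fscale_def fun_eq_iff vs_scaleD assms(3) cmod_homD[OF that] cmod_homD_val linD(3)[OF m])
qed

context hf_category
begin

text \<open>The morphism C(?, X) \<rightarrow> F which corresponds to x \<in> F(X) under the Yoneda lemma.\<close>

definition yon :: "('o, 'm, 'u) cmod => 'o => 'u => 'o => 'u => 'u" where
 "yon F X x = (\<lambda>Y v. if Y : Ob C & v : mval (hom_mod s C X) Y then mmap F Y X (unrep s C Y X v) x else 0)"

lemma yon_rep: "Y : Ob C ==> X : Ob C ==> h : Hom C Y X ==> yon F X x Y (rep s C Y X h) = mmap F Y X h x"
 by (simp add: yon_def mval_hom_mod)

lemma yon_hom:
 assumes F: "is_cmod C s F" and X: "X : Ob C" and x: "x : mval F X"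
 shows "yon F X x : cmod_hom C s (hom_mod s C X) s F"
proof (rule cmod_homI[OF is_cmod_hom_mod[OF X] F])
 fix Y assume Y: "Y : Ob C"
 show "yon F X x Y : lin s (mval (hom_mod s C X) Y) s (mval F Y)"
 proof (rule linI)
  fix v w c assume "v : mval (hom_mod s C X) Y"
  then obtain h where h: "h : Hom C Y X" "v = rep s C Y X h" by (auto simp: mval_hom_mod)
  show "yon F X x Y v : mval F Y" using h X Y x F by (simp add: yon_rep mmap_val)
  show "yon F X x Y (s c v) = s c (yon F X x Y v)"
   using h X Y by (simp add: rep_scl[symmetric] yon_rep hom_closed is_cmodD(5)[OF F] fscale_def)
  assume "w : mval (hom_mod s C X) Y"
  then obtain k where k: "k : Hom C Y X" "w = rep s C Y X k" by (auto simp: mval_hom_mod)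
  show "yon F X x Y (v + w) = yon F X x Y v + yon F X x Y w"
   using h k X Y by (simp add: rep_add[symmetric] yon_rep hom_closed is_cmodD(4)[OF F])
 qed (auto simp: yon_def)
next
 fix Y Z f v assume *: "Y : Ob C" "Z : Ob C" "f : Hom C Y Z" "v : mval (hom_mod s C X) Z"
 then obtain h where h: "h : Hom C Z X" "v = rep s C Z X h" by (auto simp: mval_hom_mod)
 show "yon F X x Y (mmap (hom_mod s C X) Y Z f v) = mmap F Y Z f (yon F X x Z v)"
  using h * X by (simp add: mmap_hom_mod yon_rep cmp_in is_cmodD(6)[OF F])
qed (auto simp: yon_def)

lemma yon_ident: "is_cmod C s F ==> X : Ob C ==> x : mval F X ==> yon F X x X (rep s C X X (Ident C X)) = x"
 by (simp add: yon_rep ident_in is_cmodD(2))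

lemma hom_mod_hom_rep:
 assumes "tau : cmod_hom C s (hom_mod s C X) t F" "X : Ob C" "Y : Ob C" "h : Hom C Y X"
 shows "tau Y (rep s C Y X h) = mmap F Y X h (tau X (rep s C X X (Ident C X)))"
 using cmod_homD(3)[OF assms(1,3,2,4), of "rep s C X X (Ident C X)"] assms
 by (simp add: mmap_hom_mod ident_in ident_left)

lemma hom_mod_hom_eqI:
 assumes "tau : cmod_hom C s (hom_mod s C X) t F" "sigma : cmod_hom C s (hom_mod s C X) t F" "X : Ob C"
  "tau X (rep s C X X (Ident C X)) = sigma X (rep s C X X (Ident C X))"
 shows "tau = sigma"
 by (rule cmod_hom_eqI[OF assms(1,2)])
  (use assms(4) hom_mod_hom_rep[OF assms(1,3)] hom_mod_hom_rep[OF assms(2,3)] in "auto simp: mval_hom_mod")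

lemma rep_ident_mem: "X : Ob C ==> rep s C X X (Ident C X) : mval (hom_mod s C X) X"
 by (auto simp: mval_hom_mod ident_in)

lemma yon_eq:
 assumes "tau : cmod_hom C s (hom_mod s C X) s F" "X : Ob C" "is_cmod C s F"
 shows "tau = yon F X (tau X (rep s C X X (Ident C X)))"
proof (rule hom_mod_hom_eqI[OF assms(1) yon_hom assms(2)])
 show "tau X (rep s C X X (Ident C X)) : mval F X" using assms by (auto intro: cmod_homD_val rep_ident_mem)
 then show "tau X (rep s C X X (Ident C X)) = yon F X (tau X (rep s C X X (Ident C X))) X (rep s C X X (Ident C X))"
  using assms yon_ident by simp
qed fact+

abbreviation "Yo \<equiv> yoneda s C C"

lemma fob_yoneda [simp]: "fob (yoneda s C B) X = hom_mod s C X"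
 by (simp add: yoneda_def)

lemma fmor_yoneda_rep: "Y : Ob B ==> Y : Ob C ==> X : Ob C ==> h : Hom C Y X ==>
  fmor (yoneda s C B) X X' g Y (rep s C Y X h) = rep s C Y X' (Cmp C g h)"
 by (simp add: yoneda_def mval_hom_mod)

lemma is_cmod_full: "is_cmod C s F ==> Ob B \<subseteq> Ob C ==> Hom B = Hom C ==> Cmp B = Cmp C ==> Ident B = Ident C
  ==> Scl B = Scl C ==> is_cmod B s F"
 unfolding is_cmod_def by (auto simp: subset_iff)

lemma fmor_yoneda_hom:
 assumes X: "X : Ob C" and X': "X' : Ob C" and g: "g : Hom C X X'"
  and B: "Ob B \<subseteq> Ob C" "Hom B = Hom C" "Cmp B = Cmp C" "Ident B = Ident C" "Scl B = Scl C"
 shows "fmor (yoneda s C B) X X' g : cmod_hom B s (hom_mod s C X) s (hom_mod s C X')"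
proof (rule cmod_homI[OF is_cmod_full[OF is_cmod_hom_mod] is_cmod_full[OF is_cmod_hom_mod]])
 fix Y assume YB: "Y : Ob B" then have Y: "Y : Ob C" using B by auto
 show "fmor (yoneda s C B) X X' g Y : lin s (mval (hom_mod s C X) Y) s (mval (hom_mod s C X') Y)"
 proof (rule linI)
  fix v w c assume "v : mval (hom_mod s C X) Y"
  then obtain h where h: "h : Hom C Y X" "v = rep s C Y X h" by (auto simp: mval_hom_mod)
  show "fmor (yoneda s C B) X X' g Y v : mval (hom_mod s C X') Y"
   using h X Y YB X' g by (auto simp: fmor_yoneda_rep mval_hom_mod cmp_in)
  show "fmor (yoneda s C B) X X' g Y (s c v) = s c (fmor (yoneda s C B) X X' g Y v)"
   using h X X' g Y YB by (simp add: rep_scl[symmetric] fmor_yoneda_rep hom_closed cmp_in cmp_scl_right)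
  assume "w : mval (hom_mod s C X) Y"
  then obtain k where k: "k : Hom C Y X" "w = rep s C Y X k" by (auto simp: mval_hom_mod)
  show "fmor (yoneda s C B) X X' g Y (v + w) = fmor (yoneda s C B) X X' g Y v + fmor (yoneda s C B) X X' g Y w"
   using h k X X' g Y YB by (simp add: rep_add[symmetric] fmor_yoneda_rep hom_closed cmp_in cmp_add_right)
 qed (auto simp: yoneda_def)
next
 fix Y Z f v assume YZ: "Y : Ob B" "Z : Ob B" and *: "f : Hom B Y Z" "v : mval (hom_mod s C X) Z"
 then obtain h where h: "h : Hom C Z X" "v = rep s C Z X h" by (auto simp: mval_hom_mod)
 have "Y : Ob C" "Z : Ob C" using YZ B by auto
 then show "fmor (yoneda s C B) X X' g Y (mmap (hom_mod s C X) Y Z f v) = mmap (hom_mod s C X') Y Z f (fmor (yoneda s C B) X X' g Z v)"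
  using h YZ * X X' g B by (simp add: mmap_hom_mod fmor_yoneda_rep cmp_in cmp_assoc)
qed (use assms in "auto simp: yoneda_def")

lemma fmor_Yo_hom: "X : Ob C ==> X' : Ob C ==> g : Hom C X X' ==>
  fmor Yo X X' g : cmod_hom C s (hom_mod s C X) s (hom_mod s C X')"
 by (rule fmor_yoneda_hom) auto

lemma Yo_full:
 assumes "tau : cmod_hom C s (hom_mod s C X) s (hom_mod s C X')" "X : Ob C" "X' : Ob C"
  "h : Hom C X X'" "tau X (rep s C X X (Ident C X)) = rep s C X X' h"
 shows "tau = fmor Yo X X' h"
 by (rule hom_mod_hom_eqI[OF assms(1) fmor_Yo_hom assms(2)])
  (use assms in "auto simp: fmor_yoneda_rep ident_in ident_right")

lemma fin_pres_hom_mod: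
 assumes "X : Ob C" shows "fin_pres s C (hom_mod s C X)"
proof -
 let ?\<pi> = "\<lambda>Y. if Y : Ob C then idm (mval (hom_mod s C X) Y) else 0"
 note m = is_cmod_hom_mod[OF assms]
 have "?\<pi> : cmod_hom C s (hom_mod s C X) s (hom_mod s C X)"
  by (rule cmod_homI[OF m m]) (auto simp: idm_lin is_cmodD(1)[OF m] vs mmap_val[OF m])
 moreover have z: "0 : Hom C X X" using hom_closed(1) assms by auto
 moreover have "fmor Yo X X 0 Y ` mval (hom_mod s C X) Y = {0}" if "Y : Ob C" for Y
 proof -
  have "fmor Yo X X 0 Y v = 0" if "v : mval (hom_mod s C X) Y" for v
   using that assms \<open>Y : Ob C\<close> z by (auto simp: mval_hom_mod fmor_yoneda_rep cmp_zero[of _ X X] rep_zero)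
  moreover have "0 : mval (hom_mod s C X) Y" using subspaceD(1)[OF vs is_cmodD(1)[OF m that]] .
  ultimately show ?thesis by auto
 qed
 moreover have "{v : mval (hom_mod s C X) Y. ?\<pi> Y v = 0} = {0}" if "Y : Ob C" for Y
  using that subspaceD(1)[OF vs is_cmodD(1)[OF m that]] by auto
 ultimately show ?thesis
  unfolding fin_pres_def using m assms
  by (intro conjI bexI[of _ X] bexI[of _ 0] bexI[of _ ?\<pi>] ballI) auto
qed

lemma fin_presE:
 assumes "fin_pres s C F"
 obtains X1 X0 g \<pi> where "is_cmod C s F" "X1 : Ob C" "X0 : Ob C" "g : Hom C X1 X0"
  "\<pi> : cmod_hom C s (hom_mod s C X0) s F"
  "!!Y. Y : Ob C ==> \<pi> Y ` mval (hom_mod s C X0) Y = mval F Y"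
  "!!Y. Y : Ob C ==> {v : mval (hom_mod s C X0) Y. \<pi> Y v = 0} =
      fmor Yo X1 X0 g Y ` mval (hom_mod s C X1) Y"
proof -
 have F: "is_cmod C s F" using assms by (simp add: fin_pres_def)
 obtain X1 X0 g \<pi> where *: "X1 : Ob C" "X0 : Ob C" "g : Hom C X1 X0"
  "\<pi> : cmod_hom C s (hom_mod s C X0) s F" and
  **: "\<forall>Y\<in>Ob C. \<pi> Y ` mval (hom_mod s C X0) Y = mval F Y \<and>
     {v : mval (hom_mod s C X0) Y. \<pi> Y v = 0} = fmor Yo X1 X0 g Y ` mval (hom_mod s C X1) Y"
  using assms unfolding fin_pres_def by (elim conjE bexE) (rule that)
 show ?thesis
  by (rule that[OF F *]) (rule bspec[OF **, THEN conjunct1] bspec[OF **, THEN conjunct2], assumption)+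
qed

lemma fin_pres_cover:
 assumes "fin_pres s C F"
 obtains X0 \<pi> where "X0 : Ob C" "\<pi> : cmod_hom C s (hom_mod s C X0) s F"
  "!!Y. Y : Ob C ==> \<pi> Y ` mval (hom_mod s C X0) Y = mval F Y"
 by (rule fin_presE[OF assms]) (rule that)

lemma fin_pres_fin_dim:
 assumes "fin_pres s C F" "Y : Ob C"
 shows "fin_dim s (mval F Y)"
proof -
 obtain X0 \<pi> where *: "X0 : Ob C" "\<pi> : cmod_hom C s (hom_mod s C X0) s F"
  "!!Y. Y : Ob C ==> \<pi> Y ` mval (hom_mod s C X0) Y = mval F Y"
  by (rule fin_pres_cover[OF assms(1)]) (rule that)
 have "fin_dim s (mval (hom_mod s C X0) Y)"
  unfolding mval_hom_mod by (rule fin_dim_image[OF rep_lin vsC vs hom_fd]) (use assms * in auto)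
 then show ?thesis using fin_dim_image[OF cmod_homD(1)[OF *(2) assms(2)] vs vs] *(3)[OF assms(2)] by auto
qed

abbreviation "MC \<equiv> mod_cat s C"

lemma fin_pres_cmod: "fin_pres s C F ==> is_cmod C s F"
 by (simp add: fin_pres_def)

lemma ident_hom: "is_cmod C s F ==> Ident (mod_cat s C) F : cmod_hom C s F s F"
 by (rule cmod_homI) (auto simp: mod_cat_ident idm_lin is_cmodD(1) vs mmap_val)

text \<open>A morphism is determined by its value at the generator of its source, so the modules form again a category with finite-dimensional
 spaces of morphisms, and the formation of module categories can be iterated.\<close>

lemma cmod_hom_fin_dim:
 assumes F: "fin_pres s C F" and G: "fin_pres s C G"
 shows "fin_dim (fscale (fscale s)) (cmod_hom C s F s G)"
proof -
 obtain X0 \<pi> where *: "X0 : Ob C" "\<pi> : cmod_hom C s (hom_mod s C X0) s F"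
  "!!Y. Y : Ob C ==> \<pi> Y ` mval (hom_mod s C X0) Y = mval F Y"
  by (rule fin_pres_cover[OF F]) (rule that)
 note v = vector_space_fscale[OF vector_space_fscale[OF vs]]
 note H = subspace_cmod_hom[OF fin_pres_cmod[OF F] fin_pres_cmod[OF G] vs]
 define z where "z = \<pi> X0 (rep s C X0 X0 (Ident C X0))"
 have z: "z : mval F X0" unfolding z_def by (rule cmod_homD_val[OF *(2,1) rep_ident_mem[OF *(1)]])
 let ?e = "\<lambda>tau. if tau : cmod_hom C s F s G then tau X0 z else 0"
 show ?thesis
 proof (rule fin_dim_inj[where f = ?e, OF _ v vs H fin_pres_fin_dim[OF G *(1)]])
  show "?e : lin (fscale (fscale s)) (cmod_hom C s F s G) s (mval G X0)"
   by (rule linI) (use subspaceD[OF v H] cmod_homD_val[OF _ *(1) z] in "auto simp: fscale_def")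
  show "tau = 0" if t: "tau : cmod_hom C s F s G" "?e tau = 0" for tau
  proof (rule cmod_hom_eqI[OF t(1) subspaceD(1)[OF v H]])
   fix Y y assume Y: "Y : Ob C" "y : mval F Y"
   then obtain h where h: "h : Hom C Y X0" "y = \<pi> Y (rep s C Y X0 h)"
    using *(3) by (auto simp: mval_hom_mod)
   then have "y = mmap F Y X0 h z" using hom_mod_hom_rep[OF *(2,1) Y(1)] by (simp add: z_def)
   then show "tau Y y = 0 Y y"
    using cmod_homD(3)[OF t(1) Y(1) *(1) h(1)] t lin_0[OF is_cmodD(3)[OF fin_pres_cmod[OF G] Y(1) *(1) h(1)]]
    by auto
  qed
 qed
qed

lemma hf_category_mod_cat: "hf_category s (mod_cat s C)"
proof (intro hf_category.intro hf_category_axioms.intro infinite_space_axioms)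
 show "vector_space (Scl MC)" by (simp add: vs vector_space_fscale)
 show "fin_dim (Scl MC) (Hom MC X Y)" if "X : Ob MC" "Y : Ob MC" for X Y
  using that by (simp add: cmod_hom_fin_dim)
 show "Ident MC X : Hom MC X X" if "X : Ob MC" for X
  using that by (simp add: ident_hom fin_pres_cmod)
 show "Cmp MC g f : Hom MC X Z" if "f : Hom MC X Y" "g : Hom MC Y Z" for X Y Z f g
  using that by (simp add: cmod_hom_comp)
 show "Cmp MC (Ident MC Y) f = f" if "X : Ob MC" "Y : Ob MC" "f : Hom MC X Y" for X Y f
  using that unfolding mod_cat_simps
  by (intro cmod_hom_eqI[OF cmod_hom_comp[OF _ ident_hom]])
   (auto simp: fin_pres_cmod mod_cat_ident dest: cmod_homD_val)
 show "Cmp MC f (Ident MC X) = f" if "X : Ob MC" "Y : Ob MC" "f : Hom MC X Y" for X Y f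
  using that unfolding mod_cat_simps
  by (intro cmod_hom_eqI[OF cmod_hom_comp[OF ident_hom]])
   (auto simp: fin_pres_cmod mod_cat_ident)
 show "Cmp MC h (Cmp MC g f) = Cmp MC (Cmp MC h g) f" for f g h by (simp add: comp_assoc)
 show "Cmp MC (g + g') f = Cmp MC g f + Cmp MC g' f" for f g g' by (auto simp: fun_eq_iff)
 show "Cmp MC (Scl MC c g) f = Scl MC c (Cmp MC g f)" for f g c by (auto simp: fun_eq_iff fscale_def)
 fix X Y Z f f' g c assume *: "X : Ob MC" "Y : Ob MC" "Z : Ob MC" "f : Hom MC X Y" "g : Hom MC Y Z"
 have **: "(g W o (f W + f' W)) = (g W o f W) + (g W o f' W)" if "f' : Hom MC X Y" "W : Ob C" for W
  by (rule comp_add_lin) (use * that cmod_homD(1) in auto)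
 have g0: "g W = 0" if "W \<notin> Ob C" for W by (rule cmod_homD(2)[OF _ that]) (use *(5) in simp)
 show "Cmp MC g (f + f') = Cmp MC g f + Cmp MC g f'" if "f' : Hom MC X Y"
 proof
  fix W show "Cmp MC g (f + f') W = (Cmp MC g f + Cmp MC g f') W"
   using **[OF that, of W] g0[of W] by (cases "W : Ob C") auto
 qed
 show "Cmp MC g (Scl MC c f) = Scl MC c (Cmp MC g f)"
 proof
  fix W show "Cmp MC g (Scl MC c f) W = Scl MC c (Cmp MC g f) W"
  proof (cases "W : Ob C")
   case True
   have "g W o fscale s c (f W) = fscale s c (g W o f W)"
    by (rule comp_fscale_lin) (use * True cmod_homD(1) vs in auto)
   then show ?thesis by (simp add: fscale_def)
  next
   case False
   then show ?thesis using g0[OF False] by (auto simp: fun_eq_iff fscale_def vs_scaleD(5)[OF vs])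
  qed
 qed
qed

end

section \<open>Cokernels of modules\<close>

text \<open>A quotient of a module is realized on complements of the submodule, chosen at each object.\<close>

lemma ex_quotient_cmod:
 assumes "vector_space s" and V: "is_cmod C s V"
  and W: "!!X. X : Ob C ==> module.subspace s (W X)" "!!X. X : Ob C ==> W X \<subseteq> mval V X"
  and st: "!!X Y f w. X : Ob C ==> Y : Ob C ==> f : Hom C X Y ==> w : W Y ==> mmap V X Y f w : W X"
 obtains F \<pi> where "is_cmod C s F" "\<pi> : cmod_hom C s V s F"
  "!!X. X : Ob C ==> \<pi> X ` mval V X = mval F X"
  "!!X. X : Ob C ==> {v : mval V X. \<pi> X v = 0} = W X"
proof -
 have "\<forall>X. \<exists>p. X : Ob C --> p : lin s (mval V X) s (mval V X) & (\<forall>x\<in>mval V X. p x = 0 \<longleftrightarrow> x : W X) & (\<forall>x\<in>mval V X. p (p x) = p x)"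
  using ex_quotient_projection[OF assms(1) is_cmodD(1)[OF V] W] by meson
 then obtain p where p: "!!X. X : Ob C ==> p X : lin s (mval V X) s (mval V X)"
  "!!X x. X : Ob C ==> x : mval V X ==> p X x = 0 \<longleftrightarrow> x : W X"
  "!!X x. X : Ob C ==> x : mval V X ==> p X (p X x) = p X x" by metis
 define F where "F = \<lparr>mval = (\<lambda>X. p X ` mval V X),
  mmap = (\<lambda>X Y f v. if v : p Y ` mval V Y then p X (mmap V X Y f v) else 0)\<rparr>"
 define \<pi> where "\<pi> = (\<lambda>X. if X : Ob C then p X else 0)"
 note sV = is_cmodD(1)[OF V]
 have sub: "module.subspace s (mval F X)" if "X : Ob C" for X
  unfolding F_def using lin_image[OF p(1)[OF that] assms(1,1) sV[OF that]] by simp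
 have pV: "p X x : mval V X" if "X : Ob C" "x : mval V X" for X x
  by (rule linD(1)[OF p(1)]) (use that in auto)
 \<comment> \<open>replacing an element by its representative in the complement changes it by an element of the submodule\<close>
 have key: "p X (mmap V X Y f (p Y v)) = p X (mmap V X Y f v)"
  if "X : Ob C" "Y : Ob C" "f : Hom C X Y" "v : mval V Y" for X Y f v
 proof -
  have d: "v - p Y v : mval V Y" using subspaceD(4)[OF assms(1) sV] that pV by auto
  have "p Y (v - p Y v) = 0"
   using lin_diff[OF p(1) assms(1) sV that(4) pV] that p(3) by auto
  then have "v - p Y v : W Y" using p(2) that d by auto
  then have m: "mmap V X Y f (v - p Y v) : W X" using st that by auto
  then have "p X (mmap V X Y f (v - p Y v)) = 0" using p(2) W(2) that by blast
  moreover have "mmap V X Y f (v - p Y v) = mmap V X Y f v - mmap V X Y f (p Y v)"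
   by (rule lin_diff[OF is_cmodD(3)[OF V] assms(1) sV]) (use that pV in auto)
  moreover have "p X (mmap V X Y f v - mmap V X Y f (p Y v)) = p X (mmap V X Y f v) - p X (mmap V X Y f (p Y v))"
   by (rule lin_diff[OF p(1) assms(1) sV]) (use that pV mmap_val[OF V] in auto)
  ultimately show ?thesis by simp
 qed
 have pF: "mmap F X Y f (p Y v) = p X (mmap V X Y f v)"
  if "X : Ob C" "Y : Ob C" "f : Hom C X Y" "v : mval V Y" for X Y f v
  using that key by (simp add: F_def)
 have l: "mmap F X Y f : lin s (mval F Y) s (mval F X)"
  if *: "X : Ob C" "Y : Ob C" "f : Hom C X Y" for X Y f
 proof (rule linI)
  fix a b c assume "a : mval F Y"
  then obtain x where x: "x : mval V Y" "a = p Y x" by (auto simp: F_def)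
  show "mmap F X Y f a : mval F X" using pF[OF * x(1)] mmap_val[OF V * x(1)] x by (auto simp: F_def)
  have "mmap F X Y f (s c a) = mmap F X Y f (p Y (s c x))" using x linD(3)[OF p(1)[OF *(2)]] by simp
  also have "... = s c (mmap F X Y f a)"
   using pF[OF *] x * subspaceD(3)[OF assms(1) sV] linD(3)[OF is_cmodD(3)[OF V *]] linD(3)[OF p(1)[OF *(1)]] mmap_val[OF V *]
   by simp
  finally show "mmap F X Y f (s c a) = s c (mmap F X Y f a)" .
  assume "b : mval F Y"
  then obtain y where y: "y : mval V Y" "b = p Y y" by (auto simp: F_def)
  have "mmap F X Y f (a + b) = mmap F X Y f (p Y (x + y))" using x y linD(2)[OF p(1)[OF *(2)]] by simp
  also have "... = mmap F X Y f a + mmap F X Y f b"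
   using pF[OF *] x y * subspaceD(2)[OF assms(1) sV] linD(2)[OF is_cmodD(3)[OF V *]] linD(2)[OF p(1)[OF *(1)]] mmap_val[OF V *]
   by simp
  finally show "mmap F X Y f (a + b) = mmap F X Y f a + mmap F X Y f b" .
 qed (auto simp: F_def)
 have "mmap F X X (Ident C X) = idm (mval F X)" if X: "X : Ob C" for X
 proof
  fix v show "mmap F X X (Ident C X) v = idm (mval F X) v"
  proof (cases "v : mval F X")
   case True
   then show ?thesis using p(3)[OF X] pV[OF X] X by (auto simp: F_def is_cmodD(2)[OF V])
  qed (simp add: F_def)
 qed
 moreover have "mmap F X Y (f + g) = mmap F X Y f + mmap F X Y g"
  "mmap F X Y (Scl C c f) = fscale s c (mmap F X Y f)"
  if *: "X : Ob C" "Y : Ob C" "f : Hom C X Y" "g : Hom C X Y" for X Y f g c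
 proof -
  have a: "p X (mmap V X Y (f + g) v) = p X (mmap V X Y f v) + p X (mmap V X Y g v)"
   "p X (mmap V X Y (Scl C c f) v) = s c (p X (mmap V X Y f v))" if v: "v : mval V Y" for v
   using linD(2,3)[OF p(1)[OF *(1)]] mmap_val[OF V *(1,2) _ v] * is_cmodD(4,5)[OF V] by (auto simp: fscale_def)
  show "mmap F X Y (f + g) = mmap F X Y f + mmap F X Y g"
  proof
   fix v show "mmap F X Y (f + g) v = (mmap F X Y f + mmap F X Y g) v"
    using a pV * by (auto simp: F_def)
  qed
  show "mmap F X Y (Scl C c f) = fscale s c (mmap F X Y f)"
  proof
   fix v show "mmap F X Y (Scl C c f) v = fscale s c (mmap F X Y f) v"
    using a pV * by (auto simp: F_def fscale_def vs_scaleD(5)[OF assms(1)])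
  qed
 qed
 moreover have "mmap F X Z (Cmp C g f) = mmap F X Y f o mmap F Y Z g"
  if "X : Ob C" "Y : Ob C" "Z : Ob C" "f : Hom C X Y" "g : Hom C Y Z" for X Y Z f g
 proof
  fix v show "mmap F X Z (Cmp C g f) v = (mmap F X Y f o mmap F Y Z g) v"
  proof (cases "v : mval F Z")
   case True
   then obtain x where x: "x : mval V Z" "v = p Z x" by (auto simp: F_def)
   have "mmap F X Z (Cmp C g f) v = p X (mmap V X Z (Cmp C g f) v)" using True by (simp add: F_def)
   also have "... = p X (mmap V X Y f (mmap V Y Z g v))" using is_cmodD(6)[OF V] that by simp
   also have "... = p X (mmap V X Y f (mmap V Y Z g (p Z x)))" using x by simp
   also have "... = mmap F X Y f (p Y (mmap V Y Z g (p Z x)))"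
    using pF that mmap_val[OF V] pV x by simp
   also have "... = (mmap F X Y f o mmap F Y Z g) v" using pF that x key by simp
   finally show ?thesis .
  next
   case False
   then have "mmap F X Z (Cmp C g f) v = 0" "mmap F Y Z g v = 0" by (simp_all add: F_def)
   then show ?thesis using that lin_0[OF l, of X Y f] by simp
  qed
 qed
 ultimately have F: "is_cmod C s F" unfolding is_cmod_def using sub l by blast
 moreover have "\<pi> : cmod_hom C s V s F"
  by (rule cmod_homI[OF V F]) (auto simp: \<pi>_def pF intro!: lin_mono[OF p(1)], auto simp: F_def)
 moreover have "\<pi> X ` mval V X = mval F X" "{v : mval V X. \<pi> X v = 0} = W X" if "X : Ob C" for X
  using that p(2) W(2) by (auto simp: \<pi>_def F_def)
 ultimately show ?thesis using that by blast
qed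

lemma cmod_factor:
 assumes "vector_space s" and V: "is_cmod C s V" and F: "is_cmod C s F" and G: "is_cmod C s G"
  and pi: "\<pi> : cmod_hom C s V s F" and su: "!!X. X : Ob C ==> \<pi> X ` mval V X = mval F X"
  and t: "tau : cmod_hom C s V s G"
  and ker: "!!X v. X : Ob C ==> v : mval V X ==> \<pi> X v = 0 ==> tau X v = 0"
 obtains theta where "theta : cmod_hom C s F s G" "!!X v. X : Ob C ==> v : mval V X ==> theta X (\<pi> X v) = tau X v"
proof -
 define theta where "theta = (\<lambda>X x. if X : Ob C & x : mval F X then tau X (SOME v. v : mval V X & \<pi> X v = x) else 0)"
 have th: "theta X (\<pi> X v) = tau X v" if X: "X : Ob C" and v: "v : mval V X" for X v
 proof -
  define w where "w = (SOME w. w : mval V X & \<pi> X w = \<pi> X v)"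
  have w: "w : mval V X" "\<pi> X w = \<pi> X v" using someI[of "\<lambda>w. w : mval V X & \<pi> X w = \<pi> X v" v] v by (auto simp: w_def)
  have d: "w - v : mval V X" using subspaceD(4)[OF assms(1) is_cmodD(1)[OF V X]] w v by auto
  have "\<pi> X (w - v) = 0" using lin_diff[OF cmod_homD(1)[OF pi X] assms(1) is_cmodD(1)[OF V X]] w v by auto
  then have "tau X (w - v) = 0" using ker X d by auto
  then have "tau X w = tau X v" using lin_diff[OF cmod_homD(1)[OF t X] assms(1) is_cmodD(1)[OF V X]] w v by auto
  then show ?thesis using X v cmod_homD_val[OF pi X v] by (simp add: theta_def w_def)
 qed
 have ex: "\<exists>v\<in>mval V X. x = \<pi> X v" if "X : Ob C" "x : mval F X" for X x
  using su[OF that(1)] that(2) by blast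
 have "theta : cmod_hom C s F s G"
 proof (rule cmod_homI[OF F G])
  fix X assume X: "X : Ob C"
  note pl = linD[OF cmod_homD(1)[OF pi X]] and tl = linD[OF cmod_homD(1)[OF t X]]
  note sV = subspaceD[OF assms(1) is_cmodD(1)[OF V X]]
  show "theta X : lin s (mval F X) s (mval G X)"
  proof (rule linI)
   fix x y c assume "x : mval F X"
   then obtain v where v: "v : mval V X" "x = \<pi> X v" using ex X by auto
   show "theta X x : mval G X" using v th X tl(1) by simp
   show "theta X (s c x) = s c (theta X x)"
    using th[OF X sV(3)[OF v(1)]] th[OF X v(1)] v pl(3) tl(3) by simp
   assume "y : mval F X"
   then obtain w where w: "w : mval V X" "y = \<pi> X w" using ex X by auto
   show "theta X (x + y) = theta X x + theta X y"
    using th[OF X sV(2)[OF v(1) w(1)]] th[OF X v(1)] th[OF X w(1)] v w pl(2) tl(2) by simp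
  qed (simp add: theta_def)
 next
  fix X Y f y assume *: "X : Ob C" "Y : Ob C" "f : Hom C X Y" "y : mval F Y"
  then obtain v where v: "v : mval V Y" "y = \<pi> Y v" using ex by auto
  have "mmap F X Y f y = \<pi> X (mmap V X Y f v)" using cmod_homD(3)[OF pi *(1-3)] v by simp
  then show "theta X (mmap F X Y f y) = mmap G X Y f (theta Y y)"
   using th[OF *(1) mmap_val[OF V *(1-3) v(1)]] th[OF *(2) v(1)] v(2) cmod_homD(3)[OF t *(1-3)] by simp
 qed (auto simp: theta_def fun_eq_iff)
 then show ?thesis using th by (rule that)
qed

lemma cmod_inverse:
 assumes "vector_space s" and F: "is_cmod C s F" and G: "is_cmod C s G"
  and t: "tau : cmod_hom C s F s G" and b: "!!X. X : Ob C ==> bij_betw (tau X) (mval F X) (mval G X)"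
 obtains sigma where "sigma : cmod_hom C s G s F" "!!X x. X : Ob C ==> x : mval F X ==> sigma X (tau X x) = x"
  "!!X y. X : Ob C ==> y : mval G X ==> tau X (sigma X y) = y"
proof -
 have su: "tau X ` mval F X = mval G X" if "X : Ob C" for X using b[OF that] by (simp add: bij_betw_def)
 let ?id = "\<lambda>X. if X : Ob C then idm (mval F X) else 0"
 have i: "?id : cmod_hom C s F s F"
  by (rule cmod_homI[OF F F]) (auto simp: idm_lin is_cmodD(1)[OF F] assms(1) mmap_val[OF F])
 obtain sigma where s: "sigma : cmod_hom C s G s F" "!!X v. X : Ob C ==> v : mval F X ==> sigma X (tau X v) = ?id X v"
 proof (rule cmod_factor[OF assms(1) F G F t su i])
  show "?id X v = 0" if X: "X : Ob C" "v : mval F X" "tau X v = 0" for X v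
   using that b[OF X(1)] lin_inj_iff[OF cmod_homD(1)[OF t X(1)] assms(1) is_cmodD(1)[OF F X(1)]]
   by (auto simp: bij_betw_def)
 qed (assumption, rule that)
 show ?thesis
 proof (rule that[OF s(1)])
  show "sigma X (tau X x) = x" if "X : Ob C" "x : mval F X" for X x using s(2) that by simp
  then show "tau X (sigma X y) = y" if "X : Ob C" "y : mval G X" for X y using su[OF that(1)] that by force
 qed
qed

lemma (in hf_category) ex_cokernel:
 assumes "X1 : Ob C" "X0 : Ob C" "g : Hom C X1 X0"
 obtains F \<pi> where "fin_pres s C F" "\<pi> : cmod_hom C s (hom_mod s C X0) s F"
  "!!Y. Y : Ob C ==> \<pi> Y ` mval (hom_mod s C X0) Y = mval F Y"
  "!!Y. Y : Ob C ==> {v : mval (hom_mod s C X0) Y. \<pi> Y v = 0} = fmor Yo X1 X0 g Y ` mval (hom_mod s C X1) Y"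
proof -
 note h = fmor_Yo_hom[OF assms] and m = is_cmod_hom_mod[OF assms(1)]
 obtain F \<pi> where *: "is_cmod C s F" "\<pi> : cmod_hom C s (hom_mod s C X0) s F"
  "!!Y. Y : Ob C ==> \<pi> Y ` mval (hom_mod s C X0) Y = mval F Y"
  "!!Y. Y : Ob C ==> {v : mval (hom_mod s C X0) Y. \<pi> Y v = 0} = fmor Yo X1 X0 g Y ` mval (hom_mod s C X1) Y"
 proof (rule ex_quotient_cmod[OF vs is_cmod_hom_mod[OF assms(2)], of "\<lambda>Y. fmor Yo X1 X0 g Y ` mval (hom_mod s C X1) Y"])
  show "module.subspace s (fmor Yo X1 X0 g Y ` mval (hom_mod s C X1) Y)" if "Y : Ob C" for Y
   by (rule lin_image[OF cmod_homD(1)[OF h that] vs vs is_cmodD(1)[OF m that]])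
  show "fmor Yo X1 X0 g Y ` mval (hom_mod s C X1) Y \<subseteq> mval (hom_mod s C X0) Y" if "Y : Ob C" for Y
   using cmod_homD_val[OF h that] by auto
  show "mmap (hom_mod s C X0) X Y f w : fmor Yo X1 X0 g X ` mval (hom_mod s C X1) X"
   if *: "X : Ob C" "Y : Ob C" "f : Hom C X Y" and w: "w : fmor Yo X1 X0 g Y ` mval (hom_mod s C X1) Y" for X Y f w
  proof -
   obtain v where v: "v : mval (hom_mod s C X1) Y" "w = fmor Yo X1 X0 g Y v" using w by auto
   then show ?thesis using cmod_homD(3)[OF h *, symmetric] mmap_val[OF m * v(1)] by auto
  qed
 qed (rule that)
 have "fin_pres s C F"
  unfolding fin_pres_def
  by (rule conjI[OF *(1)], rule bexI[OF _ assms(1)], rule bexI[OF _ assms(2)],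
    rule bexI[OF _ assms(3)], rule bexI[OF _ *(2)]) (use *(3,4) in auto)
 then show ?thesis using *(2,3,4) by (rule that)
qed

section \<open>Intermediate extensions\<close>

lemma fscale2_apply: "fscale (fscale s) c F Z v = s c (F Z v)"
 by (simp add: fscale_def)

lemma is_functorD:
 assumes "is_functor C D F"
 shows "X : Ob C ==> fob F X : Ob D" "X : Ob C ==> fmor F X X (Ident C X) = Ident D (fob F X)"
  "X : Ob C ==> Y : Ob C ==> f : Hom C X Y ==> fmor F X Y f : Hom D (fob F X) (fob F Y)"
  "X : Ob C ==> Y : Ob C ==> f : Hom C X Y ==> g : Hom C X Y ==> fmor F X Y (f + g) = fmor F X Y f + fmor F X Y g"
  "X : Ob C ==> Y : Ob C ==> f : Hom C X Y ==> fmor F X Y (Scl C c f) = Scl D c (fmor F X Y f)"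
  "X : Ob C ==> Y : Ob C ==> Z : Ob C ==> f : Hom C X Y ==> g : Hom C Y Z ==>
   fmor F X Z (Cmp C g f) = Cmp D (fmor F Y Z g) (fmor F X Y f)"
 using assms by (auto simp: is_functor_def)

lemma adjunctionD:
 assumes "adjunction C D L R \<phi>"
 shows "is_functor C D L" "is_functor D C R"
  "X : Ob C ==> Y : Ob D ==> bij_betw (\<phi> X Y) (Hom D (fob L X) Y) (Hom C X (fob R Y))"
  "X : Ob C ==> X' : Ob C ==> Y : Ob D ==> Y' : Ob D ==> u : Hom C X' X ==> v : Hom D Y Y' ==> h : Hom D (fob L X) Y ==>
     \<phi> X' Y' (Cmp D v (Cmp D h (fmor L X' X u))) = Cmp C (fmor R Y Y' v) (Cmp C (\<phi> X Y h) u)"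
 using assms unfolding adjunction_def by blast+

lemma adjunction_nat:
 assumes "adjunction C D L R \<phi>" and C: "hf_category s C" and D: "hf_category s D"
 shows "X : Ob C ==> Y : Ob D ==> Y' : Ob D ==> v : Hom D Y Y' ==> h : Hom D (fob L X) Y ==>
     \<phi> X Y' (Cmp D v h) = Cmp C (fmor R Y Y' v) (\<phi> X Y h)"
  "X : Ob C ==> X' : Ob C ==> Y : Ob D ==> u : Hom C X' X ==> h : Hom D (fob L X) Y ==>
     \<phi> X' Y (Cmp D h (fmor L X' X u)) = Cmp C (\<phi> X Y h) u"
proof -
 note L = is_functorD[OF adjunctionD(1)[OF assms(1)]] and R = is_functorD[OF adjunctionD(2)[OF assms(1)]]
 have m: "\<phi> X Y h : Hom C X (fob R Y)" if "X : Ob C" "Y : Ob D" "h : Hom D (fob L X) Y" for X Y h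
  using bij_betwE[OF adjunctionD(3)[OF assms(1) that(1,2)]] that(3) by blast
 show "\<phi> X Y' (Cmp D v h) = Cmp C (fmor R Y Y' v) (\<phi> X Y h)"
  if *: "X : Ob C" "Y : Ob D" "Y' : Ob D" "v : Hom D Y Y'" "h : Hom D (fob L X) Y"
  using adjunctionD(4)[OF assms(1) *(1,1,2,3) hf_category.ident_in[OF C *(1)] *(4,5)]
  by (simp add: L(2)[OF *(1)] hf_category.ident_right[OF D L(1)[OF *(1)] *(2,5)]
    hf_category.ident_right[OF C *(1) R(1)[OF *(2)] m[OF *(1,2,5)]])
 show "\<phi> X' Y (Cmp D h (fmor L X' X u)) = Cmp C (\<phi> X Y h) u"
  if *: "X : Ob C" "X' : Ob C" "Y : Ob D" "u : Hom C X' X" "h : Hom D (fob L X) Y"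
  using adjunctionD(4)[OF assms(1) *(1,2,3,3,4) hf_category.ident_in[OF D *(3)] *(5)]
   hf_category.cmp_in[OF D L(1)[OF *(2)] L(1)[OF *(1)] *(3) L(3)[OF *(2,1,4)] *(5)]
   hf_category.cmp_in[OF C *(2,1) R(1)[OF *(3)] *(4) m[OF *(1,3,5)]]
  by (simp add: R(2)[OF *(3)] hf_category.ident_left[OF D L(1)[OF *(2)] *(3)]
    hf_category.ident_left[OF C *(2) R(1)[OF *(3)]])
qed

locale intermediate_extension = hf_category s P
 for s :: "'k::field => 'u::ab_group_add => 'u" and P :: "('k, 'o, 'm::ab_group_add) kcat" +
 fixes KL KR \<phi> \<psi>
 assumes adjL: "adjunction (mod_cat s P) (mod_cat s (mod_cat s P)) KL (res s P) \<phi>"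
  and adjR: "adjunction (mod_cat s (mod_cat s P)) (mod_cat s P) (res s P) KR \<psi>"

sublocale intermediate_extension \<subseteq> B: hf_category s "mod_cat s P"
 by (rule hf_category_mod_cat)

sublocale intermediate_extension \<subseteq> D: hf_category s "mod_cat s (mod_cat s P)"
 by (rule B.hf_category_mod_cat)

context intermediate_extension
begin

abbreviation "B \<equiv> mod_cat s P"
abbreviation "D \<equiv> mod_cat s B"
abbreviation y where "y \<equiv> hom_mod s P"
abbreviation h where "h \<equiv> hom_mod s B"
abbreviation one where "one Y \<equiv> rep s P Y Y (Ident P Y)"
abbreviation One where "One X \<equiv> rep s B X X (Ident B X)"
abbreviation R where "R F \<equiv> pull Yo F"

lemma y_fp: "Y : Ob P ==> fin_pres s P (y Y)"
 by (rule fin_pres_hom_mod)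

lemma h_fp: "fin_pres s P X ==> fin_pres s B (h X)"
 using B.fin_pres_hom_mod by simp

lemma res_simps: "fob (res s P) F = R F"
 "fmor (res s P) F G tau Y = (if Y : Ob P then tau (y Y) else (\<lambda>_. 0))"
 by (simp_all add: res_def pull_functor_def)

lemma R_simps [simp]: "mval (R F) Y = mval F (y Y)" "mmap (R F) Y Z f = mmap F (y Y) (y Z) (fmor Yo Y Z f)"
 by (simp_all add: pull_def)

lemmas resD = is_functorD[OF adjunctionD(2)[OF adjL], unfolded res_simps(1) mod_cat_simps]
lemmas KLD = is_functorD[OF adjunctionD(1)[OF adjL], unfolded mod_cat_simps]
lemmas KRD = is_functorD[OF adjunctionD(2)[OF adjR], unfolded mod_cat_simps]
lemmas phi_bij = adjunctionD(3)[OF adjL, unfolded res_simps(1) mod_cat_simps]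
lemmas psi_bij = adjunctionD(3)[OF adjR, unfolded res_simps(1) mod_cat_simps]
lemmas phi_right = adjunction_nat(1)[OF adjL B.hf_category_axioms D.hf_category_axioms, unfolded res_simps(1) mod_cat_simps]
lemmas psi_right = adjunction_nat(1)[OF adjR D.hf_category_axioms B.hf_category_axioms, unfolded res_simps(1) mod_cat_simps]
lemmas psi_left = adjunction_nat(2)[OF adjR D.hf_category_axioms B.hf_category_axioms, unfolded res_simps(1) mod_cat_simps]
lemmas Bc = fin_pres_cmod
lemmas Dc = B.fin_pres_cmod

lemma R_cmod: "fin_pres s B F ==> is_cmod P s (R F)"
 by (rule Bc[OF resD(1)])

lemma psi_mem: "fin_pres s B F ==> fin_pres s P M ==> t : cmod_hom P s (R F) s M ==> \<psi> F M t : cmod_hom B s F s (fob KR M)"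
 using bij_betwE[OF psi_bij] by blast

lemma phi_mem: "fin_pres s P M ==> fin_pres s B F ==> t : cmod_hom B s (fob KL M) s F ==> \<phi> M F t : cmod_hom P s M s (R F)"
 using bij_betwE[OF phi_bij] by blast

lemma res_hom: "fin_pres s B F ==> fin_pres s B G ==> tau : cmod_hom B s F s G ==>
  fmor (res s P) F G tau : cmod_hom P s (R F) s (R G)"
 by (rule resD(3))

lemma res_app: "Y : Ob P ==> fmor (res s P) F G tau Y = tau (y Y)"
 by (simp add: res_simps)

lemma mmap_B_ident: "is_cmod B s F ==> fin_pres s P X ==> v : mval F X ==> mmap F X X (Ident B X) v = v"
 using is_cmodD(2)[of B s F X] by simp

lemma mmap_B_comp: "is_cmod B s F ==> fin_pres s P X ==> fin_pres s P Y ==> fin_pres s P Z ==>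
  f : cmod_hom P s X s Y ==> g : cmod_hom P s Y s Z ==>
  mmap F X Z (\<lambda>W. g W o f W) v = mmap F X Y f (mmap F Y Z g v)"
 using is_cmodD(6)[of B s F X Y Z f g] by simp

lemma mmap_B_val: "is_cmod B s F ==> fin_pres s P X ==> fin_pres s P Y ==>
  f : cmod_hom P s X s Y ==> v : mval F Y ==> mmap F X Y f v : mval F X"
 using mmap_val[of B s F X Y f v] by simp

lemma B_hom_nat: "tau : cmod_hom B s F t G ==> fin_pres s P X ==> fin_pres s P Y ==> f : cmod_hom P s X s Y ==>
  tau X (mmap F X Y f v) = mmap G X Y f (tau Y v)"
 using cmod_homD(3)[of tau B s F t G X Y f v] by simp

lemma B_hom_val: "tau : cmod_hom B s F t G ==> fin_pres s P X ==> v : mval F X ==> tau X v : mval G X"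
 using cmod_homD_val[of tau B s F t G X v] by simp

lemma yX_hom: "fin_pres s P X ==> Y : Ob P ==> x : mval X Y ==> yon X Y x : cmod_hom P s (y Y) s X"
 by (rule yon_hom[OF Bc])

lemma yon_one: assumes "Y : Ob P" shows "yon (y Y) Y (one Y) = Ident B (y Y)"
proof -
 have i: "Ident B (y Y) : cmod_hom P s (y Y) s (y Y)" by (rule ident_hom[OF is_cmod_hom_mod[OF assms]])
 have "Ident B (y Y) Y (one Y) = one Y" using assms by (simp add: mod_cat_ident rep_ident_mem)
 then show ?thesis using yon_eq[OF i assms is_cmod_hom_mod[OF assms]] by simp
qed

lemma ev_apply: assumes "fin_pres s P X" "Y : Ob P" "tau : cmod_hom P s (y Y) s X"
 shows "yoneda_ev s P X Y (rep s B (y Y) X tau) = tau Y (one Y)"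
 using assms B.unrep_rep[of "y Y" X tau] y_fp by (simp add: yoneda_ev_def B.mval_hom_mod)

text \<open>The Yoneda isomorphism res(Hom(?, X)) \<rightarrow> X.\<close>

lemma ev_hom: assumes X: "fin_pres s P X"
 shows "yoneda_ev s P X : cmod_hom P s (R (h X)) s X"
proof (rule cmod_homI[OF R_cmod[OF h_fp[OF X]] Bc[OF X]])
 fix Y assume Y: "Y : Ob P"
 note yY = y_fp[OF Y]
 have sub: "module.subspace (fscale (fscale s)) (cmod_hom P s (y Y) s X)"
  by (rule subspace_cmod_hom[OF Bc[OF yY] Bc[OF X] vs])
 note sc = subspaceD[OF vector_space_fscale[OF vector_space_fscale[OF vs]] sub]
 show "yoneda_ev s P X Y : lin s (mval (R (h X)) Y) s (mval X Y)"
 proof (rule linI)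
  fix v w c assume "v : mval (R (h X)) Y"
  then obtain tau where t: "tau : cmod_hom P s (y Y) s X" "v = rep s B (y Y) X tau" by (auto simp: B.mval_hom_mod)
  show "yoneda_ev s P X Y v : mval X Y" using t X Y by (simp add: ev_apply cmod_homD_val rep_ident_mem)
  have "s c v = rep s B (y Y) X (fscale (fscale s) c tau)"
   using B.rep_scl[of "y Y" X tau c] t X yY by simp
  then show "yoneda_ev s P X Y (s c v) = s c (yoneda_ev s P X Y v)"
   using t ev_apply[OF X Y] sc(3)[OF t(1)] by (simp add: fscale_def)
  assume "w : mval (R (h X)) Y"
  then obtain sigma where u: "sigma : cmod_hom P s (y Y) s X" "w = rep s B (y Y) X sigma" by (auto simp: B.mval_hom_mod)
  have "v + w = rep s B (y Y) X (tau + sigma)"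
   using B.rep_add[of "y Y" X tau sigma] t u X yY by simp
  then show "yoneda_ev s P X Y (v + w) = yoneda_ev s P X Y v + yoneda_ev s P X Y w"
   using t u ev_apply[OF X Y] sc(2)[OF t(1) u(1)] by simp
 qed (auto simp: yoneda_ev_def)
next
 fix Y Z f v assume *: "Y : Ob P" "Z : Ob P" "f : Hom P Y Z" "v : mval (R (h X)) Z"
 then obtain tau where t: "tau : cmod_hom P s (y Z) s X" "v = rep s B (y Z) X tau" by (auto simp: B.mval_hom_mod)
 note f = fmor_Yo_hom[OF *(1-3)]
 have "mmap (R (h X)) Y Z f v = rep s B (y Y) X (\<lambda>W. tau W o fmor Yo Y Z f W)"
  using B.mmap_hom_mod[of "y Z" X tau] t X y_fp * by simp
 also have "yoneda_ev s P X Y ... = tau Y (fmor Yo Y Z f Y (one Y))"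
  using ev_apply[OF X *(1) cmod_hom_comp[OF f t(1)]] by simp
 also have "... = tau Y (rep s P Y Z f)" using * by (simp add: fmor_yoneda_rep ident_in ident_right)
 also have "... = mmap X Y Z f (tau Z (one Z))" using hom_mod_hom_rep[OF t(1)] * by simp
 finally show "yoneda_ev s P X Y (mmap (R (h X)) Y Z f v) = mmap X Y Z f (yoneda_ev s P X Z v)"
  using ev_apply[OF X *(2) t(1)] t(2) by simp
qed (auto simp: yoneda_ev_def fun_eq_iff)

lemma ev_bij: assumes X: "fin_pres s P X" and Y: "Y : Ob P"
 shows "bij_betw (yoneda_ev s P X Y) (mval (R (h X)) Y) (mval X Y)"
proof (rule bij_betw_byWitness[where f' = "\<lambda>x. rep s B (y Y) X (yon X Y x)"])
 show "\<forall>v\<in>mval (R (h X)) Y. rep s B (y Y) X (yon X Y (yoneda_ev s P X Y v)) = v"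
  using yon_eq[OF _ Y Bc[OF X]] ev_apply[OF X Y] by (auto simp: B.mval_hom_mod)
 show "\<forall>x\<in>mval X Y. yoneda_ev s P X Y (rep s B (y Y) X (yon X Y x)) = x"
  using ev_apply[OF X Y yX_hom[OF X Y]] yon_ident[OF Bc[OF X] Y] by simp
 show "yoneda_ev s P X Y ` mval (R (h X)) Y \<subseteq> mval X Y"
  using cmod_homD_val[OF ev_hom[OF X] Y] by auto
 show "(\<lambda>x. rep s B (y Y) X (yon X Y x)) ` mval X Y \<subseteq> mval (R (h X)) Y"
  using yX_hom[OF X Y] by (auto simp: B.mval_hom_mod)
qed

text \<open>The element of KR(M)(X) defined by t : res F \<rightarrow> M and z \<in> F(X) belongs to the morphism
 X \<rightarrow> M which sends x \<in> X(Y), viewed as a morphism x* : P(?, Y) \<rightarrow> X, to t(F(x*)(z)).\<close>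

lemma psi_formula:
 assumes F: "fin_pres s B F" and M: "fin_pres s P M" and t: "t : cmod_hom P s (R F) s M"
  and X: "fin_pres s P X" and z: "z : mval F X"
 obtains u where "u : cmod_hom P s X s M"
  "!!Y x. Y : Ob P ==> x : mval X Y ==> u Y x = t Y (mmap F (y Y) X (yon X Y x) z)"
  "\<psi> F M t X z = hom_to_KR s P \<psi> X M u"
proof -
 define \<zeta> where "\<zeta> = B.yon F X z"
 have ze: "\<zeta> : cmod_hom B s (h X) s F" unfolding \<zeta>_def by (rule B.yon_hom[OF Dc[OF F]]) (use X z in auto)
 note h = h_fp[OF X]
 define r where "r = fmor (res s P) (h X) F \<zeta>"
 have r: "r : cmod_hom P s (R (h X)) s (R F)" unfolding r_def by (rule res_hom[OF h F ze])
 obtain e where e: "e : cmod_hom P s X s (R (h X))"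
  "!!Y x. Y : Ob P ==> x : mval (R (h X)) Y ==> e Y (yoneda_ev s P X Y x) = x"
  "!!Y x. Y : Ob P ==> x : mval X Y ==> yoneda_ev s P X Y (e Y x) = x"
  by (rule cmod_inverse[OF vs R_cmod[OF h] Bc[OF X] ev_hom[OF X] ev_bij[OF X]]) (assumption, rule that)
 define u where "u = (\<lambda>Y. t Y o (r Y o e Y))"
 have u: "u : cmod_hom P s X s M"
  unfolding u_def by (rule cmod_hom_comp[OF cmod_hom_comp[OF e(1) r] t])
 have ue: "(\<lambda>Y. u Y o yoneda_ev s P X Y) = (\<lambda>Y. t Y o r Y)"
  by (rule cmod_hom_eqI[OF cmod_hom_comp[OF ev_hom[OF X] u] cmod_hom_comp[OF r t]]) (simp add: u_def e)
 have app: "u Y x = t Y (mmap F (y Y) X (yon X Y x) z)" if Y: "Y : Ob P" and x: "x : mval X Y" for Y x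
 proof -
  have m: "rep s B (y Y) X (yon X Y x) : mval (R (h X)) Y" using yX_hom[OF X Y x] by (simp add: B.mval_hom_mod)
  have "yoneda_ev s P X Y (rep s B (y Y) X (yon X Y x)) = x"
   using ev_apply[OF X Y yX_hom[OF X Y x]] yon_ident[OF Bc[OF X] Y x] by simp
  then have "e Y x = rep s B (y Y) X (yon X Y x)" using e(2)[OF Y m] by simp
  then show ?thesis
   using yX_hom[OF X Y x] X y_fp[OF Y] Y by (simp add: u_def r_def res_app \<zeta>_def B.yon_rep)
 qed
 have "\<psi> (h X) M (\<lambda>Y. u Y o yoneda_ev s P X Y) = (\<lambda>Z. \<psi> F M t Z o \<zeta> Z)"
  using psi_left[OF F h M ze t] by (simp add: ue r_def)
 moreover have "\<zeta> X (One X) = z" unfolding \<zeta>_def by (rule B.yon_ident[OF Dc[OF F]]) (use X z in auto)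
 ultimately have "\<psi> F M t X z = hom_to_KR s P \<psi> X M u"
  unfolding hom_to_KR_def by simp
 then show ?thesis using u app that by blast
qed

text \<open>A composition of bijections: the Yoneda isomorphism, the adjunction, and the Yoneda lemma.\<close>

lemma hom_to_KR_bij:
 assumes X: "fin_pres s P X" and M: "fin_pres s P M"
 shows "bij_betw (hom_to_KR s P \<psi> X M) (cmod_hom P s X s M) (mval (fob KR M) X)"
proof -
 note h = h_fp[OF X]
 have K: "is_cmod B s (fob KR M)" by (rule Dc[OF KRD(1)[OF M]])
 obtain e where e: "e : cmod_hom P s X s (R (h X))"
  "!!Y x. Y : Ob P ==> x : mval (R (h X)) Y ==> e Y (yoneda_ev s P X Y x) = x"
  "!!Y x. Y : Ob P ==> x : mval X Y ==> yoneda_ev s P X Y (e Y x) = x"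
  by (rule cmod_inverse[OF vs R_cmod[OF h] Bc[OF X] ev_hom[OF X] ev_bij[OF X]]) (assumption, rule that)
 have 1: "bij_betw (\<lambda>u Y. u Y o yoneda_ev s P X Y) (cmod_hom P s X s M) (cmod_hom P s (R (h X)) s M)"
 proof (rule bij_betw_byWitness[where f' = "\<lambda>t Y. t Y o e Y"])
  show "\<forall>u\<in>cmod_hom P s X s M. (\<lambda>Y. (u Y o yoneda_ev s P X Y) o e Y) = u"
  proof
   fix u assume u: "u : cmod_hom P s X s M"
   show "(\<lambda>Y. (u Y o yoneda_ev s P X Y) o e Y) = u"
    by (rule cmod_hom_eqI[OF cmod_hom_comp[OF e(1) cmod_hom_comp[OF ev_hom[OF X] u]] u]) (simp add: e)
  qed
  show "\<forall>t\<in>cmod_hom P s (R (h X)) s M. (\<lambda>Y. (t Y o e Y) o yoneda_ev s P X Y) = t"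
  proof
   fix t assume t: "t : cmod_hom P s (R (h X)) s M"
   show "(\<lambda>Y. (t Y o e Y) o yoneda_ev s P X Y) = t"
    by (rule cmod_hom_eqI[OF cmod_hom_comp[OF ev_hom[OF X] cmod_hom_comp[OF e(1) t]] t]) (use e(2) in simp)
  qed
  show "(\<lambda>u Y. u Y o yoneda_ev s P X Y) ` cmod_hom P s X s M \<subseteq> cmod_hom P s (R (h X)) s M"
   using cmod_hom_comp[OF ev_hom[OF X]] by auto
  show "(\<lambda>t Y. t Y o e Y) ` cmod_hom P s (R (h X)) s M \<subseteq> cmod_hom P s X s M"
   using cmod_hom_comp[OF e(1)] by auto
 qed
 have 2: "bij_betw (\<lambda>tau. tau X (One X)) (cmod_hom B s (h X) s (fob KR M)) (mval (fob KR M) X)"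
 proof (rule bij_betw_byWitness[where f' = "B.yon (fob KR M) X"])
  show "\<forall>tau\<in>cmod_hom B s (h X) s (fob KR M). B.yon (fob KR M) X (tau X (One X)) = tau"
   using B.yon_eq[OF _ _ K] X by simp
  show "\<forall>x\<in>mval (fob KR M) X. B.yon (fob KR M) X x X (One X) = x"
   using B.yon_ident[OF K] X by simp
  show "(\<lambda>tau. tau X (One X)) ` cmod_hom B s (h X) s (fob KR M) \<subseteq> mval (fob KR M) X"
   using B_hom_val[OF _ X] B.rep_ident_mem[of X] X by auto
  show "B.yon (fob KR M) X ` mval (fob KR M) X \<subseteq> cmod_hom B s (h X) s (fob KR M)"
   using B.yon_hom[OF K] X by auto
 qed
 show ?thesis
  using bij_betw_trans[OF bij_betw_trans[OF 1 psi_bij[OF h M]] 2]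
  by (rule bij_betw_cong[THEN iffD1, rotated]) (simp add: hom_to_KR_def)
qed

lemma hom_to_KR_nat:
 assumes X: "fin_pres s P X" and X': "fin_pres s P X'" and M: "fin_pres s P M"
  and g: "g : cmod_hom P s X' s X" and u: "u : cmod_hom P s X s M"
 shows "hom_to_KR s P \<psi> X' M (\<lambda>Y. u Y o g Y) = mmap (fob KR M) X' X g (hom_to_KR s P \<psi> X M u)"
proof -
 note h = h_fp[OF X] and h' = h_fp[OF X']
 define t where "t = (\<lambda>Y. u Y o yoneda_ev s P X Y)"
 have t: "t : cmod_hom P s (R (h X)) s M" unfolding t_def by (rule cmod_hom_comp[OF ev_hom[OF X] u])
 have hg: "fmor B.Yo X' X g : cmod_hom B s (h X') s (h X)" by (rule B.fmor_Yo_hom) (use X X' g in auto)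
 have "(\<lambda>Y. t Y o fmor (res s P) (h X') (h X) (fmor B.Yo X' X g) Y) = (\<lambda>Y. (u Y o g Y) o yoneda_ev s P X' Y)"
 proof (rule cmod_hom_eqI[OF cmod_hom_comp[OF res_hom[OF h' h hg] t] cmod_hom_comp[OF ev_hom[OF X'] cmod_hom_comp[OF g u]]])
  fix Y v assume Y: "Y : Ob P" and "v : mval (R (h X')) Y"
  then obtain tau where t: "tau : cmod_hom P s (y Y) s X'" "v = rep s B (y Y) X' tau" by (auto simp: B.mval_hom_mod)
  have "fmor B.Yo X' X g (y Y) v = rep s B (y Y) X (\<lambda>W. g W o tau W)"
   using t Y X X' y_fp by (simp add: B.fmor_yoneda_rep)
  then show "(t Y o fmor (res s P) (h X') (h X) (fmor B.Yo X' X g) Y) v = ((u Y o g Y) o yoneda_ev s P X' Y) v"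
   using t Y X X' by (simp add: t_def res_app ev_apply cmod_hom_comp[OF _ g])
 qed
 then have e: "\<psi> (h X') M (\<lambda>Y. (u Y o g Y) o yoneda_ev s P X' Y) = (\<lambda>Z. \<psi> (h X) M t Z o fmor B.Yo X' X g Z)"
  using psi_left[OF h h' M hg t] by simp
 have "hom_to_KR s P \<psi> X' M (\<lambda>Y. u Y o g Y) = \<psi> (h X) M t X' (fmor B.Yo X' X g X' (One X'))"
  unfolding hom_to_KR_def using e by simp
 also have "fmor B.Yo X' X g X' (One X') = rep s B X' X g"
  using B.fmor_yoneda_rep[of X' B X' "Ident B X'" X g] B.ident_in[of X'] B.ident_right[of X' X g] X X' g by simp
 also have "rep s B X' X g = mmap (h X) X' X g (One X)"
  using B.mmap_hom_mod[of X X "Ident B X" X' g] B.ident_in[of X] B.ident_left[of X' X g] X X' g by simp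
 also have "\<psi> (h X) M t X' ... = mmap (fob KR M) X' X g (\<psi> (h X) M t X (One X))"
  by (rule B_hom_nat[OF psi_mem[OF h M t] X' X g])
 finally show ?thesis unfolding hom_to_KR_def t_def by simp
qed

lemma hom_to_KR_lin:
 assumes X: "fin_pres s P X" and M: "fin_pres s P M"
  and u: "u : cmod_hom P s X s M" and v: "v : cmod_hom P s X s M"
 shows "hom_to_KR s P \<psi> X M (u + v) = hom_to_KR s P \<psi> X M u + hom_to_KR s P \<psi> X M v"
  "hom_to_KR s P \<psi> X M (fscale (fscale s) c u) = s c (hom_to_KR s P \<psi> X M u)"
proof -
 note h = h_fp[OF X]
 let ?e = "yoneda_ev s P X"
 have id: "Ident B (R (h X)) : cmod_hom P s (R (h X)) s (R (h X))" by (rule ident_hom[OF R_cmod[OF h]])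
 \<comment> \<open>an adjunction is the functor followed by the unit, hence linear\<close>
 have psi: "\<psi> (h X) M t = (\<lambda>Z. fmor KR (R (h X)) M t Z o \<psi> (h X) (R (h X)) (Ident B (R (h X))) Z)"
  if t: "t : cmod_hom P s (R (h X)) s M" for t
 proof -
  have "(\<lambda>Z. t Z o Ident B (R (h X)) Z) = t"
   using B.ident_right[of "R (h X)" M t] resD(1)[OF h] M t by simp
  then show ?thesis using psi_right[OF h resD(1)[OF h] M t id] by simp
 qed
 have s: "(\<lambda>Y. (u + v) Y o ?e Y) = (\<lambda>Y. u Y o ?e Y) + (\<lambda>Y. v Y o ?e Y)"
  "(\<lambda>Y. (fscale (fscale s) c u) Y o ?e Y) = fscale (fscale s) c (\<lambda>Y. u Y o ?e Y)"
  by (auto simp: fun_eq_iff fscale_def)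
 have m: "(\<lambda>Y. u Y o ?e Y) : cmod_hom P s (R (h X)) s M" "(\<lambda>Y. v Y o ?e Y) : cmod_hom P s (R (h X)) s M"
  using cmod_hom_comp[OF ev_hom[OF X]] u v by auto
 note sc = subspaceD[OF vector_space_fscale[OF vector_space_fscale[OF vs]] subspace_cmod_hom[OF R_cmod[OF h] Bc[OF M] vs]]
 show "hom_to_KR s P \<psi> X M (u + v) = hom_to_KR s P \<psi> X M u + hom_to_KR s P \<psi> X M v"
  unfolding hom_to_KR_def mod_cat_simps s
  by (simp add: psi m sc(2)[OF m] KRD(4)[OF resD(1)[OF h] M m])
 show "hom_to_KR s P \<psi> X M (fscale (fscale s) c u) = s c (hom_to_KR s P \<psi> X M u)"
  unfolding hom_to_KR_def mod_cat_simps s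
  by (simp add: psi m(1) sc(3)[OF m(1)] KRD(5)[OF resD(1)[OF h] M m(1)] fscale2_apply)
qed

end

lemma bij_betw_ex: "bij_betw f A B ==> b : B ==> \<exists>a. a : A & f a = b"
 by (auto simp: bij_betw_def)

lemma bij_betw_eqD: "bij_betw f A B ==> f a = f a' ==> a : A ==> a' : A ==> a = a'"
 by (auto simp: bij_betw_def inj_on_def)

context intermediate_extension
begin

text \<open>The counit res (KR N) \<rightarrow> N is invertible: at Y it is the composition of KR(N)(P(?, Y)) = Hom(P(?, Y), N)
 with the Yoneda isomorphism.\<close>

lemma counit:
 assumes N: "fin_pres s P N"
 obtains \<epsilon> where "\<epsilon> : cmod_hom P s (R (fob KR N)) s N" "\<psi> (fob KR N) N \<epsilon> = Ident D (fob KR N)"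
  "!!Y. Y : Ob P ==> bij_betw (\<epsilon> Y) (mval (fob KR N) (y Y)) (mval N Y)"
proof -
 note K = KRD(1)[OF N]
 have "Ident D (fob KR N) : cmod_hom B s (fob KR N) s (fob KR N)" by (rule B.ident_hom[OF Dc[OF K]])
 then obtain \<epsilon> where e: "\<epsilon> : cmod_hom P s (R (fob KR N)) s N" "\<psi> (fob KR N) N \<epsilon> = Ident D (fob KR N)"
  using bij_betw_ex[OF psi_bij[OF K N]] by blast
 have "bij_betw (\<epsilon> Y) (mval (fob KR N) (y Y)) (mval N Y)" if Y: "Y : Ob P" for Y
 proof -
  let ?H = "hom_to_KR s P \<psi> (y Y) N"
  note H = hom_to_KR_bij[OF y_fp[OF Y] N]
  have f: "\<exists>u\<in>cmod_hom P s (y Y) s N. u Y (one Y) = \<epsilon> Y z & ?H u = z" if z: "z : mval (fob KR N) (y Y)" for z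
  proof -
   obtain u where u: "u : cmod_hom P s (y Y) s N"
    "!!W x. W : Ob P ==> x : mval (y Y) W ==> u W x = \<epsilon> W (mmap (fob KR N) (y W) (y Y) (yon (y Y) W x) z)"
    "\<psi> (fob KR N) N \<epsilon> (y Y) z = ?H u"
    by (rule psi_formula[OF K N e(1) y_fp[OF Y] z]) (rule that)
   have "u Y (one Y) = \<epsilon> Y z"
    using u(2)[OF Y rep_ident_mem[OF Y]] mmap_B_ident[OF Dc[OF K] y_fp[OF Y] z] yon_one[OF Y] by simp
   moreover have "?H u = z" using u(3) e(2) y_fp[OF Y] z by (simp add: mod_cat_ident)
   ultimately show ?thesis using u(1) by blast
  qed
  have inj: "u = u'" if "u : cmod_hom P s (y Y) s N" "u' : cmod_hom P s (y Y) s N" "u Y (one Y) = u' Y (one Y)" for u u'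
   using hom_mod_hom_eqI[OF that(1,2) Y that(3)] .
  show ?thesis unfolding bij_betw_def
  proof
   show "inj_on (\<epsilon> Y) (mval (fob KR N) (y Y))"
   proof (rule inj_onI)
    fix z z' assume z: "z : mval (fob KR N) (y Y)" "z' : mval (fob KR N) (y Y)" "\<epsilon> Y z = \<epsilon> Y z'"
    obtain u where u: "u : cmod_hom P s (y Y) s N" "u Y (one Y) = \<epsilon> Y z" "?H u = z" using f[OF z(1)] by blast
    obtain u' where u': "u' : cmod_hom P s (y Y) s N" "u' Y (one Y) = \<epsilon> Y z'" "?H u' = z'" using f[OF z(2)] by blast
    have "u = u'" by (rule inj[OF u(1) u'(1)]) (simp only: u(2) u'(2) z(3))
    then show "z = z'" using u(3) u'(3) by (simp only:)
   qed
   show "\<epsilon> Y ` mval (fob KR N) (y Y) = mval N Y"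
   proof
    show "\<epsilon> Y ` mval (fob KR N) (y Y) \<subseteq> mval N Y" using cmod_homD_val[OF e(1) Y] by auto
    show "mval N Y \<subseteq> \<epsilon> Y ` mval (fob KR N) (y Y)"
    proof
     fix m assume m: "m : mval N Y"
     define u where "u = yon N Y m"
     have u: "u : cmod_hom P s (y Y) s N" "u Y (one Y) = m"
      using yon_hom[OF Bc[OF N] Y m] yon_ident[OF Bc[OF N] Y m] by (simp_all add: u_def)
     have z: "?H u : mval (fob KR N) (y Y)" using bij_betwE[OF H] u(1) by blast
     then obtain u' where u': "u' : cmod_hom P s (y Y) s N" "u' Y (one Y) = \<epsilon> Y (?H u)" "?H u' = ?H u" using f by blast
     then have "u' = u" using bij_betw_eqD[OF H] u(1) by blast
     then have "m = \<epsilon> Y (?H u)" using u u' by simp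
     then show "m : \<epsilon> Y ` mval (fob KR N) (y Y)" using z by (rule image_eqI)
    qed
   qed
  qed
 qed
 then show ?thesis by (rule that[OF e])
qed

abbreviation eta where "eta M \<equiv> \<phi> M (fob KL M) (Ident D (fob KL M))"

lemma phi_unit:
 assumes M: "fin_pres s P M" and F: "fin_pres s B F" and t: "t : cmod_hom B s (fob KL M) s F"
 shows "\<phi> M F t = (\<lambda>Y. fmor (res s P) (fob KL M) F t Y o eta M Y)"
proof -
 note K = KLD(1)[OF M]
 have "(\<lambda>Z. t Z o Ident D (fob KL M) Z) = t"
  using D.ident_right[of "fob KL M" F t] K F t by simp
 then show ?thesis using phi_right[OF M K F t B.ident_hom[OF Dc[OF K]]] by simp
qed

lemma eta_mem: "fin_pres s P M ==> eta M : cmod_hom P s M s (R (fob KL M))"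
 by (rule phi_mem[OF _ KLD(1) B.ident_hom[OF Dc[OF KLD(1)]]])

text \<open>Since KR is fully faithful, so is KL: for every N, the map Hom(res (KL M), N) \<rightarrow> Hom(M, N) given by
 composition with the unit is the composition of the bijections Hom(res (KL M), N) = Hom(KL M, KR N) = Hom(M, res (KR N)) = Hom(M, N).\<close>

lemma unit_bij:
 assumes M: "fin_pres s P M" and N: "fin_pres s P N"
 shows "bij_betw (\<lambda>t Y. t Y o eta M Y) (cmod_hom P s (R (fob KL M)) s N) (cmod_hom P s M s N)"
proof -
 obtain \<epsilon> where e: "\<epsilon> : cmod_hom P s (R (fob KR N)) s N" "\<psi> (fob KR N) N \<epsilon> = Ident D (fob KR N)"
  "!!Y. Y : Ob P ==> bij_betw (\<epsilon> Y) (mval (fob KR N) (y Y)) (mval N Y)"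
  by (rule counit[OF N]) (rule that)
 note K = KRD(1)[OF N] and L = KLD(1)[OF M]
 obtain \<delta> where d: "\<delta> : cmod_hom P s N s (R (fob KR N))"
  "!!Y x. Y : Ob P ==> x : mval (R (fob KR N)) Y ==> \<delta> Y (\<epsilon> Y x) = x"
  "!!Y x. Y : Ob P ==> x : mval N Y ==> \<epsilon> Y (\<delta> Y x) = x"
  by (rule cmod_inverse[OF vs R_cmod[OF K] Bc[OF N] e(1)]) (use e(3) in simp, rule that)
 have 3: "bij_betw (\<lambda>w Y. \<epsilon> Y o w Y) (cmod_hom P s M s (R (fob KR N))) (cmod_hom P s M s N)"
 proof (rule bij_betw_byWitness[where f' = "\<lambda>w Y. \<delta> Y o w Y"])
  show "\<forall>w\<in>cmod_hom P s M s (R (fob KR N)). (\<lambda>Y. \<delta> Y o (\<epsilon> Y o w Y)) = w"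
  proof
   fix w assume w: "w : cmod_hom P s M s (R (fob KR N))"
   show "(\<lambda>Y. \<delta> Y o (\<epsilon> Y o w Y)) = w"
    by (rule cmod_hom_eqI[OF cmod_hom_comp[OF cmod_hom_comp[OF w e(1)] d(1)] w])
     (use d(2) cmod_homD_val[OF w] in simp)
  qed
  show "\<forall>w\<in>cmod_hom P s M s N. (\<lambda>Y. \<epsilon> Y o (\<delta> Y o w Y)) = w"
  proof
   fix w assume w: "w : cmod_hom P s M s N"
   show "(\<lambda>Y. \<epsilon> Y o (\<delta> Y o w Y)) = w"
    by (rule cmod_hom_eqI[OF cmod_hom_comp[OF cmod_hom_comp[OF w d(1)] e(1)] w])
     (use d(3) cmod_homD_val[OF w] in simp)
  qed
  show "(\<lambda>w Y. \<epsilon> Y o w Y) ` cmod_hom P s M s (R (fob KR N)) \<subseteq> cmod_hom P s M s N"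
   using cmod_hom_comp[OF _ e(1)] by auto
  show "(\<lambda>w Y. \<delta> Y o w Y) ` cmod_hom P s M s N \<subseteq> cmod_hom P s M s (R (fob KR N))"
   using cmod_hom_comp[OF _ d(1)] by auto
 qed
 have "(\<lambda>Y. t Y o eta M Y) = (\<lambda>Y. \<epsilon> Y o \<phi> M (fob KR N) (\<psi> (fob KL M) N t) Y)"
  if t: "t : cmod_hom P s (R (fob KL M)) s N" for t
 proof -
  define p where "p = \<psi> (fob KL M) N t"
  have p: "p : cmod_hom B s (fob KL M) s (fob KR N)" unfolding p_def by (rule psi_mem[OF L N t])
  note r = res_hom[OF L K p]
  define t' where "t' = (\<lambda>Y. \<epsilon> Y o fmor (res s P) (fob KL M) (fob KR N) p Y)"
  have t': "t' : cmod_hom P s (R (fob KL M)) s N" unfolding t'_def by (rule cmod_hom_comp[OF r e(1)])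
  have "\<psi> (fob KL M) N t' = p"
   using psi_left[OF K L N p e(1)] D.ident_left[of "fob KL M" "fob KR N" p] L K p e(2) by (simp add: t'_def)
  then have "t' = t" using bij_betw_eqD[OF psi_bij[OF L N] _ t' t] unfolding p_def by blast
  moreover have "\<phi> M (fob KR N) p = (\<lambda>Y. fmor (res s P) (fob KL M) (fob KR N) p Y o eta M Y)"
   by (rule phi_unit[OF M K p])
  ultimately show ?thesis unfolding p_def[symmetric] t'_def by (auto simp: fun_eq_iff)
 qed
 then show ?thesis
  using bij_betw_trans[OF bij_betw_trans[OF psi_bij[OF L N] phi_bij[OF M K]] 3]
  by (rule_tac bij_betw_cong[THEN iffD1, rotated]) (simp_all add: o_def)
qed

text \<open>By unit_bij, composition with the unit is bijective on morphisms to every module, so the unit is invertible.\<close>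

lemma unit_inverse:
 assumes M: "fin_pres s P M"
 defines "g \<equiv> unit_inv B D KL (res s P) \<phi> M"
 shows "g : cmod_hom P s (R (fob KL M)) s M"
  "Y : Ob P ==> m : mval M Y ==> g Y (eta M Y m) = m"
proof -
 note L = KLD(1)[OF M] and E = eta_mem[OF M]
 note RL = resD(1)[OF L]
 have iM: "Ident B M : cmod_hom P s M s M" by (rule ident_hom[OF Bc[OF M]])
 have iR: "Ident B (R (fob KL M)) : cmod_hom P s (R (fob KL M)) s (R (fob KL M))" by (rule ident_hom[OF R_cmod[OF L]])
 obtain f where f: "f : cmod_hom P s (R (fob KL M)) s M" "(\<lambda>Y. f Y o eta M Y) = Ident B M"
  using bij_betw_ex[OF unit_bij[OF M M] iM] by blast
 have "(\<lambda>Y. (eta M Y o f Y) o eta M Y) = (\<lambda>Y. eta M Y o Ident B M Y)"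
  using f(2) by (simp add: comp_assoc fun_eq_iff)
 also have "... = (\<lambda>Y. Ident B (R (fob KL M)) Y o eta M Y)"
  using B.ident_right[of M "R (fob KL M)" "eta M"] B.ident_left[of M "R (fob KL M)" "eta M"] E M RL by simp
 finally have 2: "(\<lambda>Y. eta M Y o f Y) = Ident B (R (fob KL M))"
  using bij_betw_eqD[OF unit_bij[OF M RL] _ cmod_hom_comp[OF f(1) E] iR] by blast
 have "g = f" unfolding g_def unit_inv_def Let_def mod_cat_simps res_simps(1)
 proof (rule the_equality)
  show "f : cmod_hom P s (R (fob KL M)) s M & (\<lambda>Y. f Y o eta M Y) = Ident B M \<and>
   (\<lambda>Y. eta M Y o f Y) = Ident B (R (fob KL M))" using f 2 by blast
  fix k assume k: "k : cmod_hom P s (R (fob KL M)) s M & (\<lambda>Y. k Y o eta M Y) = Ident B M \<and>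
   (\<lambda>Y. eta M Y o k Y) = Ident B (R (fob KL M))"
  then show "k = f" using bij_betw_eqD[OF unit_bij[OF M M], of k f] f by simp
 qed
 then show "g : cmod_hom P s (R (fob KL M)) s M" using f by simp
 show "g Y (eta M Y m) = m" if "Y : Ob P" "m : mval M Y"
  using fun_cong[OF fun_cong[OF f(2)], of Y m] that \<open>g = f\<close> by (simp add: mod_cat_ident)
qed

text \<open>Let F0 be the cokernel of the morphism between representable functors given by a presentation of M. Its restriction is M, so the adjunction
 gives \<lambda> : KL M \<rightarrow> F0; and the element of KL M defined by the generator of M gives \<mu> : F0 \<rightarrow> KL M. As \<mu> \<circ> \<lambda> is the identity, KL M
 is generated by one element, like F0.\<close>

lemma KL_generated:
 assumes M: "fin_pres s P M"
 obtains Y0 \<pi> where "Y0 : Ob P" "\<pi> : cmod_hom P s (y Y0) s M"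
  "!!X z. fin_pres s P X ==> z : mval (fob KL M) X ==>
   \<exists>a\<in>cmod_hom P s X s (y Y0). z = mmap (fob KL M) X (y Y0) a (eta M Y0 (\<pi> Y0 (one Y0)))"
proof -
 note L = KLD(1)[OF M] and E = eta_mem[OF M]
 obtain Y1 Y0 g \<pi> where pres: "is_cmod P s M" "Y1 : Ob P" "Y0 : Ob P" "g : Hom P Y1 Y0"
  "\<pi> : cmod_hom P s (y Y0) s M" "!!Y. Y : Ob P ==> \<pi> Y ` mval (y Y0) Y = mval M Y"
  "!!Y. Y : Ob P ==> {v : mval (y Y0) Y. \<pi> Y v = 0} = fmor Yo Y1 Y0 g Y ` mval (y Y1) Y"
  by (rule fin_presE[OF M]) (rule that)
 note y0 = y_fp[OF pres(3)] and y1 = y_fp[OF pres(2)]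
 define yg where "yg = fmor Yo Y1 Y0 g"
 have yg: "yg : cmod_hom P s (y Y1) s (y Y0)" unfolding yg_def by (rule fmor_Yo_hom[OF pres(2,3,4)])
 obtain F0 p where F0: "fin_pres s B F0" "p : cmod_hom B s (h (y Y0)) s F0"
  "!!X. X : Ob B ==> p X ` mval (h (y Y0)) X = mval F0 X"
  "!!X. X : Ob B ==> {v : mval (h (y Y0)) X. p X v = 0} = fmor B.Yo (y Y1) (y Y0) yg X ` mval (h (y Y1)) X"
  by (rule B.ex_cokernel[of "y Y1" "y Y0" yg]) (use y0 y1 yg in simp, use y0 y1 yg in simp, use y0 y1 yg in simp, rule that)
 define e where "e = \<pi> Y0 (one Y0)"
 have e: "e : mval M Y0" unfolding e_def by (rule cmod_homD_val[OF pres(5,3) rep_ident_mem[OF pres(3)]])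
 define q where "q = p (y Y0) (One (y Y0))"
 have One: "One (y Y0) : mval (h (y Y0)) (y Y0)" using B.rep_ident_mem[of "y Y0"] y0 by simp
 have q: "q : mval F0 (y Y0)" unfolding q_def by (rule B_hom_val[OF F0(2) y0 One])
 \<comment> \<open>the generator of F0 and that of M are killed by the relation g\<close>
 have pg: "p X (rep s B X (y Y0) (\<lambda>Y. yg Y o k Y)) = 0" if X: "fin_pres s P X" and k: "k : cmod_hom P s X s (y Y1)" for X k
 proof -
  have "rep s B X (y Y0) (\<lambda>Y. yg Y o k Y) = fmor B.Yo (y Y1) (y Y0) yg X (rep s B X (y Y1) k)"
   using X k y1 by (simp add: B.fmor_yoneda_rep)
  then have "rep s B X (y Y0) (\<lambda>Y. yg Y o k Y) : {v : mval (h (y Y0)) X. p X v = 0}"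
   using F0(4)[of X] X k by (auto simp: B.mval_hom_mod)
  then show ?thesis by simp
 qed
 have pF: "p X (rep s B X (y Y0) k) = mmap F0 X (y Y0) k q" if X: "fin_pres s P X" and k: "k : cmod_hom P s X s (y Y0)" for X k
  using B.hom_mod_hom_rep[OF F0(2), of X k] X k y0 by (simp add: q_def)
 have gM: "mmap M Y1 Y0 g e = 0"
 proof -
  have "mmap M Y1 Y0 g e = \<pi> Y1 (rep s P Y1 Y0 g)" using hom_mod_hom_rep[OF pres(5,3,2,4)] by (simp add: e_def)
  moreover have "rep s P Y1 Y0 g = fmor Yo Y1 Y0 g Y1 (one Y1)"
   using pres(2,3,4) by (simp add: fmor_yoneda_rep ident_in ident_right)
  moreover have "fmor Yo Y1 Y0 g Y1 (one Y1) : {v : mval (y Y0) Y1. \<pi> Y1 v = 0}"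
   using pres(7)[OF pres(2)] rep_ident_mem[OF pres(2)] by simp
  ultimately show ?thesis by simp
 qed
 obtain theta where th: "theta : cmod_hom P s M s (R F0)"
  "!!Y v. Y : Ob P ==> v : mval (y Y0) Y ==> theta Y (\<pi> Y v) = yon (R F0) Y0 q Y v"
 proof (rule cmod_factor[OF vs Bc[OF y0] Bc[OF M] R_cmod[OF F0(1)] pres(5,6) yon_hom[OF R_cmod[OF F0(1)] pres(3)]])
  show "yon (R F0) Y0 q Y v = 0" if *: "Y : Ob P" "v : mval (y Y0) Y" "\<pi> Y v = 0" for Y v
  proof -
   obtain w where w: "w : mval (y Y1) Y" "v = fmor Yo Y1 Y0 g Y w" using pres(7)[OF *(1)] * by blast
   then obtain k where k: "k : Hom P Y Y1" "w = rep s P Y Y1 k" by (auto simp: mval_hom_mod)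
   have gk: "Cmp P g k : Hom P Y Y0" by (rule cmp_in[OF *(1) pres(2,3) k(1) pres(4)])
   note yk = fmor_Yo_hom[OF *(1) pres(2) k(1)]
   have "yon (R F0) Y0 q Y v = mmap F0 (y Y) (y Y0) (fmor Yo Y Y0 (Cmp P g k)) q"
    using w k * pres gk by (simp add: fmor_yoneda_rep yon_rep)
   also have "fmor Yo Y Y0 (Cmp P g k) = (\<lambda>W. yg W o fmor Yo Y Y1 k W)"
    by (rule Yo_full[symmetric, OF cmod_hom_comp[OF yk yg] *(1) pres(3) gk])
     (use * pres(2-4) k in "simp add: yg_def fmor_yoneda_rep ident_in ident_right")
   also have "mmap F0 (y Y) (y Y0) ... q = 0"
    using pF[OF y_fp[OF *(1)] cmod_hom_comp[OF yk yg]] pg[OF y_fp[OF *(1)] yk] by simp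
   finally show ?thesis .
  qed
 qed (assumption, use q in simp, rule that)
 obtain \<mu> where mu: "\<mu> : cmod_hom B s F0 s (fob KL M)"
  "!!X v. X : Ob B ==> v : mval (h (y Y0)) X ==> \<mu> X (p X v) = B.yon (fob KL M) (y Y0) (eta M Y0 e) X v"
 proof (rule cmod_factor[OF vs Dc[OF h_fp[OF y0]] Dc[OF F0(1)] Dc[OF L] F0(2,3) B.yon_hom[OF Dc[OF L]]])
  have ee: "eta M Y0 e : mval (fob KL M) (y Y0)" using cmod_homD_val[OF E pres(3) e] by simp
  then show "eta M Y0 e : mval (fob KL M) (y Y0)" .
  show "B.yon (fob KL M) (y Y0) (eta M Y0 e) X v = 0" if *: "X : Ob B" "v : mval (h (y Y0)) X" "p X v = 0" for X v
  proof -
   obtain w where w: "w : mval (h (y Y1)) X" "v = fmor B.Yo (y Y1) (y Y0) yg X w" using F0(4)[OF *(1)] * by blast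
   then obtain k where k: "k : cmod_hom P s X s (y Y1)" "w = rep s B X (y Y1) k" by (auto simp: B.mval_hom_mod)
   have X: "fin_pres s P X" using * by simp
   have "B.yon (fob KL M) (y Y0) (eta M Y0 e) X v = mmap (fob KL M) X (y Y0) (\<lambda>W. yg W o k W) (eta M Y0 e)"
    using w k X y0 y1 cmod_hom_comp[OF k(1) yg] by (simp add: B.fmor_yoneda_rep B.yon_rep)
   also have "... = mmap (fob KL M) X (y Y1) k (mmap (fob KL M) (y Y1) (y Y0) yg (eta M Y0 e))"
    by (rule mmap_B_comp[OF Dc[OF L] X y1 y0 k(1) yg])
   also have "mmap (fob KL M) (y Y1) (y Y0) yg (eta M Y0 e) = eta M Y1 (mmap M Y1 Y0 g e)"
    using cmod_homD(3)[OF E pres(2,3,4)] by (simp add: yg_def)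
   also have "... = 0" using gM lin_0[OF cmod_homD(1)[OF E pres(2)]] by simp
   also have "mmap (fob KL M) X (y Y1) k 0 = 0"
    using lin_0[OF is_cmodD(3)[OF Dc[OF L], of X "y Y1" k]] X y1 k by simp
   finally show ?thesis .
  qed
 qed (assumption, use y0 in simp, rule that)
 obtain \<Lambda> where la: "\<Lambda> : cmod_hom B s (fob KL M) s F0" "\<phi> M F0 \<Lambda> = theta"
  using bij_betw_ex[OF phi_bij[OF M F0(1)] th(1)] by blast
 have one0: "one Y0 : mval (y Y0) Y0" by (rule rep_ident_mem[OF pres(3)])
 have me: "\<mu> (y Y0) q = eta M Y0 e"
  using mu(2)[OF _ One] B.yon_ident[OF Dc[OF L], of "y Y0" "eta M Y0 e"] y0 cmod_homD_val[OF E pres(3) e]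
  by (simp add: q_def)
 have te: "theta Y0 e = q"
  using th(2)[OF pres(3) one0] yon_ident[OF R_cmod[OF F0(1)] pres(3), of q] q by (simp add: e_def)
 have r: "fmor (res s P) F0 (fob KL M) \<mu> : cmod_hom P s (R F0) s (R (fob KL M))" by (rule res_hom[OF F0(1) L mu(1)])
 have comp: "(\<lambda>Z. \<mu> Z o \<Lambda> Z) : cmod_hom B s (fob KL M) s (fob KL M)" by (rule cmod_hom_comp[OF la(1) mu(1)])
 have "(\<lambda>Y. (fmor (res s P) F0 (fob KL M) \<mu> Y o theta Y) o \<pi> Y) = (\<lambda>Y. eta M Y o \<pi> Y)"
  by (rule hom_mod_hom_eqI[OF cmod_hom_comp[OF pres(5) cmod_hom_comp[OF th(1) r]] cmod_hom_comp[OF pres(5) E] pres(3)])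
   (use me te pres(3) in "simp add: res_app e_def[symmetric]")
 then have pp: "!!Y x. (fmor (res s P) F0 (fob KL M) \<mu> Y o theta Y) (\<pi> Y x) = eta M Y (\<pi> Y x)"
  by (simp add: fun_eq_iff)
 have "(\<lambda>Y. fmor (res s P) F0 (fob KL M) \<mu> Y o theta Y) = eta M"
 proof (rule cmod_hom_eqI[OF cmod_hom_comp[OF th(1) r] E])
  fix Y m assume Y: "Y : Ob P" "m : mval M Y"
  then obtain x where "m = \<pi> Y x" using pres(6)[OF Y(1)] by blast
  then show "(fmor (res s P) F0 (fob KL M) \<mu> Y o theta Y) m = eta M Y m" using pp by simp
 qed
 then have "\<phi> M (fob KL M) (\<lambda>Z. \<mu> Z o \<Lambda> Z) = eta M"
  using phi_right[OF M F0(1) L mu(1) la(1)] la(2) by simp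
 then have id: "(\<lambda>Z. \<mu> Z o \<Lambda> Z) = Ident D (fob KL M)"
  using bij_betw_eqD[OF phi_bij[OF M L] _ comp B.ident_hom[OF Dc[OF L]]] by blast
 show ?thesis
 proof (rule that[OF pres(3,5)])
  fix X z assume X: "fin_pres s P X" and z: "z : mval (fob KL M) X"
  have z': "z = \<mu> X (\<Lambda> X z)" using fun_cong[OF fun_cong[OF id], of X z] X z by (simp add: mod_cat_ident)
  have "\<Lambda> X z : mval F0 X" by (rule B_hom_val[OF la(1) X z])
  then obtain v where v: "v : mval (h (y Y0)) X" "\<Lambda> X z = p X v" using F0(3)[of X] X by auto
  then obtain a where a: "a : cmod_hom P s X s (y Y0)" "v = rep s B X (y Y0) a" by (auto simp: B.mval_hom_mod)
  have "z = mmap (fob KL M) X (y Y0) a (eta M Y0 e)"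
   using z' mu(2)[OF _ v(1)] v a X y0 by (simp add: B.yon_rep)
  then show "\<exists>a\<in>cmod_hom P s X s (y Y0). z = mmap (fob KL M) X (y Y0) a (eta M Y0 (\<pi> Y0 (one Y0)))"
   using a(1) unfolding e_def by (rule bexI)
 qed
qed

text \<open>An element of KL(M)(X) arises from the generator by means of some a : X \<rightarrow> P(?, Y), by KL_generated. The formula for \<psi>
 shows that its image in KR(M)(X) = Hom(X, M) is the composition of a with a morphism P(?, Y) \<rightarrow> M.\<close>

lemma KLR_values:
 assumes M: "fin_pres s P M" and X: "fin_pres s P X"
 shows "mval (KLR s P KL KR \<phi> \<psi> M) X = hom_to_KR s P \<psi> X M `
  {u. \<exists>Y\<in>Ob P. \<exists>a\<in>cmod_hom P s X s (y Y). \<exists>w\<in>cmod_hom P s (y Y) s M. u = (\<lambda>W. w W o a W)}"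
  (is "_ = _ ` ?U")
proof -
 define g where "g = unit_inv B D KL (res s P) \<phi> M"
 note g = unit_inverse[OF M, folded g_def]
 note L = KLD(1)[OF M] and E = eta_mem[OF M]
 define \<kappa> where "\<kappa> = KL_to_KR B D KL (res s P) \<phi> \<psi> M"
 have k: "\<kappa> = \<psi> (fob KL M) M g" by (simp add: \<kappa>_def KL_to_KR_def g_def)
 have key: "\<kappa> X (mmap (fob KL M) X (y Y) a (eta M Y (w Y (one Y)))) = hom_to_KR s P \<psi> X M (\<lambda>W. w W o a W)"
  and mem: "mmap (fob KL M) X (y Y) a (eta M Y (w Y (one Y))) : mval (fob KL M) X"
  if Y: "Y : Ob P" and a: "a : cmod_hom P s X s (y Y)" and w: "w : cmod_hom P s (y Y) s M" for Y a w
 proof -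
  have w1: "w Y (one Y) : mval M Y" by (rule cmod_homD_val[OF w Y rep_ident_mem[OF Y]])
  have e1: "eta M Y (w Y (one Y)) : mval (fob KL M) (y Y)" using cmod_homD_val[OF E Y w1] by simp
  show z: "mmap (fob KL M) X (y Y) a (eta M Y (w Y (one Y))) : mval (fob KL M) X" (is "?z : _")
   by (rule mmap_B_val[OF Dc[OF L] X y_fp[OF Y] a e1])
  obtain u where u: "u : cmod_hom P s X s M"
   "!!Z x. Z : Ob P ==> x : mval X Z ==> u Z x = g Z (mmap (fob KL M) (y Z) X (yon X Z x) ?z)"
   "\<psi> (fob KL M) M g X ?z = hom_to_KR s P \<psi> X M u"
   by (rule psi_formula[OF L M g(1) X z]) (rule that)
  have "u = (\<lambda>W. w W o a W)"
  proof (rule cmod_hom_eqI[OF u(1) cmod_hom_comp[OF a w]])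
   fix Z x assume Z: "Z : Ob P" and x: "x : mval X Z"
   note xh = yX_hom[OF X Z x]
   have "a Z x : mval (y Y) Z" by (rule cmod_homD_val[OF a Z x])
   then obtain k where k: "k : Hom P Z Y" "a Z x = rep s P Z Y k" by (auto simp: mval_hom_mod)
   have "(\<lambda>W. a W o yon X Z x W) = fmor Yo Z Y k"
    by (rule Yo_full[OF cmod_hom_comp[OF xh a] Z Y k(1)]) (use yon_ident[OF Bc[OF X] Z x] k in simp)
   then have "mmap (fob KL M) (y Z) X (yon X Z x) ?z = mmap (fob KL M) (y Z) (y Y) (fmor Yo Z Y k) (eta M Y (w Y (one Y)))"
    using mmap_B_comp[OF Dc[OF L] y_fp[OF Z] X y_fp[OF Y] xh a] by simp
   also have "... = eta M Z (mmap M Z Y k (w Y (one Y)))" using cmod_homD(3)[OF E Z Y k(1)] by simp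
   finally have "u Z x = mmap M Z Y k (w Y (one Y))"
    using u(2)[OF Z x] g(2)[OF Z] mmap_val[OF Bc[OF M] Z Y k(1) w1] by simp
   also have "... = w Z (rep s P Z Y k)" using hom_mod_hom_rep[OF w Y Z k(1)] by simp
   finally show "u Z x = (w Z o a Z) x" using k by simp
  qed
  then show "\<kappa> X ?z = hom_to_KR s P \<psi> X M (\<lambda>W. w W o a W)" using u(3) k by simp
 qed
 obtain Y0 \<pi> where gen: "Y0 : Ob P" "\<pi> : cmod_hom P s (y Y0) s M"
  "!!X z. fin_pres s P X ==> z : mval (fob KL M) X ==>
   \<exists>a\<in>cmod_hom P s X s (y Y0). z = mmap (fob KL M) X (y Y0) a (eta M Y0 (\<pi> Y0 (one Y0)))"
  by (rule KL_generated[OF M]) (rule that)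
 have "mval (KLR s P KL KR \<phi> \<psi> M) X = \<kappa> X ` mval (fob KL M) X"
  by (simp add: KLR_def image_mod_def \<kappa>_def)
 also have "... = hom_to_KR s P \<psi> X M ` ?U"
 proof
  show "\<kappa> X ` mval (fob KL M) X \<subseteq> hom_to_KR s P \<psi> X M ` ?U"
  proof
   fix v assume "v : \<kappa> X ` mval (fob KL M) X"
   then obtain z where z: "z : mval (fob KL M) X" "v = \<kappa> X z" by blast
   obtain a where a: "a : cmod_hom P s X s (y Y0)" "z = mmap (fob KL M) X (y Y0) a (eta M Y0 (\<pi> Y0 (one Y0)))"
    using gen(3)[OF X z(1)] by blast
   have "v = hom_to_KR s P \<psi> X M (\<lambda>W. \<pi> W o a W)" using key[OF gen(1) a(1) gen(2)] z(2) a(2) by simp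
   moreover have "(\<lambda>W. \<pi> W o a W) : ?U" using gen(1,2) a(1) by blast
   ultimately show "v : hom_to_KR s P \<psi> X M ` ?U" by (rule image_eqI)
  qed
  show "hom_to_KR s P \<psi> X M ` ?U \<subseteq> \<kappa> X ` mval (fob KL M) X"
  proof
   fix v assume "v : hom_to_KR s P \<psi> X M ` ?U"
   then obtain Y a w where *: "Y : Ob P" "a : cmod_hom P s X s (y Y)" "w : cmod_hom P s (y Y) s M"
    "v = hom_to_KR s P \<psi> X M (\<lambda>W. w W o a W)" by blast
   show "v : \<kappa> X ` mval (fob KL M) X"
    by (rule image_eqI[OF _ mem[OF *(1-3)]]) (simp only: key[OF *(1-3)] *(4))
  qed
 qed
 finally show ?thesis .
qed

lemma KLR_mmap: "mmap (KLR s P KL KR \<phi> \<psi> M) X X' f v =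
 (if v : mval (KLR s P KL KR \<phi> \<psi> M) X' then mmap (fob KR M) X X' f v else 0)"
 by (simp add: KLR_def image_mod_def)

end

lemma is_cmod_image_mod:
 assumes "vector_space s" and F: "is_cmod C s F" and G: "is_cmod C s G" and t: "tau : cmod_hom C s F s G"
 shows "is_cmod C s (image_mod F G tau)"
proof -
 let ?I = "image_mod F G tau"
 have v: "mval ?I X = tau X ` mval F X" for X by (simp add: image_mod_def)
 have m: "mmap ?I X Y f x = (if x : mval ?I Y then mmap G X Y f x else 0)" for X Y f x by (simp add: image_mod_def)
 have sub: "module.subspace s (mval ?I X)" if "X : Ob C" for X
  unfolding v by (rule lin_image[OF cmod_homD(1)[OF t that] assms(1,1) is_cmodD(1)[OF F that]])
 have in_G: "x : mval G X" if "X : Ob C" "x : mval ?I X" for X x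
  using that cmod_homD_val[OF t] by (auto simp: v)
 have st: "mmap G X Y f x : mval ?I X" if *: "X : Ob C" "Y : Ob C" "f : Hom C X Y" and x: "x : mval ?I Y" for X Y f x
 proof -
  obtain w where w: "w : mval F Y" "x = tau Y w" using x by (auto simp: v)
  then have "mmap G X Y f x = tau X (mmap F X Y f w)" using cmod_homD(3)[OF t *] by simp
  then show ?thesis using mmap_val[OF F * w(1)] by (simp add: v)
 qed
 have l: "mmap ?I X Y f : lin s (mval ?I Y) s (mval ?I X)" if *: "X : Ob C" "Y : Ob C" "f : Hom C X Y" for X Y f
 proof (rule linI)
  note gl = linD[OF is_cmodD(3)[OF G *]] and sY = subspaceD[OF assms(1) sub[OF *(2)]]
  fix x x' c assume x: "x : mval ?I Y"
  show "mmap ?I X Y f x : mval ?I X" using st[OF * x] x by (simp add: m)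
  show "mmap ?I X Y f (s c x) = s c (mmap ?I X Y f x)"
   using gl(3)[OF in_G[OF *(2) x]] x sY(3)[OF x] by (simp add: m)
  assume x': "x' : mval ?I Y"
  show "mmap ?I X Y f (x + x') = mmap ?I X Y f x + mmap ?I X Y f x'"
   using gl(2)[OF in_G[OF *(2) x] in_G[OF *(2) x']] x x' sY(2)[OF x x'] by (simp add: m)
 qed (simp add: m)
 have "mmap ?I X X (Ident C X) = idm (mval ?I X)" if "X : Ob C" for X
 proof
  fix x show "mmap ?I X X (Ident C X) x = idm (mval ?I X) x"
   using in_G[OF that, of x] is_cmodD(2)[OF G that] by (cases "x : mval ?I X") (auto simp: m)
 qed
 moreover have "mmap ?I X Y (f + g) = mmap ?I X Y f + mmap ?I X Y g" "mmap ?I X Y (Scl C c f) = fscale s c (mmap ?I X Y f)"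
  if "X : Ob C" "Y : Ob C" "f : Hom C X Y" "g : Hom C X Y" for X Y f g c
  using is_cmodD(4,5)[OF G] that by (auto simp: fun_eq_iff m fscale_def vs_scaleD(5)[OF assms(1)])
 moreover have "mmap ?I X Z (Cmp C g f) = mmap ?I X Y f o mmap ?I Y Z g"
  if *: "X : Ob C" "Y : Ob C" "Z : Ob C" "f : Hom C X Y" "g : Hom C Y Z" for X Y Z f g
 proof
  fix x show "mmap ?I X Z (Cmp C g f) x = (mmap ?I X Y f o mmap ?I Y Z g) x"
   using st[OF *(2,3,5), of x] is_cmodD(6)[OF G *] lin_0[OF is_cmodD(3)[OF G *(1,2,4)]]
   by (cases "x : mval ?I Z") (auto simp: m)
 qed
 ultimately show ?thesis unfolding is_cmod_def using sub l by blast
qed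

lemma (in intermediate_extension) KLR_cmod:
 assumes M: "fin_pres s P M"
 shows "is_cmod B s (KLR s P KL KR \<phi> \<psi> M)"
 unfolding KLR_def KL_to_KR_def
 by (rule is_cmod_image_mod[OF vs Dc[OF KLD(1)[OF M]] Dc[OF KRD(1)[OF M]] psi_mem[OF KLD(1)[OF M] M unit_inverse(1)[OF M]]])

section \<open>Categories with enough projectives\<close>

text \<open>Recognizes a module from a presentation: each of the two projections factors through the other.\<close>

lemma same_kernel_iso:
 assumes "vector_space s" and V: "is_cmod C s V" and F: "is_cmod C s F" and G: "is_cmod C s G"
  and p: "\<pi> : cmod_hom C s V s F" "!!X. X : Ob C ==> \<pi> X ` mval V X = mval F X"
  and q: "rho : cmod_hom C s V s G" "!!X. X : Ob C ==> rho X ` mval V X = mval G X"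
  and k: "!!X. X : Ob C ==> {v : mval V X. \<pi> X v = 0} = {v : mval V X. rho X v = 0}"
 obtains theta theta' where "theta : cmod_hom C s F s G" "theta' : cmod_hom C s G s F"
  "!!X x. X : Ob C ==> x : mval F X ==> theta' X (theta X x) = x"
  "!!X x. X : Ob C ==> x : mval G X ==> theta X (theta' X x) = x"
proof -
 have k1: "rho X v = 0" if "X : Ob C" "v : mval V X" "\<pi> X v = 0" for X v using k[OF that(1)] that by blast
 have k2: "\<pi> X v = 0" if "X : Ob C" "v : mval V X" "rho X v = 0" for X v using k[OF that(1)] that by blast
 obtain theta where th: "theta : cmod_hom C s F s G" "!!X v. X : Ob C ==> v : mval V X ==> theta X (\<pi> X v) = rho X v"
  by (rule cmod_factor[OF assms(1) V F G p q(1) k1]) (assumption, assumption, assumption, assumption, rule that)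
 obtain theta' where th': "theta' : cmod_hom C s G s F" "!!X v. X : Ob C ==> v : mval V X ==> theta' X (rho X v) = \<pi> X v"
  by (rule cmod_factor[OF assms(1) V G F q p(1) k2]) (assumption, assumption, assumption, assumption, rule that)
 show ?thesis
 proof (rule that[OF th(1) th'(1)])
  show "theta' X (theta X x) = x" if X: "X : Ob C" "x : mval F X" for X x
  proof -
   obtain v where "v : mval V X" "x = \<pi> X v" using p(2)[OF X(1)] X(2) by blast
   then show ?thesis using th(2)[OF X(1)] th'(2)[OF X(1)] by simp
  qed
  show "theta X (theta' X x) = x" if X: "X : Ob C" "x : mval G X" for X x
  proof -
   obtain v where "v : mval V X" "x = rho X v" using q(2)[OF X(1)] X(2) by blast
   then show ?thesis using th(2)[OF X(1)] th'(2)[OF X(1)] by simp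
  qed
 qed
qed

context hf_category
begin

lemma iso_obj_trans:
 assumes "X : Ob C" "Y : Ob C" "Z : Ob C" "iso_obj C X Y" "iso_obj C Y Z"
 shows "iso_obj C X Z"
proof -
 obtain f g where f: "f : Hom C X Y" "g : Hom C Y X" "Cmp C g f = Ident C X" "Cmp C f g = Ident C Y"
  using assms(4) by (auto simp: iso_obj_def)
 obtain f' g' where f': "f' : Hom C Y Z" "g' : Hom C Z Y" "Cmp C g' f' = Ident C Y" "Cmp C f' g' = Ident C Z"
  using assms(5) by (auto simp: iso_obj_def)
 have ff: "Cmp C f' f : Hom C X Z" and gg: "Cmp C g g' : Hom C Z X"
  using cmp_in assms f(1,2) f'(1,2) by blast+
 have "Cmp C (Cmp C g g') (Cmp C f' f) = Cmp C g (Cmp C g' (Cmp C f' f))"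
  using cmp_assoc[OF assms(1,3,2,1) ff f'(2) f(2)] by simp
 also have "Cmp C g' (Cmp C f' f) = f" using cmp_assoc[OF assms(1,2,3,2) f(1) f'(1,2)] f' ident_left[OF assms(1,2) f(1)] by simp
 finally have 1: "Cmp C (Cmp C g g') (Cmp C f' f) = Ident C X" using f by simp
 have "Cmp C (Cmp C f' f) (Cmp C g g') = Cmp C f' (Cmp C f (Cmp C g g'))"
  using cmp_assoc[OF assms(3,1,2,3) gg f(1) f'(1)] by simp
 also have "Cmp C f (Cmp C g g') = g'" using cmp_assoc[OF assms(3,2,1,2) f'(2) f(2,1)] f ident_left[OF assms(3,2) f'(2)] by simp
 finally have 2: "Cmp C (Cmp C f' f) (Cmp C g g') = Ident C Z" using f' by simp
 show ?thesis using ff gg 1 2 by (auto simp: iso_obj_def)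
qed

text \<open>The sequence X1 \<rightarrow> X0 \<rightarrow> N \<rightarrow> 0 of morphisms g, \<pi> is a projective presentation of N; the last condition is exactness
 at X0 as seen by projective objects.\<close>

definition proj_pres :: "'o => 'o => 'o => 'm => 'm => bool" where
 "proj_pres X1 X0 N g \<pi> \<longleftrightarrow> projective C X1 & projective C X0 & N : Ob C & g : Hom C X1 X0 & epi C X0 N \<pi> \<and>
   Cmp C \<pi> g = 0 & (\<forall>N'\<in>Ob C. \<forall>h\<in>Hom C X0 N'. Cmp C h g = 0 --> (\<exists>f\<in>Hom C N N'. Cmp C f \<pi> = h)) \<and>
   (\<forall>Y k. projective C Y & k : Hom C Y X0 & Cmp C \<pi> k = 0 --> (\<exists>l\<in>Hom C Y X1. k = Cmp C g l))"

lemma projectiveD: "projective C Y ==> epi C X N e ==> X : Ob C ==> N : Ob C ==> k : Hom C Y N ==> \<exists>l\<in>Hom C Y X. Cmp C e l = k"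
 by (auto simp: projective_def)

lemma projective_direct_sum:
 assumes "direct_sum C X Y Z" "X : Ob C" "projective C Y" "projective C Z"
 shows "projective C X"
proof -
 have YZ: "Y : Ob C" "Z : Ob C" using assms by (auto simp: projective_def)
 obtain i p j q where *: "i : Hom C Y X" "p : Hom C X Y" "j : Hom C Z X" "q : Hom C X Z"
  "Cmp C i p + Cmp C j q = Ident C X" using assms(1) by (auto simp: direct_sum_def)
 show ?thesis unfolding projective_def
 proof (intro conjI assms(2) ballI allI impI)
  fix U V e g assume UV: "U : Ob C" "V : Ob C" and eg: "epi C U V e & g : Hom C X V"
  have e: "e : Hom C U V" using eg by (simp add: epi_def)
  obtain h1 where h1: "h1 : Hom C Y U" "Cmp C e h1 = Cmp C g i"
   using projectiveD[OF assms(3) _ UV, of e "Cmp C g i"] eg cmp_in[OF YZ(1) assms(2) UV(2) *(1)] by auto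
  obtain h2 where h2: "h2 : Hom C Z U" "Cmp C e h2 = Cmp C g j"
   using projectiveD[OF assms(4) _ UV, of e "Cmp C g j"] eg cmp_in[OF YZ(2) assms(2) UV(2) *(3)] by auto
  have m: "Cmp C h1 p : Hom C X U" "Cmp C h2 q : Hom C X U"
   using cmp_in[OF assms(2) YZ(1) UV(1) *(2) h1(1)] cmp_in[OF assms(2) YZ(2) UV(1) *(4) h2(1)] by auto
  have g: "g : Hom C X V" using eg by simp
  have "Cmp C e (Cmp C h1 p + Cmp C h2 q) = Cmp C e (Cmp C h1 p) + Cmp C e (Cmp C h2 q)"
   by (rule cmp_add_right[OF assms(2) UV m e])
  also have "... = Cmp C (Cmp C g i) p + Cmp C (Cmp C g j) q"
   using cmp_assoc[OF assms(2) YZ(1) UV *(2) h1(1) e] cmp_assoc[OF assms(2) YZ(2) UV *(4) h2(1) e] h1 h2 by simp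
  also have "... = Cmp C g (Cmp C i p) + Cmp C g (Cmp C j q)"
   using cmp_assoc[OF assms(2) YZ(1) assms(2) UV(2) *(2,1) g] cmp_assoc[OF assms(2) YZ(2) assms(2) UV(2) *(4,3) g] by simp
  also have "... = Cmp C g (Cmp C i p + Cmp C j q)"
   by (rule cmp_add_right[symmetric, OF assms(2,2) UV(2) _ _ g]) (use cmp_in assms(2) YZ * in blast)+
  also have "... = g" using *(5) ident_right[OF assms(2) UV(2) g] by simp
  finally show "\<exists>h\<in>Hom C X U. Cmp C e h = g" using hom_closed(2)[OF assms(2) UV(1) m] by blast
 qed
qed

lemma projective_retract:
 assumes "projective C X" "Y : Ob C" "i : Hom C Y X" "p : Hom C X Y" "Cmp C p i = Ident C Y"
 shows "projective C Y"
 unfolding projective_def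
proof (intro conjI assms(2) ballI allI impI)
 have X: "X : Ob C" using assms(1) by (simp add: projective_def)
 fix U V e g assume UV: "U : Ob C" "V : Ob C" and eg: "epi C U V e & g : Hom C Y V"
 then have g: "g : Hom C Y V" and e: "e : Hom C U V" by (auto simp: epi_def)
 obtain l where l: "l : Hom C X U" "Cmp C e l = Cmp C g p"
  using projectiveD[OF assms(1) _ UV, of e "Cmp C g p"] eg cmp_in[OF X assms(2) UV(2) assms(4)] by auto
 have "Cmp C e (Cmp C l i) = Cmp C (Cmp C g p) i" using cmp_assoc[OF assms(2) X UV assms(3) l(1) e] l(2) by simp
 also have "... = g" using cmp_assoc[OF assms(2) X assms(2) UV(2) assms(3,4) g] assms(5) ident_right[OF assms(2) UV(2) g] by simp
 finally show "\<exists>h\<in>Hom C Y U. Cmp C e h = g" using cmp_in[OF assms(2) X UV(1) assms(3) l(1)] by blast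
qed

end

text \<open>Presentations by projective objects exist, and each morphism between projective objects presents some object; the latter is what makes
 the functor to modules over the projective objects essentially surjective.\<close>

locale enough_projectives = hf_category s C for s :: "'k::field => 'u::ab_group_add => 'u" and C :: "('k, 'o, 'm::ab_group_add) kcat" +
 assumes ex_pres: "N : Ob C ==> \<exists>X1 X0 g \<pi>. proj_pres X1 X0 N g \<pi>"
  and ex_coker: "projective C X1 ==> projective C X0 ==> g : Hom C X1 X0 ==> \<exists>N \<pi>. proj_pres X1 X0 N g \<pi>"
begin

abbreviation "PC \<equiv> full_sub C (projective C)"
abbreviation "Yp \<equiv> yoneda s C PC"

lemma PC_simps [simp]: "Hom PC = Hom C" "Cmp PC = Cmp C" "Ident PC = Ident C" "Scl PC = Scl C"
 "X : Ob PC \<longleftrightarrow> projective C X"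
 by (auto simp: full_sub_def projective_def)

lemma projective_Ob: "projective C X ==> X : Ob C" by (simp add: projective_def)

lemma hf_category_PC: "hf_category s PC"
proof (intro hf_category.intro hf_category_axioms.intro infinite_space_axioms, unfold PC_simps)
qed (auto intro: vsC hom_fd cmp_in ident_in ident_left ident_right cmp_assoc cmp_add_left cmp_add_right cmp_scl_left cmp_scl_right
  dest!: projective_Ob)

lemma rep_PC: "rep s PC = rep s C"
 by (intro ext) (simp add: rep_def)

lemma hom_mod_PC: "hom_mod s PC X = hom_mod s C X"
 unfolding hom_mod_def unrep_def rep_PC PC_simps ..

lemma yoneda_PC: "yoneda s PC PC = Yp"
 unfolding yoneda_def unrep_def hom_mod_PC rep_PC PC_simps ..

lemma Yp_cmod: "N : Ob C ==> is_cmod PC s (hom_mod s C N)"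
 by (rule is_cmod_full[OF is_cmod_hom_mod]) (auto dest: projective_Ob)

lemma Yp_mor: "X : Ob C ==> X' : Ob C ==> g : Hom C X X' ==>
  fmor Yp X X' g : cmod_hom PC s (hom_mod s C X) s (hom_mod s C X')"
 by (rule fmor_yoneda_hom) (auto dest: projective_Ob)

lemma Yp_rep: "projective C Y ==> X : Ob C ==> h : Hom C Y X ==>
  fmor Yp X X' g Y (rep s C Y X h) = rep s C Y X' (Cmp C g h)"
 by (rule fmor_yoneda_rep) (auto dest: projective_Ob)

lemma Yp_eqI:
 assumes "tau : cmod_hom PC s (hom_mod s C X) s F" "sigma : cmod_hom PC s (hom_mod s C X) s F"
  "!!Y h. projective C Y ==> h : Hom C Y X ==> tau Y (rep s C Y X h) = sigma Y (rep s C Y X h)"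
 shows "tau = sigma"
 by (rule cmod_hom_eqI[OF assms(1,2)]) (use assms(3) in "auto simp: mval_hom_mod")

lemma Yp_comp:
 assumes "X : Ob C" "Y : Ob C" "Z : Ob C" "f : Hom C X Y" "g : Hom C Y Z"
 shows "fmor Yp X Z (Cmp C g f) = (\<lambda>W. fmor Yp Y Z g W o fmor Yp X Y f W)"
proof (rule Yp_eqI[OF Yp_mor cmod_hom_comp[OF Yp_mor Yp_mor]])
 fix W h assume W: "projective C W" and h: "h : Hom C W X"
 show "fmor Yp X Z (Cmp C g f) W (rep s C W X h) = (fmor Yp Y Z g W o fmor Yp X Y f W) (rep s C W X h)"
  using cmp_assoc[OF projective_Ob[OF W] assms(1-3) h assms(4,5)] cmp_in[OF projective_Ob[OF W] assms(1,2) h assms(4)] assms W h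
  by (simp add: Yp_rep)
qed (use assms cmp_in in auto)

lemma Yp_ident:
 assumes "X : Ob C" shows "fmor Yp X X (Ident C X) = Ident (mod_cat s PC) (hom_mod s C X)"
proof (rule Yp_eqI[OF Yp_mor hf_category.ident_hom[OF hf_category_PC Yp_cmod]])
 fix Y h assume "projective C Y" "h : Hom C Y X"
 then show "fmor Yp X X (Ident C X) Y (rep s C Y X h) = Ident (mod_cat s PC) (hom_mod s C X) Y (rep s C Y X h)"
  using assms by (auto simp: projective_Ob Yp_rep ident_left[rotated 2] mod_cat_ident mval_hom_mod)
qed (use assms ident_in in auto)

lemma Yp_add:
 assumes "X : Ob C" "Y : Ob C" "f : Hom C X Y" "g : Hom C X Y"
 shows "fmor Yp X Y (f + g) = fmor Yp X Y f + fmor Yp X Y g"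
proof -
 note sc = subspaceD[OF vector_space_fscale[OF vector_space_fscale[OF vs]] subspace_cmod_hom[OF Yp_cmod[OF assms(1)] Yp_cmod[OF assms(2)] vs]]
 show ?thesis
  by (rule Yp_eqI[OF Yp_mor sc(2)[OF Yp_mor Yp_mor]])
   (use assms in "auto simp: projective_Ob Yp_rep hom_closed cmp_add_left[rotated 3] rep_add cmp_in[rotated 3]")
qed

lemma Yp_scl:
 assumes "X : Ob C" "Y : Ob C" "f : Hom C X Y"
 shows "fmor Yp X Y (Scl C c f) = fscale (fscale s) c (fmor Yp X Y f)"
proof -
 note sc = subspaceD[OF vector_space_fscale[OF vector_space_fscale[OF vs]] subspace_cmod_hom[OF Yp_cmod[OF assms(1)] Yp_cmod[OF assms(2)] vs]]
 show ?thesis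
  by (rule Yp_eqI[OF Yp_mor sc(3)[OF Yp_mor]])
   (use assms in "auto simp: projective_Ob Yp_rep hom_closed cmp_scl_left[rotated 3] rep_scl cmp_in[rotated 3] fscale2_apply")
qed

lemma Yp_exact:
 assumes pp: "proj_pres X1 X0 N g \<pi>" and Y: "projective C Y"
 shows "fmor Yp X0 N \<pi> Y ` mval (hom_mod s C X0) Y = mval (hom_mod s C N) Y"
  "{v : mval (hom_mod s C X0) Y. fmor Yp X0 N \<pi> Y v = 0} = fmor Yp X1 X0 g Y ` mval (hom_mod s C X1) Y"
proof -
 have X: "X1 : Ob C" "X0 : Ob C" "N : Ob C" "g : Hom C X1 X0" and epi: "epi C X0 N \<pi>" and pi: "\<pi> : Hom C X0 N" and 0: "Cmp C \<pi> g = 0"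
  and ex: "!!k. k : Hom C Y X0 ==> Cmp C \<pi> k = 0 ==> \<exists>l\<in>Hom C Y X1. k = Cmp C g l"
  using pp Y projective_Ob unfolding proj_pres_def epi_def by blast+
 note YO = projective_Ob[OF Y]
 show "fmor Yp X0 N \<pi> Y ` mval (hom_mod s C X0) Y = mval (hom_mod s C N) Y"
 proof
  show "fmor Yp X0 N \<pi> Y ` mval (hom_mod s C X0) Y \<subseteq> mval (hom_mod s C N) Y"
   using cmod_homD_val[OF Yp_mor[OF X(2,3) pi]] Y by auto
  show "mval (hom_mod s C N) Y \<subseteq> fmor Yp X0 N \<pi> Y ` mval (hom_mod s C X0) Y"
  proof
   fix v assume "v : mval (hom_mod s C N) Y"
   then obtain k where k: "k : Hom C Y N" "v = rep s C Y N k" by (auto simp: mval_hom_mod)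
   obtain l where l: "l : Hom C Y X0" "Cmp C \<pi> l = k" using projectiveD[OF Y epi X(2,3) k(1)] by blast
   have "v = fmor Yp X0 N \<pi> Y (rep s C Y X0 l)" using Y X l k by (simp add: Yp_rep)
   then show "v : fmor Yp X0 N \<pi> Y ` mval (hom_mod s C X0) Y" using l by (auto simp: mval_hom_mod)
  qed
 qed
 show "{v : mval (hom_mod s C X0) Y. fmor Yp X0 N \<pi> Y v = 0} = fmor Yp X1 X0 g Y ` mval (hom_mod s C X1) Y"
 proof
  show "{v : mval (hom_mod s C X0) Y. fmor Yp X0 N \<pi> Y v = 0} \<subseteq> fmor Yp X1 X0 g Y ` mval (hom_mod s C X1) Y"
  proof
   fix v assume "v : {v : mval (hom_mod s C X0) Y. fmor Yp X0 N \<pi> Y v = 0}"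
   then obtain k where k: "k : Hom C Y X0" "v = rep s C Y X0 k" "fmor Yp X0 N \<pi> Y v = 0" by (auto simp: mval_hom_mod)
   have "rep s C Y N (Cmp C \<pi> k) = 0" using k Y X by (simp add: Yp_rep)
   then have "Cmp C \<pi> k = 0"
    using lin_inj_iff[OF rep_lin[OF YO X(3)] vsC hom_sub[OF YO X(3)]] rep_inj[OF YO X(3)] cmp_in[OF YO X(2,3) k(1) pi] by blast
   then obtain l where l: "l : Hom C Y X1" "k = Cmp C g l" using ex[OF k(1)] by blast
   have "v = fmor Yp X1 X0 g Y (rep s C Y X1 l)" using Y X l k by (simp add: Yp_rep)
   then show "v : fmor Yp X1 X0 g Y ` mval (hom_mod s C X1) Y" using l by (auto simp: mval_hom_mod)
  qed
  show "fmor Yp X1 X0 g Y ` mval (hom_mod s C X1) Y \<subseteq> {v : mval (hom_mod s C X0) Y. fmor Yp X0 N \<pi> Y v = 0}"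
  proof
   fix v assume "v : fmor Yp X1 X0 g Y ` mval (hom_mod s C X1) Y"
   then obtain l where l: "l : Hom C Y X1" "v = fmor Yp X1 X0 g Y (rep s C Y X1 l)" by (auto simp: mval_hom_mod)
   have v: "v = rep s C Y X0 (Cmp C g l)" using Y X l by (simp add: Yp_rep)
   have gl: "Cmp C g l : Hom C Y X0" by (rule cmp_in[OF YO X(1,2) l(1) X(4)])
   have "Cmp C \<pi> (Cmp C g l) = 0" using cmp_assoc[OF YO X(1-3) l(1) X(4) pi] 0 cmp_zero(1)[OF YO X(1,3) l(1)] by simp
   then show "v : {v : mval (hom_mod s C X0) Y. fmor Yp X0 N \<pi> Y v = 0}"
    using v gl Y X rep_zero[OF YO X(3)] by (auto simp: Yp_rep mval_hom_mod)
  qed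
 qed
qed

lemma proj_presD:
 assumes "proj_pres X1 X0 N g \<pi>"
 shows "projective C X1" "projective C X0" "N : Ob C" "g : Hom C X1 X0" "epi C X0 N \<pi>" "\<pi> : Hom C X0 N" "Cmp C \<pi> g = 0"
 using assms by (auto simp: proj_pres_def epi_def)

lemma Yp_fin_pres:
 assumes "N : Ob C" shows "fin_pres s PC (hom_mod s C N)"
proof -
 obtain X1 X0 g \<pi> where pp: "proj_pres X1 X0 N g \<pi>" using ex_pres[OF assms] by blast
 note d = proj_presD[OF pp]
 note O = projective_Ob[OF d(1)] projective_Ob[OF d(2)]
 show ?thesis unfolding fin_pres_def hom_mod_PC yoneda_PC
  by (rule conjI[OF Yp_cmod[OF assms]], rule bexI[of _ X1], rule bexI[of _ X0], rule bexI[of _ g],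
    rule bexI[OF _ Yp_mor[OF O(2) assms d(6)]])
   (use Yp_exact[OF pp] d in auto)
qed

text \<open>The functor N \<mapsto> Hom(?, N) to modules over the projective objects is an equivalence.\<close>

lemma Yp_faithful:
 assumes "N : Ob C" "N' : Ob C" "f : Hom C N N'" "g : Hom C N N'" "fmor Yp N N' f = fmor Yp N N' g"
 shows "f = g"
proof -
 obtain X1 X0 r \<pi> where pp: "proj_pres X1 X0 N r \<pi>" using ex_pres[OF assms(1)] by blast
 note d = proj_presD[OF pp]
 note O = projective_Ob[OF d(2)]
 have "rep s C X0 N' (Cmp C f \<pi>) = rep s C X0 N' (Cmp C g \<pi>)"
  using Yp_rep[OF d(2) assms(1) d(6), of N'] assms(5) by metis
 then have "Cmp C f \<pi> = Cmp C g \<pi>"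
  using inj_onD[OF rep_inj[OF O assms(2)]] cmp_in[OF O assms(1,2) d(6)] assms(3,4) by blast
 then show ?thesis using d(5) assms(2-4) unfolding epi_def by blast
qed

text \<open>A morphism is determined by the element of Hom(X0, N') which is the image of \<pi>; the composition of this element with the morphism
 from X1 to X0 vanishes, so that it factors through \<pi>.\<close>

lemma Yp_full:
 assumes N: "N : Ob C" and N': "N' : Ob C" and t: "tau : cmod_hom PC s (hom_mod s C N) s (hom_mod s C N')"
 shows "\<exists>f\<in>Hom C N N'. tau = fmor Yp N N' f"
proof -
 obtain X1 X0 r \<pi> where pp: "proj_pres X1 X0 N r \<pi>" using ex_pres[OF N] by blast
 note d = proj_presD[OF pp]
 note O = projective_Ob[OF d(2)] and O1 = projective_Ob[OF d(1)]
 have m: "rep s C X0 N \<pi> : mval (hom_mod s C N) X0" using d(6) by (auto simp: mval_hom_mod)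
 have "tau X0 (rep s C X0 N \<pi>) : mval (hom_mod s C N') X0"
  using cmod_homD_val[OF t, of X0] d(2) m by simp
 then obtain h where h: "h : Hom C X0 N'" "tau X0 (rep s C X0 N \<pi>) = rep s C X0 N' h" by (auto simp: mval_hom_mod)
 \<comment> \<open>naturality of \<open>tau\<close>: it is composition with \<open>h\<close> on morphisms which factor through \<open>\<pi>\<close>\<close>
 have nat: "tau Y (rep s C Y N (Cmp C \<pi> k)) = rep s C Y N' (Cmp C h k)" if Y: "projective C Y" and k: "k : Hom C Y X0" for Y k
  using cmod_homD(3)[OF t, of Y X0 k "rep s C X0 N \<pi>"] Y d(2,6) k N N' h O projective_Ob[OF Y]
  by (simp add: mmap_hom_mod)
 have "rep s C X1 N' (Cmp C h r) = tau X1 (rep s C X1 N 0)" using nat[OF d(1,4)] d(7) by simp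
 also have "... = 0" using rep_zero[OF O1 N] lin_0[OF cmod_homD(1)[OF t, of X1]] d(1) by simp
 finally have "Cmp C h r = 0"
  using lin_inj_iff[OF rep_lin[OF O1 N'] vsC hom_sub[OF O1 N']] rep_inj[OF O1 N'] cmp_in[OF O1 O N' d(4) h(1)] by blast
 then obtain f where f: "f : Hom C N N'" "Cmp C f \<pi> = h" using pp h(1) N' unfolding proj_pres_def by blast
 have "tau = fmor Yp N N' f"
 proof (rule Yp_eqI[OF t Yp_mor[OF N N' f(1)]])
  fix Y k assume Y: "projective C Y" and k: "k : Hom C Y N"
  obtain l where l: "l : Hom C Y X0" "Cmp C \<pi> l = k" using projectiveD[OF Y d(5) O N k] by blast
  have "Cmp C h l = Cmp C f k" using cmp_assoc[OF projective_Ob[OF Y] O N N' l(1) d(6) f(1)] f(2) l(2) by simp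
  then show "tau Y (rep s C Y N k) = fmor Yp N N' f Y (rep s C Y N k)"
   using nat[OF Y l(1)] l(2) Y N k by (simp add: Yp_rep)
 qed
 then show ?thesis using f by blast
qed

lemma Yp_ess_surj:
 assumes X: "fin_pres s PC X"
 shows "\<exists>N\<in>Ob C. iso_obj (mod_cat s PC) X (hom_mod s C N)"
proof -
 obtain X1 X0 g p where F: "is_cmod PC s X" "X1 : Ob PC" "X0 : Ob PC" "g : Hom PC X1 X0"
  "p : cmod_hom PC s (hom_mod s PC X0) s X"
  "!!Y. Y : Ob PC ==> p Y ` mval (hom_mod s PC X0) Y = mval X Y"
  "!!Y. Y : Ob PC ==> {v : mval (hom_mod s PC X0) Y. p Y v = 0} = fmor (yoneda s PC PC) X1 X0 g Y ` mval (hom_mod s PC X1) Y"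
  by (rule hf_category.fin_presE[OF hf_category_PC X]) (rule that)
 obtain N \<pi> where pp: "proj_pres X1 X0 N g \<pi>" using ex_coker[of X1 X0 g] F(2-4) by (simp only: PC_simps) blast
 note d = proj_presD[OF pp]
 note O = projective_Ob[OF d(2)]
 have k: "{v : mval (hom_mod s C X0) Y. p Y v = 0} = {v : mval (hom_mod s C X0) Y. fmor Yp X0 N \<pi> Y v = 0}" if "Y : Ob PC" for Y
  using F(7)[OF that] Yp_exact(2)[OF pp, of Y] that unfolding hom_mod_PC yoneda_PC by simp
 obtain theta theta' where th: "theta : cmod_hom PC s X s (hom_mod s C N)" "theta' : cmod_hom PC s (hom_mod s C N) s X"
  "!!Y x. Y : Ob PC ==> x : mval X Y ==> theta' Y (theta Y x) = x"
  "!!Y x. Y : Ob PC ==> x : mval (hom_mod s C N) Y ==> theta Y (theta' Y x) = x"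
 proof (rule same_kernel_iso[OF vs Yp_cmod[OF O] F(1) Yp_cmod[OF d(3)] F(5,6)[unfolded hom_mod_PC] Yp_mor[OF O d(3,6)] _ k])
  show "fmor Yp X0 N \<pi> Y ` mval (hom_mod s C X0) Y = mval (hom_mod s C N) Y" if "Y : Ob PC" for Y
   using Yp_exact(1)[OF pp] that by simp
 qed (assumption, assumption, rule that)
 note i = hf_category.ident_hom[OF hf_category_PC F(1)] hf_category.ident_hom[OF hf_category_PC Yp_cmod[OF d(3)]]
 have "(\<lambda>Y. theta' Y o theta Y) = Ident (mod_cat s PC) X"
  by (rule cmod_hom_eqI[OF cmod_hom_comp[OF th(1,2)] i(1)]) (simp add: th(3) mod_cat_ident)
 moreover have "(\<lambda>Y. theta Y o theta' Y) = Ident (mod_cat s PC) (hom_mod s C N)"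
  by (rule cmod_hom_eqI[OF cmod_hom_comp[OF th(2,1)] i(2)]) (simp add: th(4) mod_cat_ident)
 ultimately have "iso_obj (mod_cat s PC) X (hom_mod s C N)"
  unfolding iso_obj_def using th(1,2) by auto
 then show ?thesis using d(3) by blast
qed

lemma Yp_iso:
 assumes "N : Ob C" "N' : Ob C" "iso_obj C N N'"
 shows "iso_obj (mod_cat s PC) (hom_mod s C N) (hom_mod s C N')"
proof -
 obtain f g where f: "f : Hom C N N'" "g : Hom C N' N" "Cmp C g f = Ident C N" "Cmp C f g = Ident C N'"
  using assms(3) by (auto simp: iso_obj_def)
 show ?thesis unfolding iso_obj_def
  by (rule bexI[of _ "fmor Yp N N' f"], rule bexI[of _ "fmor Yp N' N g"])
   (use assms f Yp_comp[of N N' N f g] Yp_comp[of N' N N' g f] Yp_ident Yp_mor in auto)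
qed

text \<open>A decomposition of N is transported to X by the functor and the isomorphism; faithfulness reflects zero objects.\<close>

lemma Yp_indecomposable:
 assumes X: "indecomposable (mod_cat s PC) X" and N: "N : Ob C" and iso: "iso_obj (mod_cat s PC) X (hom_mod s C N)"
 shows "indecomposable C N"
proof -
 let ?B = "mod_cat s PC"
 interpret B: hf_category s ?B by (rule hf_category.hf_category_mod_cat[OF hf_category_PC])
 have XO: "X : Ob ?B" using X by (simp add: indecomposable_def)
 have yO: "hom_mod s C N' : Ob ?B" if "N' : Ob C" for N' using Yp_fin_pres[OF that] by simp
 have ym: "fmor Yp M M' g : Hom ?B (hom_mod s C M) (hom_mod s C M')" if "M : Ob C" "M' : Ob C" "g : Hom C M M'" for M M' g
  using Yp_mor[OF that] by simp
 obtain a b where ab: "a : Hom ?B X (hom_mod s C N)" "b : Hom ?B (hom_mod s C N) X"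
  "Cmp ?B b a = Ident ?B X" "Cmp ?B a b = Ident ?B (hom_mod s C N)" using iso by (auto simp: iso_obj_def)
 have z: "zero_obj C M" if "zero_obj ?B (hom_mod s C M)" "M : Ob C" for M
 proof -
  have "Cmp C 0 0 = 0" using cmp_zero(1)[of M M M 0] hom_closed(1) that by auto
  have "fmor Yp M M 0 = 0"
   using Yp_scl[OF that(2,2), of 0 0] hom_closed(1)[OF that(2,2)] by (auto simp: vs_scaleD vsC fun_eq_iff fscale2_apply vs)
  then show ?thesis using Yp_faithful[OF that(2,2) ident_in[OF that(2)], of 0] that Yp_ident hom_closed(1)[OF that(2,2)]
   by (simp add: zero_obj_def)
 qed
 have "\<not> zero_obj C N"
 proof
  assume "zero_obj C N"
  then have "Ident ?B (hom_mod s C N) = fmor Yp N N 0" using Yp_ident[OF N] by (simp add: zero_obj_def)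
  also have "... = 0"
   using Yp_scl[OF N N, of 0 0] hom_closed(1)[OF N N] by (auto simp: vs_scaleD vsC fun_eq_iff fscale2_apply vs)
  finally have "a = 0" using B.ident_left[OF XO yO[OF N] ab(1)] B.cmp_zero(1)[OF XO yO[OF N] yO[OF N] ab(1)] by simp
  then have "Ident ?B X = 0" using ab(3) B.cmp_zero(2)[OF XO yO[OF N] XO ab(2)] by simp
  then show False using X by (simp add: indecomposable_def zero_obj_def)
 qed
 moreover have "zero_obj C N1 | zero_obj C N2" if N12: "N1 : Ob C" "N2 : Ob C" and ds: "direct_sum C N N1 N2" for N1 N2
 proof -
  obtain i p j q where *: "i : Hom C N1 N" "p : Hom C N N1" "j : Hom C N2 N" "q : Hom C N N2"
   "Cmp C p i = Ident C N1" "Cmp C q j = Ident C N2" "Cmp C i p + Cmp C j q = Ident C N"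
   using ds by (auto simp: direct_sum_def)
  let ?y = "hom_mod s C"
  have ba: "(\<lambda>W. b W o a W) = Ident ?B X" "(\<lambda>W. a W o b W) = Ident ?B (?y N)" using ab(3,4) by simp_all
  have ret: "Cmp ?B (Cmp ?B (fmor Yp N L p) a) (Cmp ?B b (fmor Yp L N i)) = Ident ?B (?y L)"
   if L: "L : Ob C" "i : Hom C L N" "p : Hom C N L" "Cmp C p i = Ident C L" for L i p
  proof -
   have "Cmp ?B (Cmp ?B (fmor Yp N L p) a) (Cmp ?B b (fmor Yp L N i)) = (\<lambda>W. fmor Yp N L p W o ((a W o b W) o fmor Yp L N i W))"
    by (simp add: comp_assoc)
   also have "... = (\<lambda>W. fmor Yp N L p W o (Ident ?B (?y N) W o fmor Yp L N i W))" using ba(2) by (simp add: fun_eq_iff)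
   also have "... = (\<lambda>W. fmor Yp N L p W o fmor Yp L N i W)"
    using B.ident_left[OF yO[OF L(1)] yO[OF N] ym[OF L(1) N L(2)]] by (simp add: fun_eq_iff)
   also have "... = Ident ?B (?y L)" using Yp_comp[OF L(1) N L(1,2,3)] L(4) Yp_ident[OF L(1)] by simp
   finally show ?thesis .
  qed
  have one: "Cmp ?B (Cmp ?B b (fmor Yp L N i)) (Cmp ?B (fmor Yp N L p) a) = Cmp ?B b (Cmp ?B (fmor Yp N N (Cmp C i p)) a)"
   if L: "L : Ob C" "i : Hom C L N" "p : Hom C N L" for L i p
   using Yp_comp[OF N L(1) N L(3,2)] by (simp add: comp_assoc)
  have ip: "Cmp C i p : Hom C N N" "Cmp C j q : Hom C N N" using cmp_in N N12 * by blast+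
  have sum: "Cmp ?B b (Cmp ?B (fmor Yp N N (Cmp C i p)) a) + Cmp ?B b (Cmp ?B (fmor Yp N N (Cmp C j q)) a) = Ident ?B X"
  proof -
   note O = XO yO[OF N] yO[OF N] XO
   have m: "fmor Yp N N (Cmp C i p) : Hom ?B (?y N) (?y N)" "fmor Yp N N (Cmp C j q) : Hom ?B (?y N) (?y N)"
    using ym[OF N N] ip by auto
   have "Cmp ?B b (Cmp ?B (fmor Yp N N (Cmp C i p)) a) + Cmp ?B b (Cmp ?B (fmor Yp N N (Cmp C j q)) a)
     = Cmp ?B b (Cmp ?B (fmor Yp N N (Cmp C i p) + fmor Yp N N (Cmp C j q)) a)"
    using B.cmp_add_left[OF O(1,2,2) ab(1) m] B.cmp_add_right[OF O(1,2,1) B.cmp_in[OF O(1,2,2) ab(1) m(1)] B.cmp_in[OF O(1,2,2) ab(1) m(2)] ab(2)]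
    by simp
   also have "fmor Yp N N (Cmp C i p) + fmor Yp N N (Cmp C j q) = Ident ?B (?y N)"
    using Yp_add[OF N N ip] *(7) Yp_ident[OF N] by simp
   also have "Cmp ?B (Ident ?B (?y N)) a = a" by (rule B.ident_left[OF XO yO[OF N] ab(1)])
   finally show ?thesis using ab(3) by (simp only:)
  qed
  have "direct_sum ?B X (?y N1) (?y N2)"
   unfolding direct_sum_def
   by (rule bexI[of _ "Cmp ?B b (fmor Yp N1 N i)"], rule bexI[of _ "Cmp ?B (fmor Yp N N1 p) a"],
     rule bexI[of _ "Cmp ?B b (fmor Yp N2 N j)"], rule bexI[of _ "Cmp ?B (fmor Yp N N2 q) a"])
    (intro conjI ret[OF N12(1) *(1,2,5)] ret[OF N12(2) *(3,4,6)], simp only: one[OF N12(1) *(1,2)] one[OF N12(2) *(3,4)] sum,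
     (rule B.cmp_in[OF XO yO[OF N] yO ab(1) ym] B.cmp_in[OF yO yO[OF N] XO ym ab(2)]; use N N12 * in blast)+)
  then show ?thesis using X yO N12 z unfolding indecomposable_def by blast
 qed
 ultimately show ?thesis using N by (simp add: indecomposable_def)
qed

end

section \<open>Modules over a finite-dimensional algebra\<close>

lemma is_rmodI:
 assumes "module.subspace s (rsp L)"
  "!!x a. x : rsp L ==> a : acar A ==> ract L x a : rsp L"
  "!!x y a. x : rsp L ==> y : rsp L ==> a : acar A ==> ract L (x + y) a = ract L x a + ract L y a"
  "!!x a b. x : rsp L ==> a : acar A ==> b : acar A ==> ract L x (a + b) = ract L x a + ract L x b"
  "!!x a c. x : rsp L ==> a : acar A ==> ract L (s c x) a = s c (ract L x a)"
  "!!x a c. x : rsp L ==> a : acar A ==> ract L x (ascl A c a) = s c (ract L x a)"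
  "!!x a b. x : rsp L ==> a : acar A ==> b : acar A ==> ract L (ract L x a) b = ract L x (amul A a b)"
  "!!x. x : rsp L ==> ract L x (aone A) = x"
 shows "is_rmod s A L"
 using assms unfolding is_rmod_def by simp

lemma is_rmodD:
 assumes "is_rmod s A L"
 shows "module.subspace s (rsp L)"
  "x : rsp L ==> a : acar A ==> ract L x a : rsp L"
  "x : rsp L ==> y : rsp L ==> a : acar A ==> ract L (x + y) a = ract L x a + ract L y a"
  "x : rsp L ==> a : acar A ==> b : acar A ==> ract L x (a + b) = ract L x a + ract L x b"
  "x : rsp L ==> a : acar A ==> ract L (s c x) a = s c (ract L x a)"
  "x : rsp L ==> a : acar A ==> ract L x (ascl A c a) = s c (ract L x a)"
  "x : rsp L ==> a : acar A ==> b : acar A ==> ract L (ract L x a) b = ract L x (amul A a b)"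
  "x : rsp L ==> ract L x (aone A) = x"
 using assms unfolding is_rmod_def by blast+

text \<open>Modules are constructed in whatever space is convenient and then copied into the ambient space; hence homomorphisms between different
 ambient spaces.\<close>

definition mhom :: "('k::field => 'w::ab_group_add => 'w) => ('k => 'u::ab_group_add => 'u) => ('k, 'a) kalg =>
  ('a, 'w) rmod => ('a, 'u) rmod => ('w => 'u) set" where
 "mhom t s A L N = {f : lin t (rsp L) s (rsp N). \<forall>x\<in>rsp L. \<forall>a\<in>acar A. f (ract L x a) = ract N (f x) a}"

lemma mhom_rhom: "mhom s s A L N = rhom s A L N"
 by (simp add: mhom_def rhom_def)

lemma mhom_comp: "f : mhom t s A L N ==> g : mhom s r A N M ==> g o f : mhom t r A L M"
 using lin_comp[of f t "rsp L" s "rsp N" g r "rsp M"] by (auto simp: mhom_def dest: linD(1))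

lemma mhomD:
 assumes "f : mhom t s A L N"
 shows "f : lin t (rsp L) s (rsp N)" "x : rsp L ==> f x : rsp N" "x : rsp L ==> a : acar A ==> f (ract L x a) = ract N (f x) a"
 using assms by (auto simp: mhom_def dest: linD(1))

lemma rhomD:
 assumes "f : rhom s A L N"
 shows "f : lin s (rsp L) s (rsp N)" "x : rsp L ==> f x : rsp N" "x : rsp L ==> a : acar A ==> f (ract L x a) = ract N (f x) a"
 using assms by (auto simp: rhom_def dest: linD(1))

lemma rhomI: "f : lin s (rsp L) s (rsp N) ==> (!!x a. x : rsp L ==> a : acar A ==> f (ract L x a) = ract N (f x) a) ==> f : rhom s A L N"
 by (simp add: rhom_def)

lemma rhom_comp: "f : rhom s A L N ==> g : rhom s A N M ==> g o f : rhom s A L M"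
 using mhom_comp[of f s s A L N g s M] by (simp add: mhom_rhom)

lemma rhom_eqI: "f : rhom s A L N ==> g : rhom s A L N' ==> (!!x. x : rsp L ==> f x = g x) ==> f = g"
 using lin_eqI[OF rhomD(1) rhomD(1)] by metis

lemma zero_rmod_simps [simp]: "rsp zero_rmod = {0}" "ract zero_rmod x a = 0"
 by (auto simp: zero_rmod_def)

locale fd_algebra = infinite_space s for s :: "'k::field => 'u::ab_group_add => 'u" +
 fixes A :: "('k, 'a::ab_group_add) kalg"
 assumes vsA: "vector_space (ascl A)" and fdA: "fin_dim (ascl A) (acar A)"
  and mul_in: "a : acar A ==> b : acar A ==> amul A a b : acar A" and one_in: "aone A : acar A"
  and mul_add_left: "a : acar A ==> b : acar A ==> x : acar A ==> amul A (a + b) x = amul A a x + amul A b x"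
  and mul_add_right: "a : acar A ==> b : acar A ==> x : acar A ==> amul A x (a + b) = amul A x a + amul A x b"
  and mul_scl_left: "a : acar A ==> x : acar A ==> amul A (ascl A c a) x = ascl A c (amul A a x)"
  and mul_scl_right: "a : acar A ==> x : acar A ==> amul A x (ascl A c a) = ascl A c (amul A x a)"
  and mul_assoc: "a : acar A ==> b : acar A ==> x : acar A ==> amul A (amul A a b) x = amul A a (amul A b x)"
  and one_left: "a : acar A ==> amul A (aone A) a = a" and one_right: "a : acar A ==> amul A a (aone A) = a"
begin

definition fmod :: "('a, 'u) rmod => bool" where
 "fmod L \<longleftrightarrow> is_rmod s A L & fin_dim s (rsp L)"

abbreviation "rh \<equiv> rhom s A"

lemma modA_simps [simp]: "L : Ob (modA s A) \<longleftrightarrow> fmod L" "Hom (modA s A) = rh" "Cmp (modA s A) = (\<circ>)"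
 "Ident (modA s A) L = idm (rsp L)" "Scl (modA s A) = fscale s"
 by (auto simp: modA_def fmod_def)

lemma fmodD: "fmod L ==> is_rmod s A L" "fmod L ==> fin_dim s (rsp L)" "fmod L ==> module.subspace s (rsp L)"
 by (auto simp: fmod_def is_rmod_def)

lemmas ract = is_rmodD(2-8)[OF fmodD(1)]
lemmas rsp_closed = subspaceD[OF vs fmodD(3)]

lemma asub: "module.subspace (ascl A) (acar A)" by (rule fin_dim_subspace[OF vsA fdA])
lemmas acar_closed = subspaceD[OF vsA asub]

lemma rhom_sub: "fmod N ==> fmod L ==> module.subspace (fscale s) (rh L N)"
proof (rule subspaceI[OF vector_space_fscale[OF vs]])
 assume *: "fmod N" "fmod L"
 note l = lin_add[OF vs fmodD(3)[OF *(1)]] lin_scale[OF vs fmodD(3)[OF *(1)]] lin_zero[OF vs rsp_closed(1)[OF *(1)]]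
 have z: "ract N 0 a = 0" if "a : acar A" for a
  using ract(4)[OF *(1) rsp_closed(1)[OF *(1)] that, of 0] by (simp add: vs_scaleD vs)
 show "0 : rh L N" by (rule rhomI[OF l(3)]) (simp add: z)
 show "f + g : rh L N" if "f : rh L N" "g : rh L N" for f g
  by (rule rhomI[OF l(1)]) (use that * in "auto simp: rhomD ract[OF *(1)]")
 show "fscale s c f : rh L N" if "f : rh L N" for f c
  by (rule rhomI[OF l(2)]) (use that * in "auto simp: rhomD ract[OF *(1)] fscale_def")
qed

lemmas rhom_closed = subspaceD[OF vector_space_fscale[OF vs] rhom_sub]

lemma ract_zero: "fmod L ==> a : acar A ==> ract L 0 a = 0"
 using ract(4)[of L 0 a 0] rsp_closed(1)[of L] by (simp add: vs_scaleD vs)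

lemma idm_rhom: "fmod L ==> idm (rsp L) : rh L L"
 by (rule rhomI[OF idm_lin]) (auto simp: fmodD vs ract)

lemma hf_category_modA: "hf_category s (modA s A)"
proof (intro hf_category.intro hf_category_axioms.intro infinite_space_axioms, unfold modA_simps)
 show "vector_space (fscale s)" by (rule vector_space_fscale[OF vs])
 show "fin_dim (fscale s) (rh X Y)" if "fmod X" "fmod Y" for X Y
  by (rule fin_dim_sub[OF vector_space_fscale[OF vs] fin_dim_lin[OF vs vs fmodD(2)[OF that(1)] fmodD(2)[OF that(2)]] rhom_sub])
   (use that rhomD(1) in auto)
 show "g o f : rh X Z" if "f : rh X Y" "g : rh Y Z" for X Y Z f g using that by (rule rhom_comp)
 show "idm (rsp X) : rh X X" if "fmod X" for X by (rule idm_rhom[OF that])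
 show "idm (rsp Y) o f = f" if "fmod Y" "f : rh X Y" for X Y f by (rule idm_lin_comp[OF rhomD(1)[OF that(2)] rsp_closed(1)[OF that(1)]])
 show "f o idm (rsp X) = f" if "f : rh X Y" for X Y f by (rule lin_idm[OF rhomD(1)[OF that]])
 show "h o (g o f) = h o g o f" for h g f :: "'u => 'u" by (simp add: comp_assoc)
 show "(g + g') o f = (g o f) + (g' o f)" for g g' f :: "'u => 'u" by (auto simp: fun_eq_iff)
 show "g o (f + f') = (g o f) + (g o f')" if "f : rh X Y" "f' : rh X Y" "g : rh Y Z" for X Y Z f f' g
  by (rule comp_add_lin[OF rhomD(1) rhomD(1) rhomD(1)]) fact+
 show "fscale s c g o f = fscale s c (g o f)" for c f g by (auto simp: fun_eq_iff fscale_def)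
 show "g o fscale s c f = fscale s c (g o f)" if "f : rh X Y" "g : rh Y Z" for X Y Z f g c
  by (rule comp_fscale_lin[OF rhomD(1) rhomD(1) vs vs]) fact+
qed

lemma fmod_zero: "fmod zero_rmod"
 unfolding fmod_def by (auto intro!: is_rmodI simp: subspace_zero[OF vs] fin_dim_zero[OF vs] vs_scaleD vs)

lemma zero_rhom: "fmod L ==> fmod N ==> 0 : rh L N" by (rule rhom_closed(1))

subsection \<open>Constructions of modules\<close>

lemma fmod_sub:
 assumes "fmod L" "module.subspace s K" "K \<subseteq> rsp L" "!!x a. x : K ==> a : acar A ==> ract L x a : K"
 shows "fmod \<lparr>rsp = K, ract = ract L\<rparr>"
 unfolding fmod_def
proof
 show "is_rmod s A \<lparr>rsp = K, ract = ract L\<rparr>"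
  by (rule is_rmodI) (use assms ract[OF assms(1)] in "auto simp: subset_iff")
 show "fin_dim s (rsp \<lparr>rsp = K, ract = ract L\<rparr>)"
  using fin_dim_sub[OF vs fmodD(2)[OF assms(1)] assms(2,3)] by simp
qed

lemma image_submodule:
 assumes "f : rh L N" "fmod L"
 shows "module.subspace s (f ` rsp L)" "f ` rsp L \<subseteq> rsp N" "x : f ` rsp L ==> a : acar A ==> ract N x a : f ` rsp L"
proof -
 show "module.subspace s (f ` rsp L)" by (rule lin_image[OF rhomD(1)[OF assms(1)] vs vs fmodD(3)[OF assms(2)]])
 show "f ` rsp L \<subseteq> rsp N" using rhomD(2)[OF assms(1)] by auto
 show "ract N x a : f ` rsp L" if x: "x : f ` rsp L" and a: "a : acar A"
 proof -
  obtain z where z: "z : rsp L" "x = f z" using x by blast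
  then show ?thesis using rhomD(3)[OF assms(1) z(1) a] ract(1)[OF assms(2) z(1) a] by (metis imageI)
 qed
qed

lemma ker_submodule:
 assumes "f : rh L N" "fmod L" "fmod N"
 shows "module.subspace s {x : rsp L. f x = 0}" "x : {x : rsp L. f x = 0} ==> a : acar A ==> ract L x a : {x : rsp L. f x = 0}"
 using lin_ker[OF rhomD(1)[OF assms(1)] vs vs fmodD(3)[OF assms(2)]] rhomD(3)[OF assms(1)] ract(1)[OF assms(2)] ract_zero[OF assms(3)]
 by auto

lemma ex_copy:
 assumes t: "vector_space t" and L: "is_rmod t A L" and fd: "fin_dim t (rsp L)"
 obtains L' f f' where "fmod L'" "f : mhom t s A L L'" "f' : mhom s t A L' L"
  "!!x. x : rsp L ==> f' (f x) = x" "!!y. y : rsp L' ==> f (f' y) = y"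
proof -
 define e where "e = emb s t (rsp L)"
 have e: "e : lin t (rsp L) s UNIV" "inj_on e (rsp L)" using emb_spec[OF vs inf_dim t fd] by (auto simp: e_def)
 define e' where "e' = lin_inv (rsp L) e"
 define L' where "L' = \<lparr>rsp = e ` rsp L, ract = (\<lambda>y a. e (ract L (e' y) a))\<rparr>"
 have ee: "e' (e x) = x" if "x : rsp L" for x using lin_inv_simp[OF e(2) that] by (simp add: e'_def)
 have eL: "e : lin t (rsp L) s (rsp L')" by (rule lin_mono[OF e(1)]) (auto simp: L'_def)
 note sL = is_rmodD(1)[OF L] and r = is_rmodD(2-8)[OF L]
 note el = linD(2,3)[OF e(1), symmetric] and cl = subspaceD[OF t sL]
 have a: "ract L' (e x) a = e (ract L x a)" if "x : rsp L" for x a using that ee by (simp add: L'_def)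
 have e': "e' : lin s (rsp L') t (rsp L)"
  unfolding e'_def by (rule lin_inv_lin[OF e(1) t sL e(2)]) (simp add: L'_def)
 have "is_rmod s A L'"
 proof (rule is_rmodI)
  show "module.subspace s (rsp L')" unfolding L'_def using lin_image[OF e(1) t vs sL] by simp
  fix x y a b c assume "x : rsp L'"
  then obtain u where u: "u : rsp L" "x = e u" by (auto simp: L'_def)
  show "ract L' x (aone A) = x" using u a r(7) by simp
  assume a1: "a : acar A"
  show "ract L' x a : rsp L'" using u a a1 r(1) by (auto simp: L'_def)
  show "ract L' (s c x) a = s c (ract L' x a)" using u a a1 r(1,4) cl el by simp
  show "ract L' x (ascl A c a) = s c (ract L' x a)" using u a a1 r(1,5) el by simp
  show "ract L' x (a + b) = ract L' x a + ract L' x b" if "b : acar A" using u a a1 that r(1,3) el by simp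
  show "ract L' (ract L' x a) b = ract L' x (amul A a b)" if "b : acar A" using u a a1 that r(1,6) by simp
  show "ract L' (x + y) a = ract L' x a + ract L' y a" if y: "y : rsp L'"
  proof -
   obtain v where v: "v : rsp L" "y = e v" using y by (auto simp: L'_def)
   then show ?thesis using u a a1 r(1,2) cl el by simp
  qed
 qed
 moreover have "fin_dim s (rsp L')" unfolding L'_def using fin_dim_image[OF e(1) t vs fd] by simp
 ultimately have fm: "fmod L'" by (simp add: fmod_def)
 have m1: "e : mhom t s A L L'" using eL a by (simp add: mhom_def)
 have m2: "e' : mhom s t A L' L" using e' ee r(1) by (auto simp: mhom_def L'_def)
 show ?thesis by (rule that[OF fm m1 m2 ee]) (auto simp: L'_def ee)
qed

text \<open>A quotient module, realized on a complement of the submodule.\<close>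

lemma ex_quotient:
 assumes L: "fmod L" and K: "module.subspace s K" "K \<subseteq> rsp L" "!!x a. x : K ==> a : acar A ==> ract L x a : K"
 obtains Q \<pi> where "fmod Q" "\<pi> : rh L Q" "\<pi> ` rsp L = rsp Q" "!!x. x : rsp L ==> \<pi> x = 0 \<longleftrightarrow> x : K"
  "rsp Q \<subseteq> rsp L" "!!x. x : rsp Q ==> \<pi> x = x"
proof -
 obtain p where p: "p : lin s (rsp L) s (rsp L)" "\<forall>x\<in>rsp L. p x = 0 \<longleftrightarrow> x : K" "\<forall>x\<in>rsp L. p (p x) = p x"
  using ex_quotient_projection[OF vs fmodD(3)[OF L] K(1,2)] by blast
 define Q where "Q = \<lparr>rsp = p ` rsp L, ract = (\<lambda>x a. p (ract L x a))\<rparr>"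
 note pl = linD[OF p(1)] and r = ract[OF L] and cl = rsp_closed[OF L]
 have key: "p (ract L (p x) a) = p (ract L x a)" if x: "x : rsp L" and a: "a : acar A" for x a
 proof -
  have d: "x - p x : rsp L" using cl(4) x pl(1) by simp
  have "p (x - p x) = 0" using lin_diff[OF p(1) vs fmodD(3)[OF L] x pl(1)[OF x]] p(3) x by simp
  then have "x - p x : K" using p(2) d by blast
  then have "ract L (x - p x) a : K" using K(3) a by blast
  then have 0: "p (ract L (x - p x) a) = 0" using p(2) K(2) by blast
  have "ract L x a = ract L (x - p x) a + ract L (p x) a" using r(2)[OF d pl(1)[OF x] a] by simp
  then show ?thesis using pl(2)[OF r(1)[OF d a] r(1)[OF pl(1)[OF x] a]] 0 by simp
 qed
 have a: "ract Q (p x) a = p (ract L x a)" if "x : rsp L" "a : acar A" for x a using key[OF that] by (simp add: Q_def)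
 have "is_rmod s A Q"
 proof (rule is_rmodI)
  show "module.subspace s (rsp Q)" unfolding Q_def using lin_image[OF p(1) vs vs fmodD(3)[OF L]] by simp
  fix x y a' b c assume "x : rsp Q"
  then obtain u where u: "u : rsp L" "x = p u" by (auto simp: Q_def)
  show "ract Q x (aone A) = x" using u a[OF u(1) one_in] r(7) by simp
  assume a1: "a' : acar A"
  show "ract Q x a' : rsp Q" using u a a1 r(1) by (auto simp: Q_def)
  show "ract Q (s c x) a' = s c (ract Q x a')" using u a a1 r(1,4) cl pl(3)[symmetric] by simp
  show "ract Q x (ascl A c a') = s c (ract Q x a')" using u a a1 r(1,5) pl(3)[symmetric] acar_closed(3) by simp
  show "ract Q x (a' + b) = ract Q x a' + ract Q x b" if "b : acar A"
   using u a a1 that r(1,3) pl(2)[symmetric] acar_closed(2) by simp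
  show "ract Q (ract Q x a') b = ract Q x (amul A a' b)" if "b : acar A" using u a a1 that r(1,6) mul_in by simp
  show "ract Q (x + y) a' = ract Q x a' + ract Q y a'" if y: "y : rsp Q"
  proof -
   obtain v where v: "v : rsp L" "y = p v" using y by (auto simp: Q_def)
   then show ?thesis using u a a1 r(1,2) cl pl(2)[symmetric] by simp
  qed
 qed
 moreover have "fin_dim s (rsp Q)" unfolding Q_def using fin_dim_image[OF p(1) vs vs fmodD(2)[OF L]] by simp
 ultimately have fm: "fmod Q" by (simp add: fmod_def)
 have m: "p : rh L Q" by (rule rhomI[OF lin_mono[OF p(1)]]) (use a in "auto simp: Q_def")
 show ?thesis by (rule that[OF fm m]) (use p pl(1) in "auto simp: Q_def")
qed

lemma rhom_factor:
 assumes L: "fmod L" and Q: "fmod Q" and N: "fmod N"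
  and pi: "\<pi> : rh L Q" and su: "\<pi> ` rsp L = rsp Q" and f: "f : rh L N"
  and ker: "!!x. x : rsp L ==> \<pi> x = 0 ==> f x = 0"
 obtains g where "g : rh Q N" "!!x. x : rsp L ==> g (\<pi> x) = f x"
proof -
 obtain sigma where sg: "sigma : lin s (rsp Q) s (rsp L)" "\<forall>y\<in>rsp Q. \<pi> (sigma y) = y"
  using ex_section[OF rhomD(1)[OF pi] vs vs fmodD(3)[OF L] su] by blast
 have eq: "f (sigma (\<pi> x)) = f x" if x: "x : rsp L" for x
 proof -
  have px: "\<pi> x : rsp Q" using su x by blast
  note s1 = linD(1)[OF sg(1) px]
  have "\<pi> (sigma (\<pi> x) - x) = 0" using lin_diff[OF rhomD(1)[OF pi] vs fmodD(3)[OF L] s1 x] sg(2) px by simp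
  then have "f (sigma (\<pi> x) - x) = 0" using ker rsp_closed(4)[OF L s1 x] by blast
  then show ?thesis using lin_diff[OF rhomD(1)[OF f] vs fmodD(3)[OF L] s1 x] by simp
 qed
 have "f o sigma : rh Q N"
 proof (rule rhomI[OF lin_comp[OF sg(1) rhomD(1)[OF f]]])
  fix y a assume y: "y : rsp Q" and a: "a : acar A"
  note s1 = linD(1)[OF sg(1) y]
  have "ract Q y a = \<pi> (ract L (sigma y) a)" using rhomD(3)[OF pi s1 a] sg(2) y by simp
  then show "(f o sigma) (ract Q y a) = ract N ((f o sigma) y) a"
   using eq[OF ract(1)[OF L s1 a]] rhomD(3)[OF f s1 a] by simp
 qed
 then show ?thesis by (rule that) (simp add: eq)
qed

lemma rhom_inverse:
 assumes "fmod L" "fmod N" "f : rh L N" "inj_on f (rsp L)" "f ` rsp L = rsp N"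
 shows "lin_inv (rsp L) f : rh N L"
proof (rule rhomI[OF lin_inv_lin[OF rhomD(1)[OF assms(3)] vs fmodD(3)[OF assms(1)] assms(4,5)]])
 fix y a assume y: "y : rsp N" and a: "a : acar A"
 then obtain x where x: "x : rsp L" "y = f x" using assms(5) by blast
 then show "lin_inv (rsp L) f (ract N y a) = ract L (lin_inv (rsp L) f y) a"
  using rhomD(3)[OF assms(3) x(1) a, symmetric] lin_inv_simp[OF assms(4)] ract(1)[OF assms(1) x(1) a] by simp
qed

lemma epi_iff_surj:
 assumes "fmod L" "fmod N"
 shows "epi (modA s A) L N f \<longleftrightarrow> f : rh L N & f ` rsp L = rsp N"
proof
 assume e: "epi (modA s A) L N f"
 then have f: "f : rh L N" by (simp add: epi_def)
 obtain Q \<pi> where Q: "fmod Q" "\<pi> : rh N Q" "\<pi> ` rsp N = rsp Q" "!!x. x : rsp N ==> \<pi> x = 0 \<longleftrightarrow> x : f ` rsp L"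
  "rsp Q \<subseteq> rsp N" "!!x. x : rsp Q ==> \<pi> x = x"
  by (rule ex_quotient[OF assms(2) image_submodule[OF f assms(1)]]) (assumption, assumption, rule that)
 have "\<pi> o f = 0 o f"
  by (rule rhom_eqI[OF rhom_comp[OF f Q(2)] rhom_comp[OF f zero_rhom[OF assms(2) Q(1)]]]) (use Q(4) rhomD(2)[OF f] in auto)
 then have "\<pi> = 0" using e Q(1,2) zero_rhom[OF assms(2) Q(1)] unfolding epi_def by auto
 then have "rsp N \<subseteq> f ` rsp L" using Q(4) by auto
 then show "f : rh L N & f ` rsp L = rsp N" using f image_submodule(2)[OF f assms(1)] by blast
next
 assume *: "f : rh L N & f ` rsp L = rsp N"
 have "u = v" if uv: "u : rh N Z" "v : rh N Z" "u o f = v o f" for u v Z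
 proof (rule rhom_eqI[OF uv(1,2)])
  fix x assume "x : rsp N"
  then obtain y where "x = f y" using * by blast
  then show "u x = v x" using fun_cong[OF uv(3), of y] by simp
 qed
 then show "epi (modA s A) L N f" using * unfolding epi_def by auto
qed

lemma projective_lift:
 assumes "projective (modA s A) P" "fmod L" "fmod N" "f : rh L N" "f ` rsp L = rsp N" "g : rh P N"
 obtains h where "h : rh P L" "f o h = g"
proof -
 have "\<exists>h\<in>Hom (modA s A) P L. Cmp (modA s A) f h = g"
  by (rule hf_category.projectiveD[OF hf_category_modA assms(1)]) (use assms(2-6) epi_iff_surj[OF assms(2,3)] in auto)
 then show ?thesis using that by auto
qed

definition biprod where
 "biprod S L N i p j q \<longleftrightarrow> fmod S & fmod L & fmod N & i : rh L S & p : rh S L & j : rh N S & q : rh S N \<and>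
   (\<forall>x\<in>rsp L. p (i x) = x & q (i x) = 0) & (\<forall>y\<in>rsp N. q (j y) = y & p (j y) = 0) & (\<forall>z\<in>rsp S. i (p z) + j (q z) = z)"

lemma biprod_direct_sum:
 assumes "biprod S L N i p j q" shows "direct_sum (modA s A) S L N"
proof -
 have *: "fmod S" "fmod L" "fmod N" "i : rh L S" "p : rh S L" "j : rh N S" "q : rh S N"
  "!!x. x : rsp L ==> p (i x) = x" "!!y. y : rsp N ==> q (j y) = y" "!!z. z : rsp S ==> i (p z) + j (q z) = z"
  using assms by (auto simp: biprod_def)
 have "p o i = idm (rsp L)" by (rule rhom_eqI[OF rhom_comp[OF *(4,5)] idm_rhom[OF *(2)]]) (simp add: *)
 moreover have "q o j = idm (rsp N)" by (rule rhom_eqI[OF rhom_comp[OF *(6,7)] idm_rhom[OF *(3)]]) (simp add: *)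
 moreover have "(i o p) + (j o q) = idm (rsp S)"
  by (rule rhom_eqI[OF rhom_closed(2)[OF *(1,1) rhom_comp[OF *(5,4)] rhom_comp[OF *(7,6)]] idm_rhom[OF *(1)]]) (simp add: *)
 ultimately show ?thesis unfolding direct_sum_def using *(4-7) by (auto intro!: bexI)
qed

lemma ex_biprod:
 assumes L: "fmod L" and N: "fmod N"
 obtains S i p j q where "biprod S L N i p j q"
proof -
 define t where "t = (\<lambda>c (x, y). (s c x, s c y) :: 'u \<times> 'u)"
 have t: "vector_space t" by unfold_locales (auto simp: t_def vs_scaleD[OF vs] plus_prod_def)
 define S where "S = \<lparr>rsp = rsp L \<times> rsp N, ract = (\<lambda>(x, y) a. (ract L x a, ract N y a))\<rparr>"
 note cl = rsp_closed[OF L] and cn = rsp_closed[OF N]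
 have sub: "module.subspace t (rsp S)"
  by (rule subspaceI[OF t]) (use cl cn in "auto simp: S_def t_def zero_prod_def")
 have r: "is_rmod t A S"
  by (rule is_rmodI[OF sub]) (auto simp: S_def t_def ract[OF L] ract[OF N])
 define f where "f = (\<lambda>(x, y). if x : rsp L & y : rsp N then x else 0)"
 define g where "g = (\<lambda>(x, y). if x : rsp L & y : rsp N then y else 0)"
 have f: "f : mhom t s A S L" and g: "g : mhom t s A S N"
  using cl cn ract(1)[OF L] ract(1)[OF N] by (auto simp: mhom_def f_def g_def S_def t_def intro!: linI split: if_splits)
 define i where "i = (\<lambda>x. if x : rsp L then (x, 0) else 0 :: 'u \<times> 'u)"
 define j where "j = (\<lambda>x. if x : rsp N then (0, x) else 0 :: 'u \<times> 'u)"
 have i: "i : mhom s t A L S" and j: "j : mhom s t A N S"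
  using cl cn ract(1)[OF L] ract(1)[OF N] ract_zero[OF L] ract_zero[OF N]
  by (auto simp: mhom_def i_def j_def S_def t_def zero_prod_def vs_scaleD[OF vs] intro!: linI)
 have fd: "fin_dim t (rsp S)"
 proof (rule fin_dim_ker_image[OF mhomD(1)[OF f] t vs sub])
  show "fin_dim s (f ` rsp S)"
   by (rule fin_dim_sub[OF vs fmodD(2)[OF L] lin_image[OF mhomD(1)[OF f] t vs sub]]) (use mhomD(2)[OF f] in auto)
  have "{x : rsp S. f x = 0} = j ` rsp N" using cl by (auto simp: f_def S_def j_def)
  then show "fin_dim t {x : rsp S. f x = 0}" using fin_dim_image[OF mhomD(1)[OF j] vs t fmodD(2)[OF N]] by simp
 qed
 obtain T h h' where T: "fmod T" "h : mhom t s A S T" "h' : mhom s t A T S"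
  "!!x. x : rsp S ==> h' (h x) = x" "!!y. y : rsp T ==> h (h' y) = y"
  by (rule ex_copy[OF t r fd]) (rule that)
 have "biprod T L N (h o i) (f o h') (h o j) (g o h')"
  unfolding biprod_def
 proof (intro conjI T(1) L N ballI)
  show "h o i : rh L T" "f o h' : rh T L" "h o j : rh N T" "g o h' : rh T N"
   using mhom_comp[OF i T(2)] mhom_comp[OF T(3) f] mhom_comp[OF j T(2)] mhom_comp[OF T(3) g] by (auto simp: mhom_rhom)
  show "(f o h') ((h o i) x) = x" "(g o h') ((h o i) x) = 0" if "x : rsp L" for x
   using mhomD(2)[OF i that] that T(4) cn by (auto simp: f_def g_def i_def)
  show "(g o h') ((h o j) x) = x" "(f o h') ((h o j) x) = 0" if "x : rsp N" for x
   using mhomD(2)[OF j that] that T(4) cl by (auto simp: f_def g_def j_def)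
  show "(h o i) ((f o h') z) + (h o j) ((g o h') z) = z" if z: "z : rsp T" for z
  proof -
   note w = mhomD(2)[OF T(3) z]
   obtain x y where xy: "h' z = (x, y)" "x : rsp L" "y : rsp N" using w by (auto simp: S_def)
   have "h (i x) + h (j y) = h (i x + j y)"
    using linD(2)[OF mhomD(1)[OF T(2)] mhomD(2)[OF i xy(2)] mhomD(2)[OF j xy(3)]] by simp
   also have "i x + j y = h' z" using xy by (simp add: i_def j_def)
   finally show ?thesis using xy w T(5)[OF z] by (simp add: f_def g_def)
  qed
 qed
 then show ?thesis by (rule that)
qed

subsection \<open>Free modules\<close>

definition regular where
 "regular G \<iota> \<longleftrightarrow> fmod G & \<iota> : lin (ascl A) (acar A) s (rsp G) & bij_betw \<iota> (acar A) (rsp G) \<and>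
   (\<forall>a\<in>acar A. \<forall>b\<in>acar A. \<iota> (amul A a b) = ract G (\<iota> a) b)"

lemma ex_regular: obtains G \<iota> where "regular G \<iota>"
proof -
 define L where "L = \<lparr>rsp = acar A, ract = amul A\<rparr>"
 have "is_rmod (ascl A) A L"
  by (rule is_rmodI) (auto simp: L_def asub mul_in mul_add_left mul_add_right mul_scl_left mul_scl_right mul_assoc one_right)
 moreover have "fin_dim (ascl A) (rsp L)" using fdA by (simp add: L_def)
 ultimately obtain G f f' where G: "fmod G" "f : mhom (ascl A) s A L G" "f' : mhom s (ascl A) A G L"
  "!!x. x : rsp L ==> f' (f x) = x" "!!y. y : rsp G ==> f (f' y) = y"
  using ex_copy[OF vsA] by blast
 have "bij_betw f (acar A) (rsp G)"
  by (rule bij_betw_byWitness[where f' = f']) (use G mhomD(2)[OF G(2)] mhomD(2)[OF G(3)] in "auto simp: L_def")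
 then have "regular G f" using G mhomD(1,3)[OF G(2)] by (auto simp: regular_def L_def)
 then show ?thesis by (rule that)
qed

text \<open>A homomorphism from A is determined by an arbitrary image of the unit.\<close>

lemma regular_lift:
 assumes "regular G \<iota>" "fmod L" "x : rsp L"
 obtains h where "h : rh G L" "!!a. a : acar A ==> h (\<iota> a) = ract L x a"
proof -
 have G: "fmod G" "\<iota> : lin (ascl A) (acar A) s (rsp G)" "inj_on \<iota> (acar A)" "\<iota> ` acar A = rsp G"
  "!!a b. a : acar A ==> b : acar A ==> \<iota> (amul A a b) = ract G (\<iota> a) b"
  using assms(1) by (auto simp: regular_def bij_betw_def)
 define m where "m = (\<lambda>a. if a : acar A then ract L x a else 0)"
 have m: "m : lin (ascl A) (acar A) s (rsp L)"
  by (rule linI) (auto simp: m_def ract[OF assms(2,3)] acar_closed)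
 define h where "h = m o lin_inv (acar A) \<iota>"
 have hl: "h : lin s (rsp G) s (rsp L)" unfolding h_def by (rule lin_comp[OF lin_inv_lin[OF G(2) vsA asub G(3,4)] m])
 have hi: "h (\<iota> a) = ract L x a" if "a : acar A" for a using that lin_inv_simp[OF G(3)] by (simp add: h_def m_def)
 have "h : rh G L"
 proof (rule rhomI[OF hl])
  fix y a assume "y : rsp G" and a: "a : acar A"
  then obtain b where b: "b : acar A" "y = \<iota> b" using G(4) by blast
  have "ract G y a = \<iota> (amul A b a)" using G(5)[OF b(1) a] b by simp
  then show "h (ract G y a) = ract L (h y) a" using hi[OF mul_in[OF b(1) a]] hi[OF b(1)] b ract(6)[OF assms(2,3) b(1) a] by simp
 qed
 then show ?thesis using hi by (rule that)
qed

text \<open>Generated from copies of A by direct sums, so that properties of A which are stable under direct sums hold for free modules.\<close>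

inductive free where
 regular: "regular G \<iota> ==> free G"
| biprod: "free L ==> free N ==> biprod S L N i p j q ==> free S"

lemma free_fmod: "free F ==> fmod F"
 by (induction rule: free.induct) (auto simp: regular_def biprod_def)

lemma free_projective: "free F ==> projective (modA s A) F"
proof (induction rule: free.induct)
 case (regular G \<iota>)
 note G = regular[unfolded regular_def bij_betw_def]
 have "\<exists>h\<in>rh G L. f o h = g" if L: "fmod L" "fmod N" and fg: "f : rh L N" "f ` rsp L = rsp N" "g : rh G N" for L N f g
 proof -
  have o: "\<iota> (aone A) : rsp G" using G one_in by blast
  obtain x where x: "x : rsp L" "f x = g (\<iota> (aone A))" using fg(2) rhomD(2)[OF fg(3) o] by (metis imageE)
  obtain h where h: "h : rh G L" "!!a. a : acar A ==> h (\<iota> a) = ract L x a"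
   by (rule regular_lift[OF regular L(1) x(1)]) (rule that)
  have "f o h = g"
  proof (rule rhom_eqI[OF rhom_comp[OF h(1) fg(1)] fg(3)])
   fix y assume "y : rsp G"
   then obtain a where a: "a : acar A" "y = \<iota> a" using G by blast
   have "y = ract G (\<iota> (aone A)) a" using G a one_in one_left[OF a(1)] by metis
   then have "g y = ract N (g (\<iota> (aone A))) a" using rhomD(3)[OF fg(3) o a(1)] by simp
   then show "(f o h) y = g y" using h(2)[OF a(1)] a rhomD(3)[OF fg(1) x(1) a(1)] x(2) by simp
  qed
  then show ?thesis using h(1) by blast
 qed
 then show ?case unfolding projective_def using G by (auto simp: epi_iff_surj)
next
 case (biprod L N S i p j q)
 then show ?case
  using hf_category.projective_direct_sum[OF hf_category_modA biprod_direct_sum] by (auto simp: biprod_def)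
qed

text \<open>Induction on a set of elements which are to be reached: a direct sum with a copy of A reaches one more.\<close>

lemma ex_free_cover:
 assumes L: "fmod L"
 obtains F \<pi> where "free F" "\<pi> : rh F L" "\<pi> ` rsp F = rsp L"
proof -
 obtain G \<iota> where G: "regular G \<iota>" by (rule ex_regular)
 have step: "\<exists>F \<pi>. free F & \<pi> : rh F L & B \<subseteq> \<pi> ` rsp F" if "finite B" "B \<subseteq> rsp L" for B
  using that
 proof (induction B rule: finite_induct)
  case empty
  have "fmod G" using G by (simp add: regular_def)
  then show ?case using free.regular[OF G] zero_rhom L by blast
 next
  case (insert x B)
  then obtain F \<pi> where F: "free F" "\<pi> : rh F L" "B \<subseteq> \<pi> ` rsp F" by auto
  obtain h where h: "h : rh G L" "!!a. a : acar A ==> h (\<iota> a) = ract L x a"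
   by (rule regular_lift[OF G L, of x]) (use insert in simp, rule that)
  have Gm: "fmod G" "\<iota> (aone A) : rsp G" using G one_in by (auto simp: regular_def bij_betw_def)
  obtain S i p j q where S: "biprod S F G i p j q" by (rule ex_biprod[OF free_fmod[OF F(1)] Gm(1)])
  have S': "i : rh F S" "p : rh S F" "j : rh G S" "q : rh S G" "fmod S" "!!x. x : rsp F ==> p (i x) = x & q (i x) = 0" "!!y. y : rsp G ==> q (j y) = y & p (j y) = 0"
   using S by (auto simp: biprod_def)
  define f where "f = (\<pi> o p) + (h o q)"
  have "f : rh S L" unfolding f_def
   by (rule rhom_closed(2)[OF L S'(5) rhom_comp[OF S'(2) F(2)] rhom_comp[OF S'(4) h(1)]])
  moreover have "insert x B \<subseteq> f ` rsp S"
  proof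
   fix y assume "y : insert x B"
   then consider "y = x" | "y : B" by blast
   then show "y : f ` rsp S"
   proof cases
    case 1
    have "f (j (\<iota> (aone A))) = y"
     using S'(7)[OF Gm(2)] h(2)[OF one_in] 1 ract(7)[OF L, of x] insert lin_0[OF rhomD(1)[OF F(2)]] by (simp add: f_def)
    then show ?thesis using rhomD(2)[OF S'(3) Gm(2)] by blast
   next
    case 2
    then obtain z where z: "z : rsp F" "y = \<pi> z" using F(3) by blast
    have "f (i z) = y" using S'(6)[OF z(1)] z(2) lin_0[OF rhomD(1)[OF h(1)]] by (simp add: f_def)
    then show ?thesis using rhomD(2)[OF S'(1) z(1)] by blast
   qed
  qed
  ultimately show ?case using free.biprod[OF F(1) free.regular[OF G] S] by blast
 qed
 obtain B where B: "finite B" "module.span s B = rsp L" using fmodD(2)[OF L] by (auto simp: fin_dim_def)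
 interpret vector_space s by (rule vs)
 have "B \<subseteq> rsp L" using B(2) span_superset by blast
 then obtain F \<pi> where F: "free F" "\<pi> : rh F L" "B \<subseteq> \<pi> ` rsp F" using step[OF B(1)] by blast
 have "rsp L \<subseteq> \<pi> ` rsp F"
  using span_minimal[OF F(3) image_submodule(1)[OF F(2) free_fmod[OF F(1)]]] B(2) by simp
 then have "\<pi> ` rsp F = rsp L" using rhomD(2)[OF F(2)] by auto
 then show ?thesis using F that by blast
qed

end

section \<open>The Nakayama functor\<close>

lemma dual_basis_delta:
 assumes "vector_space s" "fin_dim s V"
 obtains B c where "finite B" "B \<subseteq> V" "!!b. b : B ==> c b : lin s V (*) UNIV"
  "!!x. x : V ==> (\<Sum>b\<in>B. s (c b x) b) = x"
  "!!b b'. b : B ==> b' : B ==> c b b' = (if b = b' then 1 else 0)"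
proof -
 interpret vector_space s by fact
 obtain B where B: "finite B" "B \<subseteq> V" "independent B" "span B = V" using fin_dim_basis[OF assms] by blast
 let ?c = "\<lambda>b x. if x : V then representation B x b else 0"
 have "?c b : lin s V (*) UNIV" for b
  using B(3,4) subspace_add[OF fin_dim_subspace[OF assms]] subspace_scale[OF fin_dim_subspace[OF assms]]
  by (auto simp: lin_def representation_add representation_scale)
 moreover have "(\<Sum>b\<in>B. s (?c b x) b) = x" if "x : V" for x
  using sum_representation_eq[OF B(3) _ B(1) subset_refl, of x] B(4) that by simp
 moreover have "?c b b' = (if b = b' then 1 else 0)" if "b : B" "b' : B" for b b'
  using representation_basis[OF B(3) that(2)] B(2) that by auto
 ultimately show ?thesis by (rule that[OF B(1,2)])
qed

lemma balancedI:
 assumes "!!x f. x : rsp L ==> f : dual A ==> \<beta> x f : W"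
  "!!x y f. x : rsp L ==> y : rsp L ==> f : dual A ==> \<beta> (x + y) f = \<beta> x f + \<beta> y f"
  "!!x f g. x : rsp L ==> f : dual A ==> g : dual A ==> \<beta> x (f + g) = \<beta> x f + \<beta> x g"
  "!!x f c. x : rsp L ==> f : dual A ==> \<beta> (s c x) f = s c (\<beta> x f)"
  "!!x f c. x : rsp L ==> f : dual A ==> \<beta> x (fscale (*) c f) = s c (\<beta> x f)"
  "!!x f a. x : rsp L ==> f : dual A ==> a : acar A ==> \<beta> (ract L x a) f = \<beta> x (dual_lact A a f)"
 shows "balanced s A L W \<beta>"
 using assms unfolding balanced_def by simp

lemma balancedD:
 assumes "balanced s A L W \<beta>"
 shows "x : rsp L ==> f : dual A ==> \<beta> x f : W"
  "x : rsp L ==> y : rsp L ==> f : dual A ==> \<beta> (x + y) f = \<beta> x f + \<beta> y f"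
  "x : rsp L ==> f : dual A ==> g : dual A ==> \<beta> x (f + g) = \<beta> x f + \<beta> x g"
  "x : rsp L ==> f : dual A ==> \<beta> (s c x) f = s c (\<beta> x f)"
  "x : rsp L ==> f : dual A ==> \<beta> x (fscale (*) c f) = s c (\<beta> x f)"
  "x : rsp L ==> f : dual A ==> a : acar A ==> \<beta> (ract L x a) f = \<beta> x (dual_lact A a f)"
 using assms unfolding balanced_def by blast+

lemma balanced_lin: "balanced s A L W \<beta> ==> h : lin s W s U ==> balanced s A L U (\<lambda>x f. h (\<beta> x f))"
 by (rule balancedI) (auto simp: balancedD linD)

context fd_algebra
begin

lemma dual_sub: "module.subspace (fscale (*)) (dual A)"
 unfolding dual_def by (rule subspace_lin[OF vector_space_mult subspace_UNIV'[OF vector_space_mult]])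

lemmas dual_closed = subspaceD[OF vector_space_fscale[OF vector_space_mult] dual_sub]

lemma dual_lact_in: "f : dual A ==> a : acar A ==> dual_lact A a f : dual A"
 and dual_ract_in: "f : dual A ==> a : acar A ==> dual_ract A f a : dual A"
 by (auto simp: dual_def dual_lact_def dual_ract_def lin_def mul_in mul_add_left mul_add_right mul_scl_left mul_scl_right acar_closed)

lemma dual_lin: "f : dual A ==> f : lin (ascl A) (acar A) (*) UNIV"
 by (simp add: dual_def)

lemma dual_out: "f : dual A ==> x \<notin> acar A ==> f x = 0"
 by (simp add: dual_def lin_def)

lemma dual_ract_simps:
 "f : dual A ==> a : acar A ==> b : acar A ==> dual_ract A f (a + b) = dual_ract A f a + dual_ract A f b"
 "f : dual A ==> a : acar A ==> dual_ract A f (ascl A c a) = fscale (*) c (dual_ract A f a)"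
 "dual_ract A (f + g) a = dual_ract A f a + dual_ract A g a"
 "dual_ract A (fscale (*) c f) a = fscale (*) c (dual_ract A f a)"
 "f : dual A ==> a : acar A ==> b : acar A ==> dual_ract A (dual_ract A f a) b = dual_ract A f (amul A a b)"
 "f : dual A ==> dual_ract A f (aone A) = f"
 "f : dual A ==> a : acar A ==> b : acar A ==> dual_ract A (dual_lact A a f) b = dual_lact A a (dual_ract A f b)"
 by (auto simp: dual_ract_def dual_lact_def fun_eq_iff fscale_def mul_add_left mul_scl_left mul_in mul_assoc one_left dual_out
   linD[OF dual_lin])

text \<open>The tensor product is constructed as a quotient of L \<otimes> DA. A basis B of A identifies the latter with the
 functions from B to L: the tensor x \<otimes> f is the function b \<mapsto> f(b) x.\<close>

lemma ex_tensor:
 assumes L: "fmod L"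
 shows "\<exists>T t. is_tensor s A L T t"
proof -
 obtain B c where B: "finite B" "B \<subseteq> acar A" and c: "!!b. b : B ==> c b : lin (ascl A) (acar A) (*) UNIV"
  and exp: "!!x. x : acar A ==> (\<Sum>b\<in>B. ascl A (c b x) b) = x"
  and delta: "!!b b'. b : B ==> b' : B ==> c b b' = (if b = b' then 1 else 0)"
  by (rule dual_basis_delta[OF vsA fdA]) (rule that)
 have cd: "c b : dual A" if "b : B" for b using c[OF that] by (simp add: dual_def)
 note cl = rsp_closed[OF L] and sv = vs_scaleD[OF vs]
 have fexp: "f x = (\<Sum>b\<in>B. c b x * f b)" if f: "f : lin (ascl A) (acar A) (*) UNIV" and x: "x : acar A" for f x
 proof -
  have "f (\<Sum>b\<in>B. ascl A (c b x) b) = (\<Sum>b\<in>B. f (ascl A (c b x) b))"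
   by (rule lin_sum[OF f vsA asub]) (use B acar_closed(3) in auto)
  also have "... = (\<Sum>b\<in>B. c b x * f b)" by (rule sum.cong) (use B linD(3)[OF f] in auto)
  finally show ?thesis using exp[OF x] by simp
 qed
 have sexp: "s (f x) v = (\<Sum>b\<in>B. s (c b x) (s (f b) v))" if f: "f : lin (ascl A) (acar A) (*) UNIV" and x: "x : acar A" for f x v
 proof -
  interpret vector_space s by (rule vs)
  show ?thesis unfolding fexp[OF f x] by (simp add: scale_sum_left)
 qed
 define V where "V = {g :: 'a => 'u. (\<forall>b\<in>B. g b : rsp L) & (\<forall>b. b \<notin> B --> g b = 0)}"
 define act where "act = (\<lambda>(g :: 'a => 'u) a b. if b : B then (\<Sum>b'\<in>B. s (c b' (amul A a b)) (g b')) else 0)"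
 define t0 where "t0 = (\<lambda>(x :: 'u) (f :: 'a => 'k) b. if b : B then s (f b) x else 0)"
 define T where "T = \<lparr>rsp = V, ract = act\<rparr>"
 note fv = vector_space_fscale[OF vs]
 have Vsub: "module.subspace (fscale s) V"
  by (rule subspaceI[OF fv]) (auto simp: V_def fscale_def cl sv)
 have Vin: "g b : rsp L" if "g : V" "b : B" for g b using that unfolding V_def by blast
 have Vout: "g b = 0" if "g : V" "b \<notin> B" for g b using that unfolding V_def by blast
 have Vfd: "fin_dim (fscale s) V"
 proof (rule fin_dim_eval[OF vs Vsub B(1), of "\<lambda>_. rsp L"])
  show "f = 0" if "f : V" "\<forall>j\<in>B. f j = 0" for f
   using that Vout by (auto simp: fun_eq_iff)
 qed (use Vin fmodD(2)[OF L] in auto)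
 have Tr: "is_rmod (fscale s) A T"
 proof (rule is_rmodI)
  show "module.subspace (fscale s) (rsp T)" using Vsub by (simp add: T_def)
  fix x y a a' k assume "x : rsp T"
  then have x: "x : V" by (simp add: T_def)
  have "act x (aone A) b = x b" for b
  proof (cases "b : B")
   case True
   have "act x (aone A) b = (\<Sum>b'\<in>B. s (c b' b) (x b'))" using True B(2) one_left by (auto simp: act_def)
   also have "... = (\<Sum>b'\<in>B. if b' = b then x b' else 0)" by (rule sum.cong) (use True delta sv in auto)
   also have "... = x b" using True B(1) by simp
   finally show ?thesis .
  next
   case False
   then have "x b = 0" by (rule Vout[OF x])
   then show ?thesis using False by (simp add: act_def)
  qed
  then show "ract T x (aone A) = x" by (simp add: T_def fun_eq_iff)
  assume a: "a : acar A"
  show "ract T x a : rsp T"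
   using Vin[OF x] by (auto simp: T_def V_def act_def intro!: subspace_sum[OF vs fmodD(3)[OF L]] cl(3))
  show "ract T (x + y) a = ract T x a + ract T y a"
   by (auto simp: T_def act_def fun_eq_iff sv sum.distrib)
  show "ract T (fscale s k x) a = fscale s k (ract T x a)"
   by (auto simp: T_def act_def fun_eq_iff sv fscale_def mult.commute)
  show "ract T x (ascl A k a) = fscale s k (ract T x a)"
   using B(2) a by (auto simp: T_def act_def fun_eq_iff sv fscale_def mul_scl_left linD(3)[OF c] mul_in subset_iff intro!: sum.cong)
  assume a': "a' : acar A"
  show "ract T x (a + a') = ract T x a + ract T x a'"
   using B(2) a a' by (auto simp: T_def act_def fun_eq_iff sv mul_add_left linD(2)[OF c] mul_in subset_iff sum.distrib[symmetric] intro!: sum.cong)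
  have "act (act x a) a' b = act x (amul A a a') b" for b
  proof (cases "b : B")
   case True
   then have b: "b : acar A" using B by blast
   have l: "(\<lambda>z. if z : acar A then c b' (amul A a z) else 0) : lin (ascl A) (acar A) (*) UNIV" if "b' : B" for b'
    by (rule linI) (use a that in "auto simp: acar_closed mul_add_right mul_scl_right mul_in linD[OF c]")
   have "act (act x a) a' b = (\<Sum>b'\<in>B. s (c b' (amul A a' b)) (\<Sum>b''\<in>B. s (c b'' (amul A a b')) (x b'')))"
    using True by (simp add: act_def)
   also have "... = (\<Sum>b''\<in>B. \<Sum>b'\<in>B. s (c b' (amul A a' b)) (s (c b'' (amul A a b')) (x b'')))"
    by (subst sum.swap) (simp add: sv)
   also have "... = (\<Sum>b''\<in>B. s (c b'' (amul A a (amul A a' b))) (x b''))"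
   proof (rule sum.cong[OF refl])
    fix b'' assume b'': "b'' : B"
    show "(\<Sum>b'\<in>B. s (c b' (amul A a' b)) (s (c b'' (amul A a b')) (x b''))) = s (c b'' (amul A a (amul A a' b))) (x b'')"
     using sexp[OF l[OF b''] mul_in[OF a' b], of "x b''"] B(2) mul_in[OF a' b]
     by (simp add: subset_iff cong: sum.cong)
   qed
   finally show ?thesis using True b mul_assoc[OF a a' b] by (simp add: act_def)
  qed (simp add: act_def)
  then show "ract T (ract T x a) a' = ract T x (amul A a a')" by (simp add: T_def fun_eq_iff)
 qed
 have t0V: "t0 x f : V" if "x : rsp L" for x f using that cl by (auto simp: t0_def V_def)
 have t0_act: "act (t0 x f) a = t0 x (dual_ract A f a)" if f: "f : dual A" and a: "a : acar A" for x f a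
 proof
  fix b show "act (t0 x f) a b = t0 x (dual_ract A f a) b"
  proof (cases "b : B")
   case True
   then have b: "amul A a b : acar A" "b : acar A" using B mul_in[OF a] by auto
   show ?thesis using sexp[OF dual_lin[OF f] b(1), of x] True b(2) by (simp add: act_def t0_def dual_ract_def)
  qed (simp add: act_def t0_def)
 qed
 have t0_add: "t0 (x + y) f = t0 x f + t0 y f" "t0 x (f + g) = t0 x f + t0 x g" "t0 (s k x) f = fscale s k (t0 x f)"
  "t0 x (fscale (*) k f) = fscale s k (t0 x f)" for x y f g k
  by (auto simp: t0_def fun_eq_iff sv fscale_def mult.commute)
 have t0_span: "g = (\<Sum>b\<in>B. t0 (g b) (c b))" if g: "g : V" for g
 proof
  fix b show "g b = (\<Sum>b\<in>B. t0 (g b) (c b)) b"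
  proof (cases "b : B")
   case True
   have "(\<Sum>b'\<in>B. t0 (g b') (c b')) b = (\<Sum>b'\<in>B. t0 (g b') (c b') b)" by (induction B rule: infinite_finite_induct) auto
   also have "... = (\<Sum>b'\<in>B. if b' = b then g b' else 0)" by (rule sum.cong) (use True delta sv in "auto simp: t0_def")
   also have "... = g b" using True B(1) by simp
   finally show ?thesis by simp
  next
   case False
   then have "g b = 0" by (rule Vout[OF g])
   moreover have "(\<Sum>b'\<in>S. t0 (g b') (c b')) b = 0" for S using False by (induction S rule: infinite_finite_induct) (auto simp: t0_def)
   ultimately show ?thesis by simp
  qed
 qed
 have fd: "fin_dim (fscale s) (rsp T)" using Vfd by (simp add: T_def)
 obtain V' e e' where V': "fmod V'" "e : mhom (fscale s) s A T V'" "e' : mhom s (fscale s) A V' T"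
  "!!x. x : rsp T ==> e' (e x) = x" "!!y. y : rsp V' ==> e (e' y) = y"
  by (rule ex_copy[OF fv Tr fd]) (rule that)
 note el = mhomD(1)[OF V'(2), unfolded T_def, simplified]
 define t1 where "t1 = (\<lambda>x f. e (t0 x f))"
 have t1V: "t1 x f : rsp V'" if "x : rsp L" for x f using mhomD(2)[OF V'(2)] t0V[OF that] by (simp add: t1_def T_def)
 have t1_add: "x : rsp L ==> y : rsp L ==> t1 (x + y) f = t1 x f + t1 y f"
  "x : rsp L ==> t1 x (f + g) = t1 x f + t1 x g" "x : rsp L ==> t1 (s k x) f = s k (t1 x f)"
  "x : rsp L ==> t1 x (fscale (*) k f) = s k (t1 x f)" for x y f g k
  using t0V linD(2,3)[OF el] by (auto simp: t1_def t0_add)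
 have t1_act: "ract V' (t1 x f) a = t1 x (dual_ract A f a)" if "x : rsp L" "f : dual A" "a : acar A" for x f a
  using mhomD(3)[OF V'(2), of "t0 x f" a] t0V[OF that(1)] t0_act[OF that(2,3)] that(3) by (simp add: t1_def T_def)
 define E where "E = {t1 (ract L x a) f - t1 x (dual_lact A a f) |x a f. x : rsp L & a : acar A & f : dual A}"
 define K where "K = module.span s E"
 interpret VS: vector_space s by (rule vs)
 have EV: "E \<subseteq> rsp V'" using t1V ract(1)[OF L] rsp_closed(4)[OF V'(1)] by (auto simp: E_def)
 have Ksub: "module.subspace s K" unfolding K_def by (rule VS.subspace_span)
 have KV: "K \<subseteq> rsp V'" unfolding K_def by (rule VS.span_minimal[OF EV fmodD(3)[OF V'(1)]])
 have Kact': "x : rsp V' & ract V' x a : K" if "x : K" and a: "a : acar A" for x a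
  using that(1) unfolding K_def
 proof (induction rule: VS.span_induct_alt)
  case base
  then show ?case using ract_zero[OF V'(1) a] VS.span_zero rsp_closed(1)[OF V'(1)] by simp
 next
  case (step k x y)
  obtain z b f where z: "x = t1 (ract L z b) f - t1 z (dual_lact A b f)" "z : rsp L" "b : acar A" "f : dual A"
   using step(1) by (auto simp: E_def)
  have xV: "x : rsp V'" "y : rsp V'" using EV step(1,2) by auto
  have xe: "t1 (ract L z b) f = x + t1 z (dual_lact A b f)" using z(1) by simp
  have "ract V' (t1 (ract L z b) f) a = ract V' x a + ract V' (t1 z (dual_lact A b f)) a"
   unfolding xe by (rule ract(2)[OF V'(1) xV(1) t1V[OF z(2)] a])
  then have "t1 (ract L z b) (dual_ract A f a) = ract V' x a + t1 z (dual_lact A b (dual_ract A f a))"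
   using t1_act[OF ract(1)[OF L z(2,3)] z(4) a] t1_act[OF z(2) dual_lact_in[OF z(4,3)] a] dual_ract_simps(7)[OF z(4,3) a] by simp
  then have "ract V' x a = t1 (ract L z b) (dual_ract A f a) - t1 z (dual_lact A b (dual_ract A f a))"
   by simp
  then have "ract V' x a : E" using z dual_ract_in[OF z(4) a] by (auto simp: E_def)
  then have "s k (ract V' x a) + ract V' y a : VS.span E"
   using step(2) by (intro VS.span_add VS.span_scale) (auto intro: VS.span_base)
  then show ?case using ract(2,4)[OF V'(1)] rsp_closed(2,3)[OF V'(1)] xV a by simp
 qed
 then have Kact: "ract V' x a : K" if "x : K" "a : acar A" for x a using that by blast
 obtain Q \<pi> where Q: "fmod Q" "\<pi> : rh V' Q" "\<pi> ` rsp V' = rsp Q" "!!x. x : rsp V' ==> \<pi> x = 0 \<longleftrightarrow> x : K"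
  "rsp Q \<subseteq> rsp V'" "!!x. x : rsp Q ==> \<pi> x = x"
  by (rule ex_quotient[OF V'(1) Ksub KV Kact]) (assumption, assumption, rule that)
 note pl = rhomD(1)[OF Q(2)]
 define t where "t = (\<lambda>x f. \<pi> (t1 x f))"
 have bal: "balanced s A L (rsp Q) t"
 proof (rule balancedI)
  fix x f a assume x: "x : rsp L" and f: "f : dual A" and a: "a : acar A"
  have "t1 (ract L x a) f - t1 x (dual_lact A a f) : K"
   unfolding K_def by (rule VS.span_base) (use x f a in "auto simp: E_def")
  then have "\<pi> (t1 (ract L x a) f - t1 x (dual_lact A a f)) = 0" using Q(4) KV by blast
  then show "t (ract L x a) f = t x (dual_lact A a f)"
   using lin_diff[OF pl vs fmodD(3)[OF V'(1)] t1V[OF ract(1)[OF L x a]] t1V[OF x]] by (simp add: t_def)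
 qed (auto simp: t_def t1V t1_add linD[OF pl] cl)
 moreover have "\<exists>!h. h : lin s (rsp Q) s W & (\<forall>x\<in>rsp L. \<forall>f\<in>dual A. h (t x f) = \<beta> x f)"
  if W: "module.subspace s W" and be: "balanced s A L W \<beta>" for W \<beta>
 proof -
  define h0 where "h0 = (\<lambda>g. if g : V then (\<Sum>b\<in>B. \<beta> (g b) (c b)) else 0)"
  note bd = balancedD[OF be]
  have h0: "h0 : lin (fscale s) V s W"
   by (rule linI) (auto simp: h0_def subspaceD[OF fv Vsub] subspaceD(3)[OF fv Vsub, unfolded fscale_def] Vin cd bd fscale_def sv sum.distrib intro!: subspace_sum[OF vs W])
  have h0t: "h0 (t0 x f) = \<beta> x f" if x: "x : rsp L" and f: "f : dual A" for x f
  proof -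
   have e1: "\<beta> (if b : B then s (f b) x else 0) (c b) = \<beta> x (fscale (*) (f b) (c b))" if "b : B" for b
    using that x cd bd(4,5) by simp
   have "h0 (t0 x f) = (\<Sum>b\<in>B. \<beta> x (fscale (*) (f b) (c b)))"
    using t0V[OF x] e1 by (simp add: h0_def t0_def)
   also have "... = \<beta> x (\<Sum>b\<in>B. fscale (*) (f b) (c b))"
   proof -
    have l: "(\<lambda>f. if f : dual A then \<beta> x f else 0) : lin (fscale (*)) (dual A) s W"
     by (rule linI) (use x bd dual_closed in auto)
    have "(\<Sum>b\<in>B. fscale (*) (f b) (c b)) : dual A"
     by (rule subspace_sum[OF vector_space_fscale[OF vector_space_mult] dual_sub]) (use cd dual_closed(3) in auto)
    then show ?thesis
     using lin_sum[OF l vector_space_fscale[OF vector_space_mult] dual_sub, of B "\<lambda>b. fscale (*) (f b) (c b)"] cd dual_closed(3)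
     by simp
   qed
   also have "(\<Sum>b\<in>B. fscale (*) (f b) (c b)) = f"
   proof
    fix y
    have "(\<Sum>b\<in>B. fscale (*) (f b) (c b)) y = (\<Sum>b\<in>B. f b * c b y)" by (induction B rule: infinite_finite_induct) (auto simp: fscale_def)
    also have "... = f y"
     using fexp[OF dual_lin[OF f], of y] dual_out[OF f, of y] dual_out[OF cd, of _ y] by (cases "y : acar A") (auto simp: mult.commute)
    finally show "(\<Sum>b\<in>B. fscale (*) (f b) (c b)) y = f y" .
   qed
   finally show ?thesis .
  qed
  define h1 where "h1 = h0 o e'"
  have h1: "h1 : lin s (rsp V') s W" unfolding h1_def
   using lin_comp[OF mhomD(1)[OF V'(3)], of h0 s W] h0 by (simp add: T_def)
  have h1t: "h1 (t1 x f) = \<beta> x f" if x: "x : rsp L" and f: "f : dual A" for x f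
   using h0t[OF x f] V'(4)[of "t0 x f"] t0V[OF x] by (simp add: h1_def t1_def T_def)
  have "K \<subseteq> {v : rsp V'. h1 v = 0}" unfolding K_def
  proof (rule VS.span_minimal[OF _ lin_ker[OF h1 vs vs fmodD(3)[OF V'(1)]]])
   show "E \<subseteq> {v : rsp V'. h1 v = 0}"
   proof
    fix v assume v: "v : E"
    then obtain x a f where x: "v = t1 (ract L x a) f - t1 x (dual_lact A a f)" "x : rsp L" "a : acar A" "f : dual A"
     by (auto simp: E_def)
    have "h1 v = 0"
     using lin_diff[OF h1 vs fmodD(3)[OF V'(1)] t1V[OF ract(1)[OF L x(2,3)]] t1V[OF x(2)]]
      h1t[OF ract(1)[OF L x(2,3)] x(4)] h1t[OF x(2) dual_lact_in[OF x(4,3)]] bd(6)[OF x(2,4,3)] x(1) by simp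
    then show "v : {v : rsp V'. h1 v = 0}" using v EV by auto
   qed
  qed
  then have hK: "h1 v = 0" if "v : K" for v using that by auto
  define h where "h = (\<lambda>y. if y : rsp Q then h1 y else 0)"
  have h: "h : lin s (rsp Q) s W"
   by (rule linI) (use Q(5)[THEN subsetD] in "auto simp: h_def linD(1-3)[OF h1] rsp_closed[OF Q(1)]")
  have hp: "h (\<pi> v) = h1 v" if v: "v : rsp V'" for v
  proof -
   have pv: "\<pi> v : rsp Q" "\<pi> v : rsp V'" using Q(3,5) v by auto
   have "\<pi> (v - \<pi> v) = 0" using lin_diff[OF pl vs fmodD(3)[OF V'(1)] v pv(2)] Q(6)[OF pv(1)] by simp
   then have "v - \<pi> v : K" using Q(4)[OF rsp_closed(4)[OF V'(1) v pv(2)]] by simp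
   then have "h1 v = h1 (\<pi> v)" using hK lin_diff[OF h1 vs fmodD(3)[OF V'(1)] v pv(2)] by simp
   then show ?thesis using pv by (simp add: h_def)
  qed
  show ?thesis
  proof (rule ex1I)
   show "h : lin s (rsp Q) s W & (\<forall>x\<in>rsp L. \<forall>f\<in>dual A. h (t x f) = \<beta> x f)"
    using h hp h1t t1V by (simp add: t_def)
   fix k assume k: "k : lin s (rsp Q) s W & (\<forall>x\<in>rsp L. \<forall>f\<in>dual A. k (t x f) = \<beta> x f)"
   show "k = h"
   proof (rule lin_eqI[OF conjunct1[OF k] h])
    fix y assume "y : rsp Q"
    then obtain v where v: "v : rsp V'" "y = \<pi> v" using Q(3) by blast
    have e'V: "e' v : V" using mhomD(2)[OF V'(3) v(1)] by (simp add: T_def)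
    define w where "w = e' v"
    have "v = e (\<Sum>b\<in>B. t0 (w b) (c b))" using V'(5)[OF v(1)] t0_span[OF e'V] by (simp add: w_def)
    also have "... = (\<Sum>b\<in>B. t1 (w b) (c b))"
     unfolding t1_def by (rule lin_sum[OF el fv Vsub]) (use t0V Vin[OF e'V] in "auto simp: w_def")
    finally have vs': "v = (\<Sum>b\<in>B. t1 (w b) (c b))" .
    have w: "w b : rsp L" if "b : B" for b using Vin[OF e'V that] by (simp add: w_def)
    have y: "y = (\<Sum>b\<in>B. t (w b) (c b))"
     unfolding v(2) vs' t_def by (rule lin_sum[OF pl vs fmodD(3)[OF V'(1)]]) (use t1V w in auto)
    have m: "t (w b) (c b) : rsp Q" if "b : B" for b using balancedD(1)[OF bal w[OF that] cd[OF that]] .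
    show "k y = h y" unfolding y
     using lin_sum[OF conjunct1[OF k] vs fmodD(3)[OF Q(1)], of B "\<lambda>b. t (w b) (c b)"] lin_sum[OF h vs fmodD(3)[OF Q(1)], of B "\<lambda>b. t (w b) (c b)"]
      m k w cd hp h1t t1V by (simp add: t_def)
   qed
  qed
 qed
 moreover have "ract Q (t x f) a = t x (dual_ract A f a)" if "x : rsp L" "f : dual A" "a : acar A" for x f a
  unfolding t_def rhomD(3)[OF Q(2) t1V[OF that(1)] that(3), symmetric] t1_act[OF that] ..
 ultimately have "is_tensor s A L Q t" unfolding is_tensor_def using fmodD(1)[OF Q(1)] by blast
 then show ?thesis by blast
qed

lemma tensor: "fmod L ==> is_tensor s A L (nu s A L) (tens s A L)"
proof -
 assume "fmod L"
 then have "\<exists>p. case p of (T, t) => is_tensor s A L T t" using ex_tensor by auto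
 from someI_ex[OF this] show ?thesis by (auto simp: nu_def tens_def nu_tens_def split: prod.splits)
qed

abbreviation "\<nu> \<equiv> nu s A"
abbreviation "tn \<equiv> tens s A"

lemma nu_rmod: "fmod L ==> is_rmod s A (\<nu> L)"
 and tens_balanced: "fmod L ==> balanced s A L (rsp (\<nu> L)) (tn L)"
 and tens_act: "fmod L ==> x : rsp L ==> f : dual A ==> a : acar A ==> ract (\<nu> L) (tn L x f) a = tn L x (dual_ract A f a)"
 and nu_lift: "fmod L ==> module.subspace s W ==> balanced s A L W \<beta> ==>
  \<exists>!h. h : lin s (rsp (\<nu> L)) s W & (\<forall>x\<in>rsp L. \<forall>f\<in>dual A. h (tn L x f) = \<beta> x f)"
 using tensor[of L] unfolding is_tensor_def by blast+

lemmas tens = balancedD[OF tens_balanced]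

lemma nu_ext:
 assumes L: "fmod L" and h: "h : lin s (rsp (\<nu> L)) s W" "h' : lin s (rsp (\<nu> L)) s W'"
  and eq: "!!x f. x : rsp L ==> f : dual A ==> h (tn L x f) = h' (tn L x f)"
 shows "h = h'"
proof -
 have u: "h : lin s (rsp (\<nu> L)) s UNIV" "h' : lin s (rsp (\<nu> L)) s UNIV" using h by (auto simp: lin_def)
 have "balanced s A L UNIV (\<lambda>x f. h (tn L x f))" by (rule balanced_lin[OF tens_balanced[OF L] u(1)])
 from nu_lift[OF L subspace_UNIV'[OF vs] this] show ?thesis using u eq by (metis (no_types, lifting))
qed

lemma nu_span:
 assumes L: "fmod L"
 shows "rsp (\<nu> L) = module.span s {tn L x f |x f. x : rsp L & f : dual A}" (is "_ = module.span s ?E")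
proof -
 interpret VS: vector_space s by (rule vs)
 note sub = is_rmodD(1)[OF nu_rmod[OF L]]
 have le: "VS.span ?E \<subseteq> rsp (\<nu> L)" by (rule VS.span_minimal[OF _ sub]) (use tens(1)[OF L] in auto)
 obtain p where p: "p : lin s (rsp (\<nu> L)) s (rsp (\<nu> L))" "\<forall>x\<in>rsp (\<nu> L). p x = 0 \<longleftrightarrow> x : VS.span ?E"
  using ex_quotient_projection[OF vs sub VS.subspace_span le] by blast
 have "p = 0"
 proof (rule nu_ext[OF L p(1) lin_zero[OF vs, of "{0}"]])
  fix x f assume xf: "x : rsp L" "f : dual A"
  have "tn L x f : VS.span ?E" by (rule VS.span_base) (use xf in blast)
  then show "p (tn L x f) = 0 (tn L x f)" using p(2) tens(1)[OF L xf] by auto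
 qed simp
 then show ?thesis using p(2) le by auto
qed

lemma nu_fmod:
 assumes L: "fmod L" shows "fmod (\<nu> L)"
proof -
 interpret VS: vector_space s by (rule vs)
 obtain B c where B: "finite B" "B \<subseteq> rsp L" "!!b. b : B ==> c b : lin s (rsp L) (*) UNIV"
  "!!x. x : rsp L ==> (\<Sum>b\<in>B. s (c b x) b) = x" by (rule dual_basis[OF vs fmodD(2)[OF L]]) (rule that)
 have "fin_dim (fscale (*)) (dual A)" unfolding dual_def by (rule fin_dim_lin[OF vsA vector_space_mult fdA fin_dim_field])
 then obtain D d where D: "finite D" "D \<subseteq> dual A" "!!b. b : D ==> d b : lin (fscale (*)) (dual A) (*) UNIV"
  "!!x. x : dual A ==> (\<Sum>b\<in>D. fscale (*) (d b x) b) = x"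
  by (rule dual_basis[OF vector_space_fscale[OF vector_space_mult]]) (rule that)
 define E where "E = (\<lambda>(b, f). tn L b f) ` (B \<times> D)"
 have "tn L x f : VS.span E" if x: "x : rsp L" and f: "f : dual A" for x f
 proof -
  have l1: "(\<lambda>x. if x : rsp L then tn L x f else 0) : lin s (rsp L) s UNIV" if "f : dual A" for f
   by (rule linI) (use that in "auto simp: tens[OF L] rsp_closed[OF L]")
  have l2: "(\<lambda>f. if f : dual A then tn L x f else 0) : lin (fscale (*)) (dual A) s UNIV" if "x : rsp L" for x
   by (rule linI) (use that in "auto simp: tens[OF L] dual_closed")
  have b: "tn L b f : VS.span E" if b: "b : B" for b
  proof -
   have bL: "b : rsp L" using b B(2) by blast
   have "tn L b (\<Sum>g\<in>D. fscale (*) (d g f) g) = (\<Sum>g\<in>D. s (d g f) (tn L b g))"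
    using lin_sum[OF l2[OF bL] vector_space_fscale[OF vector_space_mult] dual_sub, of D "\<lambda>g. fscale (*) (d g f) g"] D(2) dual_closed(3) D(4)[OF f] f
    by (simp add: subset_iff tens(5)[OF L bL] cong: sum.cong)
   then have "tn L b f = (\<Sum>g\<in>D. s (d g f) (tn L b g))" using D(4)[OF f] by simp
   also have "... : VS.span E"
    by (rule VS.span_sum, rule VS.span_scale, rule VS.span_base) (use b in "auto simp: E_def")
   finally show ?thesis .
  qed
  have "tn L (\<Sum>b\<in>B. s (c b x) b) f = (\<Sum>b\<in>B. s (c b x) (tn L b f))"
   using lin_sum[OF l1[OF f] vs fmodD(3)[OF L], of B "\<lambda>b. s (c b x) b"] B(2) rsp_closed(3)[OF L] B(4)[OF x] x f
   by (simp add: subset_iff tens(4)[OF L] cong: sum.cong)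
  then have "tn L x f = (\<Sum>b\<in>B. s (c b x) (tn L b f))" using B(4)[OF x] by simp
  also have "... : VS.span E" by (rule VS.span_sum, rule VS.span_scale, rule b)
  finally show ?thesis .
 qed
 then have "rsp (\<nu> L) \<subseteq> VS.span E"
  unfolding nu_span[OF L] by (intro VS.span_minimal VS.subspace_span) auto
 moreover have "finite E" using B(1) D(1) by (simp add: E_def)
 then have "fin_dim s (VS.span E)" by (auto simp: fin_dim_def)
 ultimately have "fin_dim s (rsp (\<nu> L))" using fin_dim_sub[OF vs _ is_rmodD(1)[OF nu_rmod[OF L]]] by blast
 then show ?thesis using nu_rmod[OF L] by (simp add: fmod_def)
qed

text \<open>A balanced pairing which is compatible with the action of A on DA is the same as a module homomorphism.\<close>

definition bilift where
 "bilift L N \<beta> = (THE h. h : lin s (rsp (\<nu> L)) s (rsp N) & (\<forall>x\<in>rsp L. \<forall>f\<in>dual A. h (tn L x f) = \<beta> x f))"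

lemma bilift:
 assumes L: "fmod L" and N: "fmod N" and b: "balanced s A L (rsp N) \<beta>"
  and act: "!!x f a. x : rsp L ==> f : dual A ==> a : acar A ==> ract N (\<beta> x f) a = \<beta> x (dual_ract A f a)"
 shows "bilift L N \<beta> : rh (\<nu> L) N" "x : rsp L ==> f : dual A ==> bilift L N \<beta> (tn L x f) = \<beta> x f"
proof -
 have h: "bilift L N \<beta> : lin s (rsp (\<nu> L)) s (rsp N) & (\<forall>x\<in>rsp L. \<forall>f\<in>dual A. bilift L N \<beta> (tn L x f) = \<beta> x f)"
  unfolding bilift_def by (rule theI'[OF nu_lift[OF L fmodD(3)[OF N] b]])
 then show "x : rsp L ==> f : dual A ==> bilift L N \<beta> (tn L x f) = \<beta> x f" by blast
 show "bilift L N \<beta> : rh (\<nu> L) N"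
 proof (rule rhomI)
  show l: "bilift L N \<beta> : lin s (rsp (\<nu> L)) s (rsp N)" using h by blast
  fix y a assume y: "y : rsp (\<nu> L)" and a: "a : acar A"
  note nL = nu_fmod[OF L]
  have "(\<lambda>y. if y : rsp (\<nu> L) then bilift L N \<beta> (ract (\<nu> L) y a) else 0) = (\<lambda>y. if y : rsp (\<nu> L) then ract N (bilift L N \<beta> y) a else 0)"
  proof (rule nu_ext[OF L])
   show "(\<lambda>y. if y : rsp (\<nu> L) then bilift L N \<beta> (ract (\<nu> L) y a) else 0) : lin s (rsp (\<nu> L)) s (rsp N)"
    by (rule linI) (use a in "auto simp: ract[OF nL] linD[OF l] rsp_closed[OF nL]")
   show "(\<lambda>y. if y : rsp (\<nu> L) then ract N (bilift L N \<beta> y) a else 0) : lin s (rsp (\<nu> L)) s (rsp N)"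
    by (rule linI) (use a in "auto simp: ract[OF N] linD[OF l] rsp_closed[OF nL]")
   fix x f assume "x : rsp L" "f : dual A"
   then show "(if tn L x f : rsp (\<nu> L) then bilift L N \<beta> (ract (\<nu> L) (tn L x f) a) else 0) =
     (if tn L x f : rsp (\<nu> L) then ract N (bilift L N \<beta> (tn L x f)) a else 0)"
    using a h act by (simp add: tens_act[OF L] dual_ract_in)
  qed
  from fun_cong[OF this, of y] show "bilift L N \<beta> (ract (\<nu> L) y a) = ract N (bilift L N \<beta> y) a" using y by simp
 qed
qed

abbreviation "\<nu>m \<equiv> nu_map s A"

lemma nu_map_bilift: "\<nu>m L N g = bilift L (\<nu> N) (\<lambda>x f. tn N (g x) f)"
 by (simp add: nu_map_def bilift_def)

lemma nu_map:
 assumes L: "fmod L" and N: "fmod N" and g: "g : rh L N"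
 shows "\<nu>m L N g : rh (\<nu> L) (\<nu> N)" "x : rsp L ==> f : dual A ==> \<nu>m L N g (tn L x f) = tn N (g x) f"
proof -
 have b: "balanced s A L (rsp (\<nu> N)) (\<lambda>x f. tn N (g x) f)"
  by (rule balancedI) (auto simp: linD[OF rhomD(1)[OF g]] rhomD(3)[OF g] tens[OF N])
 note l = bilift[OF L nu_fmod[OF N] b tens_act[OF N rhomD(2)[OF g]], folded nu_map_bilift]
 show "\<nu>m L N g : rh (\<nu> L) (\<nu> N)" by (rule l(1)) auto
 show "x : rsp L ==> f : dual A ==> \<nu>m L N g (tn L x f) = tn N (g x) f" by (rule l(2)) auto
qed

lemma nu_map_eqI:
 assumes L: "fmod L" and N: "fmod N" and g: "g : rh L N" and h: "h : lin s (rsp (\<nu> L)) s W"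
  "!!x f. x : rsp L ==> f : dual A ==> h (tn L x f) = tn N (g x) f"
 shows "\<nu>m L N g = h"
 by (rule nu_ext[OF L rhomD(1)[OF nu_map(1)[OF L N g]] h(1)]) (simp add: nu_map(2)[OF L N g] h(2))

lemma nu_map_comp:
 assumes "fmod L" "fmod N" "fmod M" "f : rh L N" "g : rh N M"
 shows "\<nu>m L M (g o f) = \<nu>m N M g o \<nu>m L N f"
 by (rule nu_map_eqI[OF assms(1,3) rhom_comp[OF assms(4,5)] lin_comp[OF rhomD(1)[OF nu_map(1)] rhomD(1)[OF nu_map(1)]]])
  (use assms in "auto simp: nu_map rhomD(2)")

lemma nu_map_ident: "fmod L ==> \<nu>m L L (idm (rsp L)) = idm (rsp (\<nu> L))"
 by (rule nu_map_eqI[OF _ _ idm_rhom idm_lin]) (auto simp: fmodD nu_fmod vs tens)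

lemma nu_map_zero: "fmod L ==> fmod N ==> \<nu>m L N 0 = 0"
 by (rule nu_map_eqI[OF _ _ zero_rhom lin_zero[OF vs, of "{0}"]]) (use tens(4)[of N 0 _ 0] rsp_closed(1)[of N] in "auto simp: vs_scaleD vs")

lemma nu_map_add:
 assumes "fmod L" "fmod N" "f : rh L N" "g : rh L N"
 shows "\<nu>m L N (f + g) = \<nu>m L N f + \<nu>m L N g"
 by (rule nu_map_eqI[OF assms(1,2) rhom_closed(2)[OF assms(2,1,3,4)] lin_add[OF vs fmodD(3)[OF nu_fmod[OF assms(2)]] rhomD(1)[OF nu_map(1)] rhomD(1)[OF nu_map(1)]]])
  (use assms in "auto simp: nu_map tens rhomD(2)")

lemma nu_map_surj:
 assumes L: "fmod L" and N: "fmod N" and g: "g : rh L N" and su: "g ` rsp L = rsp N"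
 shows "\<nu>m L N g ` rsp (\<nu> L) = rsp (\<nu> N)"
proof
 interpret VS: vector_space s by (rule vs)
 note m = nu_map[OF L N g]
 show "\<nu>m L N g ` rsp (\<nu> L) \<subseteq> rsp (\<nu> N)" by (rule image_submodule(2)[OF m(1) nu_fmod[OF L]])
 show "rsp (\<nu> N) \<subseteq> \<nu>m L N g ` rsp (\<nu> L)" unfolding nu_span[OF N]
 proof (rule VS.span_minimal[OF _ image_submodule(1)[OF m(1) nu_fmod[OF L]]])
  show "{tn N x f |x f. x : rsp N & f : dual A} \<subseteq> \<nu>m L N g ` rsp (\<nu> L)"
  proof
   fix v assume "v : {tn N x f |x f. x : rsp N & f : dual A}"
   then obtain x f where v: "v = tn N x f" "x : rsp N" "f : dual A" by blast
   then obtain z where z: "z : rsp L" "x = g z" using su by blast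
   show "v : \<nu>m L N g ` rsp (\<nu> L)"
    by (rule image_eqI[of _ _ "tn L z f"]) (use z v m(2) tens(1)[OF L] in auto)
  qed
 qed
qed

end

section \<open>Graded modules over the trivial extension\<close>

context fd_algebra
begin

abbreviation "GM \<equiv> grm s A"

text \<open>The structure map as a pairing of gcomp N p with DA.\<close>

definition gact where
 "gact N p x f = gstr N p (tn (gcomp N p) x f)"

lemma grm_simps [simp]: "Cmp GM g f = (\<lambda>p. g p o f p)" "Ident GM M = (\<lambda>p. idm (rsp (gcomp M p)))" "Scl GM = fscale (fscale s)"
 by (auto simp: grm_def)

lemma gobD:
 assumes "M : Ob GM"
 shows "fmod (gcomp M p)" "gstr M p : rh (\<nu> (gcomp M p)) (gcomp M (p + 1))" "finite {p. rsp (gcomp M p) ~= {0}}"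
 using assms by (auto simp: grm_def is_gmod_def fmod_def)

lemma gact_balanced: "M : Ob GM ==> balanced s A (gcomp M p) (rsp (gcomp M (p + 1))) (gact M p)"
 unfolding gact_def by (rule balanced_lin[OF tens_balanced[OF gobD(1)] rhomD(1)[OF gobD(2)]])

lemmas gact = balancedD[OF gact_balanced]

lemma gact_ract: "M : Ob GM ==> x : rsp (gcomp M p) ==> f : dual A ==> a : acar A ==>
  ract (gcomp M (p + 1)) (gact M p x f) a = gact M p x (dual_ract A f a)"
 using rhomD(3)[OF gobD(2), of M "tn (gcomp M p) x f" p a] tens(1)[OF gobD(1)]
 by (simp add: gact_def tens_act[OF gobD(1)])

lemma gact_gact: "M : Ob GM ==> x : rsp (gcomp M p) ==> f : dual A ==> g : dual A ==> gact M (p + 1) (gact M p x f) g = 0"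
proof -
 assume *: "M : Ob GM" "x : rsp (gcomp M p)" "f : dual A" "g : dual A"
 have "gstr M (p + 1) o \<nu>m (\<nu> (gcomp M p)) (gcomp M (p + 1)) (gstr M p) = (\<lambda>_. 0)"
  using *(1) by (auto simp: grm_def is_gmod_def)
 from fun_cong[OF this, of "tn (\<nu> (gcomp M p)) (tn (gcomp M p) x f) g"]
 show ?thesis
  using nu_map(2)[OF nu_fmod[OF gobD(1)] gobD(1) gobD(2), OF *(1,1,1) _ *(4), of "tn (gcomp M p) x f"] tens(1)[OF gobD(1)[OF *(1)] *(2,3)]
  by (simp add: gact_def)
qed

lemma gact_zero: "M : Ob GM ==> f : dual A ==> gact M p 0 f = 0"
 using gact(4)[of M 0 p f 0] rsp_closed(1)[OF gobD(1)] by (simp add: vs_scaleD vs)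

definition mk_gmod where
 "mk_gmod L \<mu> = \<lparr>gcomp = L, gstr = (\<lambda>p. bilift (L p) (L (p + 1)) (\<mu> p))\<rparr>"

lemma gcomp_mk_gmod [simp]: "gcomp (mk_gmod L \<mu>) = L"
 by (simp add: mk_gmod_def)

text \<open>Graded modules may be given by pairings: this avoids tensor products in the constructions below.\<close>

lemma gstr_sq_zero:
 assumes "fmod L" "fmod N" "fmod M" "h : rh (\<nu> L) N" "k : rh (\<nu> N) M"
  "!!x f g. x : rsp L ==> f : dual A ==> g : dual A ==> k (tn N (h (tn L x f)) g) = 0"
 shows "k o \<nu>m (\<nu> L) N h = (\<lambda>_. 0)"
proof -
 note nL = nu_fmod[OF assms(1)] and m = nu_map[OF nu_fmod[OF assms(1)] assms(2,4)]
 have "k o \<nu>m (\<nu> L) N h = 0"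
 proof (rule nu_ext[OF nL lin_comp[OF rhomD(1)[OF m(1)] rhomD(1)[OF assms(5)]] lin_zero[OF vs, of "{0}"]])
  fix y g assume y: "y : rsp (\<nu> L)" and g: "g : dual A"
  have "(\<lambda>y. if y : rsp (\<nu> L) then k (tn N (h y) g) else 0) = 0"
  proof (rule nu_ext[OF assms(1) _ lin_zero[OF vs, of "{0}"]])
   show "(\<lambda>y. if y : rsp (\<nu> L) then k (tn N (h y) g) else 0) : lin s (rsp (\<nu> L)) s (rsp M)"
    by (rule linI) (use g in "auto simp: rsp_closed[OF nL] linD[OF rhomD(1)[OF assms(4)]] tens[OF assms(2)] linD[OF rhomD(1)[OF assms(5)]]")
  qed (use assms(6) g tens(1)[OF assms(1)] in auto)
  from fun_cong[OF this, of y] show "(k o \<nu>m (\<nu> L) N h) (tn (\<nu> L) y g) = 0 (tn (\<nu> L) y g)" using y m(2)[OF y g] by simp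
 qed simp
 then show ?thesis by (simp add: zero_fun_def)
qed

lemma gobI:
 assumes "!!p. fmod (gcomp M p)" "!!p. gstr M p : rh (\<nu> (gcomp M p)) (gcomp M (p + 1))" "finite {p. rsp (gcomp M p) ~= {0}}"
  "!!p x f g. x : rsp (gcomp M p) ==> f : dual A ==> g : dual A ==> gact M (p + 1) (gact M p x f) g = 0"
 shows "M : Ob GM"
proof -
 have "gstr M (p + 1) o \<nu>m (\<nu> (gcomp M p)) (gcomp M (p + 1)) (gstr M p) = (\<lambda>_. 0)" for p
  by (rule gstr_sq_zero[OF assms(1,1,1,2,2)]) (use assms(4) in "simp add: gact_def")
 then show ?thesis using assms by (auto simp: grm_def is_gmod_def fmod_def)
qed

lemma mk_gmod:
 assumes L: "!!p. fmod (L p)" and fin: "finite {p. rsp (L p) ~= {0}}"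
  and b: "!!p. balanced s A (L p) (rsp (L (p + 1))) (\<mu> p)"
  and act: "!!p x f a. x : rsp (L p) ==> f : dual A ==> a : acar A ==> ract (L (p + 1)) (\<mu> p x f) a = \<mu> p x (dual_ract A f a)"
  and sq: "!!p x f g. x : rsp (L p) ==> f : dual A ==> g : dual A ==> \<mu> (p + 1) (\<mu> p x f) g = 0"
 shows "mk_gmod L \<mu> : Ob GM" "x : rsp (L p) ==> f : dual A ==> gact (mk_gmod L \<mu>) p x f = \<mu> p x f"
proof -
 have l1: "bilift (L p) (L (p + 1)) (\<mu> p) : rh (\<nu> (L p)) (L (p + 1))" for p
  by (rule bilift(1)[OF L L b]) (rule act)
 have l2: "bilift (L p) (L (p + 1)) (\<mu> p) (tn (L p) x f) = \<mu> p x f" if "x : rsp (L p)" "f : dual A" for p x f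
  by (rule bilift(2)[OF L L b _ that]) (rule act)
 show g: "x : rsp (L p) ==> f : dual A ==> gact (mk_gmod L \<mu>) p x f = \<mu> p x f" for p x f
  by (simp add: gact_def mk_gmod_def l2)
 show "mk_gmod L \<mu> : Ob GM"
 proof (rule gobI)
  show "gstr (mk_gmod L \<mu>) p : rh (\<nu> (gcomp (mk_gmod L \<mu>) p)) (gcomp (mk_gmod L \<mu>) (p + 1))" for p
   by (simp add: mk_gmod_def l1)
  show "gact (mk_gmod L \<mu>) (p + 1) (gact (mk_gmod L \<mu>) p x f) k = 0"
   if "x : rsp (gcomp (mk_gmod L \<mu>) p)" "f : dual A" "k : dual A" for p x f k
   using that sq balancedD(1)[OF b] by (simp add: g)
 qed (use L fin in auto)
qed

lemma grm_hom_iff: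
 assumes M: "M : Ob GM" and N: "N : Ob GM"
 shows "f : Hom GM M N \<longleftrightarrow> (\<forall>p. f p : rh (gcomp M p) (gcomp N p) \<and>
  (\<forall>x\<in>rsp (gcomp M p). \<forall>g\<in>dual A. f (p + 1) (gact M p x g) = gact N p (f p x) g))"
proof -
 have "f (p + 1) o gstr M p = gstr N p o \<nu>m (gcomp M p) (gcomp N p) (f p) \<longleftrightarrow>
  (\<forall>x\<in>rsp (gcomp M p). \<forall>g\<in>dual A. f (p + 1) (gact M p x g) = gact N p (f p x) g)"
  if f: "!!p. f p : rh (gcomp M p) (gcomp N p)" for p
 proof
  note m = nu_map[OF gobD(1)[OF M] gobD(1)[OF N] f]
  assume "f (p + 1) o gstr M p = gstr N p o \<nu>m (gcomp M p) (gcomp N p) (f p)"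
  then have "f (p + 1) (gstr M p z) = gstr N p (\<nu>m (gcomp M p) (gcomp N p) (f p) z)" for z by (simp add: fun_eq_iff)
  then show "\<forall>x\<in>rsp (gcomp M p). \<forall>g\<in>dual A. f (p + 1) (gact M p x g) = gact N p (f p x) g"
   using m(2) by (simp add: gact_def)
 next
  note m = nu_map[OF gobD(1)[OF M] gobD(1)[OF N] f]
  assume "\<forall>x\<in>rsp (gcomp M p). \<forall>g\<in>dual A. f (p + 1) (gact M p x g) = gact N p (f p x) g"
  then show "f (p + 1) o gstr M p = gstr N p o \<nu>m (gcomp M p) (gcomp N p) (f p)"
   by (intro nu_ext[OF gobD(1)[OF M] lin_comp[OF rhomD(1)[OF gobD(2)[OF M]] rhomD(1)[OF f]]
      lin_comp[OF rhomD(1)[OF m(1)] rhomD(1)[OF gobD(2)[OF N]]]]) (simp add: m(2) gact_def)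
 qed
 then show ?thesis by (auto simp: grm_def)
qed

lemma grm_homD:
 assumes "f : Hom GM M N" "M : Ob GM" "N : Ob GM"
 shows "f p : rh (gcomp M p) (gcomp N p)"
  "x : rsp (gcomp M p) ==> g : dual A ==> f (p + 1) (gact M p x g) = gact N p (f p x) g"
  "x : rsp (gcomp M p) ==> f p x : rsp (gcomp N p)"
 using assms(1) rhomD(2) unfolding grm_hom_iff[OF assms(2,3)] by blast+

lemma grm_hom_eqI: "f : Hom GM M N ==> g : Hom GM M N' ==> M : Ob GM ==> N : Ob GM ==> N' : Ob GM ==>
  (!!p x. x : rsp (gcomp M p) ==> f p x = g p x) ==> f = g"
 by (rule ext, rule rhom_eqI[OF grm_homD(1)[of f M N] grm_homD(1)[of g M N']]) auto

lemma grm_hom_sub: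
 assumes "M : Ob GM" "N : Ob GM"
 shows "module.subspace (fscale (fscale s)) (Hom GM M N)"
proof (rule subspaceI[OF vector_space_fscale[OF vector_space_fscale[OF vs]]])
 note cl = rhom_closed[OF gobD(1)[OF assms(2)] gobD(1)[OF assms(1)]]
 note g = gact[OF assms(2)]
 show "0 : Hom GM M N"
  unfolding grm_hom_iff[OF assms] using cl(1) gact_zero[OF assms(2)] by auto
 show "f + h : Hom GM M N" if "f : Hom GM M N" "h : Hom GM M N" for f h
  unfolding grm_hom_iff[OF assms] using cl(2) grm_homD[OF that(1) assms] grm_homD[OF that(2) assms] by (auto simp: g)
 show "fscale (fscale s) c f : Hom GM M N" if "f : Hom GM M N" for c f
  unfolding grm_hom_iff[OF assms] using cl(3)[of "f _" "_" _ c] grm_homD[OF that assms] by (auto simp: g fscale2_apply, auto simp: fscale_def)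
qed

lemma hf_category_grm: "hf_category s GM"
proof (intro hf_category.intro hf_category_axioms.intro infinite_space_axioms, unfold grm_simps)
 note fv = vector_space_fscale[OF vs]
 show "vector_space (fscale (fscale s))" by (rule vector_space_fscale[OF fv])
 show "fin_dim (fscale (fscale s)) (Hom GM X Y)" if X: "X : Ob GM" and Y: "Y : Ob GM" for X Y
 proof (rule fin_dim_eval[OF fv grm_hom_sub[OF X Y] gobD(3)[OF X], of "\<lambda>p. rh (gcomp X p) (gcomp Y p)"])
  show "fin_dim (fscale s) (rh (gcomp X p) (gcomp Y p))" for p
   using hf_category.hom_fd[OF hf_category_modA] gobD(1)[OF X] gobD(1)[OF Y] by simp
  show "f p : rh (gcomp X p) (gcomp Y p)" if "f : Hom GM X Y" for f p using grm_homD(1)[OF that X Y] .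
  show "f = 0" if f: "f : Hom GM X Y" "\<forall>p\<in>{p. rsp (gcomp X p) ~= {0}}. f p = 0" for f
  proof
   fix p show "f p = 0 p"
   proof (cases "rsp (gcomp X p) = {0}")
    case True
    note l = rhomD(1)[OF grm_homD(1)[OF f(1) X Y, of p]]
    have "f p x = 0" for x using lin_0[OF l] linD(4)[OF l, of x] True by (cases "x = 0") auto
    then show ?thesis by (simp add: fun_eq_iff)
   next
    case False
    then show ?thesis using f(2) by auto
   qed
  qed
 qed
 show "(\<lambda>p. g p o f p) : Hom GM X Z" if "X : Ob GM" "Y : Ob GM" "Z : Ob GM" "f : Hom GM X Y" "g : Hom GM Y Z" for X Y Z f g
  unfolding grm_hom_iff[OF that(1,3)]
  using rhom_comp[OF grm_homD(1)[OF that(4,1,2)] grm_homD(1)[OF that(5,2,3)]] grm_homD[OF that(4,1,2)] grm_homD[OF that(5,2,3)] by auto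
 show "(\<lambda>p. idm (rsp (gcomp X p))) : Hom GM X X" if "X : Ob GM" for X
  unfolding grm_hom_iff[OF that that] using idm_rhom[OF gobD(1)[OF that]] gact(1)[OF that] by auto
 show "(\<lambda>p. idm (rsp (gcomp Y p)) o f p) = f" if "X : Ob GM" "Y : Ob GM" "f : Hom GM X Y" for X Y f
  using idm_lin_comp[OF rhomD(1)[OF grm_homD(1)[OF that(3,1,2)]] rsp_closed(1)[OF gobD(1)[OF that(2)]]] by simp
 show "(\<lambda>p. f p o idm (rsp (gcomp X p))) = f" if "X : Ob GM" "Y : Ob GM" "f : Hom GM X Y" for X Y f
  using lin_idm[OF rhomD(1)[OF grm_homD(1)[OF that(3,1,2)]]] by simp
 show "(\<lambda>p. h p o (g p o f p)) = (\<lambda>p. h p o g p o f p)" for h g f :: "int => 'u => 'u" by (simp add: comp_assoc)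
 show "(\<lambda>p. (g + g') p o f p) = (\<lambda>p. g p o f p) + (\<lambda>p. g' p o f p)" for g g' f :: "int => 'u => 'u" by (auto simp: fun_eq_iff)
 show "(\<lambda>p. g p o (f + f') p) = (\<lambda>p. g p o f p) + (\<lambda>p. g p o f' p)"
  if "X : Ob GM" "Y : Ob GM" "Z : Ob GM" "f : Hom GM X Y" "f' : Hom GM X Y" "g : Hom GM Y Z" for X Y Z f f' g
 proof
  fix p show "g p o (f + f') p = ((\<lambda>p. g p o f p) + (\<lambda>p. g p o f' p)) p"
   using comp_add_lin[OF rhomD(1)[OF grm_homD(1)[OF that(6,2,3)]] rhomD(1)[OF grm_homD(1)[OF that(4,1,2)]] rhomD(1)[OF grm_homD(1)[OF that(5,1,2)]], of p]
   by simp
 qed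
 show "(\<lambda>p. fscale (fscale s) c g p o f p) = fscale (fscale s) c (\<lambda>p. g p o f p)" for c g and f :: "int => 'u => 'u"
  by (auto simp: fun_eq_iff fscale_def)
 show "(\<lambda>p. g p o fscale (fscale s) c f p) = fscale (fscale s) c (\<lambda>p. g p o f p)"
  if "X : Ob GM" "Y : Ob GM" "Z : Ob GM" "f : Hom GM X Y" "g : Hom GM Y Z" for X Y Z f g c
 proof
  fix p show "g p o fscale (fscale s) c f p = fscale (fscale s) c (\<lambda>p. g p o f p) p"
   using comp_fscale_lin[OF rhomD(1)[OF grm_homD(1)[OF that(5,2,3)]] rhomD(1)[OF grm_homD(1)[OF that(4,1,2)]] vs vs, of p c]
   by (simp add: fscale_def[of "fscale s"])
 qed
qed

subsection \<open>Submodules, quotients and direct sums\<close>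

definition gsub where
 "gsub M K = mk_gmod (\<lambda>p. \<lparr>rsp = K p, ract = ract (gcomp M p)\<rparr>) (gact M)"

definition gsubmodule where
 "gsubmodule M K \<longleftrightarrow> (\<forall>p. module.subspace s (K p) & K p \<subseteq> rsp (gcomp M p) \<and>
   (\<forall>x\<in>K p. (\<forall>a\<in>acar A. ract (gcomp M p) x a : K p) & (\<forall>f\<in>dual A. gact M p x f : K (p + 1))))"

lemma gsubmoduleD:
 assumes "gsubmodule M K"
 shows "module.subspace s (K p)" "K p \<subseteq> rsp (gcomp M p)" "x : K p ==> x : rsp (gcomp M p)"
  "x : K p ==> a : acar A ==> ract (gcomp M p) x a : K p" "x : K p ==> f : dual A ==> gact M p x f : K (p + 1)"
 using assms unfolding gsubmodule_def by blast+

lemma gsub: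
 assumes M: "M : Ob GM" and K: "gsubmodule M K"
 shows "gsub M K : Ob GM" "rsp (gcomp (gsub M K) p) = K p" "x : K p ==> f : dual A ==> gact (gsub M K) p x f = gact M p x f"
  "ract (gcomp (gsub M K) p) = ract (gcomp M p)"
proof -
 note k = gsubmoduleD[OF K]
 let ?L = "\<lambda>p. \<lparr>rsp = K p, ract = ract (gcomp M p)\<rparr>"
 have 1: "fmod (?L p)" for p by (rule fmod_sub[OF gobD(1)[OF M] k(1,2,4)])
 have 2: "finite {p. rsp (?L p) ~= {0}}"
 proof (rule finite_subset[OF _ gobD(3)[OF M]])
  show "{p. rsp (?L p) ~= {0}} \<subseteq> {p. rsp (gcomp M p) ~= {0}}"
   using k(2) subspaceD(1)[OF vs k(1)] by auto
 qed
 have 3: "balanced s A (?L p) (rsp (?L (p + 1))) (gact M p)" for p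
  by (rule balancedI) (auto simp: k(3,5) gact[OF M])
 have 4: "mk_gmod ?L (gact M) : Ob GM & (x : K p --> f : dual A --> gact (mk_gmod ?L (gact M)) p x f = gact M p x f)" for x p f
  using mk_gmod[OF 1 2 3] gact_ract[OF M k(3)] gact_gact[OF M k(3)] by auto
 show "gsub M K : Ob GM" "x : K p ==> f : dual A ==> gact (gsub M K) p x f = gact M p x f"
  using 4 by (auto simp: gsub_def)
qed (auto simp: gsub_def)

lemma gsub_incl:
 assumes M: "M : Ob GM" and K: "gsubmodule M K"
 shows "(\<lambda>p. idm (K p)) : Hom GM (gsub M K) M"
 unfolding grm_hom_iff[OF gsub(1)[OF M K] M]
proof (intro allI conjI ballI)
 note k = gsubmoduleD[OF K] and g = gsub[OF M K]
 fix p show "idm (K p) : rh (gcomp (gsub M K) p) (gcomp M p)"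
  by (rule rhomI) (use k g(2,4) vs in "auto intro: idm_lin")
 show "idm (K (p + 1)) (gact (gsub M K) p x f) = gact M p (idm (K p) x) f" if "x : rsp (gcomp (gsub M K) p)" "f : dual A" for x f
  using that k(5) g by simp
qed

lemma gsub_factor:
 assumes M: "M : Ob GM" and K: "gsubmodule M K" and Y: "Y : Ob GM" and f: "f : Hom GM Y M"
  and im: "!!p x. x : rsp (gcomp Y p) ==> f p x : K p"
 shows "f : Hom GM Y (gsub M K)"
 unfolding grm_hom_iff[OF Y gsub(1)[OF M K]]
proof (intro allI conjI ballI)
 note k = gsubmoduleD[OF K] and g = gsub[OF M K] and fD = grm_homD[OF f Y M]
 fix p show "f p : rh (gcomp Y p) (gcomp (gsub M K) p)"
  by (rule rhomI[OF lin_mono[OF rhomD(1)[OF fD(1)]]]) (use im g rhomD(3)[OF fD(1)] in auto)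
 show "f (p + 1) (gact Y p x h) = gact (gsub M K) p (f p x) h" if "x : rsp (gcomp Y p)" "h : dual A" for x h
  using that fD(2) g(3) im by simp
qed

lemma gsubmodule_ker:
 assumes M: "M : Ob GM" and N: "N : Ob GM" and f: "f : Hom GM M N"
 shows "gsubmodule M (\<lambda>p. {x : rsp (gcomp M p). f p x = 0})"
 unfolding gsubmodule_def
 using ker_submodule[OF grm_homD(1)[OF f M N] gobD(1)[OF M] gobD(1)[OF N]] gact(1)[OF M] grm_homD(2)[OF f M N] gact_zero[OF N] by auto

lemma gsubmodule_image:
 assumes M: "M : Ob GM" and N: "N : Ob GM" and f: "f : Hom GM M N"
 shows "gsubmodule N (\<lambda>p. f p ` rsp (gcomp M p))"
 unfolding gsubmodule_def
proof (intro allI conjI ballI)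
 note fD = grm_homD[OF f M N]
 note i = image_submodule[OF fD(1) gobD(1)[OF M]]
 fix p show "module.subspace s (f p ` rsp (gcomp M p))" "f p ` rsp (gcomp M p) \<subseteq> rsp (gcomp N p)" by (rule i)+
 fix x assume x: "x : f p ` rsp (gcomp M p)"
 show "ract (gcomp N p) x a : f p ` rsp (gcomp M p)" if "a : acar A" for a by (rule i(3)[OF x that])
 obtain z where z: "z : rsp (gcomp M p)" "x = f p z" using x by blast
 show "gact N p x g : f (p + 1) ` rsp (gcomp M (p + 1))" if g: "g : dual A" for g
  by (rule image_eqI[OF _ gact(1)[OF M z(1) g]]) (simp add: fD(2)[OF z(1) g] z(2))
qed

lemma ex_gquotient:
 assumes M: "M : Ob GM" and K: "gsubmodule M K"
 obtains Q \<pi> where "Q : Ob GM" "\<pi> : Hom GM M Q" "!!p. \<pi> p ` rsp (gcomp M p) = rsp (gcomp Q p)"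
  "!!p x. x : rsp (gcomp M p) ==> \<pi> p x = 0 \<longleftrightarrow> x : K p"
proof -
 note k = gsubmoduleD[OF K] and m = gobD(1)[OF M] and g = gact[OF M]
 have "\<forall>p. \<exists>Q \<pi>. fmod Q & \<pi> : rh (gcomp M p) Q & \<pi> ` rsp (gcomp M p) = rsp Q & (\<forall>x\<in>rsp (gcomp M p). \<pi> x = 0 \<longleftrightarrow> x : K p) \<and>
  rsp Q \<subseteq> rsp (gcomp M p) & (\<forall>x\<in>rsp Q. \<pi> x = x)"
 proof
  fix p
  show "\<exists>Q \<pi>. fmod Q & \<pi> : rh (gcomp M p) Q & \<pi> ` rsp (gcomp M p) = rsp Q & (\<forall>x\<in>rsp (gcomp M p). \<pi> x = 0 \<longleftrightarrow> x : K p) \<and>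
   rsp Q \<subseteq> rsp (gcomp M p) & (\<forall>x\<in>rsp Q. \<pi> x = x)"
   by (rule ex_quotient[OF m k(1,2,4)]) (assumption, assumption, intro exI conjI ballI)
 qed
 then obtain Q \<pi> where Q: "!!p. fmod (Q p)" "!!p. \<pi> p : rh (gcomp M p) (Q p)" "!!p. \<pi> p ` rsp (gcomp M p) = rsp (Q p)"
  "!!p x. x : rsp (gcomp M p) ==> \<pi> p x = 0 \<longleftrightarrow> x : K p" "!!p. rsp (Q p) \<subseteq> rsp (gcomp M p)" "!!p x. x : rsp (Q p) ==> \<pi> p x = x"
  by metis
 have Qin: "x : rsp (gcomp M p)" if "x : rsp (Q p)" for p x using Q(5) that by blast
 have pin: "\<pi> p x : rsp (Q p)" if "x : rsp (gcomp M p)" for p x using rhomD(2)[OF Q(2) that] .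
 \<comment> \<open>the pairing does not depend on the representative modulo the submodule\<close>
 have key: "\<pi> (p + 1) (gact M p (\<pi> p x) f) = \<pi> (p + 1) (gact M p x f)" if x: "x : rsp (gcomp M p)" and f: "f : dual A" for p x f
 proof -
  note px = Qin[OF pin[OF x]]
  have d: "x - \<pi> p x : rsp (gcomp M p)" by (rule rsp_closed(4)[OF m x px])
  have "\<pi> p (x - \<pi> p x) = 0" using lin_diff[OF rhomD(1)[OF Q(2)] vs fmodD(3)[OF m] x px] Q(6)[OF pin[OF x]] by simp
  then have "gact M p (x - \<pi> p x) f : K (p + 1)" using Q(4)[OF d] k(5) f by blast
  then have 0: "\<pi> (p + 1) (gact M p (x - \<pi> p x) f) = 0" using Q(4) k(3) by blast
  have "gact M p x f = gact M p (x - \<pi> p x) f + gact M p (\<pi> p x) f" using g(2)[OF d px f] by simp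
  then show ?thesis using linD(2)[OF rhomD(1)[OF Q(2)] g(1)[OF d f] g(1)[OF px f]] 0 by simp
 qed
 note pl = linD[OF rhomD(1)[OF Q(2)]]
 let ?mu = "\<lambda>p x f. \<pi> (p + 1) (gact M p x f)"
 have 2: "finite {p. rsp (Q p) ~= {0}}"
 proof (rule finite_subset[OF _ gobD(3)[OF M]])
  show "{p. rsp (Q p) ~= {0}} \<subseteq> {p. rsp (gcomp M p) ~= {0}}" using Q(5) rsp_closed(1)[OF Q(1)] by auto
 qed
 have 3: "balanced s A (Q p) (rsp (Q (p + 1))) (?mu p)" for p
 proof (rule balancedI)
  fix x f a assume x: "x : rsp (Q p)" and f: "f : dual A" and a: "a : acar A"
  have "ract (Q p) x a = \<pi> p (ract (gcomp M p) x a)" using rhomD(3)[OF Q(2) Qin[OF x] a] Q(6)[OF x] by simp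
  then show "?mu p (ract (Q p) x a) f = ?mu p x (dual_lact A a f)"
   using key[OF ract(1)[OF m Qin[OF x] a] f] g(6)[OF Qin[OF x] f a] by simp
 qed (auto simp: Qin g pl pin)
 have 4: "ract (Q (p + 1)) (?mu p x f) a = ?mu p x (dual_ract A f a)" if "x : rsp (Q p)" "f : dual A" "a : acar A" for p x f a
  using rhomD(3)[OF Q(2) g(1)[OF Qin[OF that(1)] that(2)] that(3)] gact_ract[OF M Qin[OF that(1)] that(2,3)] by simp
 have 5: "?mu (p + 1) (?mu p x f) h = 0" if "x : rsp (Q p)" "f : dual A" "h : dual A" for p x f h
  using key[OF g(1)[OF Qin[OF that(1)] that(2)] that(3)] gact_gact[OF M Qin[OF that(1)] that(2,3)] lin_0[OF rhomD(1)[OF Q(2)]] by simp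
 have O: "mk_gmod Q ?mu : Ob GM" by (rule mk_gmod(1)[OF Q(1) 2 3]) (erule (2) 4, erule (2) 5)
 have mu: "gact (mk_gmod Q ?mu) p x f = ?mu p x f" if "x : rsp (Q p)" "f : dual A" for p x f
  by (rule mk_gmod(2)[OF Q(1) 2 3 _ _ that]) (erule (2) 4, erule (2) 5)
 have "\<pi> : Hom GM M (mk_gmod Q ?mu)"
  unfolding grm_hom_iff[OF M O] using Q(2) by (auto simp: mu pin key)
 then show ?thesis using that[OF O] Q(3,4) by simp
qed

lemma grm_factor:
 assumes M: "M : Ob GM" and Q: "Q : Ob GM" and N: "N : Ob GM" and pi: "\<pi> : Hom GM M Q" and su: "!!p. \<pi> p ` rsp (gcomp M p) = rsp (gcomp Q p)"
  and f: "f : Hom GM M N" and ker: "!!p x. x : rsp (gcomp M p) ==> \<pi> p x = 0 ==> f p x = 0"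
 shows "\<exists>g\<in>Hom GM Q N. (\<lambda>p. g p o \<pi> p) = f"
proof -
 note pD = grm_homD[OF pi M Q] and fD = grm_homD[OF f M N]
 have "\<forall>p. \<exists>g. g : rh (gcomp Q p) (gcomp N p) & (\<forall>x\<in>rsp (gcomp M p). g (\<pi> p x) = f p x)"
 proof
  fix p show "\<exists>g. g : rh (gcomp Q p) (gcomp N p) & (\<forall>x\<in>rsp (gcomp M p). g (\<pi> p x) = f p x)"
   by (rule rhom_factor[OF gobD(1)[OF M] gobD(1)[OF Q] gobD(1)[OF N] pD(1) su fD(1) ker]) (assumption, assumption, blast)
 qed
 then obtain g where g: "!!p. g p : rh (gcomp Q p) (gcomp N p)" "!!p x. x : rsp (gcomp M p) ==> g p (\<pi> p x) = f p x" by metis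
 have gh: "g : Hom GM Q N" unfolding grm_hom_iff[OF Q N]
 proof (intro allI conjI ballI g(1))
  fix p y h assume "y : rsp (gcomp Q p)" and h: "h : dual A"
  then obtain x where x: "x : rsp (gcomp M p)" "y = \<pi> p x" using su by blast
  then show "g (p + 1) (gact Q p y h) = gact N p (g p y) h"
   using pD(2)[OF x(1) h, symmetric] g(2)[OF gact(1)[OF M x(1) h]] fD(2)[OF x(1) h] g(2)[OF x(1)] by simp
 qed
 have "(\<lambda>p. g p o \<pi> p) = f"
 proof
  fix p show "g p o \<pi> p = f p" by (rule rhom_eqI[OF rhom_comp[OF pD(1) g(1)] fD(1)]) (simp add: g(2))
 qed
 then show ?thesis using gh by blast
qed

lemma grm_epi_iff_surj:
 assumes M: "M : Ob GM" and N: "N : Ob GM"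
 shows "epi GM M N f \<longleftrightarrow> f : Hom GM M N & (\<forall>p. f p ` rsp (gcomp M p) = rsp (gcomp N p))"
proof
 assume e: "epi GM M N f"
 then have f: "f : Hom GM M N" by (simp add: epi_def)
 obtain Q \<pi> where Q: "Q : Ob GM" "\<pi> : Hom GM N Q" "!!p. \<pi> p ` rsp (gcomp N p) = rsp (gcomp Q p)"
  "!!p x. x : rsp (gcomp N p) ==> \<pi> p x = 0 \<longleftrightarrow> x : f p ` rsp (gcomp M p)"
  by (rule ex_gquotient[OF N gsubmodule_image[OF M N f]]) (rule that)
 have z: "0 : Hom GM N Q" by (rule subspaceD(1)[OF vector_space_fscale[OF vector_space_fscale[OF vs]] grm_hom_sub[OF N Q(1)]])
 have "(\<lambda>p. \<pi> p o f p) = (\<lambda>p. 0 p o f p)"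
 proof
  fix p show "\<pi> p o f p = 0 p o f p"
   by (rule rhom_eqI[OF rhom_comp[OF grm_homD(1)[OF f M N] grm_homD(1)[OF Q(2) N Q(1)]] rhom_comp[OF grm_homD(1)[OF f M N] grm_homD(1)[OF z N Q(1)]]])
    (use Q(4) grm_homD(3)[OF f M N] in auto)
 qed
 then have "\<pi> = 0" using e Q(1,2) z unfolding epi_def grm_simps by blast
 then have "rsp (gcomp N p) \<subseteq> f p ` rsp (gcomp M p)" for p using Q(4) by auto
 then show "f : Hom GM M N & (\<forall>p. f p ` rsp (gcomp M p) = rsp (gcomp N p))"
  using f grm_homD(3)[OF f M N] by blast
next
 assume *: "f : Hom GM M N & (\<forall>p. f p ` rsp (gcomp M p) = rsp (gcomp N p))"
 have "u = v" if Z: "Z : Ob GM" and uv: "u : Hom GM N Z" "v : Hom GM N Z" "(\<lambda>p. u p o f p) = (\<lambda>p. v p o f p)" for u v Z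
 proof (rule grm_hom_eqI[OF uv(1,2) N Z Z])
  fix p x assume "x : rsp (gcomp N p)"
  then obtain y where "x = f p y" using * by blast
  then show "u p x = v p x" using fun_cong[OF fun_cong[OF uv(3), of p], of y] by simp
 qed
 then show "epi GM M N f" using * unfolding epi_def grm_simps by blast
qed

lemma ex_gbiprod:
 assumes M: "M : Ob GM" and N: "N : Ob GM"
 obtains S i p j q where "S : Ob GM" "i : Hom GM M S" "p : Hom GM S M" "j : Hom GM N S" "q : Hom GM S N"
  "!!d. biprod (gcomp S d) (gcomp M d) (gcomp N d) (i d) (p d) (j d) (q d)"
proof -
 have "\<forall>d. \<exists>S i p j q. biprod S (gcomp M d) (gcomp N d) i p j q"
  using ex_biprod[OF gobD(1)[OF M] gobD(1)[OF N]] by metis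
 then obtain S i p j q where bi: "!!d. biprod (S d) (gcomp M d) (gcomp N d) (i d) (p d) (j d) (q d)" by metis
 have b: "fmod (S d)" "i d : rh (gcomp M d) (S d)" "p d : rh (S d) (gcomp M d)" "j d : rh (gcomp N d) (S d)" "q d : rh (S d) (gcomp N d)"
  "x : rsp (gcomp M d) ==> p d (i d x) = x" "x : rsp (gcomp M d) ==> q d (i d x) = 0"
  "y : rsp (gcomp N d) ==> q d (j d y) = y" "y : rsp (gcomp N d) ==> p d (j d y) = 0"
  "z : rsp (S d) ==> i d (p d z) + j d (q d z) = z" for d x y z
  using bi[of d] by (auto simp: biprod_def)
 note il = linD[OF rhomD(1)[OF b(2)]] and pl = linD[OF rhomD(1)[OF b(3)]] and jl = linD[OF rhomD(1)[OF b(4)]] and ql = linD[OF rhomD(1)[OF b(5)]]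
 note gM = gact[OF M] and gN = gact[OF N]
 let ?mu = "\<lambda>d x f. i (d + 1) (gact M d (p d x) f) + j (d + 1) (gact N d (q d x) f)"
 have 2: "finite {d. rsp (S d) ~= {0}}"
 proof (rule finite_subset)
  show "finite ({d. rsp (gcomp M d) ~= {0}} \<union> {d. rsp (gcomp N d) ~= {0}})" using gobD(3)[OF M] gobD(3)[OF N] by simp
  have "rsp (S d) = {0}" if "rsp (gcomp M d) = {0}" "rsp (gcomp N d) = {0}" for d
  proof -
   have "z = 0" if z: "z : rsp (S d)" for z
    using b(10)[OF z] pl(1)[OF z] ql(1)[OF z] \<open>rsp (gcomp M d) = {0}\<close> \<open>rsp (gcomp N d) = {0}\<close> lin_0[OF rhomD(1)[OF b(2)]] lin_0[OF rhomD(1)[OF b(4)]]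
    by simp
   then show ?thesis using rsp_closed(1)[OF b(1)] by auto
  qed
  then show "{d. rsp (S d) ~= {0}} \<subseteq> {d. rsp (gcomp M d) ~= {0}} \<union> {d. rsp (gcomp N d) ~= {0}}" by blast
 qed
 have sc: "s c (x + y) = s c x + s c y" for c x y by (simp add: vs_scaleD vs)
 have 3: "balanced s A (S d) (rsp (S (d + 1))) (?mu d)" for d
  by (rule balancedI) (auto simp: pl ql il jl gM gN sc rhomD(3)[OF b(3)] rhomD(3)[OF b(5)] rsp_closed(2)[OF b(1)])
 have 4: "ract (S (d + 1)) (?mu d x f) a = ?mu d x (dual_ract A f a)" if "x : rsp (S d)" "f : dual A" "a : acar A" for d x f a
  using that by (simp add: ract(2)[OF b(1)] il(1) jl(1) gM(1) gN(1) pl(1) ql(1) rhomD(3)[OF b(2), symmetric] rhomD(3)[OF b(4), symmetric] gact_ract[OF M] gact_ract[OF N])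
 have pm: "p (d + 1) (?mu d x f) = gact M d (p d x) f" "q (d + 1) (?mu d x f) = gact N d (q d x) f" if "x : rsp (S d)" "f : dual A" for d x f
  using that by (simp_all add: pl ql il(1) jl(1) gM(1) gN(1) b(6-9))
 have 5: "?mu (d + 1) (?mu d x f) h = 0" if "x : rsp (S d)" "f : dual A" "h : dual A" for d x f h
  using that by (simp add: pm gact_gact[OF M] gact_gact[OF N] pl(1) ql(1) lin_0[OF rhomD(1)[OF b(2)]] lin_0[OF rhomD(1)[OF b(4)]])
 have O: "mk_gmod S ?mu : Ob GM" by (rule mk_gmod(1)[OF b(1) 2 3]) (erule (2) 4, erule (2) 5)
 have mu: "gact (mk_gmod S ?mu) d x f = ?mu d x f" if "x : rsp (S d)" "f : dual A" for d x f
  by (rule mk_gmod(2)[OF b(1) 2 3 _ _ that]) (erule (2) 4, erule (2) 5)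
 have "i : Hom GM M (mk_gmod S ?mu)" "j : Hom GM N (mk_gmod S ?mu)" "p : Hom GM (mk_gmod S ?mu) M" "q : Hom GM (mk_gmod S ?mu) N"
  unfolding grm_hom_iff[OF M O] grm_hom_iff[OF N O] grm_hom_iff[OF O M] grm_hom_iff[OF O N]
  using b(2-5) by (auto simp: mu il(1) jl(1) b(6-9) pm gact_zero[OF M] gact_zero[OF N] lin_0[OF rhomD(1)[OF b(2)]] lin_0[OF rhomD(1)[OF b(4)]])
 then show ?thesis using that[OF O] bi by simp
qed

lemma gbiprod_direct_sum:
 assumes "S : Ob GM" "M : Ob GM" "N : Ob GM" "i : Hom GM M S" "p : Hom GM S M" "j : Hom GM N S" "q : Hom GM S N"
  "!!d. biprod (gcomp S d) (gcomp M d) (gcomp N d) (i d) (p d) (j d) (q d)"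
 shows "direct_sum GM S M N"
proof -
 have b: "x : rsp (gcomp M d) ==> p d (i d x) = x" "y : rsp (gcomp N d) ==> q d (j d y) = y"
  "z : rsp (gcomp S d) ==> i d (p d z) + j d (q d z) = z" for d x y z
  using assms(8)[of d] by (auto simp: biprod_def)
 interpret G: hf_category s GM by (rule hf_category_grm)
 have "Cmp GM p i = Ident GM M"
  by (rule grm_hom_eqI[OF G.cmp_in[OF assms(2,1,2,4,5)] G.ident_in[OF assms(2)] assms(2,2,2)]) (simp add: b)
 moreover have "Cmp GM q j = Ident GM N"
  by (rule grm_hom_eqI[OF G.cmp_in[OF assms(3,1,3,6,7)] G.ident_in[OF assms(3)] assms(3,3,3)]) (simp add: b)
 moreover have "Cmp GM i p + Cmp GM j q = Ident GM S"
  by (rule grm_hom_eqI[OF G.hom_closed(2)[OF assms(1,1) G.cmp_in[OF assms(1,2,1,5,4)] G.cmp_in[OF assms(1,3,1,7,6)]] G.ident_in[OF assms(1)] assms(1,1,1)])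
   (simp add: b)
 ultimately show ?thesis unfolding direct_sum_def using assms(4-7) by blast
qed

end

subsection \<open>Projective graded modules\<close>

text \<open>The module L \<leadsto> N, shifted to the degrees d and d + 1.\<close>

definition glead :: "int => ('a, 'u) rmod => ('a, 'u) rmod => ('u => 'u) => ('a, 'u::zero) gmod" where
 "glead d L N m = \<lparr>
   gcomp = (\<lambda>p. if p = d then L else if p = d + 1 then N else zero_rmod),
   gstr = (\<lambda>p. if p = d then m else (\<lambda>_. 0))\<rparr>"

lemma leadsto_glead: "leadsto L N m = glead 0 L N m"
 by (auto simp: leadsto_def glead_def fun_eq_iff)

lemma glead_simps [simp]: "gcomp (glead d L N m) d = L" "gcomp (glead d L N m) (d + 1) = N"
 "p ~= d ==> p ~= d + 1 ==> gcomp (glead d L N m) p = zero_rmod" "gstr (glead d L N m) d = m"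
 "p ~= d ==> gstr (glead d L N m) p = (\<lambda>_. 0)"
 by (auto simp: glead_def)

context fd_algebra
begin

lemma glead:
 assumes L: "fmod L" and N: "fmod N" and m: "m : rh (\<nu> L) N"
 shows "glead d L N m : Ob GM" "gact (glead d L N m) d x f = m (tn L x f)" "p ~= d ==> gact (glead d L N m) p x f = 0"
proof -
 show g: "gact (glead d L N m) d x f = m (tn L x f)" "p ~= d ==> gact (glead d L N m) p x f = 0" for x f p
  by (simp_all add: gact_def)
 have c: "fmod (gcomp (glead d L N m) p)" for p using L N fmod_zero by (simp add: glead_def)
 show "glead d L N m : Ob GM"
 proof (rule gobI[OF c])
  fix p show "gstr (glead d L N m) p : rh (\<nu> (gcomp (glead d L N m) p)) (gcomp (glead d L N m) (p + 1))"
  proof (cases "p = d")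
   case True
   then show ?thesis using m by simp
  next
   case False
   have "(\<lambda>_. 0) : rh (\<nu> (gcomp (glead d L N m) p)) (gcomp (glead d L N m) (p + 1))"
    using zero_rhom[OF nu_fmod[OF c] c] by (simp add: zero_fun_def)
   then show ?thesis using False by simp
  qed
 next
  show "finite {p. rsp (gcomp (glead d L N m) p) ~= {0}}"
   by (rule finite_subset[of _ "{d, d + 1}"]) (auto simp: glead_def)
  show "gact (glead d L N m) (p + 1) (gact (glead d L N m) p x f) h = 0"
   if "x : rsp (gcomp (glead d L N m) p)" "f : dual A" "h : dual A" for p x f h
  proof (cases "p = d")
   case True
   then show ?thesis by (simp add: g(2))
  next
   case False
   have 0: "tn L 0 h = 0" using tens(4)[OF L rsp_closed(1)[OF L] that(3), of 0] by (simp add: vs_scaleD vs)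
   show ?thesis
   proof (cases "p + 1 = d")
    case True
    then have "gact (glead d L N m) (p + 1) 0 h = 0" using g(1)[of 0 h] 0 lin_0[OF rhomD(1)[OF m]] by simp
    then show ?thesis using False by (simp add: g(2))
   next
    case F2: False
    then show ?thesis by (simp add: g(2))
   qed
  qed
 qed
qed

lemma glead_homI:
 assumes L: "fmod L" and N: "fmod N" and m: "m : rh (\<nu> L) N" and Y: "Y : Ob GM"
  and a: "a : rh L (gcomp Y d)" and b: "b : rh N (gcomp Y (d + 1))"
  and c1: "!!x f. x : rsp L ==> f : dual A ==> b (m (tn L x f)) = gact Y d (a x) f"
  and c2: "!!y f. y : rsp N ==> f : dual A ==> gact Y (d + 1) (b y) f = 0"
 shows "(\<lambda>p. if p = d then a else if p = d + 1 then b else (\<lambda>_. 0)) : Hom GM (glead d L N m) Y"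
  (is "?h : _")
 unfolding grm_hom_iff[OF glead(1)[OF L N m] Y]
proof (intro allI conjI ballI)
 note g = glead[OF L N m]
 have z: "0 : rh (gcomp (glead d L N m) p) (gcomp Y p)" for p by (rule zero_rhom[OF gobD(1)[OF g(1)] gobD(1)[OF Y]])
 fix p
 show "?h p : rh (gcomp (glead d L N m) p) (gcomp Y p)"
  using a b z[of p] by (auto simp: zero_fun_def)
 fix x f assume x: "x : rsp (gcomp (glead d L N m) p)" and f: "f : dual A"
 consider "p = d" | "p = d + 1" | "p ~= d" "p ~= d + 1" by blast
 then show "?h (p + 1) (gact (glead d L N m) p x f) = gact Y p (?h p x) f"
 proof cases
  case 1
  then show ?thesis using x f c1 g(2) by simp
 next
  case 2
  then show ?thesis using x f c2 g(3)[of p d] by simp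
 next
  case 3
  then show ?thesis using g(3)[of p d] gact_zero[OF Y f] lin_0[OF rhomD(1)[OF a]] by simp
 qed
qed

definition gind where
 "gind d P = glead d P (\<nu> P) (idm (rsp (\<nu> P)))"

lemma gind:
 assumes P: "fmod P"
 shows "gind d P : Ob GM" "gcomp (gind d P) d = P" "gcomp (gind d P) (d + 1) = \<nu> P"
  "x : rsp P ==> f : dual A ==> gact (gind d P) d x f = tn P x f"
  "p ~= d ==> p ~= d + 1 ==> gcomp (gind d P) p = zero_rmod"
 using glead[OF P nu_fmod[OF P] idm_rhom[OF nu_fmod[OF P]]] tens(1)[OF P] by (auto simp: gind_def)

lemma gind_hom_eqI:
 assumes P: "fmod P" and Y: "Y : Ob GM" and fg: "f : Hom GM (gind d P) Y" "g : Hom GM (gind d P) Y" and eq: "f d = g d"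
 shows "f = g"
proof
 note G = gind[OF P] and fD = grm_homD[OF fg(1) gind(1)[OF P] Y] and gD = grm_homD[OF fg(2) gind(1)[OF P] Y]
 fix p
 consider "p = d" | "p = d + 1" | "p ~= d" "p ~= d + 1" by blast
 then show "f p = g p"
 proof cases
  case 2
  have "f (d + 1) = g (d + 1)"
  proof (rule nu_ext[OF P])
   show "f (d + 1) : lin s (rsp (\<nu> P)) s (rsp (gcomp Y (d + 1)))" "g (d + 1) : lin s (rsp (\<nu> P)) s (rsp (gcomp Y (d + 1)))"
    using rhomD(1)[OF fD(1)[of "d + 1"]] rhomD(1)[OF gD(1)[of "d + 1"]] by (simp_all add: G)
   fix x h assume "x : rsp P" "h : dual A"
   then show "f (d + 1) (tn P x h) = g (d + 1) (tn P x h)"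
    using fD(2)[of x d h] gD(2)[of x d h] eq by (simp add: G)
  qed
  then show ?thesis using 2 by simp
 next
  case 3
  show ?thesis
   by (rule rhom_eqI[OF fD(1) gD(1)]) (use 3 lin_0[OF rhomD(1)[OF fD(1)]] lin_0[OF rhomD(1)[OF gD(1)]] in "simp add: G")
 qed (use eq in simp)
qed

lemma gind_lift:
 assumes P: "fmod P" and Y: "Y : Ob GM" and a: "a : rh P (gcomp Y d)"
 obtains h where "h : Hom GM (gind d P) Y" "h d = a"
proof -
 note m = nu_map[OF P gobD(1)[OF Y] a] and nP = nu_fmod[OF P]
 let ?b = "gstr Y d o \<nu>m P (gcomp Y d) a"
 have b: "?b : rh (\<nu> P) (gcomp Y (d + 1))" by (rule rhom_comp[OF m(1) gobD(2)[OF Y]])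
 have bt: "?b (tn P x f) = gact Y d (a x) f" if "x : rsp P" "f : dual A" for x f using m(2)[OF that] by (simp add: gact_def)
 have sq: "gstr Y (d + 1) o \<nu>m (\<nu> P) (gcomp Y (d + 1)) ?b = (\<lambda>_. 0)"
  by (rule gstr_sq_zero[OF P gobD(1)[OF Y] gobD(1)[OF Y] b gobD(2)[OF Y]])
   (use bt gact_gact[OF Y rhomD(2)[OF a]] in "simp add: gact_def")
 have c2: "gact Y (d + 1) (?b y) f = 0" if "y : rsp (\<nu> P)" "f : dual A" for y f
  using fun_cong[OF sq, of "tn (\<nu> P) y f"] nu_map(2)[OF nP gobD(1)[OF Y] b that] by (simp add: gact_def)
 have c1: "?b (idm (rsp (\<nu> P)) (tn P x f)) = gact Y d (a x) f" if "x : rsp P" "f : dual A" for x f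
  using bt[OF that] tens(1)[OF P that] by simp
 have h: "(\<lambda>p. if p = d then a else if p = d + 1 then ?b else (\<lambda>_. 0)) : Hom GM (gind d P) Y"
  unfolding gind_def by (rule glead_homI[OF P nP idm_rhom[OF nP] Y a b c1 c2])
 show ?thesis by (rule that[OF h]) simp
qed

text \<open>Morphisms from P \<leadsto> \<nu>(P) to Y are the same as homomorphisms from P to the component of Y in the degree of P
 (gind_hom_eqI, gind_lift).\<close>

lemma gind_projective:
 assumes "projective (modA s A) P"
 shows "projective GM (gind d P)"
proof -
 have P: "fmod P" using assms by (simp add: projective_def)
 note G = gind[OF P]
 show ?thesis unfolding projective_def
 proof (intro conjI G(1) ballI allI impI)
  fix X Y e g assume X: "X : Ob GM" and Y: "Y : Ob GM" and eg: "epi GM X Y e & g : Hom GM (gind d P) Y"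
  then have e: "e : Hom GM X Y" "!!p. e p ` rsp (gcomp X p) = rsp (gcomp Y p)" and g: "g : Hom GM (gind d P) Y"
   using grm_epi_iff_surj[OF X Y] by auto
  have gd: "g d : rh P (gcomp Y d)" using grm_homD(1)[OF g G(1) Y, of d] by (simp add: G)
  obtain a where a: "a : rh P (gcomp X d)" "e d o a = g d"
   by (rule projective_lift[OF assms gobD(1)[OF X] gobD(1)[OF Y] grm_homD(1)[OF e(1) X Y] e(2) gd]) (rule that)
  obtain h where h: "h : Hom GM (gind d P) X" "h d = a" by (rule gind_lift[OF P X a(1)]) (rule that)
  have "Cmp GM e h = g"
   by (rule gind_hom_eqI[OF P Y hf_category.cmp_in[OF hf_category_grm G(1) X Y h(1) e(1)] g]) (simp add: h a)
  then show "\<exists>h\<in>Hom GM (gind d P) X. Cmp GM e h = g" using h(1) by blast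
 qed
qed

text \<open>Only finitely many components are nonzero; they are covered one after the other.\<close>

lemma ex_gcover:
 assumes N: "N : Ob GM"
 shows "\<exists>Y h. projective GM Y & epi GM Y N h"
proof -
 have step: "\<exists>Y h. projective GM Y & Y : Ob GM & h : Hom GM Y N & (\<forall>d\<in>D. rsp (gcomp N d) \<subseteq> h d ` rsp (gcomp Y d))" if "finite D" for D
  using that
 proof (induction D rule: finite_induct)
  case empty
  obtain F \<pi> where "free F" by (rule ex_free_cover[OF fmod_zero])
  then have "projective GM (gind 0 F)" "gind 0 F : Ob GM" using gind_projective free_projective gind(1) free_fmod by auto
  moreover have "0 : Hom GM (gind 0 F) N"
   by (rule subspaceD(1)[OF vector_space_fscale[OF vector_space_fscale[OF vs]] grm_hom_sub]) fact+
  ultimately show ?case by blast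
 next
  case (insert d D)
  then obtain Y h where Y: "projective GM Y" "Y : Ob GM" "h : Hom GM Y N" "!!e. e : D ==> rsp (gcomp N e) \<subseteq> h e ` rsp (gcomp Y e)" by auto
  obtain F \<pi> where F: "free F" "\<pi> : rh F (gcomp N d)" "\<pi> ` rsp F = rsp (gcomp N d)" by (rule ex_free_cover[OF gobD(1)[OF N]])
  note Fm = free_fmod[OF F(1)] and FO = gind(1)[OF free_fmod[OF F(1)], of d]
  obtain k where k: "k : Hom GM (gind d F) N" "k d = \<pi>" by (rule gind_lift[OF Fm N F(2)]) (rule that)
  obtain S i p j q where S: "S : Ob GM" "i : Hom GM Y S" "p : Hom GM S Y" "j : Hom GM (gind d F) S" "q : Hom GM S (gind d F)"
   "!!e. biprod (gcomp S e) (gcomp Y e) (gcomp (gind d F) e) (i e) (p e) (j e) (q e)"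
   by (rule ex_gbiprod[OF Y(2) FO]) (rule that)
  interpret G: hf_category s GM by (rule hf_category_grm)
  have SP: "projective GM S"
   by (rule G.projective_direct_sum[OF gbiprod_direct_sum[OF S(1) Y(2) FO S(2-6)] S(1) Y(1) gind_projective[OF free_projective[OF F(1)]]])
  have b: "x : rsp (gcomp Y e) ==> p e (i e x) = x & q e (i e x) = 0" "y : rsp (gcomp (gind d F) e) ==> q e (j e y) = y & p e (j e y) = 0" for e x y
   using S(6)[of e] by (auto simp: biprod_def)
  define m where "m = Cmp GM h p + Cmp GM k q"
  have m: "m : Hom GM S N"
   unfolding m_def by (rule G.hom_closed(2)[OF S(1) N G.cmp_in[OF S(1) Y(2) N S(3) Y(3)] G.cmp_in[OF S(1) FO N S(5) k(1)]])
  have mi: "m e (i e x) = h e x" if "x : rsp (gcomp Y e)" for e x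
   using b(1)[OF that] lin_0[OF rhomD(1)[OF grm_homD(1)[OF k(1) FO N]]] by (simp add: m_def)
  have mj: "m e (j e x) = k e x" if "x : rsp (gcomp (gind d F) e)" for e x
   using b(2)[OF that] lin_0[OF rhomD(1)[OF grm_homD(1)[OF Y(3,2) N]]] by (simp add: m_def)
  have "rsp (gcomp N e) \<subseteq> m e ` rsp (gcomp S e)" if e: "e : insert d D" for e
  proof
   fix z assume z: "z : rsp (gcomp N e)"
   show "z : m e ` rsp (gcomp S e)"
   proof (cases "e = d")
    case True
    then obtain x where x: "x : rsp F" "z = k e x" using F(3) z k(2) by auto
    then have "x : rsp (gcomp (gind d F) e)" using True by (simp add: gind(2)[OF Fm])
    then show ?thesis using mj x(2) grm_homD(3)[OF S(4) FO S(1)] by (metis image_eqI)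
   next
    case False
    then obtain x where "x : rsp (gcomp Y e)" "z = h e x" using Y(4)[of e] e z by auto
    then show ?thesis using mi grm_homD(3)[OF S(2) Y(2) S(1)] by (metis image_eqI)
   qed
  qed
  then show ?case using SP S(1) m by blast
 qed
 obtain Y h where Y: "projective GM Y" "Y : Ob GM" "h : Hom GM Y N" "\<forall>d\<in>{p. rsp (gcomp N p) ~= {0}}. rsp (gcomp N d) \<subseteq> h d ` rsp (gcomp Y d)"
  using step[OF gobD(3)[OF N]] by blast
 note hD = grm_homD[OF Y(3,2) N]
 have "h d ` rsp (gcomp Y d) = rsp (gcomp N d)" for d
 proof
  show "h d ` rsp (gcomp Y d) \<subseteq> rsp (gcomp N d)" using hD(3) by auto
  show "rsp (gcomp N d) \<subseteq> h d ` rsp (gcomp Y d)"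
   using Y(4) subspaceD(1)[OF vs image_submodule(1)[OF hD(1) gobD(1)[OF Y(2)]]] by (cases "rsp (gcomp N d) = {0}") auto
 qed
 then have "epi GM Y N h" using grm_epi_iff_surj[OF Y(2) N] Y(3) by blast
 then show ?thesis using Y(1) by blast
qed

lemma grm_proj_presI:
 assumes X1: "projective GM X1" and X0: "projective GM X0" and N: "N : Ob GM" and g: "g : Hom GM X1 X0" and pi: "\<pi> : Hom GM X0 N"
  and su: "!!p. \<pi> p ` rsp (gcomp X0 p) = rsp (gcomp N p)"
  and ex: "!!p. g p ` rsp (gcomp X1 p) = {x : rsp (gcomp X0 p). \<pi> p x = 0}"
 shows "hf_category.proj_pres GM X1 X0 N g \<pi>"
proof -
 interpret G: hf_category s GM by (rule hf_category_grm)
 have O: "X1 : Ob GM" "X0 : Ob GM" using X1 X0 by (auto simp: projective_def)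
 have z: "0 : Hom GM X1 N" by (rule G.hom_closed(1)[OF O(1) N])
 have gx: "g p x : rsp (gcomp X0 p) & \<pi> p (g p x) = 0" if "x : rsp (gcomp X1 p)" for p x using ex[of p] that by blast
 have 0: "Cmp GM \<pi> g = 0"
  by (rule grm_hom_eqI[OF G.cmp_in[OF O N g pi] z O(1) N N]) (simp add: gx)
 have fac: "\<exists>f\<in>Hom GM N N'. Cmp GM f \<pi> = h" if N': "N' : Ob GM" and h: "h : Hom GM X0 N'" "Cmp GM h g = 0" for N' h
 proof -
  have "h p x = 0" if x: "x : rsp (gcomp X0 p)" "\<pi> p x = 0" for p x
  proof -
   have "x : g p ` rsp (gcomp X1 p)" unfolding ex using x by simp
   then obtain y where "x = g p y" by blast
   then show ?thesis using fun_cong[OF fun_cong[OF h(2), of p], of y] by simp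
  qed
  then show ?thesis using grm_factor[OF O(2) N N' pi su h(1)] by simp
 qed
 have lift: "\<exists>l\<in>Hom GM Y X1. k = Cmp GM g l" if Y: "projective GM Y" and k: "k : Hom GM Y X0" "Cmp GM \<pi> k = 0" for Y k
 proof -
  have YO: "Y : Ob GM" using Y by (simp add: projective_def)
  define K where "K = (\<lambda>p. {x : rsp (gcomp X0 p). \<pi> p x = 0})"
  have K: "gsubmodule X0 K" unfolding K_def by (rule gsubmodule_ker[OF O(2) N pi])
  note S = gsub[OF O(2) K]
  have g': "g : Hom GM X1 (gsub X0 K)" by (rule gsub_factor[OF O(2) K O(1) g]) (use gx in "auto simp: K_def")
  have e: "epi GM X1 (gsub X0 K) g" using grm_epi_iff_surj[OF O(1) S(1)] g' ex S(2) by (simp add: K_def)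
  have "k : Hom GM Y (gsub X0 K)"
  proof (rule gsub_factor[OF O(2) K YO k(1)])
   fix p x assume "x : rsp (gcomp Y p)"
   then show "k p x : K p" using grm_homD(3)[OF k(1) YO O(2)] fun_cong[OF fun_cong[OF k(2), of p], of x] by (simp add: K_def)
  qed
  then show ?thesis using G.projectiveD[OF Y e O(1) S(1)] by metis
 qed
 show ?thesis unfolding G.proj_pres_def
  using X1 X0 N g 0 fac lift grm_epi_iff_surj[OF O(2) N] pi su by blast
qed

lemma enough_projectives_grm: "enough_projectives s GM"
proof (intro enough_projectives.intro enough_projectives_axioms.intro hf_category_grm)
 interpret G: hf_category s GM by (rule hf_category_grm)
 fix N assume N: "N : Ob GM"
 obtain X0 \<pi> where X0: "projective GM X0" "epi GM X0 N \<pi>" using ex_gcover[OF N] by blast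
 have O: "X0 : Ob GM" using X0 by (simp add: projective_def)
 have pi: "\<pi> : Hom GM X0 N" "!!p. \<pi> p ` rsp (gcomp X0 p) = rsp (gcomp N p)" using grm_epi_iff_surj[OF O N] X0(2) by auto
 define K where "K = (\<lambda>p. {x : rsp (gcomp X0 p). \<pi> p x = 0})"
 have K: "gsubmodule X0 K" unfolding K_def by (rule gsubmodule_ker[OF O N pi(1)])
 note S = gsub[OF O K]
 obtain X1 g where X1: "projective GM X1" "epi GM X1 (gsub X0 K) g" using ex_gcover[OF S(1)] by blast
 have O1: "X1 : Ob GM" using X1 by (simp add: projective_def)
 have g: "g : Hom GM X1 (gsub X0 K)" "!!p. g p ` rsp (gcomp X1 p) = K p" using grm_epi_iff_surj[OF O1 S(1)] X1(2) S(2) by auto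
 define g' where "g' = Cmp GM (\<lambda>p. idm (K p)) g"
 have g': "g' : Hom GM X1 X0" unfolding g'_def by (rule G.cmp_in[OF O1 S(1) O g(1) gsub_incl[OF O K]])
 have "g' p x = g p x" if "x : rsp (gcomp X1 p)" for p x
 proof -
  have "g p x : K p" using g(2)[of p] that by blast
  then show ?thesis by (simp add: g'_def)
 qed
 then have "g' p ` rsp (gcomp X1 p) = K p" for p using g(2)[of p] by (metis (mono_tags, lifting) image_cong)
 then have "G.proj_pres X1 X0 N g' \<pi>" by (intro grm_proj_presI[OF X1(1) X0(1) N g' pi]) (simp add: K_def)
 then show "\<exists>X1 X0 g \<pi>. G.proj_pres X1 X0 N g \<pi>" by blast
next
 interpret G: hf_category s GM by (rule hf_category_grm)
 fix X1 X0 g assume X: "projective GM X1" "projective GM X0" and g: "g : Hom GM X1 X0"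
 have O: "X1 : Ob GM" "X0 : Ob GM" using X by (auto simp: projective_def)
 obtain Q \<pi> where Q: "Q : Ob GM" "\<pi> : Hom GM X0 Q" "!!p. \<pi> p ` rsp (gcomp X0 p) = rsp (gcomp Q p)"
  "!!p x. x : rsp (gcomp X0 p) ==> \<pi> p x = 0 \<longleftrightarrow> x : g p ` rsp (gcomp X1 p)"
  by (rule ex_gquotient[OF O(2) gsubmodule_image[OF O g]]) (rule that)
 have "g p ` rsp (gcomp X1 p) = {x : rsp (gcomp X0 p). \<pi> p x = 0}" for p
  using Q(4) grm_homD(3)[OF g O] by auto
 then have "G.proj_pres X1 X0 Q g \<pi>" by (intro grm_proj_presI[OF X Q(1) g Q(2,3)])
 then show "\<exists>N \<pi>. G.proj_pres X1 X0 N g \<pi>" by blast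
qed

end

section \<open>The Nakayama functor on projective modules\<close>

context fd_algebra
begin

definition DA where "DA = \<lparr>rsp = dual A, ract = dual_ract A\<rparr>"

abbreviation "ms \<equiv> (fscale (*) :: 'k => ('a => 'k) => 'a => 'k)"

lemma DA_simps [simp]: "rsp DA = dual A" "ract DA = dual_ract A"
 by (auto simp: DA_def)

lemma vs_dual: "vector_space ms" by (rule vector_space_fscale[OF vector_space_mult])

lemma DA_rmod: "is_rmod ms A DA"
 by (rule is_rmodI) (auto simp: dual_sub dual_ract_in dual_ract_simps)

lemma DA_fd: "fin_dim ms (rsp DA)"
 unfolding DA_simps dual_def by (rule fin_dim_lin[OF vsA vector_space_mult fdA fin_dim_field])

lemma dual_separates: "a : acar A ==> (!!f. f : dual A ==> f a = 0) ==> a = 0"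
proof -
 assume a: "a : acar A" and z: "!!f. f : dual A ==> f a = 0"
 obtain B c where B: "finite B" "B \<subseteq> acar A" "!!b. b : B ==> c b : lin (ascl A) (acar A) (*) UNIV"
  "!!x. x : acar A ==> (\<Sum>b\<in>B. ascl A (c b x) b) = x" by (rule dual_basis[OF vsA fdA]) (rule that)
 have "(\<Sum>b\<in>B. ascl A (c b a) b) = 0"
  by (rule sum.neutral) (use z[unfolded dual_def, OF B(3)] vs_scaleD(6)[OF vsA] in auto)
 then show "a = 0" using B(4)[OF a] by simp
qed

text \<open>For an endomorphism \<phi>, the map f \<mapsto> \<phi>(f)(1) is a linear form on DA, hence evaluation at an element of A.\<close>

lemma dual_endo:
 assumes phi: "\<phi> : mhom ms ms A DA DA"
 obtains a where "a : acar A" "!!f. f : dual A ==> \<phi> f = dual_lact A a f"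
proof -
 obtain B c where B: "finite B" "B \<subseteq> acar A" "!!b. b : B ==> c b : lin (ascl A) (acar A) (*) UNIV"
  "!!x. x : acar A ==> (\<Sum>b\<in>B. ascl A (c b x) b) = x" by (rule dual_basis[OF vsA fdA]) (rule that)
 have cd: "c b : dual A" if "b : B" for b using B(3)[OF that] by (simp add: dual_def)
 note pl = mhomD(1)[OF phi, simplified]
 define a where "a = (\<Sum>b\<in>B. ascl A (\<phi> (c b) (aone A)) b)"
 have a: "a : acar A" unfolding a_def by (rule subspace_sum[OF vsA asub]) (use B(2) acar_closed(3) in auto)
 have fexp: "f x = (\<Sum>b\<in>B. k b * f b)" if f: "f : dual A" and x: "x = (\<Sum>b\<in>B. ascl A (k b) b)" for f x k
 proof -
  have "f (\<Sum>b\<in>B. ascl A (k b) b) = (\<Sum>b\<in>B. f (ascl A (k b) b))"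
   by (rule lin_sum[OF dual_lin[OF f] vsA asub]) (use B acar_closed(3) in auto)
  also have "... = (\<Sum>b\<in>B. k b * f b)" by (rule sum.cong) (use B linD(3)[OF dual_lin[OF f]] in auto)
  finally show ?thesis using x by simp
 qed
 have 1: "\<phi> f (aone A) = f a" if f: "f : dual A" for f
 proof -
  have fe: "f = (\<Sum>b\<in>B. fscale (*) (f b) (c b))"
  proof
   fix y
   have "(\<Sum>b\<in>B. fscale (*) (f b) (c b)) y = (\<Sum>b\<in>B. f b * c b y)" by (induction B rule: infinite_finite_induct) (auto simp: fscale_def)
   also have "... = f y"
    using fexp[OF f B(4)[symmetric], of y] dual_out[OF f, of y] dual_out[OF cd, of _ y] by (cases "y : acar A") (auto simp: mult.commute)
   finally show "f y = (\<Sum>b\<in>B. fscale (*) (f b) (c b)) y" by simp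
  qed
  have "\<phi> (\<Sum>b\<in>B. fscale (*) (f b) (c b)) = (\<Sum>b\<in>B. \<phi> (fscale (*) (f b) (c b)))"
   by (rule lin_sum[OF pl vs_dual dual_sub]) (use cd dual_closed(3) in auto)
  also have "... = (\<Sum>b\<in>B. fscale (*) (f b) (\<phi> (c b)))" by (rule sum.cong) (use linD(3)[OF pl] cd in auto)
  finally have "\<phi> f = (\<Sum>b\<in>B. fscale (*) (f b) (\<phi> (c b)))" using fe by simp
  moreover have "(\<Sum>b\<in>S. fscale (*) (f b) (\<phi> (c b))) y = (\<Sum>b\<in>S. f b * \<phi> (c b) y)" for S y
   by (induction S rule: infinite_finite_induct) (auto simp: fscale_def)
  ultimately have "\<phi> f (aone A) = (\<Sum>b\<in>B. f b * \<phi> (c b) (aone A))" by simp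
  also have "... = f a" using fexp[OF f a_def] by (simp add: mult.commute)
  finally show ?thesis .
 qed
 have "\<phi> f = dual_lact A a f" if f: "f : dual A" for f
 proof
  fix x show "\<phi> f x = dual_lact A a f x"
  proof (cases "x : acar A")
   case True
   have "\<phi> f x = dual_ract A (\<phi> f) x (aone A)" using True one_right one_in by (simp add: dual_ract_def)
   also have "... = \<phi> (dual_ract A f x) (aone A)" using mhomD(3)[OF phi, of f x] f True by simp
   also have "... = f (amul A x a)" using 1[OF dual_ract_in[OF f True]] a by (simp add: dual_ract_def)
   finally show ?thesis using True by (simp add: dual_lact_def)
  next
   case False
   then show ?thesis using dual_out[of "\<phi> f"] mhomD(2)[OF phi, of f] f by (simp add: dual_lact_def)
  qed
 qed
 then show ?thesis using a that by blast
qed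

text \<open>Modules P for which the canonical map from P to Hom(DA, \<nu>(P)) is bijective; these include the projective modules.\<close>

definition reflexive where
 "reflexive P \<longleftrightarrow> fmod P & (\<forall>theta\<in>mhom ms s A DA (\<nu> P). \<exists>x\<in>rsp P. \<forall>f\<in>dual A. theta f = tn P x f) \<and>
   (\<forall>x\<in>rsp P. (\<forall>f\<in>dual A. tn P x f = 0) --> x = 0)"

definition inj_mod where
 "inj_mod I \<longleftrightarrow> fmod I & (\<forall>X E j g. fmod X & fmod E & j : rh X E & inj_on j (rsp X) & g : rh X I \<longrightarrow>
   (\<exists>h\<in>rh E I. \<forall>x\<in>rsp X. h (j x) = g x))"

lemma inj_modD: "inj_mod I ==> fmod X ==> fmod E ==> j : rh X E ==> inj_on j (rsp X) ==> g : rh X I ==>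
   \<exists>h\<in>rh E I. \<forall>x\<in>rsp X. h (j x) = g x"
 by (auto simp: inj_mod_def)

text \<open>The isomorphism \<nu>(A) = DA.\<close>

lemma nu_regular:
 assumes G: "regular G \<iota>"
 defines "e0 \<equiv> \<iota> (aone A)"
 obtains r where "r : mhom s ms A (\<nu> G) DA" "!!f. f : dual A ==> r (tn G e0 f) = f" "!!z. z : rsp (\<nu> G) ==> tn G e0 (r z) = z"
  "!!a f. a : acar A ==> f : dual A ==> tn G (\<iota> a) f = tn G e0 (dual_lact A a f)" "e0 : rsp G"
proof -
 have Gm: "fmod G" and il: "\<iota> : lin (ascl A) (acar A) s (rsp G)" and ii: "inj_on \<iota> (acar A)" and im: "\<iota> ` acar A = rsp G"
  and ia: "!!a b. a : acar A ==> b : acar A ==> \<iota> (amul A a b) = ract G (\<iota> a) b"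
  using G by (auto simp: regular_def bij_betw_def)
 have e0: "e0 : rsp G" using im one_in by (auto simp: e0_def)
 have ia1: "ract G e0 a = \<iota> a" if "a : acar A" for a using ia[OF one_in that] one_left[OF that] by (simp add: e0_def)
 have to: "tn G (\<iota> a) f = tn G e0 (dual_lact A a f)" if "a : acar A" "f : dual A" for a f
  using tens(6)[OF Gm e0 that(2,1)] ia1[OF that(1)] by simp
 obtain D e e' where D: "fmod D" "e : mhom ms s A DA D" "e' : mhom s ms A D DA"
  "!!x. x : rsp DA ==> e' (e x) = x" "!!y. y : rsp D ==> e (e' y) = y"
  by (rule ex_copy[OF vs_dual DA_rmod DA_fd]) (rule that)
 define l where "l = lin_inv (acar A) \<iota>"
 have li: "l (\<iota> a) = a" if "a : acar A" for a using lin_inv_simp[OF ii that] by (simp add: l_def)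
 have ll: "l : lin s (rsp G) (ascl A) (acar A)" unfolding l_def by (rule lin_inv_lin[OF il vsA asub ii im])
 note lD = linD[OF ll] and eD = linD[OF mhomD(1)[OF D(2), simplified]]
 let ?be = "\<lambda>x f. e (dual_lact A (l x) f)"
 have dl: "b : acar A ==> dual_lact A (a + b) f = dual_lact A a f + dual_lact A b f" "dual_lact A (ascl A c a) f = fscale (*) c (dual_lact A a f)"
  if "f : dual A" "a : acar A" for a b f c
  using that by (auto simp: dual_lact_def fun_eq_iff fscale_def mul_add_right mul_scl_right mul_in linD[OF dual_lin])
 have dl': "dual_lact A a (f + g) = dual_lact A a f + dual_lact A a g" "dual_lact A a (fscale (*) c f) = fscale (*) c (dual_lact A a f)" for a f g c
  by (auto simp: dual_lact_def fun_eq_iff fscale_def)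
 have b: "balanced s A G (rsp D) ?be"
 proof (rule balancedI)
  fix x f a assume x: "x : rsp G" and f: "f : dual A" and a: "a : acar A"
  obtain b where b: "b : acar A" "x = \<iota> b" using x im by blast
  have "l (ract G x a) = amul A b a" using ia[OF b(1) a, symmetric] b li[OF mul_in[OF b(1) a]] by simp
  moreover have "dual_lact A (amul A b a) f = dual_lact A b (dual_lact A a f)"
   using b(1) a by (auto simp: dual_lact_def fun_eq_iff mul_assoc mul_in)
  ultimately show "?be (ract G x a) f = ?be x (dual_lact A a f)" using b li by simp
 qed (auto simp: eD lD dl dl' dual_lact_in)
 have act: "ract D (?be x f) a = ?be x (dual_ract A f a)" if "x : rsp G" "f : dual A" "a : acar A" for x f a
  using mhomD(3)[OF D(2), of "dual_lact A (l x) f" a] dual_lact_in[OF that(2) lD(1)[OF that(1)]] that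
  by (simp add: dual_ract_simps(7) lD(1))
 define h where "h = bilift G D ?be"
 have hh: "h : rh (\<nu> G) D" unfolding h_def by (rule bilift(1)[OF Gm D(1) b]) (erule (2) act)
 have ht: "h (tn G x f) = ?be x f" if "x : rsp G" "f : dual A" for x f
  unfolding h_def by (rule bilift(2)[OF Gm D(1) b _ that]) (erule (2) act)
 define r where "r = e' o h"
 have r: "r : mhom s ms A (\<nu> G) DA" unfolding r_def by (rule mhom_comp[OF _ D(3)]) (use hh in "simp add: mhom_rhom")
 have one: "dual_lact A (aone A) f = f" if "f : dual A" for f
  using that by (auto simp: dual_lact_def fun_eq_iff one_right dual_out)
 have r1: "r (tn G e0 f) = f" if f: "f : dual A" for f
  using ht[OF e0 f] li[OF one_in] one[OF f] D(4)[of f] f by (simp add: r_def e0_def)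
 have rt: "r (tn G (\<iota> a) f) = dual_lact A a f" if "a : acar A" "f : dual A" for a f
  using to[OF that] r1 dual_lact_in[OF that(2,1)] by simp
 have "(\<lambda>z. if z : rsp (\<nu> G) then tn G e0 (r z) else 0) = idm (rsp (\<nu> G))"
 proof (rule nu_ext[OF Gm])
  note rD = linD[OF mhomD(1)[OF r, simplified]]
  show "(\<lambda>z. if z : rsp (\<nu> G) then tn G e0 (r z) else 0) : lin s (rsp (\<nu> G)) s (rsp (\<nu> G))"
   by (rule linI) (auto simp: rD tens[OF Gm e0] rsp_closed[OF nu_fmod[OF Gm]])
  show "idm (rsp (\<nu> G)) : lin s (rsp (\<nu> G)) s (rsp (\<nu> G))" by (rule rhomD(1)[OF idm_rhom[OF nu_fmod[OF Gm]]])
  fix x f assume x: "x : rsp G" and f: "f : dual A"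
  obtain a where a: "a : acar A" "x = \<iota> a" using x im by blast
  show "(if tn G x f : rsp (\<nu> G) then tn G e0 (r (tn G x f)) else 0) = idm (rsp (\<nu> G)) (tn G x f)"
   using tens(1)[OF Gm x f] rt[OF a(1) f] to[OF a(1) f] a(2) by simp
 qed
 then have "tn G e0 (r z) = z" if "z : rsp (\<nu> G)" for z using fun_cong[of _ _ z] that by fastforce
 then show ?thesis using that r r1 to e0 by blast
qed

lemma reflexive_regular:
 assumes G: "regular G \<iota>" shows "reflexive G"
proof -
 have Gm: "fmod G" and il: "\<iota> : lin (ascl A) (acar A) s (rsp G)" and im: "\<iota> ` acar A = rsp G"
  using G by (auto simp: regular_def bij_betw_def)
 define e0 where "e0 = \<iota> (aone A)"
 obtain r where r: "r : mhom s ms A (\<nu> G) DA" "!!f. f : dual A ==> r (tn G e0 f) = f" "!!z. z : rsp (\<nu> G) ==> tn G e0 (r z) = z"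
  "!!a f. a : acar A ==> f : dual A ==> tn G (\<iota> a) f = tn G e0 (dual_lact A a f)" "e0 : rsp G"
  by (rule nu_regular[OF G, folded e0_def]) (rule that)
 have "\<exists>x\<in>rsp G. \<forall>f\<in>dual A. theta f = tn G x f" if th: "theta : mhom ms s A DA (\<nu> G)" for theta
 proof -
  obtain a where a: "a : acar A" "!!f. f : dual A ==> (r o theta) f = dual_lact A a f"
   by (rule dual_endo[OF mhom_comp[OF th r(1)]]) (rule that)
  have "theta f = tn G (\<iota> a) f" if f: "f : dual A" for f
   using r(3)[OF mhomD(2)[OF th, of f]] a(2)[OF f] r(4)[OF a(1) f] f by simp
  then show ?thesis using a(1) im by blast
 qed
 moreover have "x = 0" if x: "x : rsp G" and z: "\<forall>f\<in>dual A. tn G x f = 0" for x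
 proof -
  obtain a where a: "a : acar A" "x = \<iota> a" using x im by blast
  have "dual_lact A a f = 0" if f: "f : dual A" for f
   using r(2)[OF dual_lact_in[OF f a(1)]] r(4)[OF a(1) f] z a(2) f lin_0[OF mhomD(1)[OF r(1)]] by simp
  then have z1: "dual_lact A a f (aone A) = 0" if "f : dual A" for f using that by simp
  have "f a = 0" if "f : dual A" for f
   using z1[OF that] one_in one_left[OF a(1)] by (simp add: dual_lact_def)
  then have "a = 0" by (rule dual_separates[OF a(1)])
  then show ?thesis using a lin_0[OF il] by simp
 qed
 ultimately show ?thesis using Gm by (simp add: reflexive_def)
qed

text \<open>The homomorphism from Y to \<nu>(A) = DA which corresponds to the linear form l on Y sends y to a \<mapsto> l(y a).\<close>

lemma coinduced:
 assumes G: "regular G \<iota>" and Y: "fmod Y" and l: "\<xi> : lin s (rsp Y) (*) UNIV"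
 defines "c \<equiv> (\<lambda>y. if y : rsp Y then tn G (\<iota> (aone A)) (\<lambda>a. if a : acar A then \<xi> (ract Y y a) else 0) else 0)"
 shows "c : rh Y (\<nu> G)" "y : rsp Y ==> c y = 0 ==> \<xi> y = 0"
proof -
 have Gm: "fmod G" using G by (simp add: regular_def)
 define e0 where "e0 = \<iota> (aone A)"
 obtain r where r: "r : mhom s ms A (\<nu> G) DA" "!!f. f : dual A ==> r (tn G e0 f) = f" "!!z. z : rsp (\<nu> G) ==> tn G e0 (r z) = z"
  "!!a f. a : acar A ==> f : dual A ==> tn G (\<iota> a) f = tn G e0 (dual_lact A a f)" "e0 : rsp G"
  by (rule nu_regular[OF G, folded e0_def]) (rule that)
 define d where "d = (\<lambda>y a. if a : acar A then \<xi> (ract Y y a) else 0)"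
 note lD = linD[OF l] and rY = ract[OF Y]
 have dd: "d y : dual A" if "y : rsp Y" for y
  unfolding dual_def by (rule linI) (use that in "auto simp: d_def rY lD acar_closed")
 have c: "c y = tn G e0 (d y)" if "y : rsp Y" for y using that by (simp add: c_def e0_def d_def)
 have d_add: "d (y + z) = d y + d z" "d (s k y) = fscale (*) k (d y)" if "y : rsp Y" "z : rsp Y" for y z k
  using that by (auto simp: d_def fun_eq_iff rY lD fscale_def)
 show "c : rh Y (\<nu> G)"
 proof (rule rhomI)
  show "c : lin s (rsp Y) s (rsp (\<nu> G))"
   by (rule linI) (auto simp: c rsp_closed[OF Y] d_add tens[OF Gm r(5)] dd, auto simp: c_def)
  fix y a assume y: "y : rsp Y" and a: "a : acar A"
  have "d (ract Y y a) = dual_ract A (d y) a"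
   using y a by (auto simp: d_def dual_ract_def fun_eq_iff rY mul_in)
  then show "c (ract Y y a) = ract (\<nu> G) (c y) a"
   using y a by (simp add: c rY(1) tens_act[OF Gm r(5) dd[OF y] a])
 qed
 show "\<xi> y = 0" if y: "y : rsp Y" and z: "c y = 0"
 proof -
  have "d y = 0" using r(2)[OF dd[OF y]] c[OF y] z lin_0[OF mhomD(1)[OF r(1)]] by simp
  then have "d y (aone A) = 0" by simp
  then show ?thesis using one_in rY(7)[OF y] by (simp add: d_def)
 qed
qed

text \<open>Homomorphisms to \<nu>(A) are linear forms, and these extend from a subspace.\<close>

lemma inj_regular:
 assumes G: "regular G \<iota>" shows "inj_mod (\<nu> G)"
proof -
 have Gm: "fmod G" using G by (simp add: regular_def)
 define e0 where "e0 = \<iota> (aone A)"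
 obtain r where r: "r : mhom s ms A (\<nu> G) DA" "!!f. f : dual A ==> r (tn G e0 f) = f" "!!z. z : rsp (\<nu> G) ==> tn G e0 (r z) = z"
  "!!a f. a : acar A ==> f : dual A ==> tn G (\<iota> a) f = tn G e0 (dual_lact A a f)" "e0 : rsp G"
  by (rule nu_regular[OF G, folded e0_def]) (rule that)
 note rD = linD[OF mhomD(1)[OF r(1), simplified]]
 have "\<exists>h\<in>rh E (\<nu> G). \<forall>x\<in>rsp X. h (j x) = g x"
  if X: "fmod X" and E: "fmod E" and j: "j : rh X E" and inj: "inj_on j (rsp X)" and g: "g : rh X (\<nu> G)" for X E j g
 proof -
  define l0 where "l0 = (\<lambda>x. if x : rsp X then r (g x) (aone A) else 0)"
  have l0: "l0 : lin s (rsp X) (*) UNIV"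
   by (rule linI) (auto simp: l0_def rsp_closed[OF X] linD[OF rhomD(1)[OF g]] rD fscale_def)
  note jX = image_submodule[OF j X]
  obtain rho where rho: "rho : lin s (rsp E) s (j ` rsp X)" "\<forall>v\<in>j ` rsp X. rho v = v"
   using ex_retraction[OF vs jX(1) fmodD(3)[OF E] jX(2)] by blast
  define l where "l = l0 o (lin_inv (rsp X) j o rho)"
  have l: "l : lin s (rsp E) (*) UNIV"
   unfolding l_def by (rule lin_comp[OF lin_comp[OF rho(1) lin_inv_lin[OF rhomD(1)[OF j] vs fmodD(3)[OF X] inj refl]] l0])
  have lj: "l (j x) = l0 x" if "x : rsp X" for x using that rho(2) lin_inv_simp[OF inj that] by (simp add: l_def)
  let ?c = "\<lambda>y. if y : rsp E then tn G (\<iota> (aone A)) (\<lambda>a. if a : acar A then l (ract E y a) else 0) else 0"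
  have "?c (j x) = g x" if x: "x : rsp X" for x
  proof -
   have gx: "g x : rsp (\<nu> G)" by (rule rhomD(2)[OF g x])
   have "(if a : acar A then l (ract E (j x) a) else 0) = r (g x) a" for a
   proof (cases "a : acar A")
    case True
    have "l (ract E (j x) a) = l0 (ract X x a)"
     using rhomD(3)[OF j x True, symmetric] lj[OF ract(1)[OF X x True]] by simp
    also have "... = r (ract (\<nu> G) (g x) a) (aone A)" using ract(1)[OF X x True] rhomD(3)[OF g x True] by (simp add: l0_def)
    also have "... = dual_ract A (r (g x)) a (aone A)" using mhomD(3)[OF r(1) gx True] by simp
    also have "... = r (g x) a" using one_in one_right[OF True] by (simp add: dual_ract_def)
    finally show ?thesis using True by simp
   next
    case False
    then show ?thesis using dual_out[OF rD(1)[OF gx] False] by simp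
   qed
   then have "(\<lambda>a. if a : acar A then l (ract E (j x) a) else 0) = r (g x)" by (simp add: fun_eq_iff)
   then show ?thesis using r(3)[OF gx] rhomD(2)[OF j x] by (simp add: e0_def)
  qed
  then show ?thesis by (intro bexI[OF _ coinduced(1)[OF G E l]] ballI)
 qed
 then show ?thesis using nu_fmod[OF Gm] by (simp add: inj_mod_def)
qed

lemma nu_biprod:
 assumes "biprod S L N i p j q"
 shows "z : rsp (\<nu> S) ==> \<nu>m L S i (\<nu>m S L p z) + \<nu>m N S j (\<nu>m S N q z) = z"
  "x : rsp (\<nu> L) ==> \<nu>m S L p (\<nu>m L S i x) = x" "y : rsp (\<nu> N) ==> \<nu>m S N q (\<nu>m N S j y) = y"
  "x : rsp (\<nu> L) ==> \<nu>m S N q (\<nu>m L S i x) = 0" "y : rsp (\<nu> N) ==> \<nu>m S L p (\<nu>m N S j y) = 0"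
proof -
 have b: "fmod S" "fmod L" "fmod N" "i : rh L S" "p : rh S L" "j : rh N S" "q : rh S N"
  and e: "!!x. x : rsp L ==> p (i x) = x" "!!x. x : rsp L ==> q (i x) = 0" "!!y. y : rsp N ==> q (j y) = y"
  "!!y. y : rsp N ==> p (j y) = 0" "!!z. z : rsp S ==> i (p z) + j (q z) = z"
  using assms by (auto simp: biprod_def)
 have s1: "(i o p) + (j o q) = idm (rsp S)"
  by (rule rhom_eqI[OF rhom_closed(2)[OF b(1,1) rhom_comp[OF b(5,4)] rhom_comp[OF b(7,6)]] idm_rhom[OF b(1)]]) (simp add: e)
 have "(\<nu>m L S i o \<nu>m S L p) + (\<nu>m N S j o \<nu>m S N q) = \<nu>m S S ((i o p) + (j o q))"
  using nu_map_add[OF b(1,1) rhom_comp[OF b(5,4)] rhom_comp[OF b(7,6)]] nu_map_comp[OF b(1,2,1,5,4)] nu_map_comp[OF b(1,3,1,7,6)] by simp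
 then have 1: "(\<nu>m L S i o \<nu>m S L p) + (\<nu>m N S j o \<nu>m S N q) = idm (rsp (\<nu> S))" using s1 nu_map_ident[OF b(1)] by simp
 show "\<nu>m L S i (\<nu>m S L p z) + \<nu>m N S j (\<nu>m S N q z) = z" if "z : rsp (\<nu> S)" using fun_cong[OF 1, of z] that by simp
 have c: "\<nu>m S L' v (\<nu>m L S u x) = \<nu>m L L' (v o u) x" if "fmod L" "fmod L'" "u : rh L S" "v : rh S L'" for L L' u v x
  using nu_map_comp[OF that(1) b(1) that(2-4)] by simp
 have "p o i = idm (rsp L)" by (rule rhom_eqI[OF rhom_comp[OF b(4,5)] idm_rhom[OF b(2)]]) (simp add: e)
 then show "x : rsp (\<nu> L) ==> \<nu>m S L p (\<nu>m L S i x) = x" using c[OF b(2,2,4,5)] nu_map_ident[OF b(2)] by simp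
 have "q o j = idm (rsp N)" by (rule rhom_eqI[OF rhom_comp[OF b(6,7)] idm_rhom[OF b(3)]]) (simp add: e)
 then show "y : rsp (\<nu> N) ==> \<nu>m S N q (\<nu>m N S j y) = y" using c[OF b(3,3,6,7)] nu_map_ident[OF b(3)] by simp
 have "q o i = 0" by (rule rhom_eqI[OF rhom_comp[OF b(4,7)] zero_rhom[OF b(2,3)]]) (simp add: e)
 then show "x : rsp (\<nu> L) ==> \<nu>m S N q (\<nu>m L S i x) = 0" using c[OF b(2,3,4,7)] nu_map_zero[OF b(2,3)] by simp
 have "p o j = 0" by (rule rhom_eqI[OF rhom_comp[OF b(6,5)] zero_rhom[OF b(3,2)]]) (simp add: e)
 then show "y : rsp (\<nu> N) ==> \<nu>m S L p (\<nu>m N S j y) = 0" using c[OF b(3,2,6,5)] nu_map_zero[OF b(3,2)] by simp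
qed

lemma reflexive_biprod:
 assumes "reflexive L" "reflexive N" "biprod S L N i p j q"
 shows "reflexive S"
proof -
 have b: "fmod S" "fmod L" "fmod N" "i : rh L S" "p : rh S L" "j : rh N S" "q : rh S N"
  and e: "!!z. z : rsp S ==> i (p z) + j (q z) = z"
  using assms(3) by (auto simp: biprod_def)
 note nb = nu_biprod[OF assms(3)]
 have "\<exists>x\<in>rsp S. \<forall>f\<in>dual A. theta f = tn S x f" if th: "theta : mhom ms s A DA (\<nu> S)" for theta
 proof -
  have "\<nu>m S L p o theta : mhom ms s A DA (\<nu> L)" "\<nu>m S N q o theta : mhom ms s A DA (\<nu> N)"
   using mhom_comp[OF th nu_map(1)[OF b(1,2,5), folded mhom_rhom]] mhom_comp[OF th nu_map(1)[OF b(1,3,7), folded mhom_rhom]] .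
  then obtain x y where x: "x : rsp L" "\<forall>f\<in>dual A. (\<nu>m S L p o theta) f = tn L x f" and y: "y : rsp N" "\<forall>f\<in>dual A. (\<nu>m S N q o theta) f = tn N y f"
   using assms(1,2) unfolding reflexive_def by blast
  have m: "i x : rsp S" "j y : rsp S" using rhomD(2)[OF b(4) x(1)] rhomD(2)[OF b(6) y(1)] by auto
  have "theta f = tn S (i x + j y) f" if f: "f : dual A" for f
   using nb(1)[OF mhomD(2)[OF th, of f]] f x(2) y(2) nu_map(2)[OF b(2,1,4) x(1) f] nu_map(2)[OF b(3,1,6) y(1) f] tens(2)[OF b(1) m f]
   by simp
  then show ?thesis using rsp_closed(2)[OF b(1) m] by blast
 qed
 moreover have "z = 0" if z: "z : rsp S" and t: "\<forall>f\<in>dual A. tn S z f = 0" for z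
 proof -
  have "tn L (p z) f = 0" "tn N (q z) f = 0" if f: "f : dual A" for f
   using nu_map(2)[OF b(1,2,5) z f] nu_map(2)[OF b(1,3,7) z f] t f lin_0[OF rhomD(1)[OF nu_map(1)[OF b(1,2,5)]]] lin_0[OF rhomD(1)[OF nu_map(1)[OF b(1,3,7)]]]
   by auto
  then have "p z = 0" "q z = 0" using assms(1,2) rhomD(2)[OF b(5) z] rhomD(2)[OF b(7) z] unfolding reflexive_def by blast+
  then show ?thesis using e[OF z] lin_0[OF rhomD(1)[OF b(4)]] lin_0[OF rhomD(1)[OF b(6)]] by simp
 qed
 ultimately show ?thesis using b(1) by (simp add: reflexive_def)
qed

lemma reflexive_retract:
 assumes F: "reflexive F" and P: "fmod P" and i: "i : rh P F" and p: "p : rh F P" and pi: "!!x. x : rsp P ==> p (i x) = x"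
 shows "reflexive P"
proof -
 have Fm: "fmod F" using F by (simp add: reflexive_def)
 note mi = nu_map[OF P Fm i] and mp = nu_map[OF Fm P p]
 have "p o i = idm (rsp P)" by (rule rhom_eqI[OF rhom_comp[OF i p] idm_rhom[OF P]]) (simp add: pi)
 then have npi: "\<nu>m F P p (\<nu>m P F i z) = z" if "z : rsp (\<nu> P)" for z
  using nu_map_comp[OF P Fm P i p] nu_map_ident[OF P] that by (metis comp_apply idm_simp(1))
 have "\<exists>x\<in>rsp P. \<forall>f\<in>dual A. theta f = tn P x f" if th: "theta : mhom ms s A DA (\<nu> P)" for theta
 proof -
  have "\<nu>m P F i o theta : mhom ms s A DA (\<nu> F)" using mhom_comp[OF th mi(1)[folded mhom_rhom]] .
  then obtain x where x: "x : rsp F" "\<forall>f\<in>dual A. (\<nu>m P F i o theta) f = tn F x f" using F unfolding reflexive_def by blast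
  have "theta f = tn P (p x) f" if f: "f : dual A" for f
   using npi[OF mhomD(2)[OF th, of f]] x f mp(2)[OF x(1) f] by simp
  then show ?thesis using rhomD(2)[OF p x(1)] by blast
 qed
 moreover have "x = 0" if x: "x : rsp P" and t: "\<forall>f\<in>dual A. tn P x f = 0" for x
 proof -
  have "tn F (i x) f = 0" if f: "f : dual A" for f using mi(2)[OF x f] t f lin_0[OF rhomD(1)[OF mi(1)]] by simp
  then have "i x = 0" using F rhomD(2)[OF i x] unfolding reflexive_def by blast
  then show ?thesis using pi[OF x] lin_0[OF rhomD(1)[OF p]] by simp
 qed
 ultimately show ?thesis using P by (simp add: reflexive_def)
qed

lemma free_reflexive: "free F ==> reflexive F"
 by (induction rule: free.induct) (auto intro: reflexive_regular reflexive_biprod)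

lemma projective_reflexive:
 assumes "projective (modA s A) P" shows "reflexive P"
proof -
 have P: "fmod P" using assms by (simp add: projective_def)
 obtain F \<pi> where F: "free F" "\<pi> : rh F P" "\<pi> ` rsp F = rsp P" by (rule ex_free_cover[OF P])
 obtain i where i: "i : rh P F" "\<pi> o i = idm (rsp P)"
  by (rule projective_lift[OF assms free_fmod[OF F(1)] P F(2,3) idm_rhom[OF P]])
 show ?thesis
  by (rule reflexive_retract[OF free_reflexive[OF F(1)] P i(1) F(2)]) (use fun_cong[OF i(2)] in simp)
qed

lemma free_inj: "free F ==> inj_mod (\<nu> F)"
proof (induction rule: free.induct)
 case (regular G \<iota>)
 then show ?case by (rule inj_regular)
next
 case (biprod L N S i p j q)
 have b: "fmod S" "fmod L" "fmod N" "i : rh L S" "p : rh S L" "j : rh N S" "q : rh S N"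
  using biprod(3) by (auto simp: biprod_def)
 note nb = nu_biprod[OF biprod(3)] and mi = nu_map(1)[OF b(2,1,4)] and mp = nu_map(1)[OF b(1,2,5)] and mj = nu_map(1)[OF b(3,1,6)] and mq = nu_map(1)[OF b(1,3,7)]
 have "\<exists>h\<in>rh E (\<nu> S). \<forall>x\<in>rsp X. h (k x) = g x"
  if X: "fmod X" and E: "fmod E" and k: "k : rh X E" and inj: "inj_on k (rsp X)" and g: "g : rh X (\<nu> S)" for X E k g
 proof -
  obtain h1 where h1: "h1 : rh E (\<nu> L)" "\<forall>x\<in>rsp X. h1 (k x) = (\<nu>m S L p o g) x"
   using inj_modD[OF biprod.IH(1) X E k inj rhom_comp[OF g mp]] by blast
  obtain h2 where h2: "h2 : rh E (\<nu> N)" "\<forall>x\<in>rsp X. h2 (k x) = (\<nu>m S N q o g) x"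
   using inj_modD[OF biprod.IH(2) X E k inj rhom_comp[OF g mq]] by blast
  have "(\<nu>m L S i o h1) + (\<nu>m N S j o h2) : rh E (\<nu> S)"
   by (rule rhom_closed(2)[OF nu_fmod[OF b(1)] E rhom_comp[OF h1(1) mi] rhom_comp[OF h2(1) mj]])
  moreover have "((\<nu>m L S i o h1) + (\<nu>m N S j o h2)) (k x) = g x" if "x : rsp X" for x
   using h1(2) h2(2) that nb(1)[OF rhomD(2)[OF g that]] by simp
  ultimately show ?thesis by blast
 qed
 then show ?case using nu_fmod[OF b(1)] by (simp add: inj_mod_def)
qed

text \<open>The homomorphisms to \<nu>(A) given by the linear forms of a dual basis separate the elements.\<close>

lemma ex_embedding:
 assumes J: "fmod J"
 obtains F theta where "free F" "theta : rh J (\<nu> F)" "inj_on theta (rsp J)"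
proof -
 obtain G \<iota> where G: "regular G \<iota>" by (rule ex_regular)
 have Gm: "fmod G" using G by (simp add: regular_def)
 have step: "\<exists>F theta. free F & theta : rh J (\<nu> F) & (\<forall>y\<in>rsp J. theta y = 0 --> (\<forall>l\<in>\<Lambda>. l y = 0))"
  if "finite \<Lambda>" "\<Lambda> \<subseteq> lin s (rsp J) (*) UNIV" for \<Lambda> :: "('u => 'k) set"
  using that
 proof (induction \<Lambda> rule: finite_induct)
  case empty
  show ?case using free.regular[OF G] zero_rhom[OF J nu_fmod[OF Gm]] by auto
 next
  case (insert l \<Lambda>)
  then obtain F theta where F: "free F" "theta : rh J (\<nu> F)" "!!y k. y : rsp J ==> theta y = 0 ==> k : \<Lambda> ==> k y = 0" by auto
  have ll: "l : lin s (rsp J) (*) UNIV" using insert.prems by simp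
  obtain c where c: "c : rh J (\<nu> G)" "!!y. y : rsp J ==> c y = 0 ==> l y = 0"
   by (rule that[OF coinduced(1)[OF G J ll]]) (rule coinduced(2)[OF G J ll])
  note Fm = free_fmod[OF F(1)]
  obtain S i p j q where S: "biprod S F G i p j q" by (rule ex_biprod[OF Fm Gm])
  have b: "fmod S" "i : rh F S" "p : rh S F" "j : rh G S" "q : rh S G" using S by (auto simp: biprod_def)
  note nb = nu_biprod[OF S] and mi = nu_map(1)[OF Fm b(1,2)] and mj = nu_map(1)[OF Gm b(1,4)] and mp = nu_map(1)[OF b(1) Fm b(3)] and mq = nu_map(1)[OF b(1) Gm b(5)]
  let ?t = "(\<nu>m F S i o theta) + (\<nu>m G S j o c)"
  have t: "?t : rh J (\<nu> S)" by (rule rhom_closed(2)[OF nu_fmod[OF b(1)] J rhom_comp[OF F(2) mi] rhom_comp[OF c(1) mj]])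
  have "theta y = 0 & c y = 0" if y: "y : rsp J" and z: "?t y = 0" for y
  proof -
   note ty = rhomD(2)[OF F(2) y] and cy = rhomD(2)[OF c(1) y]
   have "\<nu>m S F p (?t y) = theta y" "\<nu>m S G q (?t y) = c y"
    using linD(2)[OF rhomD(1)[OF mp] rhomD(2)[OF mi ty] rhomD(2)[OF mj cy]] linD(2)[OF rhomD(1)[OF mq] rhomD(2)[OF mi ty] rhomD(2)[OF mj cy]]
     nb(2,4)[OF ty] nb(3,5)[OF cy] by simp_all
   then show ?thesis using z lin_0[OF rhomD(1)[OF mp]] lin_0[OF rhomD(1)[OF mq]] by simp
  qed
  then show ?case using free.biprod[OF F(1) free.regular[OF G] S] t F(3) c(2) by blast
 qed
 obtain B c where B: "finite B" "B \<subseteq> rsp J" "!!b. b : B ==> c b : lin s (rsp J) (*) UNIV"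
  "!!x. x : rsp J ==> (\<Sum>b\<in>B. s (c b x) b) = x" by (rule dual_basis[OF vs fmodD(2)[OF J]]) (rule that)
 have "finite (c ` B)" "c ` B \<subseteq> lin s (rsp J) (*) UNIV" using B(1,3) by auto
 from step[OF this] obtain F theta where F: "free F" "theta : rh J (\<nu> F)" "!!y b. y : rsp J ==> theta y = 0 ==> b : B ==> c b y = 0" by blast
 have "y = 0" if y: "y : rsp J" "theta y = 0" for y
 proof -
  have "(\<Sum>b\<in>B. s (c b y) b) = 0" by (rule sum.neutral) (simp add: F(3)[OF y] vs_scaleD vs)
  then show ?thesis using B(4)[OF y(1)] by simp
 qed
 then have "inj_on theta (rsp J)" using lin_inj_iff[OF rhomD(1)[OF F(2)] vs fmodD(3)[OF J]] by blast
 then show ?thesis using F that by blast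
qed

lemma reflexiveD:
 assumes "reflexive P"
 shows "fmod P" "x : rsp P ==> (!!f. f : dual A ==> tn P x f = 0) ==> x = 0"
  "theta : mhom ms s A DA (\<nu> P) ==> \<exists>x\<in>rsp P. \<forall>f\<in>dual A. theta f = tn P x f"
 using assms by (auto simp: reflexive_def)

lemma nu_faithful:
 assumes P: "reflexive P" and L: "fmod L" and a: "a : rh L P" and z: "\<nu>m L P a = 0"
 shows "a = 0"
proof (rule rhom_eqI[OF a zero_rhom[OF L reflexiveD(1)[OF P]]])
 fix x assume x: "x : rsp L"
 show "a x = 0 x"
  using reflexiveD(2)[OF P rhomD(2)[OF a x]] nu_map(2)[OF L reflexiveD(1)[OF P] a x] z by simp
qed

lemma reflexive_unique:
 assumes P: "reflexive P" and "x : rsp P" "y : rsp P" "!!f. f : dual A ==> tn P x f = tn P y f"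
 shows "x = y"
proof -
 note Pm = reflexiveD(1)[OF P]
 have "tn P (x - y) f = 0" if f: "f : dual A" for f
  using tens(2)[OF Pm rsp_closed(4)[OF Pm assms(2,3)] assms(3) f] assms(4)[OF f] by simp
 then have "x - y = 0" by (rule reflexiveD(2)[OF P rsp_closed(4)[OF Pm assms(2,3)]])
 then show ?thesis by simp
qed

text \<open>For fixed x, the map f \<mapsto> b(x \<otimes> f) is a homomorphism from DA to \<nu>(P), hence of the form f \<mapsto> a(x) \<otimes> f.\<close>

lemma nu_full:
 assumes P: "reflexive P" and L: "fmod L" and b: "b : rh (\<nu> L) (\<nu> P)"
 obtains a where "a : rh L P" "\<nu>m L P a = b" "!!x f. x : rsp L ==> f : dual A ==> tn P (a x) f = b (tn L x f)"
proof -
 note Pm = reflexiveD(1)[OF P] and bD = linD[OF rhomD(1)[OF b]]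
 have "\<exists>y. y : rsp P & (\<forall>f\<in>dual A. b (tn L x f) = tn P y f)" if x: "x : rsp L" for x
 proof -
  have "(\<lambda>f. if f : dual A then b (tn L x f) else 0) : mhom ms s A DA (\<nu> P)"
   using x by (auto simp: mhom_def dual_closed tens[OF L] bD dual_ract_in tens_act[OF L, symmetric] rhomD(3)[OF b] intro!: linI)
  from reflexiveD(3)[OF P this] show ?thesis by auto
 qed
 then have "\<forall>x. \<exists>y. x : rsp L --> y : rsp P & (\<forall>f\<in>dual A. b (tn L x f) = tn P y f)" by blast
 then obtain a0 where a0: "\<forall>x. x : rsp L --> a0 x : rsp P & (\<forall>f\<in>dual A. b (tn L x f) = tn P (a0 x) f)" by (rule choice[THEN exE])
 define a where "a = (\<lambda>x. if x : rsp L then a0 x else 0)"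
 have aP: "a x : rsp P" if "x : rsp L" for x using a0 that by (simp add: a_def)
 have at: "tn P (a x) f = b (tn L x f)" if "x : rsp L" "f : dual A" for x f using a0 that by (simp add: a_def)
 have a: "a : rh L P"
 proof (rule rhomI[OF linI])
  fix x y c r assume x: "x : rsp L"
  show "a x : rsp P" by (rule aP[OF x])
  show "a (s c x) = s c (a x)"
   by (rule reflexive_unique[OF P]) (use x in "simp_all add: aP rsp_closed[OF L] rsp_closed[OF Pm] at tens[OF L] tens[OF Pm] bD")
  show "a (x + y) = a x + a y" if y: "y : rsp L"
   by (rule reflexive_unique[OF P]) (use x y in "simp_all add: aP rsp_closed[OF L] rsp_closed[OF Pm] at tens[OF L] tens[OF Pm] bD")
  show "a (ract L x r) = ract P (a x) r" if r: "r : acar A"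
  proof (rule reflexive_unique[OF P aP[OF ract(1)[OF L x r]] ract(1)[OF Pm aP[OF x] r]])
   fix f assume f: "f : dual A"
   show "tn P (a (ract L x r)) f = tn P (ract P (a x) r) f"
    using at[OF ract(1)[OF L x r] f] tens(6)[OF L x f r] tens(6)[OF Pm aP[OF x] f r] at[OF x dual_lact_in[OF f r]] by simp
  qed
 qed (simp add: a_def)
 have "\<nu>m L P a = b" by (rule nu_map_eqI[OF L Pm a rhomD(1)[OF b]]) (simp add: at)
 then show ?thesis using that a at by blast
qed

end

section \<open>Hereditary algebras\<close>

text \<open>
 The last assumption says that Ext^1(Z, I) \<rightarrow> Ext^1(Z, J) is surjective for every epimorphism I \<rightarrow> J: an extension E of
 Z = E/J by J comes from an extension E' of Z by I. In other words, Ext^2 vanishes.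
\<close>

locale hereditary_algebra = fd_algebra s A for s :: "'k::field => 'u::ab_group_add => 'u" and A :: "('k, 'a::ab_group_add) kalg" +
 assumes ext_lift: "fmod J ==> fmod E ==> fmod I ==> j : rh J E ==> inj_on j (rsp J) ==> q : rh I J ==> q ` rsp I = rsp J ==>
  \<exists>E' i g. fmod E' & i : rh I E' & inj_on i (rsp I) & g : rh E' E & g ` rsp E' = rsp E & (\<forall>x\<in>rsp I. g (i x) = j (q x)) \<and>
   (\<forall>y\<in>rsp E'. g y : j ` rsp J --> y : i ` rsp I)"
begin

text \<open>The extension P of P/K by K comes from an extension E by a free module F which covers K. The epimorphism E \<rightarrow> P splits;
 the splitting maps K to F, and so makes K a direct factor of F.\<close>

lemma submodule_projective:
 assumes P: "projective (modA s A) P" and K: "fmod K" and k: "\<kappa> : rh K P" "inj_on \<kappa> (rsp K)"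
 shows "projective (modA s A) K"
proof -
 have Pm: "fmod P" using P by (simp add: projective_def)
 obtain F q where F: "free F" "q : rh F K" "q ` rsp F = rsp K" by (rule ex_free_cover[OF K])
 note Fm = free_fmod[OF F(1)]
 obtain E i g where E: "fmod E" "i : rh F E" "inj_on i (rsp F)" "g : rh E P" "g ` rsp E = rsp P" "\<forall>x\<in>rsp F. g (i x) = \<kappa> (q x)"
  "\<forall>y\<in>rsp E. g y : \<kappa> ` rsp K --> y : i ` rsp F"
  using ext_lift[OF K Pm Fm k F(2,3)] by blast
 obtain sigma where sg: "sigma : rh P E" "g o sigma = idm (rsp P)" by (rule projective_lift[OF P E(1) Pm E(4,5) idm_rhom[OF Pm]])
 define r where "r = lin_inv (rsp F) i o (sigma o \<kappa>)"
 define F' where "F' = \<lparr>rsp = i ` rsp F, ract = ract E\<rparr>"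
 note im = image_submodule[OF E(2) Fm]
 have F': "fmod F'" unfolding F'_def by (rule fmod_sub[OF E(1) im])
 have iF: "i : rh F F'" by (rule rhomI[OF lin_mono[OF rhomD(1)[OF E(2)]]]) (use rhomD(3)[OF E(2)] in "auto simp: F'_def")
 have inF: "sigma (\<kappa> x) : i ` rsp F" if x: "x : rsp K" for x
 proof -
  have "g (sigma (\<kappa> x)) = \<kappa> x" using fun_cong[OF sg(2), of "\<kappa> x"] rhomD(2)[OF k(1) x] by simp
  then show ?thesis using E(7) rhomD(2)[OF sg(1) rhomD(2)[OF k(1) x]] x by simp
 qed
 have sk: "sigma o \<kappa> : rh K F'"
  by (rule rhomI[OF lin_mono[OF rhomD(1)[OF rhom_comp[OF k(1) sg(1)]]]])
   (use inF rhomD(3)[OF rhom_comp[OF k(1) sg(1)]] in "auto simp: F'_def")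
 have r: "r : rh K F" unfolding r_def
  by (rule rhom_comp[OF sk rhom_inverse[OF Fm F' iF E(3)]]) (simp add: F'_def)
 have "q (r x) = x" if x: "x : rsp K" for x
 proof -
  obtain y where y: "y : rsp F" "sigma (\<kappa> x) = i y" using inF[OF x] by blast
  have "r x = y" using y lin_inv_simp[OF E(3)] by (simp add: r_def)
  moreover have "\<kappa> (q y) = \<kappa> x"
   using E(6) y fun_cong[OF sg(2), of "\<kappa> x"] rhomD(2)[OF k(1) x] by simp
  then have "q y = x" using inj_onD[OF k(2)] rhomD(2)[OF F(2) y(1)] x by blast
  ultimately show ?thesis by simp
 qed
 then have "q o r = idm (rsp K)" by (intro rhom_eqI[OF rhom_comp[OF r F(2)] idm_rhom[OF K]]) simp
 then show ?thesis
  using hf_category.projective_retract[OF hf_category_modA free_projective[OF F(1)], of K r q] K r F(2) by simp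
qed

text \<open>The extension E by J comes from an extension by I. The latter splits, and hence so does the former.\<close>

lemma quotient_injective:
 assumes I: "inj_mod I" and J: "fmod J" and q: "q : rh I J" "q ` rsp I = rsp J" and E: "fmod E" and j: "j : rh J E" "inj_on j (rsp J)"
 obtains rho where "rho : rh E J" "!!x. x : rsp J ==> rho (j x) = x"
proof -
 have Im: "fmod I" using I by (simp add: inj_mod_def)
 obtain E' i g where E': "fmod E'" "i : rh I E'" "inj_on i (rsp I)" "g : rh E' E" "g ` rsp E' = rsp E" "\<forall>x\<in>rsp I. g (i x) = j (q x)"
  "\<forall>y\<in>rsp E'. g y : j ` rsp J --> y : i ` rsp I"
  using ext_lift[OF J E Im j q] by blast
 obtain r where r: "r : rh E' I" "\<forall>x\<in>rsp I. r (i x) = idm (rsp I) x" using inj_modD[OF I Im E'(1-3) idm_rhom[OF Im]] by blast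
 have ker: "(q o r) y = 0" if y: "y : rsp E'" "g y = 0" for y
 proof -
  have "g y : j ` rsp J" using y(2) lin_0[OF rhomD(1)[OF j(1)]] rsp_closed(1)[OF J] by (metis imageI)
  then obtain x where x: "x : rsp I" "y = i x" using E'(7) y(1) by blast
  have "j (q x) = j 0" using E'(6) x y(2) lin_0[OF rhomD(1)[OF j(1)]] by simp
  then have "q x = 0" using inj_onD[OF j(2)] rhomD(2)[OF q(1) x(1)] rsp_closed(1)[OF J] by blast
  then show ?thesis using r(2) x by simp
 qed
 obtain rho where rho: "rho : rh E J" "!!y. y : rsp E' ==> rho (g y) = (q o r) y"
  by (rule rhom_factor[OF E'(1) E J E'(4,5) rhom_comp[OF r(1) q(1)] ker]) (assumption, assumption, rule that)
 have "rho (j z) = z" if "z : rsp J" for z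
 proof -
  obtain x where x: "x : rsp I" "z = q x" using q(2) \<open>z : rsp J\<close> by blast
  have "j z = g (i x)" using E'(6) x by simp
  then show ?thesis using rho(2)[OF rhomD(2)[OF E'(2) x(1)]] r(2) x by simp
 qed
 then show ?thesis using rho(1) that by blast
qed

text \<open>A quotient J of \<nu>(L) is injective, hence a direct factor of some \<nu>(F) with F free; as \<nu> is fully faithful on
 projective modules, the idempotent which cuts out J comes from an idempotent of F.\<close>

lemma quotient_of_nu:
 assumes L: "fmod L" and J: "fmod J" and q: "q : rh (\<nu> L) J" "q ` rsp (\<nu> L) = rsp J"
 obtains P \<alpha> \<beta> where "projective (modA s A) P" "\<alpha> : rh (\<nu> P) J" "\<beta> : rh J (\<nu> P)"
  "!!x. x : rsp J ==> \<alpha> (\<beta> x) = x" "!!y. y : rsp (\<nu> P) ==> \<beta> (\<alpha> y) = y"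
  "!!E j. fmod E ==> j : rh J E ==> inj_on j (rsp J) ==> \<exists>rho\<in>rh E J. \<forall>x\<in>rsp J. rho (j x) = x"
proof -
 obtain F0 \<pi> where F0: "free F0" "\<pi> : rh F0 L" "\<pi> ` rsp F0 = rsp L" by (rule ex_free_cover[OF L])
 note F0m = free_fmod[OF F0(1)]
 note np = nu_map(1)[OF F0m L F0(2)] nu_map_surj[OF F0m L F0(2,3)]
 have q'1: "q o \<nu>m F0 L \<pi> : rh (\<nu> F0) J" by (rule rhom_comp[OF np(1) q(1)])
 have q'2: "(q o \<nu>m F0 L \<pi>) ` rsp (\<nu> F0) = rsp J" unfolding image_comp[symmetric] np(2) q(2) ..
 have split: "\<exists>rho\<in>rh E J. \<forall>x\<in>rsp J. rho (j x) = x" if "fmod E" "j : rh J E" "inj_on j (rsp J)" for E j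
  by (rule quotient_injective[OF free_inj[OF F0(1)] J q'1 q'2 that]) blast
 obtain F theta where F: "free F" "theta : rh J (\<nu> F)" "inj_on theta (rsp J)" by (rule ex_embedding[OF J])
 note Fm = free_fmod[OF F(1)] and Fr = free_reflexive[OF F(1)]
 obtain rho where rho: "rho : rh (\<nu> F) J" "!!x. x : rsp J ==> rho (theta x) = x" using split[OF nu_fmod[OF Fm] F(2,3)] by blast
 obtain a where a: "a : rh F F" "\<nu>m F F a = theta o rho" by (rule nu_full[OF Fr Fm rhom_comp[OF rho(1) F(2)]])
 have "theta o rho o (theta o rho) = theta o rho"
  by (rule rhom_eqI[OF rhom_comp[OF rhom_comp[OF rho(1) F(2)] rhom_comp[OF rho(1) F(2)]] rhom_comp[OF rho(1) F(2)]])
   (simp add: rho(2) rhomD(2)[OF rho(1)])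
 then have idem: "\<nu>m F F (a o a) = \<nu>m F F a" using nu_map_comp[OF Fm Fm Fm a(1) a(1)] a(2) by simp
 have aa: "a (a x) = a x" if x: "x : rsp F" for x
 proof (rule reflexive_unique[OF Fr rhomD(2)[OF a(1) rhomD(2)[OF a(1) x]] rhomD(2)[OF a(1) x]])
  fix f assume f: "f : dual A"
  show "tn F (a (a x)) f = tn F (a x) f"
   using nu_map(2)[OF Fm Fm rhom_comp[OF a(1) a(1)] x f] nu_map(2)[OF Fm Fm a(1) x f] idem by simp
 qed
 define P where "P = \<lparr>rsp = a ` rsp F, ract = ract F\<rparr>"
 note im = image_submodule[OF a(1) Fm]
 have P: "fmod P" unfolding P_def by (rule fmod_sub[OF Fm im])
 have aP: "a : rh F P" by (rule rhomI[OF lin_mono[OF rhomD(1)[OF a(1)]]]) (use rhomD(3)[OF a(1)] in "auto simp: P_def")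
 define i where "i = idm (rsp P)"
 have i: "i : rh P F" unfolding i_def by (rule rhomI[OF idm_lin[OF fmodD(3)[OF P] vs]]) (use im ract(1)[OF P] in "auto simp: P_def")
 have ai: "a (i x) = x" if "x : rsp P" for x using that aa by (auto simp: P_def i_def)
 have ia: "i (a x) = a x" if "x : rsp F" for x using that by (auto simp: P_def i_def)
 have api: "a o i = idm (rsp P)" by (rule rhom_eqI[OF rhom_comp[OF i aP] idm_rhom[OF P]]) (simp add: ai)
 have ipa: "i o a = a" by (rule rhom_eqI[OF rhom_comp[OF aP i] a(1)]) (simp add: ia)
 have PP: "projective (modA s A) P"
  using hf_category.projective_retract[OF hf_category_modA free_projective[OF F(1)], of P i a] P i aP api by simp
 note ni = nu_map(1)[OF P Fm i] and na = nu_map(1)[OF Fm P aP]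
 define \<alpha> where "\<alpha> = rho o \<nu>m P F i"
 define \<beta> where "\<beta> = \<nu>m F P a o theta"
 have n1: "\<nu>m P F i (\<nu>m F P a z) = theta (rho z)" for z
  using nu_map_comp[OF Fm P Fm aP i] ipa a(2) by (metis comp_apply)
 have n2: "\<nu>m F P a (\<nu>m P F i y) = y" if "y : rsp (\<nu> P)" for y
  using nu_map_comp[OF P Fm P i aP] api nu_map_ident[OF P] that by (metis comp_apply idm_simp(1))
 have ab: "\<alpha> (\<beta> x) = x" if x: "x : rsp J" for x using rho(2)[OF x] by (simp add: \<alpha>_def \<beta>_def n1)
 have ba: "\<beta> (\<alpha> y) = y" if y: "y : rsp (\<nu> P)" for y
 proof -
  have "\<beta> (\<alpha> y) = \<nu>m F P a (\<nu>m P F i (\<nu>m F P a (\<nu>m P F i y)))" by (simp add: \<alpha>_def \<beta>_def n1)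
  then show ?thesis using n2[OF y] by simp
 qed
 show ?thesis
  by (rule that[OF PP _ _ ab ba split]) (use rhom_comp[OF ni rho(1)] rhom_comp[OF F(2) na] in "simp_all only: \<alpha>_def \<beta>_def")
qed

section \<open>The category HQ inside graded modules\<close>

definition hqm where
 "hqm P1 P0 f = glead 0 P1 (\<nu> P0) (\<nu>m P1 P0 f)"

lemma hqm:
 assumes "fmod P1" "fmod P0" "f : rh P1 P0"
 shows "hqm P1 P0 f : Ob GM" "gcomp (hqm P1 P0 f) 0 = P1" "gcomp (hqm P1 P0 f) 1 = \<nu> P0"
  "p ~= 0 ==> p ~= 1 ==> gcomp (hqm P1 P0 f) p = zero_rmod"
  "x : rsp P1 ==> g : dual A ==> gact (hqm P1 P0 f) 0 x g = tn P0 (f x) g" "p ~= 0 ==> gact (hqm P1 P0 f) p x g = 0"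
proof -
 note g = glead[OF assms(1) nu_fmod[OF assms(2)] nu_map(1)[OF assms], where d = 0]
 show "hqm P1 P0 f : Ob GM" unfolding hqm_def by (rule g(1))
 show "gcomp (hqm P1 P0 f) 0 = P1" "gcomp (hqm P1 P0 f) 1 = \<nu> P0" "p ~= 0 ==> p ~= 1 ==> gcomp (hqm P1 P0 f) p = zero_rmod"
  by (simp_all add: hqm_def glead_def)
 show "gact (hqm P1 P0 f) 0 x g = tn P0 (f x) g" if "x : rsp P1" "g : dual A"
  unfolding hqm_def g(2) by (rule nu_map(2)[OF assms that])
 show "gact (hqm P1 P0 f) p x g = 0" if "p ~= 0" unfolding hqm_def by (rule g(3)[OF that])
qed

lemma stalk:
 assumes "fmod M"
 shows "stalk M : Ob GM" "gcomp (stalk M) 0 = M" "p ~= 0 ==> gcomp (stalk M) p = zero_rmod" "gact (stalk M) p x g = 0"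
proof -
 have z: "(\<lambda>_. 0) : rh (\<nu> M) zero_rmod" using zero_rhom[OF nu_fmod[OF assms] fmod_zero] by (simp add: zero_fun_def)
 note g = glead[OF assms fmod_zero z]
 show "stalk M : Ob GM" unfolding stalk_def leadsto_glead by (rule g(1))
 show "gact (stalk M) p x g = 0" unfolding stalk_def leadsto_glead by (cases "p = 0") (simp_all add: g(2,3))
qed (auto simp: stalk_def leadsto_def)

lemma stalk_hom_eqI:
 assumes M: "fmod M" and N: "N : Ob GM" and fg: "f : Hom GM N (stalk M)" "g : Hom GM N (stalk M)" "f 0 = g 0"
 shows "f = g"
proof (rule grm_hom_eqI[OF fg(1,2) N stalk(1)[OF M] stalk(1)[OF M]])
 fix p x assume x: "x : rsp (gcomp N p)"
 show "f p x = g p x"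
  using grm_homD(3)[OF fg(1) N stalk(1)[OF M] x] grm_homD(3)[OF fg(2) N stalk(1)[OF M] x] fg(3) stalk(3)[OF M, of p]
  by (cases "p = 0") auto
qed

abbreviation "deg0 h \<equiv> (\<lambda>p :: int. if p = 0 then h else (\<lambda>_. 0 :: 'u))"

lemma deg0_hom:
 assumes P: "fmod P1" "fmod P0" "f : rh P1 P0" and M: "fmod M" and h: "h : rh P1 M"
 shows "deg0 h : Hom GM (hqm P1 P0 f) (stalk M)"
proof -
 have z: "(\<lambda>_. 0) : rh (\<nu> P0) (gcomp (stalk M) (0 + 1))"
  using zero_rhom[OF nu_fmod[OF P(2)] fmod_zero] stalk(3)[OF M, of 1] by (simp add: zero_fun_def)
 have h': "h : rh P1 (gcomp (stalk M) 0)" using h stalk(2)[OF M] by simp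
 have "(\<lambda>p. if p = 0 then h else if p = 0 + 1 then (\<lambda>_. 0) else (\<lambda>_. 0)) : Hom GM (hqm P1 P0 f) (stalk M)"
  unfolding hqm_def
  by (rule glead_homI[OF P(1) nu_fmod[OF P(2)] nu_map(1)[OF P] stalk(1)[OF M] h' z]) (auto simp: stalk(4)[OF M])
 moreover have "(\<lambda>p. if p = 0 then h else if p = 0 + 1 then (\<lambda>_. 0) else (\<lambda>_. 0)) = deg0 h" by (auto simp: fun_eq_iff)
 ultimately show ?thesis by simp
qed

lemma stalk_hom_deg0:
 assumes P: "fmod P1" "fmod P0" "f : rh P1 P0" and M: "fmod M" and u: "u : Hom GM (hqm P1 P0 f) (stalk M)"
 shows "u 0 : rh P1 M" "u = deg0 (u 0)"
proof -
 show "u 0 : rh P1 M" using grm_homD(1)[OF u hqm(1)[OF P] stalk(1)[OF M], of 0] by (simp add: hqm(2)[OF P] stalk(2)[OF M])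
 then show "u = deg0 (u 0)" by (intro stalk_hom_eqI[OF M hqm(1)[OF P] u deg0_hom[OF P M]]) auto
qed

text \<open>The epimorphism from F \<leadsto> \<nu>(F) to M through which all morphisms from projectives factor.\<close>

lemma stalk_cover:
 assumes M: "fmod M"
 obtains F \<pi> rho where "free F" "\<pi> : rh F M" "rho : Hom GM (gind 0 F) (stalk M)" "rho 0 = \<pi>"
  "!!Y w. projective GM Y ==> w : Hom GM Y (stalk M) ==> \<exists>w'\<in>Hom GM Y (gind 0 F). Cmp GM rho w' = w"
proof -
 obtain F \<pi> where F: "free F" "\<pi> : rh F M" "\<pi> ` rsp F = rsp M" by (rule ex_free_cover[OF M])
 note Fm = free_fmod[OF F(1)] and S = stalk[OF M]
 have "\<pi> : rh F (gcomp (stalk M) 0)" using F(2) S(2) by simp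
 then obtain rho where r: "rho : Hom GM (gind 0 F) (stalk M)" "rho 0 = \<pi>" by (rule gind_lift[OF Fm S(1)])
 note G = gind[OF Fm, where d = 0]
 have "rho p ` rsp (gcomp (gind 0 F) p) = rsp (gcomp (stalk M) p)" for p
 proof (cases "p = 0")
  case True
  then show ?thesis using F(3) r(2) G(2) S(2) by simp
 next
  case False
  then have z: "rsp (gcomp (stalk M) p) = {0}" using S(3) by simp
  then have "rho p ` rsp (gcomp (gind 0 F) p) \<subseteq> {0}" using grm_homD(3)[OF r(1) G(1) S(1)] by blast
  moreover have "0 : rho p ` rsp (gcomp (gind 0 F) p)"
   by (rule subspaceD(1)[OF vs image_submodule(1)[OF grm_homD(1)[OF r(1) G(1) S(1)] gobD(1)[OF G(1)]]])
  ultimately have "rho p ` rsp (gcomp (gind 0 F) p) = {0}" by (simp only: subset_singleton_iff) (metis empty_iff)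
  then show ?thesis unfolding z .
 qed
 then have e: "epi GM (gind 0 F) (stalk M) rho" unfolding grm_epi_iff_surj[OF G(1) S(1)] using r(1) by simp
 show ?thesis
  by (rule that[OF F(1,2) r]) (rule hf_category.projectiveD[OF hf_category_grm _ e G(1) S(1)])
qed

text \<open>The component \<nu>(P0) \<rightarrow> \<nu>(F) of a morphism from P1 \<leadsto> \<nu>(P0) to F \<leadsto> \<nu>(F) is \<nu>(b), and then b \<circ> f is its component in
 degree 0. Conversely, f defines a morphism to the projective object P0 \<leadsto> \<nu>(P0).\<close>

lemma factor_iff:
 assumes P: "projective (modA s A) P1" "projective (modA s A) P0" "f : rh P1 P0" and M: "fmod M" and h: "h : rh P1 M"
 shows "(\<exists>Y a w. projective GM Y & a : Hom GM (hqm P1 P0 f) Y & w : Hom GM Y (stalk M) & deg0 h = Cmp GM w a) \<longleftrightarrow>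
  h : (\<lambda>g. g o f) ` rh P0 M" (is "?L \<longleftrightarrow> ?R")
proof
 have Pm: "fmod P1" "fmod P0" using P by (auto simp: projective_def)
 note X = hqm[OF Pm P(3)] and S = stalk[OF M]
 interpret G: hf_category s GM by (rule hf_category_grm)
 {
  assume ?L
  then obtain Y a w where Y: "projective GM Y" "a : Hom GM (hqm P1 P0 f) Y" "w : Hom GM Y (stalk M)" "deg0 h = Cmp GM w a" by blast
  have YO: "Y : Ob GM" using Y by (simp add: projective_def)
  obtain F \<pi> rho where F: "free F" "\<pi> : rh F M" "rho : Hom GM (gind 0 F) (stalk M)" "rho 0 = \<pi>"
   "!!Y w. projective GM Y ==> w : Hom GM Y (stalk M) ==> \<exists>w'\<in>Hom GM Y (gind 0 F). Cmp GM rho w' = w"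
   by (rule stalk_cover[OF M]) (rule that)
  note Fm = free_fmod[OF F(1)] and Fr = free_reflexive[OF F(1)]
  note I = gind[OF Fm, where d = 0]
  obtain w' where w': "w' : Hom GM Y (gind 0 F)" "Cmp GM rho w' = w" using F(5)[OF Y(1,3)] by blast
  define t where "t = Cmp GM w' a"
  have t: "t : Hom GM (hqm P1 P0 f) (gind 0 F)" unfolding t_def by (rule G.cmp_in[OF X(1) YO I(1) Y(2) w'(1)])
  have ht: "h = \<pi> o t 0"
  proof
   fix x
   have "h x = w 0 (a 0 x)" using fun_cong[OF fun_cong[OF Y(4), of 0], of x] by simp
   then show "h x = (\<pi> o t 0) x" unfolding w'(2)[symmetric] t_def by (simp add: F(4))
  qed
  note tD = grm_homD[OF t X(1) I(1)]
  have t0: "t 0 : rh P1 F" using tD(1)[of 0] by (simp add: X(2) I(2))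
  have t1: "t 1 : rh (\<nu> P0) (\<nu> F)" using tD(1)[of 1] I(3) by (simp add: X(3))
  obtain b where b: "b : rh P0 F" "!!x g. x : rsp P0 ==> g : dual A ==> tn F (b x) g = t 1 (tn P0 x g)"
   by (rule nu_full[OF Fr Pm(2) t1]) (rule that)
  have "b (f x) = t 0 x" if x: "x : rsp P1" for x
  proof (rule reflexive_unique[OF Fr rhomD(2)[OF b(1) rhomD(2)[OF P(3) x]] rhomD(2)[OF t0 x]])
   fix g assume g: "g : dual A"
   show "tn F (b (f x)) g = tn F (t 0 x) g"
    using b(2)[OF rhomD(2)[OF P(3) x] g] tD(2)[of x 0 g] x g by (simp add: X(2,5) I(4) rhomD(2)[OF t0])
  qed
  then have "b o f = t 0" by (intro rhom_eqI[OF rhom_comp[OF P(3) b(1)] t0]) simp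
  then have "h = (\<pi> o b) o f" using ht by (simp add: comp_assoc)
  then show ?R using rhom_comp[OF b(1) F(2)] by blast
 }
 assume ?R
 then obtain g where g: "g : rh P0 M" "h = g o f" by blast
 note I = gind[OF Pm(2), where d = 0] and nP = nu_fmod[OF Pm(2)]
 have a: "(\<lambda>p. if p = 0 then f else if p = 0 + 1 then idm (rsp (\<nu> P0)) else (\<lambda>_. 0)) : Hom GM (hqm P1 P0 f) (gind 0 P0)" (is "?a : _")
  unfolding hqm_def
 proof (rule glead_homI[OF Pm(1) nP nu_map(1)[OF Pm P(3)] I(1)])
  show "f : rh P1 (gcomp (gind 0 P0) 0)" "idm (rsp (\<nu> P0)) : rh (\<nu> P0) (gcomp (gind 0 P0) (0 + 1))"
   using P(3) idm_rhom[OF nP] I(2,3) by auto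
  show "idm (rsp (\<nu> P0)) (\<nu>m P1 P0 f (tn P1 x k)) = gact (gind 0 P0) 0 (f x) k" if "x : rsp P1" "k : dual A" for x k
   using that nu_map(2)[OF Pm P(3)] I(4) rhomD(2)[OF P(3)] tens(1)[OF Pm(2)] by simp
  show "gact (gind 0 P0) (0 + 1) (idm (rsp (\<nu> P0)) z) k = 0" for z k
   using glead(3)[OF Pm(2) nP idm_rhom[OF nP], of "0 + 1" 0] by (simp add: gind_def)
 qed
 have "g : rh P0 (gcomp (stalk M) 0)" using g(1) S(2) by simp
 then obtain w where w: "w : Hom GM (gind 0 P0) (stalk M)" "w 0 = g" by (rule gind_lift[OF Pm(2) S(1)])
 have "deg0 h = Cmp GM w ?a"
  by (rule stalk_hom_eqI[OF M X(1) deg0_hom[OF Pm P(3) M h] G.cmp_in[OF X(1) I(1) S(1) a w(1)]]) (simp add: w g)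
 then show ?L using gind_projective[OF P(2)] a w(1) by blast
qed

text \<open>Let J be the image of the structure map \<nu>(N^0) \<rightarrow> N^1. It is a quotient of \<nu>(N^0), hence isomorphic to
 \<nu>(P0) for a projective P0 and a direct factor of N^1; and \<nu>(N^0) \<rightarrow> J comes from a homomorphism f : N^0 \<rightarrow> P0.
 The image R of f is projective, hence a direct factor of N^0. So R \<leadsto> \<nu>(P0) is a direct factor of N.\<close>

lemma hqm_retract:
 assumes N: "N : Ob GM"
 obtains R P f \<Phi> \<Psi> where "projective (modA s A) R" "projective (modA s A) P" "f : rh R P" "inj_on f (rsp R)"
  "\<nu>m R P f ` rsp (\<nu> R) = rsp (\<nu> P)" "\<Phi> : Hom GM N (hqm R P f)" "\<Psi> : Hom GM (hqm R P f) N" "Cmp GM \<Phi> \<Psi> = Ident GM (hqm R P f)"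
  "!!x g. x : rsp (gcomp N 0) ==> \<Phi> 0 x = 0 ==> g : dual A ==> gact N 0 x g = 0"
proof -
 define L where "L = gcomp N 0"
 define E where "E = gcomp N 1"
 have L: "fmod L" and E: "fmod E" using gobD(1)[OF N] by (auto simp: L_def E_def)
 define m where "m = gstr N 0"
 have m: "m : rh (\<nu> L) E" using gobD(2)[OF N, of 0] by (simp add: m_def L_def E_def)
 have gm: "gact N 0 x g = m (tn L x g)" for x g by (simp add: gact_def m_def L_def)
 define J where "J = \<lparr>rsp = m ` rsp (\<nu> L), ract = ract E\<rparr>"
 note im = image_submodule[OF m nu_fmod[OF L]]
 have J: "fmod J" unfolding J_def by (rule fmod_sub[OF E im])
 have mJ: "m : rh (\<nu> L) J" by (rule rhomI[OF lin_mono[OF rhomD(1)[OF m]]]) (use rhomD(3)[OF m] in "auto simp: J_def")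
 define \<iota> where "\<iota> = idm (rsp J)"
 have io: "\<iota> : rh J E" unfolding \<iota>_def by (rule rhomI[OF idm_lin[OF fmodD(3)[OF J] vs]]) (use im ract(1)[OF J] in "auto simp: J_def")
 have mJs: "m ` rsp (\<nu> L) = rsp J" by (simp add: J_def)
 obtain P \<alpha> \<beta> where P: "projective (modA s A) P" "\<alpha> : rh (\<nu> P) J" "\<beta> : rh J (\<nu> P)"
  "!!x. x : rsp J ==> \<alpha> (\<beta> x) = x" "!!y. y : rsp (\<nu> P) ==> \<beta> (\<alpha> y) = y"
  "!!E j. fmod E ==> j : rh J E ==> inj_on j (rsp J) ==> \<exists>rho\<in>rh E J. \<forall>x\<in>rsp J. rho (j x) = x"
  by (rule quotient_of_nu[OF L J mJ mJs]) (rule that)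
 have Pm: "fmod P" using P(1) by (simp add: projective_def)
 note Pr = projective_reflexive[OF P(1)] and nP = nu_fmod[OF Pm]
 have "inj_on \<iota> (rsp J)" by (auto simp: \<iota>_def inj_on_def)
 then obtain rho where rho: "rho : rh E J" "!!x. x : rsp J ==> rho (\<iota> x) = x" using P(6)[OF E io] by blast
 obtain f0 where f0: "f0 : rh L P" "\<nu>m L P f0 = \<beta> o m" "!!x g. x : rsp L ==> g : dual A ==> tn P (f0 x) g = (\<beta> o m) (tn L x g)"
  by (rule nu_full[OF Pr L rhom_comp[OF mJ P(3)]]) (rule that)
 define R where "R = \<lparr>rsp = f0 ` rsp L, ract = ract P\<rparr>"
 note imR = image_submodule[OF f0(1) L]
 have R: "fmod R" unfolding R_def by (rule fmod_sub[OF Pm imR])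
 define f where "f = idm (rsp R)"
 have f: "f : rh R P" unfolding f_def by (rule rhomI[OF idm_lin[OF fmodD(3)[OF R] vs]]) (use imR ract(1)[OF R] in "auto simp: R_def")
 have finj: "inj_on f (rsp R)" by (auto simp: f_def inj_on_def)
 have RP: "projective (modA s A) R" by (rule submodule_projective[OF P(1) R f finj])
 have fR: "f0 : rh L R" by (rule rhomI[OF lin_mono[OF rhomD(1)[OF f0(1)]]]) (use rhomD(3)[OF f0(1)] in "auto simp: R_def")
 obtain sigma where sg: "sigma : rh R L" "f0 o sigma = idm (rsp R)" by (rule projective_lift[OF RP L R fR _ idm_rhom[OF R]]) (simp add: R_def)
 have fs: "f0 (sigma x) = x" if "x : rsp R" for x using fun_cong[OF sg(2), of x] that by simp
 have ff: "f o f0 = f0" by (rule rhom_eqI[OF rhom_comp[OF fR f] f0(1)]) (simp add: f_def rhomD(2)[OF fR])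
 have bm: "\<beta> (m z) = \<nu>m R P f (\<nu>m L R f0 z)" for z
  using nu_map_comp[OF L R Pm fR f] ff f0(2) by (metis comp_apply)
 have mz: "m z : rsp J" if "z : rsp (\<nu> L)" for z using rhomD(2)[OF mJ that] .
 have nsurj: "\<nu>m R P f ` rsp (\<nu> R) = rsp (\<nu> P)"
 proof
  show "\<nu>m R P f ` rsp (\<nu> R) \<subseteq> rsp (\<nu> P)" by (rule image_submodule(2)[OF nu_map(1)[OF R Pm f] nu_fmod[OF R]])
  show "rsp (\<nu> P) \<subseteq> \<nu>m R P f ` rsp (\<nu> R)"
  proof
   fix y assume y: "y : rsp (\<nu> P)"
   obtain z where z: "z : rsp (\<nu> L)" "\<alpha> y = m z" using rhomD(2)[OF P(2) y] mJs by blast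
   have "y = \<nu>m R P f (\<nu>m L R f0 z)" using P(5)[OF y] z bm by simp
   then show "y : \<nu>m R P f ` rsp (\<nu> R)" using rhomD(2)[OF nu_map(1)[OF L R fR] z(1)] by blast
  qed
 qed
 let ?X = "hqm R P f"
 note X = hqm[OF R Pm f]
 have O: "?X : Ob GM" by (rule X(1))
 \<comment> \<open>the projection to the direct factor and its section\<close>
 define \<Phi> where "\<Phi> = (\<lambda>p :: int. if p = 0 then f0 else if p = 1 then \<beta> o rho else (\<lambda>_. 0))"
 define \<Psi> where "\<Psi> = (\<lambda>p :: int. if p = 0 then sigma else if p = 0 + 1 then \<iota> o \<alpha> else (\<lambda>_. 0))"
 have rm: "rho (m z) = m z" if "z : rsp (\<nu> L)" for z using rho(2)[OF mz[OF that]] mz[OF that] by (simp add: \<iota>_def)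
 have Phi: "\<Phi> : Hom GM N ?X"
  unfolding grm_hom_iff[OF N O]
 proof (intro allI conjI ballI)
  fix p :: int
  have c3: "(\<lambda>_. 0) : rh (gcomp N p) zero_rmod" using zero_rhom[OF gobD(1)[OF N] fmod_zero] by (simp add: zero_fun_def)
  show "\<Phi> p : rh (gcomp N p) (gcomp ?X p)"
   using fR rhom_comp[OF rho(1) P(3)] c3 X(2-4) by (auto simp: \<Phi>_def L_def E_def)
  fix x g assume x: "x : rsp (gcomp N p)" and g: "g : dual A"
  consider "p = 0" | "p = -1" | "p ~= 0" "p ~= -1" by blast
  then show "\<Phi> (p + 1) (gact N p x g) = gact ?X p (\<Phi> p x) g"
  proof cases
   case 1
   then have xL: "x : rsp L" using x by (simp add: L_def)
   have "\<beta> (rho (m (tn L x g))) = tn P (f0 x) g" using rm[OF tens(1)[OF L xL g]] f0(3)[OF xL g] by simp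
   then show ?thesis using 1 gm X(5)[OF rhomD(2)[OF fR xL] g] rhomD(2)[OF fR xL] by (simp add: \<Phi>_def f_def)
  next
   case 2
   let ?y = "gact N (-1) x g"
   have x1: "x : rsp (gcomp N (-1))" using x 2 by simp
   have y: "?y : rsp L" using gact(1)[OF N x1 g] by (simp add: L_def)
   have "f0 ?y = 0"
   proof (rule reflexiveD(2)[OF Pr rhomD(2)[OF f0(1) y]])
    fix k assume k: "k : dual A"
    have "m (tn L ?y k) = 0" using gact_gact[OF N x1 g k] gm by simp
    then show "tn P (f0 ?y) k = 0" using f0(3)[OF y k] lin_0[OF rhomD(1)[OF P(3)]] by simp
   qed
   then show ?thesis using 2 X(6) by (simp add: \<Phi>_def)
  next
   case 3
   then show ?thesis using X(6) by (simp add: \<Phi>_def)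
  qed
 qed
 have a0: "\<iota> (\<alpha> y) = \<alpha> y" if "y : rsp (\<nu> P)" for y using rhomD(2)[OF P(2) that] by (simp add: \<iota>_def)
 have Psi: "\<Psi> : Hom GM ?X N"
  unfolding \<Psi>_def hqm_def
 proof (rule glead_homI[OF R nP nu_map(1)[OF R Pm f] N])
  show "sigma : rh R (gcomp N 0)" "\<iota> o \<alpha> : rh (\<nu> P) (gcomp N (0 + 1))" using sg(1) rhom_comp[OF P(2) io] by (auto simp: L_def E_def)
  show "(\<iota> o \<alpha>) (\<nu>m R P f (tn R x g)) = gact N 0 (sigma x) g" if x: "x : rsp R" and g: "g : dual A" for x g
  proof -
   note sx = rhomD(2)[OF sg(1) x]
   have "\<nu>m R P f (tn R x g) = \<beta> (m (tn L (sigma x) g))"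
    using bm[of "tn L (sigma x) g"] nu_map(2)[OF L R fR sx g] fs[OF x] by simp
   moreover have tz: "tn L (sigma x) g : rsp (\<nu> L)" by (rule tens(1)[OF L sx g])
   moreover have "\<iota> (m (tn L (sigma x) g)) = m (tn L (sigma x) g)" using mz[OF tz] by (simp add: \<iota>_def)
   moreover have "\<nu>m R P f (tn R x g) : rsp (\<nu> P)" by (rule rhomD(2)[OF nu_map(1)[OF R Pm f] tens(1)[OF R x g]])
   ultimately show ?thesis using a0 P(4)[OF mz] gm by simp
  qed
  show "gact N (0 + 1) ((\<iota> o \<alpha>) y) g = 0" if y: "y : rsp (\<nu> P)" and g: "g : dual A" for y g
  proof -
   obtain z where z: "z : rsp (\<nu> L)" "\<alpha> y = m z" using rhomD(2)[OF P(2) y] mJs by blast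
   have sq: "\<forall>p. gstr N (p + 1) o \<nu>m (\<nu> (gcomp N p)) (gcomp N (p + 1)) (gstr N p) = (\<lambda>_. 0)"
    using N unfolding grm_def is_gmod_def by simp
   from fun_cong[OF spec[OF sq, of 0], of "tn (\<nu> L) z g"]
   have "gstr N 1 (tn E (m z) g) = 0" using nu_map(2)[OF nu_fmod[OF L] E m z(1) g] by (simp add: L_def E_def m_def)
   then show ?thesis using a0[OF y] z(2) by (simp add: gact_def E_def)
  qed
 qed
 have "Cmp GM \<Phi> \<Psi> = Ident GM ?X"
 proof (rule grm_hom_eqI[OF hf_category.cmp_in[OF hf_category_grm O N O Psi Phi] hf_category.ident_in[OF hf_category_grm O] O O O])
  fix p :: int and x assume x: "x : rsp (gcomp ?X p)"
  consider "p = 0" | "p = 1" | "p ~= 0" "p ~= 1" by blast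
  then show "Cmp GM \<Phi> \<Psi> p x = Ident GM ?X p x"
  proof cases
   case 1
   then show ?thesis using x fs X(2) by (simp add: \<Phi>_def \<Psi>_def)
  next
   case 2
   then have y: "x : rsp (\<nu> P)" using x X(3) by simp
   then show ?thesis using 2 x rho(2)[OF rhomD(2)[OF P(2) y]] P(5)[OF y] by (simp add: \<Phi>_def \<Psi>_def)
  next
   case 3
   then show ?thesis using x X(4) by (simp add: \<Phi>_def)
  qed
 qed
 moreover have "gact N 0 x g = 0" if x: "x : rsp (gcomp N 0)" and z: "\<Phi> 0 x = 0" and g: "g : dual A" for x g
 proof -
  have xL: "x : rsp L" using x by (simp add: L_def)
  have "f0 x = 0" using z by (simp add: \<Phi>_def)
  then have "\<beta> (m (tn L x g)) = 0"
   using f0(3)[OF xL g] tens(4)[OF Pm rsp_closed(1)[OF Pm] g, of 0] by (simp add: vs_scaleD vs)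
  then have "m (tn L x g) = 0" using P(4)[OF mz[OF tens(1)[OF L xL g]]] lin_0[OF rhomD(1)[OF P(2)]] by simp
  then show ?thesis using gm by simp
 qed
 ultimately show ?thesis by (rule that[OF RP P(1) f finj nsurj Phi Psi])
qed

lemma retract_direct_sum:
 assumes N: "N : Ob GM" and X: "X : Ob GM" and p: "p : Hom GM N X" and i: "i : Hom GM X N" and pi: "Cmp GM p i = Ident GM X"
 obtains Z where "Z : Ob GM" "direct_sum GM N X Z" "zero_obj GM Z ==> Cmp GM i p = Ident GM N"
proof -
 interpret G: hf_category s GM by (rule hf_category_grm)
 define K where "K = (\<lambda>d. {x : rsp (gcomp N d). p d x = 0})"
 have K: "gsubmodule N K" unfolding K_def by (rule gsubmodule_ker[OF N X p])
 note S = gsub[OF N K]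
 define j where "j = (\<lambda>d. idm (K d))"
 have j: "j : Hom GM (gsub N K) N" unfolding j_def by (rule gsub_incl[OF N K])
 note ip = G.cmp_in[OF N X N p i]
 define q where "q = Ident GM N + Scl GM (-1) (Cmp GM i p)"
 have q0: "q : Hom GM N N" unfolding q_def by (rule G.hom_closed(2)[OF N N G.ident_in[OF N] G.hom_closed(3)[OF N N ip]])
 have qx: "q d x = x - i d (p d x)" if "x : rsp (gcomp N d)" for d x using that by (simp add: q_def fscale_def vs_scaleD(9)[OF vs])
 have pix: "p d (i d x) = x" if "x : rsp (gcomp X d)" for d x using fun_cong[OF fun_cong[OF pi, of d], of x] that by simp
 note pD = grm_homD[OF p N X] and iD = grm_homD[OF i X N]
 have q: "q : Hom GM N (gsub N K)"
 proof (rule gsub_factor[OF N K N q0])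
  fix d x assume x: "x : rsp (gcomp N d)"
  note m = iD(3)[OF pD(3)[OF x]]
  show "q d x : K d"
   using lin_diff[OF rhomD(1)[OF pD(1)] vs fmodD(3)[OF gobD(1)[OF N]] x m] pix[OF pD(3)[OF x]] rsp_closed(4)[OF gobD(1)[OF N] x m] qx[OF x]
   by (simp add: K_def)
 qed
 have jx: "j d x = x" "x : rsp (gcomp N d)" "p d x = 0" if "x : K d" for d x using that by (simp_all add: j_def K_def)
 have "Cmp GM q j = Ident GM (gsub N K)"
  by (rule grm_hom_eqI[OF G.cmp_in[OF S(1) N S(1) j q] G.ident_in[OF S(1)] S(1) S(1) S(1)])
   (simp add: S(2) jx qx lin_0[OF rhomD(1)[OF iD(1)]])
 moreover have sum: "Cmp GM i p + Cmp GM j q = Ident GM N"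
  by (rule grm_hom_eqI[OF G.hom_closed(2)[OF N N ip G.cmp_in[OF N S(1) N q j]] G.ident_in[OF N] N N N])
   (use grm_homD(3)[OF q N S(1)] jx(1) qx S(2) in simp)
 ultimately have ds: "direct_sum GM N X (gsub N K)" unfolding direct_sum_def using i p j q pi by blast
 show ?thesis
 proof (rule that[OF S(1) ds])
  assume "zero_obj GM (gsub N K)"
  then have "Cmp GM j (Ident GM (gsub N K)) = Cmp GM j 0" by (simp only: zero_obj_def)
  then have "j = 0" using G.ident_right[OF S(1) N j] G.cmp_zero(2)[OF S(1) S(1) N j] by simp
  then have "Cmp GM j q = 0" using G.cmp_zero(1)[OF N S(1) N q] by simp
  then show "Cmp GM i p = Ident GM N" using sum by simp
 qed
qed

text \<open>A factor 0 \<rightarrow> Q of f yields a factor 0 \<rightarrow> \<nu>(Q) of the epimorphism \<nu>(f), so \<nu>(Q) and Q vanish.\<close>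

lemma hqm_in_HQ:
 assumes R: "projective (modA s A) R" and P: "projective (modA s A) P" and f: "f : rh R P" "inj_on f (rsp R)"
  and su: "\<nu>m R P f ` rsp (\<nu> R) = rsp (\<nu> P)"
 shows "(R, P, f) : Ob (HQ s A)"
proof -
 have m: "fmod R" "fmod P" using R P by (auto simp: projective_def)
 have "zero_obj (modA s A) Q"
  if Q: "projective (modA s A) Q" and df: "direct_factor (mor_cat s A) (zero_rmod, Q, \<lambda>_. 0) (R, P, f)" for Q
 proof -
  have Qm: "fmod Q" using Q by (simp add: projective_def)
  obtain b c where b: "b : rh Q P" and c: "c : rh P Q" "c o f = (\<lambda>_. 0)" "c o b = idm (rsp Q)"
   using df by (auto simp: direct_factor_def direct_sum_def mor_cat_def fun_eq_iff)
  have "\<nu>m P Q c o \<nu>m R P f = \<nu>m R Q 0" using nu_map_comp[OF m Qm f(1) c(1)] c(2) by (simp add: zero_fun_def)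
  then have z: "\<nu>m P Q c (\<nu>m R P f y) = 0" for y using nu_map_zero[OF m(1) Qm] by (simp add: fun_eq_iff)
  have "\<nu>m P Q c = 0"
  proof (rule rhom_eqI[OF nu_map(1)[OF m(2) Qm c(1)] zero_rhom[OF nu_fmod[OF m(2)] nu_fmod[OF Qm]]])
   fix y assume "y : rsp (\<nu> P)"
   then obtain w where "y = \<nu>m R P f w" using su by blast
   then show "\<nu>m P Q c y = 0 y" using z by simp
  qed
  then have "c = 0" by (rule nu_faithful[OF projective_reflexive[OF Q] m(2) c(1)])
  then have "idm (rsp Q) = 0" using c(3) by (auto simp: fun_eq_iff)
  then show ?thesis by (simp add: zero_obj_def)
 qed
 then show ?thesis using R P f m by (auto simp: HQ_def full_sub_def in_HQ_def mor_cat_def)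
qed

text \<open>If the direct factor from hqm_retract were zero, DA would annihilate the component of N in degree 0, and therefore its image
 under t. But no nonzero element of F is annihilated by DA in F \<leadsto> \<nu>(F).\<close>

lemma indecomposable_hqm:
 assumes N: "indecomposable GM N" and F: "reflexive F" and t: "t : Hom GM N (gind 0 F)" "t 0 ~= 0"
 obtains R P f where "(R, P, f) : Ob (HQ s A)" "iso_obj GM N (hqm R P f)" "hqm R P f : Ob GM"
proof -
 have NO: "N : Ob GM" using N by (simp add: indecomposable_def)
 obtain R P f \<Phi> \<Psi> where *: "projective (modA s A) R" "projective (modA s A) P" "f : rh R P" "inj_on f (rsp R)"
  "\<nu>m R P f ` rsp (\<nu> R) = rsp (\<nu> P)" "\<Phi> : Hom GM N (hqm R P f)" "\<Psi> : Hom GM (hqm R P f) N" "Cmp GM \<Phi> \<Psi> = Ident GM (hqm R P f)"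
  "!!x g. x : rsp (gcomp N 0) ==> \<Phi> 0 x = 0 ==> g : dual A ==> gact N 0 x g = 0"
  by (rule hqm_retract[OF NO]) (rule that)
 interpret G: hf_category s GM by (rule hf_category_grm)
 have O: "hqm R P f : Ob GM" using hqm(1)[of R P f] * by (auto simp: projective_def)
 note Fm = reflexiveD(1)[OF F]
 note I = gind[OF Fm, where d = 0]
 obtain Z where Z: "Z : Ob GM" "direct_sum GM N (hqm R P f) Z" "zero_obj GM Z ==> Cmp GM \<Psi> \<Phi> = Ident GM N"
  by (rule retract_direct_sum[OF NO O *(6,7,8)]) (rule that)
 have "\<not> zero_obj GM (hqm R P f)"
 proof
  assume "zero_obj GM (hqm R P f)"
  then have "Cmp GM (Ident GM (hqm R P f)) \<Phi> = Cmp GM 0 \<Phi>" by (simp only: zero_obj_def)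
  then have z: "\<Phi> = 0" using G.ident_left[OF NO O *(6)] G.cmp_zero(1)[OF NO O O *(6)] by simp
  note tD = grm_homD[OF t(1) NO I(1)]
  have t0: "t 0 : rh (gcomp N 0) F" using tD(1)[of 0] by (simp add: I(2))
  have "t 0 = 0"
  proof (rule rhom_eqI[OF t0 zero_rhom[OF gobD(1)[OF NO] Fm]])
   fix x assume x: "x : rsp (gcomp N 0)"
   have "tn F (t 0 x) g = 0" if g: "g : dual A" for g
    using tD(2)[OF x g] *(9)[OF x _ g] z I(4)[OF rhomD(2)[OF t0 x] g] lin_0[OF rhomD(1)[OF tD(1)]] by simp
   then show "t 0 x = 0 x" using reflexiveD(2)[OF F rhomD(2)[OF t0 x]] by simp
  qed
  then show False using t(2) by simp
 qed
 then have "zero_obj GM Z" using N O Z(1,2) unfolding indecomposable_def by blast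
 then have "Cmp GM \<Psi> \<Phi> = Ident GM N" by (rule Z(3))
 then have "iso_obj GM N (hqm R P f)" using *(6-8) unfolding iso_obj_def by blast
 then show ?thesis using that hqm_in_HQ[OF *(1-5)] O by blast
qed

end

section \<open>Path algebras\<close>

abbreviation delta :: "'a => 'a => 'k::zero_neq_one" where
 "delta w \<equiv> (\<lambda>w'. if w' = w then 1 else 0)"

locale acyclic_quiver = wf_digraph Q for Q :: "('v, 'e) pre_digraph" +
 assumes finite_paths: "finite (quiver_paths Q)"
begin

abbreviation "Pth \<equiv> quiver_paths Q"

abbreviation KQ :: "('k::field, 'v \<times> 'e list => 'k) kalg" where
 "KQ \<equiv> path_algebra Q"

lemma path_iff: "(u, p) : Pth \<longleftrightarrow> awalk u p (awlast u p)"
 by (auto simp: quiver_paths_def)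

lemma path_simps [simp]: "(u, []) : Pth \<longleftrightarrow> u : verts Q"
 "(u, e # p) : Pth \<longleftrightarrow> e : arcs Q & tail Q e = u & (head Q e, p) : Pth"
 by (auto simp: path_iff awalk_def)

lemma path_append: "(u, p @ q) : Pth \<longleftrightarrow> (u, p) : Pth & (awlast u p, q) : Pth"
 by (simp add: path_iff awlast_append)

lemma path_split: "(u, p) : Pth ==> (u, take i p) : Pth" "(u, p) : Pth ==> (awlast u (take i p), drop i p) : Pth"
 using path_append[of u "take i p" "drop i p"] by auto

lemma path_verts: "(u, p) : Pth ==> u : verts Q" "(u, p) : Pth ==> awlast u p : verts Q"
 by (auto simp: path_iff)

lemma arc_path: "e : arcs Q ==> (tail Q e, [e]) : Pth"
 by simp

lemma finite_verts: "finite (verts Q)"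
proof (rule finite_imageD[of "\<lambda>u. (u, [] :: 'e list)"])
 show "finite ((\<lambda>u. (u, [] :: 'e list)) ` verts Q)" by (rule finite_subset[OF _ finite_paths]) auto
qed (auto simp: inj_on_def)

lemma acar_iff: "x : acar KQ \<longleftrightarrow> {w. x w ~= 0} \<subseteq> Pth"
 using finite_subset[OF _ finite_paths] by (auto simp: path_algebra_def)

lemma acarD: "x : acar KQ ==> w \<notin> Pth ==> x w = 0"
 by (auto simp: acar_iff)

lemma amul_eq: "amul KQ x y (u, p) = (\<Sum>i\<le>length p. x (awlast u (take i p), drop i p) * y (u, take i p))"
 by (simp add: path_algebra_def)

lemma ascl_eq: "ascl KQ = fscale (*)" by (simp add: path_algebra_def)

lemma aone_eq: "aone KQ = (\<lambda>(u, p). if u : verts Q & p = [] then 1 else 0)" by (simp add: path_algebra_def)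

lemma delta_in: "w : Pth ==> delta w : acar KQ"
 by (auto simp: acar_iff)

lemma amul_in: assumes "x : acar KQ" "y : acar KQ" shows "amul KQ x y : acar KQ"
proof -
 have "(u, p) : Pth" if nz: "amul KQ x y (u, p) ~= 0" for u p
 proof -
  obtain i where "x (awlast u (take i p), drop i p) * y (u, take i p) ~= 0"
   using nz unfolding amul_eq by (meson sum.not_neutral_contains_not_neutral)
  then have "(awlast u (take i p), drop i p) : Pth" "(u, take i p) : Pth" using assms by (auto simp: acar_iff)
  then show ?thesis using path_append[of u "take i p" "drop i p"] by simp
 qed
 then show ?thesis by (auto simp: acar_iff)
qed

lemma amul_one: assumes "x : acar KQ" shows "amul KQ (aone KQ) x = x" "amul KQ x (aone KQ) = x"
proof -
 have "amul KQ (aone KQ) x (u, p) = x (u, p)" for u p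
 proof -
  have "amul KQ (aone KQ) x (u, p) = (\<Sum>i\<le>length p. if i = length p then x (u, p) else 0)"
   unfolding amul_eq aone_eq
  proof (rule sum.cong[OF refl])
   fix i assume "i : {..length p}"
   then show "(case (awlast u (take i p), drop i p) of (u, p) => if u : verts Q & p = [] then 1 else 0) * x (u, take i p) =
     (if i = length p then x (u, p) else 0)"
    using acarD[OF assms, of "(u, p)"] path_verts(2)[of u p] by (cases "(u, p) : Pth") auto
  qed
  then show ?thesis by simp
 qed
 then show "amul KQ (aone KQ) x = x" by auto
 have "amul KQ x (aone KQ) (u, p) = x (u, p)" for u p
 proof -
  have "amul KQ x (aone KQ) (u, p) = (\<Sum>i\<le>length p. if i = 0 then x (u, p) else 0)"
   unfolding amul_eq aone_eq
  proof (rule sum.cong[OF refl])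
   fix i assume "i : {..length p}"
   then show "x (awlast u (take i p), drop i p) * (case (u, take i p) of (u, p) => if u : verts Q & p = [] then 1 else 0) =
     (if i = 0 then x (u, p) else 0)"
    using acarD[OF assms, of "(u, p)"] path_verts(1)[of u p] by (cases "(u, p) : Pth") auto
  qed
  then show ?thesis by simp
 qed
 then show "amul KQ x (aone KQ) = x" by auto
qed

text \<open>Both products are the sum over all decompositions of the path into three pieces.\<close>

lemma amul_assoc: "amul KQ (amul KQ a b) x = amul KQ a (amul KQ b x)"
proof
 fix w :: "'v \<times> 'e list"
 obtain u p where w: "w = (u, p)" by (cases w)
 let ?n = "length p"
 define f where "f i j = a (awlast u (take (i + j) p), drop (i + j) p) * b (awlast u (take i p), take j (drop i p)) * x (u, take i p)" for i j
 have aw: "awlast (awlast u (take i p)) (take j (drop i p)) = awlast u (take (i + j) p)" for i j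
  by (simp add: take_add awlast_append)
 have "amul KQ (amul KQ a b) x w = (\<Sum>i\<le>?n. \<Sum>j\<le>?n - i. f i j)"
  unfolding w amul_eq[of "amul KQ a b"] by (simp add: amul_eq sum_distrib_right f_def aw add.commute)
 also have "... = (\<Sum>(i, j)\<in>Sigma {..?n} (\<lambda>i. {..?n - i}). f i j)" by (simp add: sum.Sigma)
 also have "... = (\<Sum>(k, i)\<in>Sigma {..?n} (\<lambda>k. {..k}). f i (k - i))"
  by (rule sum.reindex_bij_witness[of _ "\<lambda>(k, i). (i, k - i)" "\<lambda>(i, j). (i + j, i)"]) auto
 also have "... = (\<Sum>k\<le>?n. \<Sum>i\<le>k. f i (k - i))" by (simp add: sum.Sigma)
 also have "... = amul KQ a (amul KQ b x) w"
  unfolding w amul_eq[of a]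
 proof (rule sum.cong[OF refl])
  fix k assume k: "k : {..?n}"
  show "(\<Sum>i\<le>k. f i (k - i)) = a (awlast u (take k p), drop k p) * amul KQ b x (u, take k p)"
   unfolding amul_eq sum_distrib_left
   by (rule sum.cong) (use k in "auto simp: f_def drop_take mult.assoc min_absorb1 min_absorb2")
 qed
 finally show "amul KQ (amul KQ a b) x w = amul KQ a (amul KQ b x) w" .
qed

lemma fd_path_algebra:
 assumes "infinite_space s"
 shows "fd_algebra s (KQ :: ('k::field, 'v \<times> 'e list => 'k) kalg)"
proof (intro fd_algebra.intro fd_algebra_axioms.intro assms)
 note v = vector_space_fscale[OF vector_space_mult]
 show "vector_space (ascl KQ :: 'k => _)" unfolding ascl_eq by (rule v)
 have "module.subspace (fscale (*)) (acar KQ :: ('v \<times> 'e list => 'k) set)"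
 proof (rule subspaceI[OF v])
  fix x y :: "'v \<times> 'e list => 'k" assume xy: "x : acar KQ" "y : acar KQ"
  have "(x + y) w = 0" if "w \<notin> Pth" for w using acarD[OF xy(1) that] acarD[OF xy(2) that] by simp
  then show "x + y : acar KQ" unfolding acar_iff by blast
 qed (auto simp: acar_iff fscale_def)
 then show "fin_dim (ascl KQ) (acar KQ :: ('v \<times> 'e list => 'k) set)" unfolding ascl_eq
  by (rule fin_dim_eval[OF vector_space_mult _ finite_paths fin_dim_field]) (auto simp: fun_eq_iff dest: acarD)
 show "aone KQ : acar KQ" unfolding acar_iff aone_eq by (auto split: if_splits)
qed (auto simp: amul_in amul_one amul_assoc amul_eq ascl_eq fscale_def fun_eq_iff algebra_simps sum.distrib sum_distrib_left)

text \<open>A pair of composable paths amounts to a path with a position on it.\<close>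

lemma split_sum:
 fixes f :: "'v \<times> 'e list => 'v \<times> 'e list => 'w::comm_monoid_add"
 shows "(\<Sum>(u, r)\<in>Pth. \<Sum>i\<le>length r. f (awlast u (take i r), drop i r) (u, take i r)) =
  (\<Sum>w\<in>Pth. \<Sum>v\<in>{v : Pth. fst v = awlast (fst w) (snd w)}. f v w)"
proof -
 have "(\<Sum>(u, r)\<in>Pth. \<Sum>i\<le>length r. f (awlast u (take i r), drop i r) (u, take i r)) =
  (\<Sum>((u, r), i)\<in>Sigma Pth (\<lambda>x. {..length (snd x)}). f (awlast u (take i r), drop i r) (u, take i r))"
  using sum.Sigma[of Pth "\<lambda>x. {..length (snd x)}" "\<lambda>(u, r) i. f (awlast u (take i r), drop i r) (u, take i r)"]
  by (simp add: finite_paths case_prod_beta)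
 also have "... = (\<Sum>(w, v)\<in>Sigma Pth (\<lambda>w. {v : Pth. fst v = awlast (fst w) (snd w)}). f v w)"
  by (rule sum.reindex_bij_witness[of _ "\<lambda>(w, v). ((fst w, snd w @ snd v), length (snd w))"
     "\<lambda>((u, r), i). ((u, take i r), (awlast u (take i r), drop i r))"])
   (auto simp: path_append path_split)
 also have "... = (\<Sum>w\<in>Pth. \<Sum>v\<in>{v : Pth. fst v = awlast (fst w) (snd w)}. f v w)"
  by (rule sum.Sigma[symmetric]) (auto simp: finite_paths)
 finally show ?thesis .
qed

lemma delta_mul:
 "amul KQ (delta v) (delta w) = (if fst v = awlast (fst w) (snd w) then delta (fst w, snd w @ snd v) else 0 :: _ => 'k::field)"
proof
 fix x :: "'v \<times> 'e list"
 obtain u p where x: "x = (u, p)" by (cases x)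
 let ?c = "u = fst w & p = snd w @ snd v & fst v = awlast (fst w) (snd w)"
 have "amul KQ (delta v) (delta w) x = (\<Sum>i\<le>length p. if i = length (snd w) then (if ?c then 1 else 0) else 0 :: 'k)"
  unfolding x amul_eq
 proof (rule sum.cong[OF refl])
  fix i assume "i : {..length p}"
  then have i: "i \<le> length p" by simp
  have iff: "((awlast u (take i p), drop i p) = v & (u, take i p) = w) \<longleftrightarrow> (i = length (snd w) & ?c)"
   using i by (cases v; cases w) (auto simp: min_def)
  have 1: "(if X then 1 else 0) * (if Y then 1 else 0) = (if X & Y then 1 else 0 :: 'k)" for X Y by simp
  have 2: "(if X then if Y then 1 else 0 else 0) = (if X & Y then 1 else 0 :: 'k)" for X Y by simp
  show "(if (awlast u (take i p), drop i p) = v then 1 else 0) * (if (u, take i p) = w then 1 else 0) =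
    (if i = length (snd w) then (if ?c then 1 else 0) else 0 :: 'k)"
   unfolding 1 2 iff ..
 qed
 also have "... = (if ?c then 1 else 0)"
 proof (cases ?c)
  case True
  then have "length (snd w) \<le> length p" by simp
  then show ?thesis by (simp only: sum.delta[OF finite_atMost] atMost_iff if_True)
 next
  case False
  then show ?thesis unfolding if_not_P[OF False] by (simp only: if_cancel sum.neutral_const)
 qed
 finally show "amul KQ (delta v) (delta w) x = (if fst v = awlast (fst w) (snd w) then delta (fst w, snd w @ snd v) else 0 :: _ => 'k) x"
  unfolding x by (cases "fst v = awlast (fst w) (snd w)"; simp only: simp_thms if_True if_False zero_fun_apply prod.inject; assumption)
qed

end

text \<open>
 Right modules over the path algebra are representations of the quiver: a space with a projection \<epsilon> v for each vertex and a linear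
 map T e for each arc, from the component of the head of e to that of its tail. A path acts as the composition of its arcs.
\<close>

primrec pact :: "('v, 'e) pre_digraph => ('v => 'w => 'w) => ('e => 'w => 'w) => 'e list => 'v => 'w => 'w" where
 "pact Q \<epsilon> T [] u = \<epsilon> u"
| "pact Q \<epsilon> T (e # p) u = T e o pact Q \<epsilon> T p (head Q e)"

definition rep_mod :: "('v, 'e) pre_digraph => ('k => 'w::ab_group_add => 'w) => 'w set => ('v => 'w => 'w) => ('e => 'w => 'w) =>
  ('v \<times> 'e list => 'k, 'w) rmod" where
 "rep_mod Q t V \<epsilon> T = \<lparr>rsp = V, ract = (\<lambda>z a. \<Sum>(u, p)\<in>quiver_paths Q. t (a (u, p)) (pact Q \<epsilon> T p u z))\<rparr>"

locale quiver_rep = acyclic_quiver Q for Q :: "('v, 'e) pre_digraph" +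
 fixes t :: "'k::field => 'w::ab_group_add => 'w" and V \<epsilon> T
 assumes vt: "vector_space t" and subV: "module.subspace t V"
  and eps_lin: "v : verts Q ==> \<epsilon> v : lin t V t V" and T_lin: "e : arcs Q ==> T e : lin t V t V"
  and eps_eps: "u : verts Q ==> v : verts Q ==> z : V ==> \<epsilon> u (\<epsilon> v z) = (if u = v then \<epsilon> v z else 0)"
  and eps_sum: "z : V ==> (\<Sum>v\<in>verts Q. \<epsilon> v z) = z"
  and eps_tail: "e : arcs Q ==> z : V ==> \<epsilon> (tail Q e) (T e z) = T e z"
  and eps_head: "e : arcs Q ==> z : V ==> T e (\<epsilon> (head Q e) z) = T e z"
begin

abbreviation "R p u \<equiv> pact Q \<epsilon> T p u"
abbreviation "L \<equiv> rep_mod Q t V \<epsilon> T"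

lemma R_lin: "(u, p) : Pth ==> R p u : lin t V t V"
proof (induction p arbitrary: u)
 case (Cons e p)
 then have "R p (head Q e) : lin t V t V" "T e : lin t V t V" using T_lin by auto
 then show ?case unfolding pact.simps by (intro lin_comp)
qed (simp add: eps_lin)

lemma eps_R: "(u, p) : Pth ==> z : V ==> \<epsilon> u (R p u z) = R p u z"
proof (cases p)
 case (Cons e q)
 assume *: "(u, p) : Pth" "z : V"
 then have "R q (head Q e) z : V" using linD(1)[OF R_lin] Cons by simp
 then show ?thesis using eps_tail * Cons by auto
qed (simp add: eps_eps)

lemma R_append: "(u, p @ q) : Pth ==> z : V ==> R p u (R q (awlast u p) z) = R (p @ q) u z"
proof (induction p arbitrary: u)
 case Nil
 then show ?case using eps_R[of u q] by simp
qed auto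

lemma R_eps: "(u, p) : Pth ==> v : verts Q ==> v ~= awlast u p ==> z : V ==> R p u (\<epsilon> v z) = 0"
proof (induction p arbitrary: u)
 case (Cons e p)
 then have "R p (head Q e) (\<epsilon> v z) = 0" by simp
 then show ?case using lin_0[OF T_lin] Cons.prems by simp
qed (auto simp: eps_eps)

lemma R_R:
 assumes "(u, p) : Pth" "(v, q) : Pth" "z : V"
 shows "R p u (R q v z) = (if v = awlast u p then R (p @ q) u z else 0)"
proof (cases "v = awlast u p")
 case True
 then show ?thesis using R_append[of u p q z] assms path_append by simp
next
 case False
 then show ?thesis
  using R_eps[OF assms(1) path_verts(1)[OF assms(2)] False linD(1)[OF R_lin[OF assms(2)] assms(3)]] eps_R[OF assms(2,3)] by simp
qed

lemma rep_ract: "ract L z a = (\<Sum>w\<in>Pth. t (a w) (R (snd w) (fst w) z))"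
 by (simp add: rep_mod_def case_prod_beta)

lemma rep_rsp [simp]: "rsp L = V" by (simp add: rep_mod_def)

lemma R_in: "w : Pth ==> z : V ==> R (snd w) (fst w) z : V"
 using linD(1)[OF R_lin[of "fst w" "snd w"]] by simp

lemma rep_ract_in: "z : V ==> ract L z a : V"
 unfolding rep_ract by (rule subspace_sum[OF vt subV]) (auto intro: subspaceD(3)[OF vt subV] R_in)

lemma rep_ract_mul:
 assumes z: "z : V"
 shows "ract L (ract L z a) b = ract L z (amul KQ a b)"
proof -
 have Rl: "R (snd w) (fst w) : lin t V t V" if "w : Pth" for w using R_lin[of "fst w" "snd w"] that by simp
 have "ract L (ract L z a) b = (\<Sum>w\<in>Pth. \<Sum>v\<in>Pth. if fst v = awlast (fst w) (snd w)
   then t (a v * b w) (R (snd w @ snd v) (fst w) z) else 0)"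
  unfolding rep_ract[of "ract L z a"]
 proof (rule sum.cong[OF refl])
  fix w assume w: "w : Pth"
  have "t (b w) (R (snd w) (fst w) (ract L z a)) = (\<Sum>v\<in>Pth. t (b w) (R (snd w) (fst w) (t (a v) (R (snd v) (fst v) z))))"
   unfolding rep_ract
   by (subst lin_sum[OF Rl[OF w] vt subV]) (auto intro: subspaceD(3)[OF vt subV] R_in z simp: vs_scaleD vt)
  also have "... = (\<Sum>v\<in>Pth. if fst v = awlast (fst w) (snd w) then t (a v * b w) (R (snd w @ snd v) (fst w) z) else 0)"
  proof (rule sum.cong[OF refl])
   fix v assume v: "v : Pth"
   have "R (snd w) (fst w) (R (snd v) (fst v) z) = (if fst v = awlast (fst w) (snd w) then R (snd w @ snd v) (fst w) z else 0)"
    by (rule R_R) (use v w z in auto)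
   then show "t (b w) (R (snd w) (fst w) (t (a v) (R (snd v) (fst v) z))) =
     (if fst v = awlast (fst w) (snd w) then t (a v * b w) (R (snd w @ snd v) (fst w) z) else 0)"
    using linD(3)[OF Rl[OF w] R_in[OF v z], of "a v"] by (auto simp: vs_scaleD vt mult.commute)
  qed
  finally show "t (b w) (R (snd w) (fst w) (ract L z a)) = ..." .
 qed
 also have "... = (\<Sum>w\<in>Pth. \<Sum>v\<in>{v : Pth. fst v = awlast (fst w) (snd w)}. t (a v * b w) (R (snd w @ snd v) (fst w) z))"
  by (simp add: sum.inter_filter[symmetric] finite_paths)
 also have "... = (\<Sum>(u, r)\<in>Pth. \<Sum>i\<le>length r. t (a (awlast u (take i r), drop i r) * b (u, take i r)) (R r u z))"
  using split_sum[of "\<lambda>v w. t (a v * b w) (R (snd w @ snd v) (fst w) z)"] by simp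
 also have "... = ract L z (amul KQ a b)"
  unfolding rep_ract
 proof (rule sum.cong[OF refl], clarify)
  interpret vector_space t by (rule vt)
  show "(\<Sum>i\<le>length r. t (a (awlast u (take i r), drop i r) * b (u, take i r)) (R r u z)) =
    t (amul KQ a b (u, r)) (R (snd (u, r)) (fst (u, r)) z)" for u r
   by (simp add: amul_eq scale_sum_left)
 qed
 finally show ?thesis .
qed

lemma rep_ract_one:
 assumes z: "z : V"
 shows "ract L z (aone KQ) = z"
proof -
 have "ract L z (aone KQ) = (\<Sum>w\<in>(\<lambda>v. (v, [])) ` verts Q. t (aone KQ w) (R (snd w) (fst w) z))"
  unfolding rep_ract by (rule sum.mono_neutral_right[OF finite_paths]) (auto simp: aone_eq vs_scaleD vt)
 also have "... = (\<Sum>v\<in>verts Q. \<epsilon> v z)"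
  by (subst sum.reindex) (auto simp: inj_on_def aone_eq vs_scaleD vt)
 finally show ?thesis using eps_sum[OF z] by simp
qed

lemma is_rmod_rep: "is_rmod t KQ L"
proof (rule is_rmodI)
 show "ract L (x + y) a = ract L x a + ract L y a" if "x : rsp L" "y : rsp L" for x y a
  unfolding rep_ract sum.distrib[symmetric]
  by (rule sum.cong[OF refl]) (use that linD(2)[OF R_lin] in "auto simp: vs_scaleD vt")
 show "ract L (t c x) a = t c (ract L x a)" if "x : rsp L" for x a c
  unfolding rep_ract vs_scaleD(10)[OF vt]
  by (rule sum.cong[OF refl]) (use that linD(3)[OF R_lin] in "auto simp: vs_scaleD vt mult.commute")
 show "ract L x (a + b) = ract L x a + ract L x b" for x a b
  by (simp add: rep_ract vs_scaleD vt sum.distrib)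
 show "ract L x (ascl KQ c a) = t c (ract L x a)" for x a c
  by (simp add: rep_ract vs_scaleD vt ascl_eq fscale_def)
qed (simp_all add: subV rep_ract_in rep_ract_mul rep_ract_one)

end

context acyclic_quiver
begin

lemma rep_hom:
 assumes 1: "quiver_rep Q t V \<epsilon> T" and 2: "quiver_rep Q s W \<eta> S" and f: "f : lin t V s W"
  and fe: "!!v z. v : verts Q ==> z : V ==> f (\<epsilon> v z) = \<eta> v (f z)"
  and fT: "!!e z. e : arcs Q ==> z : V ==> f (T e z) = S e (f z)"
  and z: "z : V"
 shows "f (ract (rep_mod Q t V \<epsilon> T) z a) = ract (rep_mod Q s W \<eta> S) (f z) a"
proof -
 interpret A: quiver_rep Q t V \<epsilon> T by (rule 1)
 interpret B: quiver_rep Q s W \<eta> S by (rule 2)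
 have R: "f (A.R p u z) = B.R p u (f z)" if "(u, p) : Pth" for u p
  using that
 proof (induction p arbitrary: u)
  case (Cons e p)
  then have "A.R p (head Q e) z : V" using linD(1)[OF A.R_lin[of "head Q e" p] z] by simp
  then show ?case using Cons fT by simp
 qed (simp add: fe z)
 have "f (ract A.L z a) = (\<Sum>w\<in>Pth. f (t (a w) (A.R (snd w) (fst w) z)))"
  unfolding A.rep_ract
  by (rule lin_sum[OF f A.vt A.subV]) (auto intro: subspaceD(3)[OF A.vt A.subV] A.R_in z)
 also have "... = ract B.L (f z) a"
  unfolding B.rep_ract
  by (rule sum.cong[OF refl]) (use R linD(3)[OF f A.R_in[OF _ z]] in auto)
 finally show ?thesis .
qed

end

locale quiver_space = acyclic_quiver Q + infinite_space s for Q :: "('v, 'e) pre_digraph" and s :: "'k::field => 'u::ab_group_add => 'u"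
begin

sublocale fd_algebra s "path_algebra Q :: ('k, 'v \<times> 'e list => 'k) kalg"
 by (rule fd_path_algebra) (rule infinite_space_axioms)

lemma kdelta_in: "w : Pth ==> (delta w :: _ => 'k) : acar KQ" by (rule delta_in)

lemma fun_sum_apply: "(sum f I) x = (\<Sum>i\<in>I. f i x :: 'y::comm_monoid_add)"
 by (induction I rule: infinite_finite_induct) auto

definition vact where
 "vact L v z = (if z : rsp L then ract L z (delta (v, []) :: 'v \<times> 'e list => 'k) else (0 :: 'u))"

definition aact where
 "aact L e z = (if z : rsp L then ract L z (delta (tail Q e, [e]) :: 'v \<times> 'e list => 'k) else (0 :: 'u))"

lemma ract_lin_right: "fmod L ==> z : rsp L ==> (\<lambda>a. if a : acar KQ then ract L z a else 0) : lin (ascl KQ) (acar KQ) s (rsp L)"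
 by (rule linI) (auto simp: ract acar_closed)

lemma ract_sum_right:
 assumes "fmod L" "z : rsp L" "!!i. i : I ==> f i : acar KQ"
 shows "ract L z (sum f I) = (\<Sum>i\<in>I. ract L z (f i))"
 using lin_sum[OF ract_lin_right[OF assms(1,2)] vsA asub assms(3), of I] subspace_sum[OF vsA asub assms(3), of I] assms(3) by simp

lemma ract_zero_right: "fmod L ==> z : rsp L ==> ract L z 0 = 0"
 using ract_sum_right[of L z "{}"] by simp

lemma ract_delta:
 assumes "fmod L" "z : rsp L" "v : Pth" "w : Pth"
 shows "ract L (ract L z (delta v)) (delta w) = (if fst v = awlast (fst w) (snd w) then ract L z (delta (fst w, snd w @ snd v)) else 0)"
 using ract(6)[OF assms(1,2) kdelta_in[OF assms(3)] kdelta_in[OF assms(4)]] ract_zero_right[OF assms(1,2)] by (simp only: delta_mul split: if_split) simp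

text \<open>Conversely, the idempotents and the arcs in the path algebra make every module a representation, and by rep_of_ract the action of the
 algebra is recovered from it.\<close>

lemma rep_of:
 assumes L: "fmod L"
 shows "quiver_rep Q s (rsp L) (vact L) (aact L)"
proof (intro quiver_rep.intro quiver_rep_axioms.intro acyclic_quiver_axioms vs fmodD(3)[OF L])
 note c = rsp_closed[OF L] and r = ract[OF L] and d = ract_delta[OF L]
 show "vact L v : lin s (rsp L) s (rsp L)" if "v : verts Q" for v
  by (rule linI) (use that in "auto simp: vact_def c r kdelta_in")
 show "aact L e : lin s (rsp L) s (rsp L)" if "e : arcs Q" for e
  by (rule linI) (use that kdelta_in[OF arc_path[OF that]] in "auto simp: aact_def c r")
 show "vact L u (vact L v z) = (if u = v then vact L v z else 0)" if "u : verts Q" "v : verts Q" "z : rsp L" for u v z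
  using d[OF that(3), of "(v, [])" "(u, [])"] that r(1)[OF that(3) kdelta_in[of "(v, [])"]] by (auto simp: vact_def)
 show "(\<Sum>v\<in>verts Q. vact L v z) = z" if z: "z : rsp L" for z
 proof -
  have "(\<Sum>v\<in>verts Q. delta (v, [])) w = (aone KQ :: _ => 'k) w" for w :: "'v \<times> 'e list"
  proof -
   have "(\<Sum>v\<in>verts Q. delta (v, []) w :: 'k) = (\<Sum>v\<in>verts Q. if v = fst w then (if snd w = [] then 1 else 0) else 0)"
    by (rule sum.cong[OF refl]) (cases w, auto)
   then show ?thesis by (cases w) (simp add: sum.delta finite_verts aone_eq fun_sum_apply)
  qed
  then have "(\<Sum>v\<in>verts Q. delta (v, [])) = (aone KQ :: _ => 'k)" by blast
  then show ?thesis
   using ract_sum_right[OF L z, of "verts Q" "\<lambda>v. delta (v, [])"] r(7)[OF z] z kdelta_in by (simp add: vact_def)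
 qed
 show "vact L (tail Q e) (aact L e z) = aact L e z" if "e : arcs Q" "z : rsp L" for e z
  using d[OF that(2) arc_path[OF that(1)], of "(tail Q e, [])"] that r(1)[OF that(2) kdelta_in[OF arc_path[OF that(1)]]]
  by (auto simp: vact_def aact_def)
 show "aact L e (vact L (head Q e) z) = aact L e z" if "e : arcs Q" "z : rsp L" for e z
  using d[OF that(2) _ arc_path[OF that(1)], of "(head Q e, [])"] that r(1)[OF that(2) kdelta_in[of "(head Q e, [])"]]
  by (auto simp: vact_def aact_def)
qed

lemma rep_of_ract:
 assumes L: "fmod L" and z: "z : rsp L" and a: "a : acar KQ"
 shows "ract (rep_mod Q s (rsp L) (vact L) (aact L)) z a = ract L z a"
proof -
 interpret R: quiver_rep Q s "rsp L" "vact L" "aact L" by (rule rep_of[OF L])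
 have R: "R.R p u z = ract L z (delta (u, p))" if "(u, p) : Pth" for u p
  using that
 proof (induction p arbitrary: u)
  case (Cons e p)
  then have p: "(head Q e, p) : Pth" "e : arcs Q" "u = tail Q e" by auto
  have "R.R (e # p) u z = ract L (ract L z (delta (head Q e, p))) (delta (tail Q e, [e]))"
   unfolding pact.simps comp_apply Cons.IH[OF p(1)] using ract(1)[OF L z kdelta_in[OF p(1)]] by (simp add: aact_def)
  also have "... = ract L z (delta (u, e # p))"
   using ract_delta[OF L z p(1) arc_path[OF p(2)]] p(3) by simp
  finally show ?case .
 qed (simp add: vact_def z)
 have "ract R.L z a = (\<Sum>w\<in>Pth. ract L z (fscale (*) (a w) (delta w)))"
  unfolding R.rep_ract
 proof (rule sum.cong[OF refl])
  fix w assume w: "w : Pth"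
  have "R.R (snd w) (fst w) z = ract L z (delta w)" using R[of "fst w" "snd w"] w by simp
  then show "s (a w) (R.R (snd w) (fst w) z) = ract L z (fscale (*) (a w) (delta w))"
   using ract(5)[OF L z kdelta_in[OF w], of "a w"] by (simp add: ascl_eq)
 qed
 also have "... = ract L z (\<Sum>w\<in>Pth. fscale (*) (a w) (delta w))"
  using ract_sum_right[OF L z, of Pth "\<lambda>w. fscale (*) (a w) (delta w)"] acar_closed(3)[OF kdelta_in] by (simp add: ascl_eq)
 also have "(\<Sum>w\<in>Pth. fscale (*) (a w) (delta w)) = a"
 proof
  fix w'
  have "(\<Sum>w\<in>Pth. fscale (*) (a w) (delta w)) w' = (\<Sum>w\<in>Pth. if w = w' then a w' else 0)"
   unfolding fun_sum_apply by (rule sum.cong) (auto simp: fscale_def)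
  then show "(\<Sum>w\<in>Pth. fscale (*) (a w) (delta w)) w' = a w'"
   using acarD[OF a, of w'] by (simp add: sum.delta finite_paths)
 qed
 finally show ?thesis .
qed

text \<open>Summation over the vertices turns a linear map into one which respects the components at the vertices.\<close>

definition sym where
 "sym L N f z = (\<Sum>v\<in>verts Q. vact N v (f (vact L v z)))"

lemma sym:
 assumes L: "fmod L" and N: "fmod N" and f: "f : lin s (rsp L) s (rsp N)"
 shows "sym L N f : lin s (rsp L) s (rsp N)"
  "u : verts Q ==> z : rsp L ==> sym L N f (vact L u z) = vact N u (sym L N f z)"
proof -
 interpret A: quiver_rep Q s "rsp L" "vact L" "aact L" by (rule rep_of[OF L])
 interpret B: quiver_rep Q s "rsp N" "vact N" "aact N" by (rule rep_of[OF N])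
 have c: "(vact N v o f) o vact L v : lin s (rsp L) s (rsp N)" if "v : verts Q" for v
  by (intro lin_comp[OF A.eps_lin[OF that] lin_comp[OF f B.eps_lin[OF that]]])
 then have c': "(\<lambda>z. vact N v (f (vact L v z))) : lin s (rsp L) s (rsp N)" if "v : verts Q" for v using that by (simp add: comp_def)
 have "sum (\<lambda>v z. vact N v (f (vact L v z))) (verts Q) : lin s (rsp L) s (rsp N)"
  by (rule subspace_sum[OF vector_space_fscale[OF vs] subspace_lin[OF vs fmodD(3)[OF N]] c'])
 moreover have "sum (\<lambda>v z. vact N v (f (vact L v z))) (verts Q) = sym L N f" by (rule ext) (simp add: sym_def fun_sum_apply)
 ultimately show "sym L N f : lin s (rsp L) s (rsp N)" by simp
 assume u: "u : verts Q" and z: "z : rsp L"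
 have in1: "vact L v z : rsp L" "f (vact L v z) : rsp N" "vact N v (f (vact L v z)) : rsp N" if "v : verts Q" for v
  using linD(1)[OF A.eps_lin[OF that]] linD(1)[OF f] linD(1)[OF B.eps_lin[OF that]] z by auto
 have "sym L N f (vact L u z) = (\<Sum>v\<in>verts Q. if v = u then vact N u (f (vact L u z)) else 0)"
  unfolding sym_def
  by (rule sum.cong[OF refl]) (auto simp: A.eps_eps u z lin_0[OF f] lin_0[OF B.eps_lin])
 moreover have "vact N u (sym L N f z) = (\<Sum>v\<in>verts Q. if v = u then vact N u (f (vact L u z)) else 0)"
  unfolding sym_def
  by (subst lin_sum[OF B.eps_lin[OF u] vs fmodD(3)[OF N]]) (auto intro!: sum.cong simp: in1 B.eps_eps u)
 ultimately show "sym L N f (vact L u z) = vact N u (sym L N f z)" by simp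
qed

lemma rhom_vact:
 assumes "f : rh L N" "z : rsp L"
 shows "v : verts Q ==> f (vact L v z) = vact N v (f z)" "e : arcs Q ==> f (aact L e z) = aact N e (f z)"
 using rhomD(2)[OF assms] rhomD(3)[OF assms kdelta_in] assms(2) by (auto simp: vact_def aact_def)

end

context quiver_space
begin

lemma fin_dim_prod:
 assumes "vector_space t" "module.subspace t (V \<times> W)" "fin_dim s V" "fin_dim s W" "!!c x y. t c (x, y) = (s c x, s c y)"
 shows "fin_dim t (V \<times> W)"
proof -
 have z: "0 : V" "0 : W" using subspaceD(1)[OF assms(1,2)] by (auto simp: zero_prod_def)
 have V: "module.subspace s V" and W: "module.subspace s W" using fin_dim_subspace vs assms by blast+
 note c = subspaceD[OF vs V] subspaceD[OF vs W]
 define f where "f = (\<lambda>x. if x : V \<times> W then fst x else 0)"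
 define g where "g = (\<lambda>x. if x : {x : V \<times> W. f x = 0} then snd x else 0)"
 have f: "f : lin t (V \<times> W) s V" by (rule linI) (use c assms(5) in "auto simp: f_def")
 have K: "module.subspace t {x : V \<times> W. f x = 0}" by (rule lin_ker[OF f assms(1) vs assms(2)])
 have g: "g : lin t {x : V \<times> W. f x = 0} s W"
  by (rule linI) (use c assms(5) in "auto simp: g_def f_def vs_scaleD vs")
 have "fin_dim t {x : V \<times> W. f x = 0}"
  by (rule fin_dim_inj[OF g assms(1) vs K assms(4)]) (auto simp: g_def f_def zero_prod_def)
 then show ?thesis
  using fin_dim_ker_image[OF f assms(1) vs assms(2)] fin_dim_sub[OF vs assms(3) lin_image[OF f assms(1) vs assms(2)]] linD(1)[OF f] by blast
qed

lemma ex_vertexwise_retraction: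
 assumes J: "fmod J" and E: "fmod E" and j: "j : rh J E" "inj_on j (rsp J)"
 obtains r where "r : lin s (rsp E) s (rsp J)" "!!x. x : rsp J ==> r (j x) = x"
  "!!v z. v : verts Q ==> z : rsp E ==> r (vact E v z) = vact J v (r z)"
proof -
 interpret B: quiver_rep Q s "rsp J" "vact J" "aact J" by (rule rep_of[OF J])
 note im = image_submodule[OF j(1) J]
 obtain rho where rho: "rho : lin s (rsp E) s (j ` rsp J)" "\<forall>v\<in>j ` rsp J. rho v = v"
  using ex_retraction[OF vs im(1) fmodD(3)[OF E] im(2)] by blast
 define r0 where "r0 = lin_inv (rsp J) j o rho"
 have r0: "r0 : lin s (rsp E) s (rsp J)"
  unfolding r0_def by (rule lin_comp[OF rho(1) lin_inv_lin[OF rhomD(1)[OF j(1)] vs fmodD(3)[OF J] j(2) refl]])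
 have rj: "r0 (j x) = x" if "x : rsp J" for x using rho(2) that lin_inv_simp[OF j(2) that] by (simp add: r0_def)
 have "sym E J r0 (j x) = x" if x: "x : rsp J" for x
 proof -
  have "sym E J r0 (j x) = (\<Sum>v\<in>verts Q. vact J v x)"
   unfolding sym_def
  proof (rule sum.cong[OF refl])
   fix v assume v: "v : verts Q"
   have "vact J v x : rsp J" using linD(1)[OF B.eps_lin[OF v] x] .
   then show "vact J v (r0 (vact E v (j x))) = vact J v x"
    using rhom_vact(1)[OF j(1) x v] rj[of "vact J v x"] B.eps_eps[OF v v x] by simp
  qed
  then show ?thesis using B.eps_sum[OF x] by simp
 qed
 then show ?thesis using sym[OF E J r0] that by blast
qed

lemma ex_vertexwise_section:
 assumes I: "fmod I" and J: "fmod J" and q: "q : rh I J" "q ` rsp I = rsp J"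
 obtains sigma where "sigma : lin s (rsp J) s (rsp I)" "!!x. x : rsp J ==> q (sigma x) = x"
  "!!v z. v : verts Q ==> z : rsp J ==> sigma (vact J v z) = vact I v (sigma z)"
proof -
 interpret B: quiver_rep Q s "rsp J" "vact J" "aact J" by (rule rep_of[OF J])
 interpret A: quiver_rep Q s "rsp I" "vact I" "aact I" by (rule rep_of[OF I])
 obtain sigma0 where s0: "sigma0 : lin s (rsp J) s (rsp I)" "\<forall>w\<in>rsp J. q (sigma0 w) = w"
  using ex_section[OF rhomD(1)[OF q(1)] vs vs fmodD(3)[OF I] q(2)] by blast
 have "q (sym J I sigma0 x) = x" if x: "x : rsp J" for x
 proof -
  have in1: "vact J v x : rsp J" "sigma0 (vact J v x) : rsp I" "vact I v (sigma0 (vact J v x)) : rsp I" if v: "v : verts Q" for v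
   using linD(1)[OF B.eps_lin[OF v] x] linD(1)[OF s0(1)] linD(1)[OF A.eps_lin[OF v]] by auto
  have "q (sym J I sigma0 x) = (\<Sum>v\<in>verts Q. q (vact I v (sigma0 (vact J v x))))"
   unfolding sym_def by (rule lin_sum[OF rhomD(1)[OF q(1)] vs fmodD(3)[OF I]]) (rule in1(3))
  also have "... = (\<Sum>v\<in>verts Q. vact J v x)"
   by (rule sum.cong[OF refl]) (use rhom_vact(1)[OF q(1) in1(2)] s0(2) in1(1) B.eps_eps[OF _ _ x] in auto)
  finally show ?thesis using B.eps_sum[OF x] by simp
 qed
 then show ?thesis using sym[OF J I s0(1)] that by blast
qed

text \<open>
 Choose a retraction r of j : J \<rightarrow> E and a section sigma of q : I \<rightarrow> J which respect the components at the vertices. With respect to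
 the decomposition E = J \<oplus> Z, where Z is the kernel of r, an arc acts on z \<in> Z by z \<mapsto> (r(T z), T z - j(r(T z))). Since
 the action of the arcs on a representation can be prescribed freely, z \<mapsto> (sigma(r(T z)), T z - j(r(T z))) defines a representation
 on I \<oplus> Z.
\<close>

lemma path_algebra_ext_lift:
 assumes J: "fmod J" and E: "fmod E" and I: "fmod I" and j: "j : rh J E" "inj_on j (rsp J)" and q: "q : rh I J" "q ` rsp I = rsp J"
 shows "\<exists>E' i g. fmod E' & i : rh I E' & inj_on i (rsp I) & g : rh E' E & g ` rsp E' = rsp E & (\<forall>x\<in>rsp I. g (i x) = j (q x)) \<and>
   (\<forall>y\<in>rsp E'. g y : j ` rsp J --> y : i ` rsp I)"
proof -
 interpret RI: quiver_rep Q s "rsp I" "vact I" "aact I" by (rule rep_of[OF I])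
 interpret RJ: quiver_rep Q s "rsp J" "vact J" "aact J" by (rule rep_of[OF J])
 interpret RE: quiver_rep Q s "rsp E" "vact E" "aact E" by (rule rep_of[OF E])
 obtain r where r: "r : lin s (rsp E) s (rsp J)" "!!x. x : rsp J ==> r (j x) = x"
  "!!v z. v : verts Q ==> z : rsp E ==> r (vact E v z) = vact J v (r z)"
  by (rule ex_vertexwise_retraction[OF J E j]) (rule that)
 obtain sigma where sg: "sigma : lin s (rsp J) s (rsp I)" "!!x. x : rsp J ==> q (sigma x) = x"
  "!!v z. v : verts Q ==> z : rsp J ==> sigma (vact J v z) = vact I v (sigma z)"
  by (rule ex_vertexwise_section[OF I J q]) (rule that)
 define t where "t = (\<lambda>c (x, y). (s c x, s c y) :: 'u \<times> 'u)"
 have t: "vector_space t" by unfold_locales (auto simp: t_def vs_scaleD[OF vs] plus_prod_def)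
 define Z where "Z = {z : rsp E. r z = 0}"
 have Z: "module.subspace s Z" unfolding Z_def by (rule lin_ker[OF r(1) vs vs fmodD(3)[OF E]])
 have ZE: "z : rsp E" "r z = 0" if "z : Z" for z using that by (auto simp: Z_def)
 note cI = rsp_closed[OF I] and cE = rsp_closed[OF E] and cZ = subspaceD[OF vs Z]
 note jD = rhomD(1,2)[OF j(1)] and qD = rhomD(1,2)[OF q(1)]
 note rl = linD[OF r(1)] and sl = linD[OF sg(1)] and jl = linD[OF jD(1)] and ql = linD[OF qD(1)]
 define V where "V = rsp I \<times> Z"
 have subV: "module.subspace t V"
  by (rule subspaceI[OF t]) (use cI cZ in "auto simp: V_def t_def zero_prod_def")
 define \<epsilon> where "\<epsilon> v x = (if x : V then (vact I v (fst x), vact E v (snd x)) else 0)" for v x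
 define a where "a e z = sigma (r (aact E e z))" for e z
 define b where "b e z = aact E e z - j (r (aact E e z))" for e z
 define T where "T e x = (if x : V then (aact I e (fst x) + a e (snd x), b e (snd x)) else 0)" for e x
 have vI: "vact I v x : rsp I" if "v : verts Q" "x : rsp I" for v x using linD(1)[OF RI.eps_lin] that by blast
 have vE: "vact E v x : rsp E" if "v : verts Q" "x : rsp E" for v x using linD(1)[OF RE.eps_lin] that by blast
 have vZ: "vact E v x : Z" if "v : verts Q" "x : Z" for v x
  using vE[OF that(1) ZE(1)[OF that(2)]] r(3)[OF that(1) ZE(1)[OF that(2)]] ZE(2)[OF that(2)] lin_0[OF RJ.eps_lin[OF that(1)]] by (simp add: Z_def)
 have aI: "aact I e x : rsp I" if "e : arcs Q" "x : rsp I" for e x using linD(1)[OF RI.T_lin] that by blast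
 have aE: "aact E e x : rsp E" if "e : arcs Q" "x : rsp E" for e x using linD(1)[OF RE.T_lin] that by blast
 have raE: "r (aact E e x) : rsp J" if "e : arcs Q" "x : rsp E" for e x using rl(1) aE[OF that] by blast
 have a_in: "a e z : rsp I" if "e : arcs Q" "z : Z" for e z unfolding a_def using sl(1) raE[OF that(1) ZE(1)[OF that(2)]] by blast
 have b_in: "b e z : Z" if "e : arcs Q" "z : Z" for e z
 proof -
  note 1 = aE[OF that(1) ZE(1)[OF that(2)]] and 2 = raE[OF that(1) ZE(1)[OF that(2)]]
  have "r (b e z) = r (aact E e z) - r (j (r (aact E e z)))" unfolding b_def by (rule lin_diff[OF r(1) vs fmodD(3)[OF E] 1 jD(2)[OF 2]])
  then show ?thesis using r(2)[OF 2] cE(4)[OF 1 jD(2)[OF 2]] by (simp add: Z_def b_def)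
 qed
 have a_add: "a e (z + w) = a e z + a e w" and b_add: "b e (z + w) = b e z + b e w" if "e : arcs Q" "z : Z" "w : Z" for e z w
  unfolding a_def b_def
  using linD(2)[OF RE.T_lin[OF that(1)] ZE(1)[OF that(2)] ZE(1)[OF that(3)]]
   rl(2)[OF aE[OF that(1) ZE(1)[OF that(2)]] aE[OF that(1) ZE(1)[OF that(3)]]]
   sl(2)[OF raE[OF that(1) ZE(1)[OF that(2)]] raE[OF that(1) ZE(1)[OF that(3)]]]
   jl(2)[OF raE[OF that(1) ZE(1)[OF that(2)]] raE[OF that(1) ZE(1)[OF that(3)]]]
  by (simp_all add: algebra_simps)
 have a_scl: "a e (s c z) = s c (a e z)" and b_scl: "b e (s c z) = s c (b e z)" if "e : arcs Q" "z : Z" for e z c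
  unfolding a_def b_def
  using linD(3)[OF RE.T_lin[OF that(1)] ZE(1)[OF that(2)]] rl(3)[OF aE[OF that(1) ZE(1)[OF that(2)]]]
   sl(3)[OF raE[OF that(1) ZE(1)[OF that(2)]]] jl(3)[OF raE[OF that(1) ZE(1)[OF that(2)]]]
  by (simp_all add: vs_scaleD vs)
 have a_tail: "vact I (tail Q e) (a e z) = a e z" and b_tail: "vact E (tail Q e) (b e z) = b e z" if "e : arcs Q" "z : Z" for e z
 proof -
  note 0 = tail_in_verts[OF that(1)] and z = ZE(1)[OF that(2)]
  note 1 = aE[OF that(1) z] and 2 = raE[OF that(1) z]
  have 3: "vact J (tail Q e) (r (aact E e z)) = r (aact E e z)" using r(3)[OF 0 1] RE.eps_tail[OF that(1) z] by simp
  then show "vact I (tail Q e) (a e z) = a e z" using sg(3)[OF 0 2] by (simp add: a_def)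
  have "vact E (tail Q e) (j (r (aact E e z))) = j (r (aact E e z))" using rhom_vact(1)[OF j(1) 2 0] 3 by simp
  then show "vact E (tail Q e) (b e z) = b e z"
   using lin_diff[OF RE.eps_lin[OF 0] vs fmodD(3)[OF E] 1 jD(2)[OF 2]] RE.eps_tail[OF that(1) z] by (simp add: b_def)
 qed
 have ab_head: "a e (vact E (head Q e) z) = a e z" "b e (vact E (head Q e) z) = b e z" if "e : arcs Q" "z : Z" for e z
  using RE.eps_head[OF that(1) ZE(1)[OF that(2)]] by (simp_all add: a_def b_def)
 have Vi: "(x, z) : V \<longleftrightarrow> x : rsp I & z : Z" for x z by (simp add: V_def)
 \<comment> \<open>each arc runs from the component of its head to that of its tail because \<open>r\<close> and \<open>sigma\<close> respect the components\<close>
 have rep: "quiver_rep Q t V \<epsilon> T"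
 proof (intro quiver_rep.intro quiver_rep_axioms.intro acyclic_quiver_axioms t subV)
  show "\<epsilon> v : lin t V t V" if v: "v : verts Q" for v
  proof (rule linI)
   show "\<epsilon> v (x + y) = \<epsilon> v x + \<epsilon> v y" if "x : V" "y : V" for x y
    using that subspaceD(2)[OF t subV that] linD(2)[OF RI.eps_lin[OF v]] linD(2)[OF RE.eps_lin[OF v]] ZE
    by (cases x; cases y) (simp add: \<epsilon>_def Vi)
   show "\<epsilon> v (t c x) = t c (\<epsilon> v x)" if "x : V" for x c
    using that subspaceD(3)[OF t subV that] linD(3)[OF RI.eps_lin[OF v]] linD(3)[OF RE.eps_lin[OF v]] ZE
    by (cases x) (simp add: \<epsilon>_def Vi t_def)
  qed (auto simp: \<epsilon>_def V_def vI vZ v)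
  show "T e : lin t V t V" if e: "e : arcs Q" for e
  proof (rule linI)
   show "T e (x + y) = T e x + T e y" if "x : V" "y : V" for x y
    using that subspaceD(2)[OF t subV that] linD(2)[OF RI.T_lin[OF e]] a_add[OF e] b_add[OF e]
    by (cases x; cases y) (simp add: T_def Vi)
   show "T e (t c x) = t c (T e x)" if "x : V" for x c
    using that subspaceD(3)[OF t subV that] linD(3)[OF RI.T_lin[OF e]] a_scl[OF e] b_scl[OF e]
    by (cases x) (simp add: T_def Vi t_def vs_scaleD vs)
  qed (auto simp: T_def V_def cI(2) aI a_in b_in e)
  show "\<epsilon> u (\<epsilon> v z) = (if u = v then \<epsilon> v z else 0)" if "u : verts Q" "v : verts Q" "z : V" for u v z
   using that vI[OF that(2)] vZ[OF that(2)] RI.eps_eps[OF that(1,2)] RE.eps_eps[OF that(1,2)] ZE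
   by (cases z) (simp add: \<epsilon>_def Vi zero_prod_def)
  show "(\<Sum>v\<in>verts Q. \<epsilon> v z) = z" if z: "z : V" for z
  proof (rule prod_eqI)
   have "fst (\<Sum>v\<in>verts Q. \<epsilon> v z) = (\<Sum>v\<in>verts Q. vact I v (fst z))" using z by (simp add: fst_sum \<epsilon>_def)
   then show "fst (\<Sum>v\<in>verts Q. \<epsilon> v z) = fst z" using RI.eps_sum z by (cases z) (simp add: Vi)
   have "snd (\<Sum>v\<in>verts Q. \<epsilon> v z) = (\<Sum>v\<in>verts Q. vact E v (snd z))" using z by (simp add: snd_sum \<epsilon>_def)
   then show "snd (\<Sum>v\<in>verts Q. \<epsilon> v z) = snd z" using RE.eps_sum z ZE by (cases z) (simp add: Vi)
  qed
  show "\<epsilon> (tail Q e) (T e z) = T e z" if e: "e : arcs Q" "z : V" for e z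
  proof -
   obtain x y where z: "z = (x, y)" "x : rsp I" "y : Z" using e(2) by (auto simp: V_def)
   have "vact I (tail Q e) (aact I e x + a e y) = aact I e x + a e y"
    using linD(2)[OF RI.eps_lin[OF tail_in_verts[OF e(1)]] aI[OF e(1) z(2)] a_in[OF e(1) z(3)]] RI.eps_tail[OF e(1) z(2)] a_tail[OF e(1) z(3)] by simp
   then show ?thesis
    using z b_tail[OF e(1) z(3)] b_in[OF e(1) z(3)] cI(2)[OF aI[OF e(1) z(2)] a_in[OF e(1) z(3)]] by (simp add: \<epsilon>_def T_def Vi)
  qed
  show "T e (\<epsilon> (head Q e) z) = T e z" if e: "e : arcs Q" "z : V" for e z
   using e(2) vI[OF head_in_verts[OF e(1)]] vZ[OF head_in_verts[OF e(1)]] RI.eps_head[OF e(1)] ab_head[OF e(1)]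
   by (cases z) (simp add: \<epsilon>_def T_def Vi)
 qed
 interpret RV: quiver_rep Q t V \<epsilon> T by (rule rep)
 have "fin_dim s Z" by (rule fin_dim_sub[OF vs fmodD(2)[OF E] Z]) (auto simp: Z_def)
 then have fd: "fin_dim t (rsp RV.L)"
  unfolding RV.rep_rsp unfolding V_def by (rule fin_dim_prod[OF t subV[unfolded V_def] fmodD(2)[OF I]]) (simp add: t_def)
 obtain E' f f' where E': "fmod E'" "f : mhom t s KQ RV.L E'" "f' : mhom s t KQ E' RV.L"
  "!!x. x : rsp RV.L ==> f' (f x) = x" "!!y. y : rsp E' ==> f (f' y) = y"
  by (rule ex_copy[OF t RV.is_rmod_rep fd]) (rule that)
 define i where "i = (\<lambda>x. if x : rsp I then (x, 0 :: 'u) else 0)"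
 have i_lin: "i : lin s (rsp I) t V" by (rule linI) (use cI cZ in "auto simp: i_def V_def t_def vs_scaleD vs")
 have a0: "a e 0 = 0" "b e 0 = 0" if "e : arcs Q" for e
  using lin_0[OF RE.T_lin[OF that]] lin_0[OF r(1)] lin_0[OF sg(1)] lin_0[OF jD(1)] by (simp_all add: a_def b_def)
 have i: "i : mhom s t KQ I RV.L" unfolding mhom_def
 proof (intro CollectI conjI ballI)
  show "i : lin s (rsp I) t (rsp RV.L)" using i_lin by simp
  fix x and c :: "'v \<times> 'e list => 'k" assume x: "x : rsp I" and c: "c : acar KQ"
  have "i (ract (rep_mod Q s (rsp I) (vact I) (aact I)) x c) = ract RV.L (i x) c"
  proof (rule rep_hom[OF rep_of[OF I] rep i_lin _ _ x])
   show "i (vact I v z) = \<epsilon> v (i z)" if "v : verts Q" "z : rsp I" for v z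
    using that vI cZ(1) lin_0[OF RE.eps_lin] by (simp add: i_def \<epsilon>_def Vi)
   show "i (aact I e z) = T e (i z)" if "e : arcs Q" "z : rsp I" for e z
    using that aI cZ(1) a0 by (simp add: i_def T_def Vi)
  qed
  then show "i (ract I x c) = ract RV.L (i x) c" using rep_of_ract[OF I x c] by simp
 qed
 define g where "g = (\<lambda>x. if x : V then j (q (fst x)) + snd x else 0)"
 have g_lin: "g : lin t V s (rsp E)"
 proof (rule linI)
  show "g (x + y) = g x + g y" if "x : V" "y : V" for x y
   using that subspaceD(2)[OF t subV that] ql(2) jl(2) ql(1) by (cases x; cases y) (simp add: g_def Vi)
  show "g (t c x) = s c (g x)" if "x : V" for x c
   using that subspaceD(3)[OF t subV that] ql(3) jl(3) ql(1) by (cases x) (simp add: g_def Vi t_def vs_scaleD vs)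
 qed (auto simp: g_def V_def cE(2) jl(1) ql(1) ZE)
 have g: "g : mhom t s KQ RV.L E" unfolding mhom_def
 proof (intro CollectI conjI ballI)
  show "g : lin t (rsp RV.L) s (rsp E)" using g_lin by simp
  fix x and c :: "'v \<times> 'e list => 'k" assume "x : rsp RV.L" and c: "c : acar KQ"
  then have x: "x : V" by simp
  have "g (ract RV.L x c) = ract (rep_mod Q s (rsp E) (vact E) (aact E)) (g x) c"
  proof (rule rep_hom[OF rep rep_of[OF E] g_lin _ _ x])
   show "g (\<epsilon> v z) = vact E v (g z)" if v: "v : verts Q" and z: "z : V" for v z
   proof -
    obtain x y where xy: "z = (x, y)" "x : rsp I" "y : Z" using z by (auto simp: V_def)
    have "vact E v (j (q x) + y) = vact E v (j (q x)) + vact E v y"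
     by (rule linD(2)[OF RE.eps_lin[OF v] jD(2)[OF qD(2)[OF xy(2)]] ZE(1)[OF xy(3)]])
    then show ?thesis
     using xy vI[OF v xy(2)] vZ[OF v xy(3)] rhom_vact(1)[OF q(1) xy(2) v] rhom_vact(1)[OF j(1) qD(2)[OF xy(2)] v] by (simp add: \<epsilon>_def g_def Vi)
   qed
   show "g (T e z) = aact E e (g z)" if e: "e : arcs Q" and z: "z : V" for e z
   proof -
    obtain x y where xy: "z = (x, y)" "x : rsp I" "y : Z" using z by (auto simp: V_def)
    note 2 = raE[OF e ZE(1)[OF xy(3)]]
    have 1: "aact E e (j (q x) + y) = aact E e (j (q x)) + aact E e y"
     by (rule linD(2)[OF RE.T_lin[OF e] jD(2)[OF qD(2)[OF xy(2)]] ZE(1)[OF xy(3)]])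
    have "q (aact I e x + a e y) = aact J e (q x) + r (aact E e y)"
     using ql(2)[OF aI[OF e xy(2)] a_in[OF e xy(3)]] rhom_vact(2)[OF q(1) xy(2) e] sg(2)[OF 2] by (simp add: a_def)
    then have "j (q (aact I e x + a e y)) = aact E e (j (q x)) + j (r (aact E e y))"
     using jl(2)[OF linD(1)[OF RJ.T_lin[OF e] qD(2)[OF xy(2)]] 2] rhom_vact(2)[OF j(1) qD(2)[OF xy(2)] e] by simp
    then show ?thesis
     using xy 1 b_in[OF e xy(3)] cI(2)[OF aI[OF e xy(2)] a_in[OF e xy(3)]] by (simp add: T_def g_def Vi b_def)
   qed
  qed
  then show "g (ract RV.L x c) = ract E (g x) c" using rep_of_ract[OF E linD(1)[OF g_lin x] c] by simp
 qed
 have fi: "f o i : rh I E'" and gf: "g o f' : rh E' E"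
  using mhom_comp[OF i E'(2)] mhom_comp[OF E'(3) g] by (simp_all add: mhom_rhom)
 have iV: "i x : V" if "x : rsp I" for x using linD(1)[OF i_lin that] .
 have E4: "f' (f x) = x" if "x : V" for x by (rule E'(4)) (simp add: that)
 have 1: "inj_on (f o i) (rsp I)"
 proof (rule inj_onI)
  fix x y assume xy: "x : rsp I" "y : rsp I" "(f o i) x = (f o i) y"
  have "i x = i y" using arg_cong[OF xy(3), of f'] by (simp only: comp_apply E4[OF iV[OF xy(1)]] E4[OF iV[OF xy(2)]])
  then show "x = y" using xy(1,2) by (simp add: i_def)
 qed
 have f'V: "f' y : V" if "y : rsp E'" for y using mhomD(2)[OF E'(3) that] by simp
 have 2: "(g o f') ` rsp E' = rsp E"
 proof
  show "(g o f') ` rsp E' \<subseteq> rsp E" using rhomD(2)[OF gf] by blast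
  show "rsp E \<subseteq> (g o f') ` rsp E'"
  proof
   fix y assume y: "y : rsp E"
   have ry: "r y : rsp J" "j (r y) : rsp E" "sigma (r y) : rsp I" using rl(1)[OF y] jD(2) sl(1) by auto
   have "r (y - j (r y)) = 0" using lin_diff[OF r(1) vs fmodD(3)[OF E] y ry(2)] r(2)[OF ry(1)] by simp
   then have x: "(sigma (r y), y - j (r y)) : V" using ry cE(4)[OF y ry(2)] by (simp add: Vi Z_def)
   then have "g (sigma (r y), y - j (r y)) = y" using sg(2)[OF ry(1)] by (simp add: g_def)
   then have "(g o f') (f (sigma (r y), y - j (r y))) = y" using E4[OF x] by simp
   then show "y : (g o f') ` rsp E'" using mhomD(2)[OF E'(2)] x by (metis RV.rep_rsp imageI)
  qed
 qed
 have 3: "(g o f') ((f o i) x) = j (q x)" if "x : rsp I" for x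
  using iV[OF that] that by (simp add: E4 g_def) (simp add: i_def)
 have 4: "y : (f o i) ` rsp I" if y: "y : rsp E'" and gy: "(g o f') y : j ` rsp J" for y
 proof -
  obtain x z where xz: "f' y = (x, z)" "x : rsp I" "z : Z" using f'V[OF y] by (auto simp: V_def)
  obtain w where w: "w : rsp J" "j (q x) + z = j w" using gy xz by (auto simp: g_def Vi)
  have "r (j (q x) + z) = r (j (q x)) + r z" by (rule rl(2)[OF jD(2)[OF qD(2)[OF xz(2)]] ZE(1)[OF xz(3)]])
  then have "q x = w" using w r(2)[OF qD(2)[OF xz(2)]] r(2)[OF w(1)] ZE(2)[OF xz(3)] by simp
  then have "z = 0" using w(2) by simp
  then have "f' y = i x" using xz by (simp add: i_def)
  then have "y = (f o i) x" using E'(5)[OF y] by simp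
  then show ?thesis by (rule image_eqI[OF _ xz(2)])
 qed
 show ?thesis by (intro exI conjI ballI impI) (fact E'(1) fi 1 gf 2 | erule 3 | erule (1) 4)+
qed

lemma hereditary_path_algebra: "hereditary_algebra s (path_algebra Q :: ('k, 'v \<times> 'e list => 'k) kalg)"
 by (intro hereditary_algebra.intro hereditary_algebra_axioms.intro fd_algebra_axioms path_algebra_ext_lift)

end

section \<open>Dynkin quivers have finitely many paths\<close>

text \<open>
 The underlying graph is a tree. Hence there is a height function on the vertices which grows by one along each arc, and this
 bounds the length of the paths.
\<close>

definition height_fn :: "('v, 'e) pre_digraph => ('v => nat) => nat set set => (nat => int) => bool" where
 "height_fn Q rho E h \<longleftrightarrow>
   (\<forall>e\<in>arcs Q. {rho (tail Q e), rho (head Q e)} : E --> h (rho (head Q e)) = h (rho (tail Q e)) + 1)"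

text \<open>The edge attaches a new vertex b, whose height is dictated by the orientation of the only arc over this edge.\<close>

lemma height_fn_insert:
 assumes inj: "inj_on (\<lambda>e. {rho (tail Q e), rho (head Q e)}) (arcs Q)"
  and h: "height_fn Q rho E h" and b: "b \<notin> \<Union>E" "a ~= b"
 shows "\<exists>h. height_fn Q rho (insert {a, b} E) h"
proof (cases "\<exists>e\<in>arcs Q. {rho (tail Q e), rho (head Q e)} = {a, b}")
 case False
 then show ?thesis using h unfolding height_fn_def by (intro exI[of _ h]) auto
next
 case True
 then obtain e where e: "e : arcs Q" "{rho (tail Q e), rho (head Q e)} = {a, b}" by blast
 define h' where "h' = h(b := if rho (tail Q e) = a then h a + 1 else h a - 1)"
 have "h' (rho (head Q f)) = h' (rho (tail Q f)) + 1"
  if f: "f : arcs Q" "{rho (tail Q f), rho (head Q f)} : insert {a, b} E" for f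
 proof (cases "{rho (tail Q f), rho (head Q f)} = {a, b}")
  case True
  then have "f = e" using inj_onD[OF inj, of f e] f(1) e by simp
  moreover have "(rho (tail Q e) = a & rho (head Q e) = b) | (rho (tail Q e) = b & rho (head Q e) = a)"
   using e(2) by (auto simp: doubleton_eq_iff)
  ultimately show ?thesis using b(2) by (auto simp: h'_def)
 next
  case False
  then have E: "{rho (tail Q f), rho (head Q f)} : E" using f(2) by simp
  then have "rho (tail Q f) ~= b" "rho (head Q f) ~= b" using b(1) by auto
  then show ?thesis using h E f(1) by (simp add: h'_def height_fn_def)
 qed
 then show ?thesis unfolding height_fn_def by blast
qed

lemma height_fn_chain:
 assumes inj: "inj_on (\<lambda>e. {rho (tail Q e), rho (head Q e)}) (arcs Q)"
 shows "\<exists>h. height_fn Q rho (chain n) h"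
proof (induction n)
 case 0
 show ?case by (simp add: chain_def height_fn_def)
next
 case (Suc n)
 then obtain h where h: "height_fn Q rho (chain n) h" by blast
 show ?case
 proof (cases n)
  case 0
  then show ?thesis by (simp add: chain_def height_fn_def)
 next
  case (Suc m)
  have "chain (Suc n) = insert {m, n} (chain n)"
   using Suc by (auto simp: chain_def less_Suc_eq)
  moreover have "n \<notin> \<Union>(chain n)" by (auto simp: chain_def)
  ultimately show ?thesis using height_fn_insert[OF inj h, of n m] Suc by simp
 qed
qed

lemma height_fn_dynkin:
 assumes inj: "inj_on (\<lambda>e. {rho (tail Q e), rho (head Q e)}) (arcs Q)" and E: "dynkin_diagram n E"
 shows "\<exists>h. height_fn Q rho E h"
proof -
 have br: "\<exists>h. height_fn Q rho (branched n b) h" if b: "b < n - 1" for b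
 proof -
  obtain h where h: "height_fn Q rho (chain (n - 1)) h" using height_fn_chain[OF inj] by blast
  have "n - 1 \<notin> \<Union>(chain (n - 1))" by (auto simp: chain_def)
  then show ?thesis using height_fn_insert[OF inj h, of "n - 1" b] b by (simp add: branched_def)
 qed
 show ?thesis
  using E height_fn_chain[OF inj, of n] br[of "n - 3"] br[of 2] unfolding dynkin_diagram_def by auto
qed

lemma acyclic_quiver_dynkin:
 assumes "connected_dynkin_quiver Q"
 shows "acyclic_quiver Q"
proof -
 obtain n E rho where Q: "wf_digraph Q" "dynkin_diagram n E" "bij_betw rho (verts Q) {..<n}"
  "bij_betw (\<lambda>e. {rho (tail Q e), rho (head Q e)}) (arcs Q) E"
  using assms unfolding connected_dynkin_quiver_def by blast
 interpret wf_digraph Q by (rule Q(1))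
 note inj = bij_betw_imp_inj_on[OF Q(4)]
 obtain h' where h': "height_fn Q rho E h'" using height_fn_dynkin[OF inj Q(2)] by blast
 define h where "h v = h' (rho v)" for v
 have hd: "h (head Q e) = h (tail Q e) + 1" if "e : arcs Q" for e
  using h' that bij_betwE[OF Q(4)] unfolding height_fn_def h_def by blast
 have fv: "finite (verts Q)" using bij_betw_finite[OF Q(3)] by simp
 have "finite (chain m)" for m
  by (rule finite_subset[of _ "(\<lambda>i. {i, i + 1}) ` {..<m}"]) (auto simp: chain_def)
 then have "finite E" using Q(2) by (auto simp: dynkin_diagram_def branched_def)
 then have fa: "finite (arcs Q)" using bij_betw_finite[OF Q(4)] by simp
 have len: "h v = h u + int (length p)" if "awalk u p v" for u p v
  using that
 proof (induction p arbitrary: u)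
  case (Cons e p)
  then have "e : arcs Q" "tail Q e = u" "awalk (head Q e) p v" by (auto simp: awalk_def)
  then show ?case using Cons.IH[of "head Q e"] hd by simp
 qed (simp add: awalk_def)
 obtain m where m: "!!v. v : verts Q ==> \<bar>h v\<bar> \<le> m" using fv by (metis (mono_tags, opaque_lifting) finite_imageI imageI Max_ge)
 \<comment> \<open>the heights lie between \<open>- m\<close> and \<open>m\<close>\<close>
 have "quiver_paths Q \<subseteq> verts Q \<times> {p. set p \<subseteq> arcs Q & length p \<le> nat (2 * m)}"
 proof
  fix w assume "w : quiver_paths Q"
  then obtain u p v where w: "w = (u, p)" "awalk u p v" by (auto simp: quiver_paths_def)
  have "u : verts Q" "v : verts Q" "set p \<subseteq> arcs Q" using w(2) by auto
  then show "w : verts Q \<times> {p. set p \<subseteq> arcs Q & length p \<le> nat (2 * m)}"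
   using w(1) len[OF w(2)] m[of u] m[of v] by auto
 qed
 then have "finite (quiver_paths Q)"
  by (rule finite_subset) (intro finite_cartesian_product fv finite_lists_length_le fa)
 then show ?thesis by unfold_locales
qed

section \<open>The support and the values of the intermediate extension\<close>

lemma is_functorI:
 assumes "!!X. X : Ob C ==> fob F X : Ob D" "!!X. X : Ob C ==> fmor F X X (Ident C X) = Ident D (fob F X)"
  "!!X Y f. X : Ob C ==> Y : Ob C ==> f : Hom C X Y ==> fmor F X Y f : Hom D (fob F X) (fob F Y)"
  "!!X Y f g. X : Ob C ==> Y : Ob C ==> f : Hom C X Y ==> g : Hom C X Y ==> fmor F X Y (f + g) = fmor F X Y f + fmor F X Y g"
  "!!X Y f c. X : Ob C ==> Y : Ob C ==> f : Hom C X Y ==> fmor F X Y (Scl C c f) = Scl D c (fmor F X Y f)"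
  "!!X Y Z f g. X : Ob C ==> Y : Ob C ==> Z : Ob C ==> f : Hom C X Y ==> g : Hom C Y Z ==>
   fmor F X Z (Cmp C g f) = Cmp D (fmor F Y Z g) (fmor F X Y f)"
 shows "is_functor C D F"
 using assms by (simp add: is_functor_def)

lemma is_functor_comp:
 assumes "is_functor C D F" "is_functor D E G"
 shows "is_functor C E \<lparr>fob = (\<lambda>x. fob G (fob F x)), fmor = (\<lambda>x y u. fmor G (fob F x) (fob F y) (fmor F x y u))\<rparr>"
 by (rule is_functorI) (simp_all add: is_functorD[OF assms(1)] is_functorD[OF assms(2)])

lemma is_cmod_pull:
 assumes F: "is_functor C D F" and G: "is_cmod D s G"
 shows "is_cmod C s (pull F G)"
 unfolding is_cmod_def pull_def
 by (simp add: is_functorD[OF F] is_cmodD[OF G])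

context enough_projectives
begin

lemma is_functor_Yp: "is_functor C (mod_cat s PC) Yp"
 by (rule is_functorI) (simp_all add: Yp_fin_pres Yp_ident Yp_mor Yp_add Yp_scl Yp_comp yoneda_def[of s C PC, THEN arg_cong[of _ _ fob]])

end

context fd_algebra
begin

lemma nu_map_scl:
 assumes "fmod L" "fmod N" "f : rh L N"
 shows "\<nu>m L N (fscale s c f) = fscale s c (\<nu>m L N f)"
 by (rule nu_map_eqI[OF assms(1,2) rhom_closed(3)[OF assms(2,1,3)] lin_scale[OF vs fmodD(3)[OF nu_fmod[OF assms(2)]] rhomD(1)[OF nu_map(1)]]])
  (use assms in "auto simp: nu_map tens rhomD(2) fscale_def")

end

context hereditary_algebra
begin

lemma HQ_Ob:
 assumes "(P1, P0, f) : Ob (HQ s A)"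
 shows "projective (modA s A) P1" "projective (modA s A) P0" "f : rh P1 P0" "fmod P1" "fmod P0"
 using assms by (auto simp: HQ_def full_sub_def mor_cat_def in_HQ_def)

lemma HQ_simps: "Cmp (HQ s A) (a', b') (a, b) = (a' o a, b' o b)" "Ident (HQ s A) (P1, P0, f) = (idm (rsp P1), idm (rsp P0))"
 "Scl (HQ s A) c (a, b) = (fscale s c a, fscale s c b)"
 "(a, b) : Hom (HQ s A) (P1, P0, f) (R1, R0, g) \<longleftrightarrow> a : rh P1 R1 & b : rh P0 R0 & b o f = g o a"
 by (auto simp: HQ_def full_sub_def mor_cat_def)

lemma HQ_to_grm_simps: "fob (HQ_to_grm s A) (P1, P0, f) = hqm P1 P0 f"
 "fmor (HQ_to_grm s A) (P1, P0, f) (R1, R0, g) (a, b) = (\<lambda>p. if p = 0 then a else if p = 0 + 1 then \<nu>m P0 R0 b else (\<lambda>_. 0))"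
 by (auto simp: HQ_to_grm_def hqm_def leadsto_glead)

lemma HQ_to_grm_mor:
 assumes x: "(P1, P0, f) : Ob (HQ s A)" and y: "(R1, R0, g) : Ob (HQ s A)" and ab: "(a, b) : Hom (HQ s A) (P1, P0, f) (R1, R0, g)"
 shows "fmor (HQ_to_grm s A) (P1, P0, f) (R1, R0, g) (a, b) : Hom GM (hqm P1 P0 f) (hqm R1 R0 g)"
proof -
 note P = HQ_Ob[OF x] and R = HQ_Ob[OF y]
 note X = hqm[OF P(4,5,3)] and Y = hqm[OF R(4,5,3)]
 have ab: "a : rh P1 R1" "b : rh P0 R0" "b o f = g o a" using ab by (simp_all add: HQ_simps)
 have bf: "b (f z) = g (a z)" for z using fun_cong[OF ab(3), of z] by simp
 have "(\<lambda>p. if p = 0 then a else if p = 0 + 1 then \<nu>m P0 R0 b else (\<lambda>_. 0)) : Hom GM (glead 0 P1 (\<nu> P0) (\<nu>m P1 P0 f)) (hqm R1 R0 g)"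
 proof (rule glead_homI[OF P(4) nu_fmod[OF P(5)] nu_map(1)[OF P(4,5,3)] Y(1)])
  show "a : rh P1 (gcomp (hqm R1 R0 g) 0)" using ab(1) by (simp add: Y(2))
  show "\<nu>m P0 R0 b : rh (\<nu> P0) (gcomp (hqm R1 R0 g) (0 + 1))" using nu_map(1)[OF P(5) R(5) ab(2)] by (simp add: Y(3))
  show "\<nu>m P0 R0 b (\<nu>m P1 P0 f (tn P1 z h)) = gact (hqm R1 R0 g) 0 (a z) h" if "z : rsp P1" "h : dual A" for z h
   using nu_map(2)[OF P(4,5,3) that] nu_map(2)[OF P(5) R(5) ab(2) rhomD(2)[OF P(3) that(1)] that(2)]
    Y(5)[OF rhomD(2)[OF ab(1) that(1)] that(2)] by (simp add: bf)
  show "gact (hqm R1 R0 g) (0 + 1) w h = 0" for w h using Y(6)[of "0 + 1"] by simp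
 qed
 then show ?thesis unfolding HQ_to_grm_simps hqm_def[of P1] .
qed

lemma is_functor_HQ: "is_functor (HQ s A) GM (HQ_to_grm s A)"
proof (rule is_functorI, goal_cases)
 case (1 x)
 then show ?case using HQ_Ob hqm(1) by (cases x) (auto simp: HQ_to_grm_simps)
next
 case (2 x)
 obtain P1 P0 f where x: "x = (P1, P0, f)" by (cases x)
 note P = HQ_Ob[OF 2[unfolded x]] and z = subspace_zero[OF vs]
 show ?case unfolding x HQ_simps HQ_to_grm_simps grm_simps
  using hqm[OF P(4,5,3)] nu_map_ident[OF P(5)] by (auto simp: fun_eq_iff idm_def)
next
 case (3 x y u)
 then show ?case using HQ_to_grm_mor by (cases x; cases y; cases u) (auto simp: HQ_to_grm_simps(1))
next
 case (4 x y u v)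
 obtain P1 P0 f where x: "x = (P1, P0, f)" by (cases x)
 obtain R1 R0 g where y: "y = (R1, R0, g)" by (cases y)
 obtain a b where u: "u = (a, b)" by (cases u)
 obtain a' b' where v: "v = (a', b')" by (cases v)
 have "b : rh P0 R0" "b' : rh P0 R0" using 4 by (auto simp: x y u v HQ_simps)
 then have "\<nu>m P0 R0 (b + b') = \<nu>m P0 R0 b + \<nu>m P0 R0 b'"
  using nu_map_add HQ_Ob(5)[OF 4(1)[unfolded x]] HQ_Ob(5)[OF 4(2)[unfolded y]] by blast
 then show ?case by (auto simp: x y u v HQ_to_grm_simps fun_eq_iff)
next
 case (5 x y u c)
 obtain P1 P0 f where x: "x = (P1, P0, f)" by (cases x)
 obtain R1 R0 g where y: "y = (R1, R0, g)" by (cases y)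
 obtain a b where u: "u = (a, b)" by (cases u)
 have "b : rh P0 R0" using 5 by (auto simp: x y u HQ_simps)
 then have "\<nu>m P0 R0 (fscale s c b) = fscale s c (\<nu>m P0 R0 b)"
  using nu_map_scl HQ_Ob(5)[OF 5(1)[unfolded x]] HQ_Ob(5)[OF 5(2)[unfolded y]] by blast
 then show ?case by (auto simp: x y u HQ_simps HQ_to_grm_simps fun_eq_iff fscale_def vs_scaleD vs)
next
 case (6 x y z u v)
 obtain P1 P0 f where x: "x = (P1, P0, f)" by (cases x)
 obtain R1 R0 g where y: "y = (R1, R0, g)" by (cases y)
 obtain S1 S0 h where z: "z = (S1, S0, h)" by (cases z)
 obtain a b where u: "u = (a, b)" by (cases u)
 obtain a' b' where v: "v = (a', b')" by (cases v)
 have b: "b : rh P0 R0" "b' : rh R0 S0" using 6 by (auto simp: x y z u v HQ_simps)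
 then have "\<nu>m P0 S0 (b' o b) = \<nu>m R0 S0 b' o \<nu>m P0 R0 b"
  using nu_map_comp HQ_Ob(5)[OF 6(1)[unfolded x]] HQ_Ob(5)[OF 6(2)[unfolded y]] HQ_Ob(5)[OF 6(3)[unfolded z]] by blast
 then show ?case by (auto simp: x y z u v HQ_simps HQ_to_grm_simps fun_eq_iff)
qed

lemma hatM_simps: "mval (hatM s A M) (P1, P0, f) = (\<lambda>g. g o f) ` rh P0 M"
 "mmap (hatM s A M) x y (a, b) h = (if h : mval (hatM s A M) y then h o a else 0)"
 by (simp_all add: hatM_def Let_def)

lemma hatM_rh: "(P1, P0, f) : Ob (HQ s A) ==> h : mval (hatM s A M) (P1, P0, f) ==> h : rh P1 M"
 using rhom_comp[OF HQ_Ob(3)] by (auto simp: hatM_simps)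

lemma hatM_map:
 assumes "(P1, P0, f) : Ob (HQ s A)" "(a, b) : Hom (HQ s A) (P1, P0, f) (R1, R0, g)" "h : mval (hatM s A M) (R1, R0, g)"
 shows "h o a : mval (hatM s A M) (P1, P0, f)"
proof -
 have ab: "b : rh P0 R0" "b o f = g o a" using assms(2) by (simp_all add: HQ_simps)
 obtain k where k: "k : rh R0 M" "h = k o g" using assms(3) by (auto simp: hatM_simps)
 have "h o a = (k o b) o f" by (simp only: k(2) comp_assoc ab(2))
 then show ?thesis unfolding hatM_simps using rhom_comp[OF ab(1) k(1)] by (rule image_eqI)
qed

lemma hatM_sub:
 assumes "(P1, P0, f) : Ob (HQ s A)" and M: "fmod M"
 shows "module.subspace (fscale s) (mval (hatM s A M) (P1, P0, f))"
proof -
 note P = HQ_Ob[OF assms(1)] and c = rhom_closed[OF M HQ_Ob(5)[OF assms(1)]]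
 show ?thesis
 proof (rule subspaceI[OF vector_space_fscale[OF vs]])
  show "0 : mval (hatM s A M) (P1, P0, f)" unfolding hatM_simps by (rule image_eqI[OF _ c(1)]) (auto simp: fun_eq_iff)
  show "h + h' : mval (hatM s A M) (P1, P0, f)" if hh: "h : mval (hatM s A M) (P1, P0, f)" "h' : mval (hatM s A M) (P1, P0, f)" for h h'
  proof -
   obtain k k' where k: "k : rh P0 M" "h = k o f" "k' : rh P0 M" "h' = k' o f" using hh by (auto simp: hatM_simps)
   then show ?thesis unfolding hatM_simps by (intro image_eqI[OF _ c(2)[OF k(1,3)]]) (auto simp: fun_eq_iff)
  qed
  show "fscale s d h : mval (hatM s A M) (P1, P0, f)" if hh: "h : mval (hatM s A M) (P1, P0, f)" for h d
  proof -
   obtain k where k: "k : rh P0 M" "h = k o f" using hh by (auto simp: hatM_simps)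
   then show ?thesis unfolding hatM_simps by (intro image_eqI[OF _ c(3)[OF k(1)]]) (auto simp: fun_eq_iff fscale_def)
  qed
 qed
qed

lemma is_cmod_hatM:
 assumes M: "fmod M"
 shows "is_cmod (HQ s A) (fscale s) (hatM s A M)"
 unfolding is_cmod_def
proof (intro conjI ballI allI, goal_cases)
 case (1 x)
 then show ?case using hatM_sub[OF _ M] by (cases x) auto
next
 case (2 x)
 obtain P1 P0 f where x: "x = (P1, P0, f)" by (cases x)
 have "h o idm (rsp P1) = h" if "h : mval (hatM s A M) x" for h
  by (rule lin_idm[OF rhomD(1)[OF hatM_rh]]) (use 2 that x in auto)
 then show ?case unfolding x HQ_simps by (auto simp: fun_eq_iff hatM_simps(2) idm_def x)
next
 case (3 x y u)
 obtain P1 P0 f where x: "x = (P1, P0, f)" by (cases x)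
 obtain R1 R0 g where y: "y = (R1, R0, g)" by (cases y)
 obtain a b where u: "u = (a, b)" by (cases u)
 note sub = subspaceD[OF vector_space_fscale[OF vs] hatM_sub[OF 3(2)[unfolded y] M]]
 show ?case unfolding x y u
  by (rule linI) (use hatM_map[OF 3(1,3)[unfolded x y u]] sub in "auto simp: hatM_simps(2) fun_eq_iff fscale_def")
next
 case (4 x y u v)
 obtain P1 P0 f where x: "x = (P1, P0, f)" by (cases x)
 obtain R1 R0 g where y: "y = (R1, R0, g)" by (cases y)
 obtain a b where u: "u = (a, b)" by (cases u)
 obtain a' b' where v: "v = (a', b')" by (cases v)
 have a: "a : rh P1 R1" "a' : rh P1 R1" using 4 by (auto simp: x y u v HQ_simps)
 have "h o (a + a') = (h o a) + (h o a')" if "h : mval (hatM s A M) y" for h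
  using comp_add_lin[OF rhomD(1)[OF hatM_rh] rhomD(1)[OF a(1)] rhomD(1)[OF a(2)]] 4(2) that y by blast
 then show ?case by (auto simp: u v hatM_simps(2) fun_eq_iff)
next
 case (5 x y u c)
 obtain P1 P0 f where x: "x = (P1, P0, f)" by (cases x)
 obtain R1 R0 g where y: "y = (R1, R0, g)" by (cases y)
 obtain a b where u: "u = (a, b)" by (cases u)
 have a: "a : rh P1 R1" using 5 by (auto simp: x y u HQ_simps)
 have "h o fscale s c a = fscale s c (h o a)" if "h : mval (hatM s A M) y" for h
  using comp_fscale_lin[OF rhomD(1)[OF hatM_rh] rhomD(1)[OF a] vs vs] 5(2) that y by blast
 then show ?case by (auto simp: u HQ_simps hatM_simps(2) fun_eq_iff fscale_def vs_scaleD vs)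
next
 case (6 x y z u v)
 obtain P1 P0 f where x: "x = (P1, P0, f)" by (cases x)
 obtain R1 R0 g where y: "y = (R1, R0, g)" by (cases y)
 obtain S1 S0 k where z: "z = (S1, S0, k)" by (cases z)
 obtain a b where u: "u = (a, b)" by (cases u)
 obtain a' b' where v: "v = (a', b')" by (cases v)
 note 1 = hatM_map[OF 6(2,5)[unfolded y z v]]
 have 0: "(0 :: 'u => 'u) o a = 0" by (auto simp: fun_eq_iff)
 show ?case
 proof
  fix h
  show "mmap (hatM s A M) x z (Cmp (HQ s A) v u) h = (mmap (hatM s A M) x y u o mmap (hatM s A M) y z v) h"
   using 1[of h M] by (cases "h : mval (hatM s A M) z") (auto simp: u v HQ_simps hatM_simps(2) 0 comp_assoc y z)
 qed
qed

end

locale hereditary_extension = hereditary_algebra s A for s :: "'k::field => 'u::ab_group_add => 'u" and A :: "('k, 'a::ab_group_add) kalg" +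
 fixes KL KR \<phi> \<psi>
 assumes adjL: "adjunction (mod_cat s (grP s A)) (mod_cat s (mod_cat s (grP s A))) KL (res s (grP s A)) \<phi>"
  and adjR: "adjunction (mod_cat s (mod_cat s (grP s A))) (mod_cat s (grP s A)) (res s (grP s A)) KR \<psi>"
begin

sublocale E: enough_projectives s GM by (rule enough_projectives_grm)

lemma grP_PC: "grP s A = E.PC" by (simp add: grP_def)

lemma grm_to_modP_Yp: "grm_to_modP s A = E.Yp" by (simp add: grm_to_modP_def grP_PC)

sublocale I: intermediate_extension s "grP s A" KL KR \<phi> \<psi>
 by (intro intermediate_extension.intro intermediate_extension_axioms.intro adjL adjR) (simp add: grP_PC E.hf_category_PC)

abbreviation "yo \<equiv> hom_mod s GM"
abbreviation "ym \<equiv> fmor E.Yp"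
abbreviation "K M N \<equiv> hom_to_KR s (grP s A) \<psi> (yo N) (yo (stalk M))"
abbreviation "KLRM M \<equiv> KLR s (grP s A) KL KR \<phi> \<psi> (yo (stalk M))"

lemma fp: "N : Ob GM ==> fin_pres s (grP s A) (yo N)" using E.Yp_fin_pres by (simp add: grP_PC)

lemma ym: "N : Ob GM ==> N' : Ob GM ==> g : Hom GM N N' ==> ym N N' g : cmod_hom (grP s A) s (yo N) s (yo N')"
 using E.Yp_mor by (simp add: grP_PC)

lemma modA_to_modP_eq: "modA_to_modP s A M = yo (stalk M)"
 by (simp add: modA_to_modP_def grm_to_modP_def yoneda_def)

lemma HQ_to_modP_eq: "fob (HQ_to_modP s A) (P1, P0, f) = yo (hqm P1 P0 f)"
 "fmor (HQ_to_modP s A) (P1, P0, f) (R1, R0, g) u = ym (hqm P1 P0 f) (hqm R1 R0 g) (fmor (HQ_to_grm s A) (P1, P0, f) (R1, R0, g) u)"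
proof -
 have y: "fob E.Yp = yo" by (simp add: yoneda_def)
 show "fob (HQ_to_modP s A) (P1, P0, f) = yo (hqm P1 P0 f)"
  by (simp add: HQ_to_modP_def HQ_to_grm_simps grm_to_modP_Yp y)
 show "fmor (HQ_to_modP s A) (P1, P0, f) (R1, R0, g) u = ym (hqm P1 P0 f) (hqm R1 R0 g) (fmor (HQ_to_grm s A) (P1, P0, f) (R1, R0, g) u)"
  by (simp add: HQ_to_modP_def HQ_to_grm_simps grm_to_modP_Yp)
qed

lemma is_functor_HQ_to_modP: "is_functor (HQ s A) (mod_cat s (grP s A)) (HQ_to_modP s A)"
 unfolding HQ_to_modP_def by (rule is_functor_comp[OF is_functor_HQ]) (simp add: grm_to_modP_Yp grP_PC E.is_functor_Yp)

lemma KLR_values_grm: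
 assumes M: "fmod M" and N: "N : Ob GM"
 shows "mval (KLRM M) (yo N) = (\<lambda>u. K M N (ym N (stalk M) u)) ` {Cmp GM w a | Y a w. projective GM Y & a : Hom GM N Y & w : Hom GM Y (stalk M)}"
  (is "_ = _ ` ?F")
proof -
 note S = stalk(1)[OF M]
 let ?U = "{u. \<exists>Y\<in>Ob (grP s A). \<exists>a\<in>cmod_hom (grP s A) s (yo N) s (hom_mod s (grP s A) Y).
  \<exists>w\<in>cmod_hom (grP s A) s (hom_mod s (grP s A) Y) s (yo (stalk M)). u = (\<lambda>W. w W o a W)}"
 have "?U = ym N (stalk M) ` ?F"
 proof (intro set_eqI iffI)
  fix u assume "u : ?U"
  then obtain Y a w where Y: "projective GM Y" "a : cmod_hom E.PC s (yo N) s (yo Y)" "w : cmod_hom E.PC s (yo Y) s (yo (stalk M))"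
   "u = (\<lambda>W. w W o a W)" unfolding grP_PC E.hom_mod_PC mem_Collect_eq Bex_def E.PC_simps by blast
  note YO = E.projective_Ob[OF Y(1)]
  obtain a' where a': "a' : Hom GM N Y" "a = ym N Y a'" using E.Yp_full[OF N YO Y(2)] by blast
  obtain w' where w': "w' : Hom GM Y (stalk M)" "w = ym Y (stalk M) w'" using E.Yp_full[OF YO S Y(3)] by blast
  have "u = ym N (stalk M) (Cmp GM w' a')"
   unfolding E.Yp_comp[OF N YO S a'(1) w'(1)] Y(4) a'(2) w'(2) ..
  then show "u : ym N (stalk M) ` ?F" using Y(1) a'(1) w'(1) by blast
 next
  fix u assume "u : ym N (stalk M) ` ?F"
  then obtain Y a w where Y: "projective GM Y" "a : Hom GM N Y" "w : Hom GM Y (stalk M)" "u = ym N (stalk M) (Cmp GM w a)" by blast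
  note YO = E.projective_Ob[OF Y(1)]
  have 1: "u = (\<lambda>W. ym Y (stalk M) w W o ym N Y a W)" unfolding Y(4) by (rule E.Yp_comp[OF N YO S Y(2,3)])
  have 2: "Y : Ob (grP s A)" using Y(1) by (simp add: grP_PC)
  have 3: "hom_mod s (grP s A) Y = yo Y" by (simp add: grP_PC E.hom_mod_PC)
  show "u : ?U"
   by (rule CollectI, rule bexI[OF _ 2], rule bexI[of _ "ym N Y a"], rule bexI[of _ "ym Y (stalk M) w"])
    (simp_all only: 1 3 ym[OF N YO Y(2)] ym[OF YO S Y(3)])
 qed
 then show ?thesis unfolding I.KLR_values[OF fp[OF S] fp[OF N]] by (simp only: image_image)
qed

lemma K_inj:
 assumes M: "fmod M" and N: "N : Ob GM" and uv: "u : Hom GM N (stalk M)" "v : Hom GM N (stalk M)"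
  "K M N (ym N (stalk M) u) = K M N (ym N (stalk M) v)"
 shows "u = v"
proof -
 note S = stalk(1)[OF M]
 have "ym N (stalk M) u = ym N (stalk M) v"
  by (rule inj_onD[OF bij_betw_imp_inj_on[OF I.hom_to_KR_bij[OF fp[OF N] fp[OF S]]] uv(3) ym[OF N S uv(1)] ym[OF N S uv(2)]])
 then show ?thesis by (rule E.Yp_faithful[OF N S uv(1,2)])
qed

text \<open>By factor_iff, the morphisms which factor through a projective object are the extensions by zero of the elements of hatM.\<close>

lemma hat_values:
 assumes M: "fmod M" and x: "(P1, P0, f) : Ob (HQ s A)"
 shows "mval (KLRM M) (yo (hqm P1 P0 f)) = (\<lambda>h. K M (hqm P1 P0 f) (ym (hqm P1 P0 f) (stalk M) (deg0 h))) ` mval (hatM s A M) (P1, P0, f)"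
proof -
 note P = HQ_Ob[OF x] and S = stalk(1)[OF M]
 let ?X = "hqm P1 P0 f"
 note X = hqm(1)[OF P(4,5,3)]
 have "{Cmp GM w a | Y a w. projective GM Y & a : Hom GM ?X Y & w : Hom GM Y (stalk M)} = deg0 ` mval (hatM s A M) (P1, P0, f)" (is "?F = _")
 proof (intro set_eqI iffI)
  fix u assume "u : ?F"
  then obtain Y a w where Y: "projective GM Y" "a : Hom GM ?X Y" "w : Hom GM Y (stalk M)" "u = Cmp GM w a" by blast
  have u: "u : Hom GM ?X (stalk M)" unfolding Y(4) by (rule E.cmp_in[OF X E.projective_Ob[OF Y(1)] S Y(2,3)])
  note d = stalk_hom_deg0[OF P(4,5,3) M u]
  have "deg0 (u 0) = Cmp GM w a" using d(2) Y(4) by simp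
  then have "u 0 : mval (hatM s A M) (P1, P0, f)" unfolding hatM_simps factor_iff[OF P(1-3) M d(1), symmetric] using Y(1-3) by blast
  then have "deg0 (u 0) : deg0 ` mval (hatM s A M) (P1, P0, f)" by (rule imageI)
  then show "u : deg0 ` mval (hatM s A M) (P1, P0, f)" unfolding d(2)[symmetric] .
 next
  fix u assume "u : deg0 ` mval (hatM s A M) (P1, P0, f)"
  then obtain h where h: "h : mval (hatM s A M) (P1, P0, f)" "u = deg0 h" by blast
  show "u : ?F" using factor_iff[OF P(1-3) M hatM_rh[OF x h(1)]] h unfolding hatM_simps by blast
 qed
 then show ?thesis unfolding KLR_values_grm[OF M X] by (simp only: image_image)
qed

text \<open>A nonzero element of KLR(M)(X) amounts to a nonzero morphism X \<rightarrow> M which factors through a projective module. It is transported to a graded module N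
 which corresponds to X, and lifted along the cover of M; then indecomposable_hqm applies to N.\<close>

lemma supported:
 assumes M: "fmod M"
 shows "supported_on (mod_cat s (grP s A)) s (KLRM M) (fob (HQ_to_modP s A) ` Ob (HQ s A))"
 unfolding supported_on_def
proof (intro conjI allI impI I.KLR_cmod fp stalk(1)[OF M])
 let ?B = "mod_cat s (grP s A)"
 fix X assume "indecomposable ?B X & \<not> (\<exists>Y\<in>fob (HQ_to_modP s A) ` Ob (HQ s A). iso_obj ?B X Y)"
 then have X: "indecomposable ?B X" and no: "!!Y. Y : Ob (HQ s A) ==> \<not> iso_obj ?B X (fob (HQ_to_modP s A) Y)" by auto
 have XO: "X : Ob ?B" using X by (simp add: indecomposable_def)
 then have Xf: "fin_pres s (grP s A) X" by simp
 note S = stalk(1)[OF M]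
 have 0: "0 : mval (KLRM M) X" by (rule subspaceD(1)[OF vs is_cmodD(1)[OF I.KLR_cmod[OF fp[OF S]] XO]])
 show "mval (KLRM M) X = {0}"
 proof (rule ccontr)
  assume "mval (KLRM M) X ~= {0}"
  then obtain z where z: "z : mval (KLRM M) X" "z ~= 0" using 0 by auto
  obtain Y a w where Y: "projective GM Y" "a : cmod_hom (grP s A) s X s (yo Y)" "w : cmod_hom (grP s A) s (yo Y) s (yo (stalk M))"
   "z = hom_to_KR s (grP s A) \<psi> X (yo (stalk M)) (\<lambda>W. w W o a W)"
   using z(1) unfolding I.KLR_values[OF fp[OF S] Xf] unfolding grP_PC E.hom_mod_PC image_iff mem_Collect_eq Bex_def E.PC_simps by blast
  note YO = E.projective_Ob[OF Y(1)]
  have wa: "(\<lambda>W. w W o a W) : cmod_hom (grP s A) s X s (yo (stalk M))" by (rule cmod_hom_comp[OF Y(2,3)])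
  have u0: "(\<lambda>W. w W o a W) ~= 0"
  proof
   assume 0: "(\<lambda>W. w W o a W) = 0"
   have "z = z + z" using I.hom_to_KR_lin(1)[OF Xf fp[OF S] wa wa] unfolding Y(4) 0 by simp
   then show False using z(2) by simp
  qed
  obtain N where N: "N : Ob GM" "iso_obj ?B X (yo N)" using E.Yp_ess_surj[of X] Xf by (auto simp: grP_PC)
  obtain k l where kl: "k : Hom ?B X (yo N)" "l : Hom ?B (yo N) X" "Cmp ?B l k = Ident ?B X" using N(2) by (auto simp: iso_obj_def)
  have kl': "k : cmod_hom (grP s A) s X s (yo N)" "l : cmod_hom (grP s A) s (yo N) s X" using kl by simp_all
  have al: "(\<lambda>W. a W o l W) : cmod_hom (grP s A) s (yo N) s (yo Y)" by (rule cmod_hom_comp[OF kl'(2) Y(2)])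
  obtain a' where a': "a' : Hom GM N Y" "(\<lambda>W. a W o l W) = ym N Y a'" using E.Yp_full[OF N(1) YO] al unfolding grP_PC by blast
  obtain w' where w': "w' : Hom GM Y (stalk M)" "w = ym Y (stalk M) w'" using E.Yp_full[OF YO S] Y(3) unfolding grP_PC by blast
  have u': "Cmp GM w' a' : Hom GM N (stalk M)" by (rule E.cmp_in[OF N(1) YO S a'(1) w'(1)])
  have ne: "Cmp GM w' a' ~= 0"
  proof
   assume "Cmp GM w' a' = 0"
   then have "ym N (stalk M) (Cmp GM w' a') + ym N (stalk M) (Cmp GM w' a') = ym N (stalk M) (Cmp GM w' a')"
    using E.Yp_add[OF N(1) S u' u'] by simp
   then have "ym N (stalk M) (Cmp GM w' a') = 0" by (simp only: add_cancel_left_right)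
   then have "(\<lambda>W. ym Y (stalk M) w' W o ym N Y a' W) = 0" using E.Yp_comp[OF N(1) YO S a'(1) w'(1)] by simp
   then have z: "(\<lambda>W. w W o (a W o l W)) = 0" using fun_cong[OF a'(2)] by (simp only: w'(2))
   have id: "(\<lambda>W. l W o k W) = Ident ?B X" using kl(3) by simp
   have "(\<lambda>W. w W o a W) = Cmp ?B (\<lambda>W. w W o a W) (Ident ?B X)"
    by (rule I.B.ident_right[OF XO _ _, symmetric]) (use wa fp[OF S] in auto)
   also have "... = (\<lambda>W. (w W o (a W o l W)) o k W)" unfolding id[symmetric] by (simp add: comp_assoc)
   also have "... = 0" using fun_cong[OF z] by (auto simp: fun_eq_iff)
   finally show False using u0 by simp
  qed
  obtain F \<pi> rho where F: "free F" "rho : Hom GM (gind 0 F) (stalk M)"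
   "!!Y w. projective GM Y ==> w : Hom GM Y (stalk M) ==> \<exists>w'\<in>Hom GM Y (gind 0 F). Cmp GM rho w' = w"
   by (rule stalk_cover[OF M]) (rule that)
  note GO = gind(1)[OF free_fmod[OF F(1)], of 0]
  obtain w'' where w'': "w'' : Hom GM Y (gind 0 F)" "Cmp GM rho w'' = w'" using F(3)[OF Y(1) w'(1)] by blast
  define t where "t = Cmp GM w'' a'"
  have t: "t : Hom GM N (gind 0 F)" unfolding t_def by (rule E.cmp_in[OF N(1) YO GO a'(1) w''(1)])
  have rt: "Cmp GM rho t = Cmp GM w' a'" unfolding t_def E.cmp_assoc[OF N(1) YO GO S a'(1) w''(1) F(2)] w''(2) ..
  have "t 0 ~= 0"
  proof
   assume "t 0 = 0"
   then have "Cmp GM rho t 0 = 0" using lin_0[OF rhomD(1)[OF grm_homD(1)[OF F(2) GO S]]] by (auto simp: fun_eq_iff)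
   then have "Cmp GM rho t = 0"
    by (intro stalk_hom_eqI[OF M N(1)] E.cmp_in[OF N(1) GO S t F(2)] E.hom_closed(1)[OF N(1) S]) simp
   then show False using rt ne by simp
  qed
  moreover have "indecomposable GM N" by (rule E.Yp_indecomposable[of X]) (use X N in "auto simp: grP_PC")
  ultimately obtain R P f where f: "(R, P, f) : Ob (HQ s A)" "iso_obj GM N (hqm R P f)" "hqm R P f : Ob GM"
   using indecomposable_hqm[OF _ free_reflexive[OF F(1)] t] by blast
  have "iso_obj ?B (yo N) (yo (hqm R P f))" using E.Yp_iso[OF N(1) f(3,2)] by (simp add: grP_PC)
  moreover have "yo N : Ob ?B" "yo (hqm R P f) : Ob ?B" using fp N(1) f(3) by auto
  ultimately have "iso_obj ?B X (yo (hqm R P f))" using I.B.iso_obj_trans[OF XO _ _ N(2)] by blast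
  then show False using no[OF f(1)] by (simp add: HQ_to_modP_eq)
 qed
qed

lemma hatM_to_KR_eq:
 assumes "(P1, P0, f) : Ob (HQ s A)" "h : mval (hatM s A M) (P1, P0, f)"
 shows "hatM_to_KR s A \<psi> M (P1, P0, f) h = K M (hqm P1 P0 f) (ym (hqm P1 P0 f) (stalk M) (deg0 h))"
 using assms by (simp add: hatM_to_KR_def modA_to_modP_eq HQ_to_modP_eq grm_to_modP_Yp HQ_to_grm_simps)

text \<open>Bijectivity combines hat_values with the faithfulness of the functor and the injectivity of hom_to_KR; naturality holds because each
 of these maps is natural.\<close>

lemma hat_iso:
 assumes M: "fmod M"
 shows "cmod_iso (HQ s A) (fscale s) (hatM s A M) s (pull (HQ_to_modP s A) (KLRM M)) (hatM_to_KR s A \<psi> M)"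
 unfolding cmod_iso_def
proof (intro conjI is_cmod_hatM[OF M])
 note S = stalk(1)[OF M]
 note KC = I.KLR_cmod[OF fp[OF S]]
 let ?G = "pull (HQ_to_modP s A) (KLRM M)"
 show G: "is_cmod (HQ s A) s ?G" by (rule is_cmod_pull[OF is_functor_HQ_to_modP KC])
 have bij: "bij_betw (hatM_to_KR s A \<psi> M x) (mval (hatM s A M) x) (mval ?G x)" if x: "x : Ob (HQ s A)" for x
 proof -
  obtain P1 P0 f where xx: "x = (P1, P0, f)" by (cases x)
  note x = that[unfolded xx] and P = HQ_Ob[OF that[unfolded xx]]
  note X = hqm(1)[OF P(4,5,3)] and e = hatM_to_KR_eq[OF that[unfolded xx]]
  have "inj_on (hatM_to_KR s A \<psi> M (P1, P0, f)) (mval (hatM s A M) (P1, P0, f))"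
  proof (rule inj_onI)
   fix h h' assume h: "h : mval (hatM s A M) (P1, P0, f)" "h' : mval (hatM s A M) (P1, P0, f)"
    "hatM_to_KR s A \<psi> M (P1, P0, f) h = hatM_to_KR s A \<psi> M (P1, P0, f) h'"
   have "deg0 h = deg0 h'"
    by (rule K_inj[OF M X deg0_hom[OF P(4,5,3) M hatM_rh[OF x h(1)]] deg0_hom[OF P(4,5,3) M hatM_rh[OF x h(2)]] h(3)[unfolded e[OF h(1)] e[OF h(2)]]])
   from fun_cong[OF this, of 0] show "h = h'" by simp
  qed
  moreover have "hatM_to_KR s A \<psi> M (P1, P0, f) ` mval (hatM s A M) (P1, P0, f) = mval ?G (P1, P0, f)"
   using hat_values[OF M x] e by (simp add: pull_def HQ_to_modP_eq)
  ultimately show ?thesis unfolding xx by (simp add: bij_betw_def)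
 qed
 then show "\<forall>x\<in>Ob (HQ s A). bij_betw (hatM_to_KR s A \<psi> M x) (mval (hatM s A M) x) (mval ?G x)" by blast
 show "hatM_to_KR s A \<psi> M : cmod_hom (HQ s A) (fscale s) (hatM s A M) s ?G"
 proof (rule cmod_homI[OF is_cmod_hatM[OF M] G])
  fix x assume x: "x : Ob (HQ s A)"
  obtain P1 P0 f where xx: "x = (P1, P0, f)" by (cases x)
  note x' = x[unfolded xx]
  note P = HQ_Ob[OF x']
  note X = hqm(1)[OF P(4,5,3)] and e = hatM_to_KR_eq[OF x'] and c = subspaceD[OF vector_space_fscale[OF vs] hatM_sub[OF x' M]]
  note d = deg0_hom[OF P(4,5,3) M hatM_rh[OF x']]
  show "hatM_to_KR s A \<psi> M x : lin (fscale s) (mval (hatM s A M) x) s (mval ?G x)"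
  proof (rule linI)
   show "hatM_to_KR s A \<psi> M x h : mval ?G x" if "h : mval (hatM s A M) x" for h using bij_betwE[OF bij[OF x]] that by blast
   show "hatM_to_KR s A \<psi> M x (h + h') = hatM_to_KR s A \<psi> M x h + hatM_to_KR s A \<psi> M x h'"
    if "h : mval (hatM s A M) x" "h' : mval (hatM s A M) x" for h h'
   proof -
    note hh = that[unfolded xx]
    have "deg0 (h + h') = deg0 h + deg0 h'" by (auto simp: fun_eq_iff)
    then show ?thesis unfolding xx e[OF hh(1)] e[OF hh(2)] e[OF c(2)[OF hh]]
     using E.Yp_add[OF X S d[OF hh(1)] d[OF hh(2)]]
      I.hom_to_KR_lin(1)[OF fp[OF X] fp[OF S] ym[OF X S d[OF hh(1)]] ym[OF X S d[OF hh(2)]]] by simp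
   qed
   show "hatM_to_KR s A \<psi> M x (fscale s k h) = s k (hatM_to_KR s A \<psi> M x h)"
    if "h : mval (hatM s A M) x" for h k
   proof -
    note hh = that[unfolded xx]
    have "deg0 (fscale s k h) = Scl GM k (deg0 h)" by (auto simp: fun_eq_iff fscale_def vs_scaleD vs)
    then show ?thesis unfolding xx e[OF hh] e[OF c(3)[OF hh]]
     using E.Yp_scl[OF X S d[OF hh], of k] I.hom_to_KR_lin(2)[OF fp[OF X] fp[OF S] ym[OF X S d[OF hh]] ym[OF X S d[OF hh]]] by simp
   qed
   show "hatM_to_KR s A \<psi> M x h = 0" if "h \<notin> mval (hatM s A M) x" for h using that by (simp add: hatM_to_KR_def)
  qed
  fix y u h assume y: "y : Ob (HQ s A)" and u: "u : Hom (HQ s A) x y" and h: "h : mval (hatM s A M) y"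
  obtain R1 R0 g where yy: "y = (R1, R0, g)" by (cases y)
  obtain a b where uu: "u = (a, b)" by (cases u)
  note y' = y[unfolded yy] and u' = u[unfolded xx yy uu] and h' = h[unfolded yy]
  note R = HQ_Ob[OF y']
  note Y = hqm(1)[OF R(4,5,3)] and ey = hatM_to_KR_eq[OF y' h'] and m = HQ_to_grm_mor[OF x' y' u']
  note dy = deg0_hom[OF R(4,5,3) M hatM_rh[OF y' h']] and ha = hatM_map[OF x' u' h']
  let ?m = "fmor (HQ_to_grm s A) (P1, P0, f) (R1, R0, g) (a, b)"
  have "deg0 (h o a) = Cmp GM (deg0 h) ?m" by (auto simp: fun_eq_iff HQ_to_grm_simps)
  then have "ym (hqm P1 P0 f) (stalk M) (deg0 (h o a)) = (\<lambda>W. ym (hqm R1 R0 g) (stalk M) (deg0 h) W o ym (hqm P1 P0 f) (hqm R1 R0 g) ?m W)"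
   using E.Yp_comp[OF X Y S m dy] by simp
  then have "hatM_to_KR s A \<psi> M x (h o a) = mmap (fob KR (yo (stalk M))) (yo (hqm P1 P0 f)) (yo (hqm R1 R0 g))
    (ym (hqm P1 P0 f) (hqm R1 R0 g) ?m) (hatM_to_KR s A \<psi> M y h)"
   using I.hom_to_KR_nat[OF fp[OF Y] fp[OF X] fp[OF S] ym[OF X Y m] ym[OF Y S dy]] unfolding xx yy e[OF ha] ey by simp
  moreover have "hatM_to_KR s A \<psi> M y h : mval ?G y" using bij_betwE[OF bij[OF y]] h by blast
  then have "hatM_to_KR s A \<psi> M y h : mval (KLRM M) (yo (hqm R1 R0 g))" by (simp add: yy pull_def HQ_to_modP_eq)
  ultimately show "hatM_to_KR s A \<psi> M x (mmap (hatM s A M) x y u h) = mmap ?G x y u (hatM_to_KR s A \<psi> M y h)"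
   using h by (simp add: uu hatM_simps(2) pull_def xx yy HQ_to_modP_eq I.KLR_mmap)
 qed (simp add: hatM_to_KR_def fun_eq_iff)
qed

end

theorem proposition4p6:
  fixes s :: "'k::field \<Rightarrow> 'u::ab_group_add \<Rightarrow> 'u"
    and Q :: "('v, 'e) pre_digraph"
    and A :: "('k, 'v \<times> 'e list \<Rightarrow> 'k) kalg"
    and M :: "('v \<times> 'e list \<Rightarrow> 'k, 'u) rmod"
  assumes "vector_space s" and "\<not> fin_dim s (UNIV :: 'u set)"
    and "connected_dynkin_quiver Q"
    and "A = path_algebra Q"
    and "M \<in> Ob (modA s A)"
    and "adjunction (mod_cat s (grP s A)) (mod_cat s (mod_cat s (grP s A))) K\<^sub>L (res s (grP s A)) \<phi>"
    and "adjunction (mod_cat s (mod_cat s (grP s A))) (mod_cat s (grP s A)) (res s (grP s A)) K\<^sub>R \<psi>"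
  shows "supported_on (mod_cat s (grP s A)) s
           (KLR s (grP s A) K\<^sub>L K\<^sub>R \<phi> \<psi> (modA_to_modP s A M))
           (fob (HQ_to_modP s A) ` Ob (HQ s A))
       \<and> cmod_iso (HQ s A)
           (fscale s) (hatM s A M)
           s (pull (HQ_to_modP s A) (KLR s (grP s A) K\<^sub>L K\<^sub>R \<phi> \<psi> (modA_to_modP s A M)))
           (hatM_to_KR s A \<psi> M)"
proof -
 interpret quiver_space Q s
  using acyclic_quiver_dynkin[OF assms(3)] assms(1,2) by (intro quiver_space.intro infinite_space.intro)
 have "hereditary_algebra s A" unfolding assms(4) by (rule hereditary_path_algebra)
 then interpret H: hereditary_extension s A K\<^sub>L K\<^sub>R \<phi> \<psi>
  by (intro hereditary_extension.intro hereditary_extension_axioms.intro assms(6,7))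
 have "H.fmod M" using assms(5) by simp
 then show ?thesis unfolding H.modA_to_modP_eq using H.supported H.hat_iso by blast
qed

end
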